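(* Let $h$ be a boundary function, and suppose that either (1) (Poly-$R_1$) and $\mathbf{HK}^h_B$ hold, or (2) (Poly-$\infty$) and $\mathbf{HK}^h_U$ hold. Let $G_D(x,y):=\int_0^\infty q(t,x,y)\,dt$ be the Green function of $X$. Suppose that $C_0=1$, $h$ is regular, (H2* ) holds with $\gamma_*>(\beta_2\wedge1)+1$, and (H2** ) holds. Suppose also that one of the following holds: (1) $d_1>\alpha_2(\beta_2\wedge1)$, or (2) $d_1=d_2=\alpha_1\beta_1=\alpha_2\beta_2$, or (3) $d_2<\alpha_1\beta_1$. Then for $x,y\in D$, $x\ne y$, $$G_D(x,y)\simeq[h](x,y)\,\frac{\Phi(\rho(x,y))}{\Psi(\rho(x,y))}\,\frac{\psi(\rho(x,y))}{V(x,\rho(x,y))}+h(\Phi(\rho(x,y)),x,y)\,g_0(x,y).$$ In particular, if $\Psi\simeq\Phi$, then $$G_D(x,y)\simeq[h](x,y)\,g_0(x,y).$$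
   Context: Notation: $a\wedge b=\min$, $a\vee b=\max$; $f\simeq g$ means $c_1g\le f\le c_2g$ on the specified range for some constants $c_1,c_2>0$. Quotients $c/0$ with $c>0$ are $+\infty$. Subordinator: $S=(S_t)_{t\ge0}$ is a driftless subordinator (non-decreasing pure-jump Lévy process, $S_0=0$) with Laplace exponent $\phi(\lambda)=-\log\mathbb{E}e^{-\lambda S_1}=\int_0^\infty(1-e^{-\lambda s})\nu(ds)$ and $w(r):=\nu(r,\infty)$. Condition (Poly-$R_1$), $R_1\in(0,\infty]$: there are constants $c_1,c_2>0$, $\beta_2\ge\beta_1>0$ with $c_1(R/r)^{\beta_1}\le w(r)/w(R)\le c_2(R/r)^{\beta_2}$ for all $0<r\le R<R_1$. (Poly-$\infty$) is the case $R_1=\infty$. Space and process: $(E,\rho)$ is a locally compact separable metric space in which all bounded closed sets are compact, $m$ is a positive Radon measure on $E$ with full support, $B(x,r)$ is the open ball, $V(x,r)=m(B(x,r))$. There are $R_E\in(0,\infty]$ and $d_2\ge d_1>0$ such that for every $a\ge1$ there is $C_V\ge1$ with $C_V^{-1}(R/r)^{d_1}\le V(x,R)/V(x,r)\le C_V(R/r)^{d_2}$ for all $x\in E$, $0<r\le R<aR_E$. $D\subset E$ is a proper open subset, $\delta_D(x)=\rho(x,E\setminus D)$, $\delta_\wedge(x,y)=\delta_D(x)\wedge\delta_D(y)$, $\delta_\vee(x,y)=\delta_D(x)\vee\delta_D(y)$. $Y^D$ is a Hunt process in $D$ independent of $S$ whose semigroup has a density (heat kernel) $p_D(t,x,y)$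 with respect to $m$; $X_t=Y^D_{S_t}$ has heat kernel $q(t,x,y)=\int_0^\infty p_D(s,x,y)\mathbb{P}(S_t\in ds)$. Scale functions: $\Phi,\Psi:[0,\infty)\to[0,\infty)$ are strictly increasing, $\Psi\ge\Phi$, and for some constants $\alpha_1,\dots,\alpha_4,c_1,\dots,c_4>0$ and all $R\ge r>0$: $c_1(R/r)^{\alpha_1}\le\Phi(R)/\Phi(r)\le c_2(R/r)^{\alpha_2}$ and $c_3(R/r)^{\alpha_3}\le\Psi(R)/\Psi(r)\le c_4(R/r)^{\alpha_4}$. Set $\psi(r)=1/\phi(1/\Phi(r))$. If $D$ is unbounded, $\Phi(\mathrm{diam}(D))$ is read as $\infty$. Boundary function: $h:(0,\infty)\times D\times D\to[0,1]$ such that (H1) $s\mapsto h(s,x,y)$ is non-increasing for all $x,y\in D$; (H2) there are $c_1>0$, $\gamma\ge0$ with $s^\gamma h(s,x,y)\le c_1t^\gamma h(t,x,y)$ for $0<s\le t<4\Phi(\mathrm{diam}(D))+1$, $x,y\in D$. $h$ is regular if there is $c_2>0$ with $h(t,x,y)\ge c_2$ whenever $0<t<4\Phi(\mathrm{diam}(D))+1$ and $\delta_\wedge(x,y)\ge\Phi^{-1}(t)$. (H2* ): there are $c_1,\gamma_*>0$ such that $s^{\gamma_*}h(s,x,y)\ge c_1t^{\gamma_*}h(t,x,y)$ for all $x,y\in D$ and $\Phi(\delta_\vee(x,y))\le s\le t<2\Phi(\mathrm{diam}(D))$. (H2** ): there are $c_1>0$ and $\gamma_{**}\in(0,1+\beta_1)$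 such that $s^{\gamma_{**}}h(s,x,y)\le c_1t^{\gamma_{**}}h(t,x,y)$ for all $x,y\in D$ and $\Phi(\delta_\wedge(x,y))\le s\le t<\Phi(\delta_\vee(x,y))$. Heat kernel conditions: for $C_0\in\{0,1\}$ and $c>0$ put $$I_{c}(t,x,y)=\frac1{V(x,\Phi^{-1}(t))}\wedge\Big(\frac{C_0t}{V(x,\rho(x,y))\Psi(\rho(x,y))}+\frac1{V(x,\Phi^{-1}(t))}\exp\Big(-\frac{c\,\rho(x,y)^2}{\Phi^{-1}(t)^2}\Big)\Big)$$ (the first summand is absent if $C_0=0$). $\mathbf{HK}^h_B$: $D$ is bounded; (i) there are $C_0\in\{0,1\}$ and $c_1,c_2,c_3,c_4>0$ with $c_1h(t,x,y)I_{c_2}(t,x,y)\le p_D(t,x,y)\le c_3h(t,x,y)I_{c_4}(t,x,y)$ for all $(t,x,y)\in(0,1]\times D\times D$; (ii) there is $\lambda_D>0$ with $p_D(t,x,y)\simeq e^{-\lambda_Dt}h(1,x,y)$ for $(t,x,y)\in[1,\infty)\times D\times D$. $\mathbf{HK}^h_U$: $R_E=\infty$ and the two-sided estimate in (i) holds for all $(t,x,y)\in(0,\infty)\times D\times D$. In the claim, $C_0,d_1,d_2,\beta_1,\beta_2,\alpha_1,\alpha_2,\gamma_*$ are the constants in these conditions. Standing convention: when (Poly-$R_1$) and $\mathbf{HK}^h_B$ hold, $\Phi$ is normalized (by multiplication by a constant) so that $\Phi(\mathrm{diam}(D))<R_1/8$. The functions $g_0$ and $[h]$: $$g_0(x,y)=\begin{cases}\dfrac{\psi(\rho(x,y))}{V(x,\rho(x,y))},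 & d_1>\alpha_2(\beta_2\wedge1),\\[6pt] \log\Big(e+\dfrac{\delta_\vee(x,y)}{\rho(x,y)}\Big), & d_1=d_2=\alpha_1\beta_1=\alpha_2\beta_2,\\[6pt] \dfrac{\psi(\rho(x,y)\vee\delta_\vee(x,y))}{V(x,\rho(x,y)\vee\delta_\vee(x,y))}, & d_2<\alpha_1\beta_1,\end{cases}$$ $$[h](x,y):=h\big(\Phi(\rho(x,y)\wedge\delta_\vee(x,y)),x,y\big)\left(1\wedge\frac{\Phi(\delta_\vee(x,y))\,\psi(\delta_\vee(x,y))}{\Phi(\rho(x,y))\,\psi(\rho(x,y))}\right).$$
   Formalization: The heat kernel p_D is taken jointly measurable and satisfying Chapman–Kolmogorov for all x,y; for a density fixed only almost everywhere, the claim can fail on null sets when D is bounded under HK_U. *)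

theory Defs
  imports "HOL-Probability.Probability"
begin

section \<open>The state space and the scale functions\<close>

text \<open>
  The space \<^term>\<open>E\<close> is the whole type. On a metric space of this kind (which is \<open>\<sigma>\<close>-compact)
  a Radon measure is the same thing as a Borel measure that is finite on compact sets.
\<close>

definition proper_metric_measure_space :: "'a::metric_space measure \<Rightarrow> bool" where
  "proper_metric_measure_space m \<longleftrightarrow>
     locally compact (UNIV :: 'a set) \<and> separable_space (euclidean :: 'a topology) \<and>
     (\<forall>K :: 'a set. bounded K \<longrightarrow> closed K \<longrightarrow> compact K) \<and>
     sets m = sets borel \<and>
     (\<forall>K. compact K \<longrightarrow> emeasure m K < \<infinity>) \<and>
     (\<forall>U. open U \<longrightarrow> U \<noteq> {} \<longrightarrow> 0 < emeasure m U)"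

definition vol :: "'a::metric_space measure \<Rightarrow> 'a \<Rightarrow> real \<Rightarrow> real" where
  "vol m x r = measure m (ball x r)"

definition volume_scaling :: "'a::metric_space measure \<Rightarrow> ereal \<Rightarrow> real \<Rightarrow> real \<Rightarrow> bool" where
  "volume_scaling m R\<^sub>E d\<^sub>1 d\<^sub>2 \<longleftrightarrow>
     0 < R\<^sub>E \<and> 0 < d\<^sub>1 \<and> d\<^sub>1 \<le> d\<^sub>2 \<and>
     (\<forall>a\<ge>1. \<exists>C\<ge>1. \<forall>x r R. 0 < r \<and> r \<le> R \<and> ereal R < ereal a * R\<^sub>E \<longrightarrow>
        inverse C * (R / r) powr d\<^sub>1 \<le> vol m x R / vol m x r \<and>
        vol m x R / vol m x r \<le> C * (R / r) powr d\<^sub>2)"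

definition dist_compl :: "'a::metric_space set \<Rightarrow> 'a \<Rightarrow> real" where
  "dist_compl D x = infdist x (- D)"

definition delta_min :: "'a::metric_space set \<Rightarrow> 'a \<Rightarrow> 'a \<Rightarrow> real" where
  "delta_min D x y = min (dist_compl D x) (dist_compl D y)"

definition delta_max :: "'a::metric_space set \<Rightarrow> 'a \<Rightarrow> 'a \<Rightarrow> real" where
  "delta_max D x y = max (dist_compl D x) (dist_compl D y)"

definition comparable_on :: "'z set \<Rightarrow> ('z \<Rightarrow> real) \<Rightarrow> ('z \<Rightarrow> real) \<Rightarrow> bool" where
  "comparable_on A f g \<longleftrightarrow>
     (\<exists>c\<^sub>1>0. \<exists>c\<^sub>2>0. \<forall>z\<in>A. c\<^sub>1 * g z \<le> f z \<and> f z \<le> c\<^sub>2 * g z)"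

definition ecomparable_on :: "'z set \<Rightarrow> ('z \<Rightarrow> ennreal) \<Rightarrow> ('z \<Rightarrow> real) \<Rightarrow> bool" where
  "ecomparable_on A f g \<longleftrightarrow>
     (\<exists>c\<^sub>1>0. \<exists>c\<^sub>2>0. \<forall>z\<in>A. ennreal (c\<^sub>1 * g z) \<le> f z \<and> f z \<le> ennreal (c\<^sub>2 * g z))"

definition weak_scaling :: "(real \<Rightarrow> real) \<Rightarrow> real \<Rightarrow> real \<Rightarrow> bool" where
  "weak_scaling f a b \<longleftrightarrow>
     0 < a \<and> 0 < b \<and>
     (\<exists>c\<^sub>1>0. \<exists>c\<^sub>2>0. \<forall>r R. 0 < r \<and> r \<le> R \<longrightarrow>
        c\<^sub>1 * (R / r) powr a \<le> f R / f r \<and> f R / f r \<le> c\<^sub>2 * (R / r) powr b)"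

definition scale_functions ::
    "(real \<Rightarrow> real) \<Rightarrow> (real \<Rightarrow> real) \<Rightarrow> real \<Rightarrow> real \<Rightarrow> real \<Rightarrow> real \<Rightarrow> bool" where
  "scale_functions \<Phi> \<Psi> \<alpha>\<^sub>1 \<alpha>\<^sub>2 \<alpha>\<^sub>3 \<alpha>\<^sub>4 \<longleftrightarrow>
     strict_mono_on {0..} \<Phi> \<and> strict_mono_on {0..} \<Psi> \<and>
     (\<forall>r\<ge>0. 0 \<le> \<Phi> r \<and> \<Phi> r \<le> \<Psi> r) \<and>
     weak_scaling \<Phi> \<alpha>\<^sub>1 \<alpha>\<^sub>2 \<and> weak_scaling \<Psi> \<alpha>\<^sub>3 \<alpha>\<^sub>4"

text \<open>
  Scale functions need not be continuous, so the inverse is the generalized one. For a strictly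
  increasing function, using \<open><\<close> instead of \<open>\<le>\<close> below would give the same value.
\<close>

definition gen_inv :: "(real \<Rightarrow> real) \<Rightarrow> real \<Rightarrow> real" where
  "gen_inv f t = Inf {r. 0 \<le> r \<and> t \<le> f r}"

lemma gen_inv_left_inverse:
  assumes "strict_mono_on {0..} f" and "0 \<le> r"
  shows "gen_inv f (f r) = r"
proof -
  have "{s. 0 \<le> s \<and> f r \<le> f s} = {r..}"
    using assms by (auto simp: strict_mono_on_leD strict_mono_on_less_eq)
  then show ?thesis
    by (simp add: gen_inv_def)
qed

definition scale_diam :: "(real \<Rightarrow> real) \<Rightarrow> 'a::metric_space set \<Rightarrow> ereal" where
  "scale_diam \<Phi> D = (if bounded D then ereal (\<Phi> (diameter D)) else \<infinity>)"


section \<open>Hunt processes\<close>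

text \<open>The \<open>\<sigma>\<close>-algebra on \<^term>\<open>\<Omega>\<close> generated by the variables \<^term>\<open>Z t\<close> with \<^term>\<open>t \<in> T\<close>.\<close>

definition gen_sigma :: "'w set \<Rightarrow> 's measure \<Rightarrow> (real \<Rightarrow> 'w \<Rightarrow> 's) \<Rightarrow> real set \<Rightarrow> 'w measure" where
  "gen_sigma \<Omega> N Z T = sigma \<Omega> {Z t -` B \<inter> \<Omega> | t B. t \<in> T \<and> B \<in> sets N}"

text \<open>
  The state space with cemetery \<^term>\<open>None\<close>: the one-point compactification of \<^term>\<open>D\<close>
  (the cemetery is isolated if \<^term>\<open>D\<close> is compact).
\<close>

definition cemetery_top :: "'a::topological_space set \<Rightarrow> 'a option topology" where
  "cemetery_top D = Alexandroff_compactification (top_of_set D)"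

definition cemetery_borel :: "'a::topological_space set \<Rightarrow> 'a option measure" where
  "cemetery_borel D = sigma (topspace (cemetery_top D)) {U. openin (cemetery_top D) U}"

text \<open>
  The right-continuous natural filtration. Time is extended by \<open>\<infinity>\<close>, where the
  filtration is the full \<open>\<sigma>\<close>-algebra, so that stopping times may be infinite.
\<close>

definition natural_filtration ::
    "'a::topological_space set \<Rightarrow> 'w measure \<Rightarrow> (real \<Rightarrow> 'w \<Rightarrow> 'a option) \<Rightarrow> ennreal \<Rightarrow> 'w measure" where
  "natural_filtration D \<F> Y t =
     sigma (space \<F>) (sets \<F> \<inter>
       (\<Inter>u\<in>{t<..}. sets (gen_sigma (space \<F>) (cemetery_borel D) Y {s. 0 \<le> s \<and> ennreal s \<le> u})))"

text \<open>
  A Hunt process in \<^term>\<open>D\<close>: a normal Markov process on \<open>(\<Omega>, \<F>)\<close> under the laws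
  \<^term>\<open>P z\<close>, where \<^term>\<open>z\<close> ranges over \<^term>\<open>D\<close> and the cemetery, whose paths are right continuous
  with left limits, which is strong Markov and quasi-left-continuous on \<open>[0,\<infinity>)\<close>.
  The last two conditions are stated for the uncompleted filtration above; they hold in particular
  when they hold for a larger right-continuous filtration, such as a completed one.
\<close>

definition hunt_process ::
    "'a::topological_space set \<Rightarrow> 'w measure \<Rightarrow> ('a option \<Rightarrow> 'w measure) \<Rightarrow>
     (real \<Rightarrow> 'w \<Rightarrow> 'a option) \<Rightarrow> bool" where
  "hunt_process D \<F> P Y \<longleftrightarrow>
     (\<forall>z\<in>topspace (cemetery_top D). prob_space (P z) \<and> sets (P z) = sets \<F>) \<and>
     (\<forall>t\<ge>0. Y t \<in> measurable \<F> (cemetery_borel D)) \<and>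
     (\<forall>t\<ge>0. \<forall>B\<in>sets (cemetery_borel D).
        (\<lambda>z. emeasure (P z) (Y t -` B \<inter> space \<F>)) \<in> borel_measurable (cemetery_borel D)) \<and>
     (\<forall>z\<in>topspace (cemetery_top D). AE \<omega> in P z. Y 0 \<omega> = z) \<and>
     (\<forall>\<omega>\<in>space \<F>. \<forall>s t. 0 \<le> s \<and> s \<le> t \<and> Y s \<omega> = None \<longrightarrow> Y t \<omega> = None) \<and>
     (\<exists>\<theta>. \<forall>t\<ge>0. \<forall>\<omega>\<in>space \<F>. \<theta> t \<omega> \<in> space \<F> \<and> (\<forall>s\<ge>0. Y s (\<theta> t \<omega>) = Y (s + t) \<omega>)) \<and>
     (\<forall>\<omega>\<in>space \<F>.
        (\<forall>t\<ge>0. limitin (cemetery_top D) (\<lambda>s. Y s \<omega>) (Y t \<omega>) (at_right t)) \<and>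
        (\<forall>t>0. \<exists>l. limitin (cemetery_top D) (\<lambda>s. Y s \<omega>) l (at_left t))) \<and>
     (\<forall>\<sigma>. stopping_time (natural_filtration D \<F> Y) \<sigma> \<longrightarrow>
        (\<forall>z\<in>topspace (cemetery_top D).
         \<forall>A\<in>sets (filtration.pre_sigma (space \<F>) (natural_filtration D \<F> Y) \<sigma>).
         \<forall>s\<ge>0. \<forall>B\<in>sets (cemetery_borel D).
           emeasure (P z) {\<omega>\<in>A. \<sigma> \<omega> < \<infinity> \<and> Y (enn2real (\<sigma> \<omega>) + s) \<omega> \<in> B} =
           (\<integral>\<^sup>+\<omega>\<in>{\<omega>\<in>A. \<sigma> \<omega> < \<infinity>}.
              emeasure (P (Y (enn2real (\<sigma> \<omega>)) \<omega>)) (Y s -` B \<inter> space \<F>) \<partial>P z))) \<and>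
     (\<forall>\<tau> :: nat \<Rightarrow> 'w \<Rightarrow> ennreal.
        (\<forall>n. stopping_time (natural_filtration D \<F> Y) (\<tau> n)) \<and>
        (\<forall>\<omega>\<in>space \<F>. incseq (\<lambda>n. \<tau> n \<omega>)) \<longrightarrow>
        (\<forall>z\<in>topspace (cemetery_top D). AE \<omega> in P z. (SUP n. \<tau> n \<omega>) < \<infinity> \<longrightarrow>
           limitin (cemetery_top D) (\<lambda>n. Y (enn2real (\<tau> n \<omega>)) \<omega>)
             (Y (enn2real (SUP n. \<tau> n \<omega>)) \<omega>) sequentially))"

text \<open>
  A heat kernel of the process is a jointly measurable transition density which satisfies the
  Chapman-Kolmogorov equation everywhere (and not only almost everywhere, as would follow from the
  density property alone).
\<close>

definition heat_kernel ::
    "'a::metric_space set \<Rightarrow> 'a measure \<Rightarrow> 'w measure \<Rightarrow> ('a option \<Rightarrow> 'w measure) \<Rightarrow>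
     (real \<Rightarrow> 'w \<Rightarrow> 'a option) \<Rightarrow> (real \<Rightarrow> 'a \<Rightarrow> 'a \<Rightarrow> real) \<Rightarrow> bool" where
  "heat_kernel D m \<F> P Y p \<longleftrightarrow>
     (\<forall>t>0. \<forall>x\<in>D. \<forall>y\<in>D. 0 \<le> p t x y) \<and>
     (\<lambda>(t, x, y). p t x y) \<in>
       borel_measurable (restrict_space (borel \<Otimes>\<^sub>M borel \<Otimes>\<^sub>M borel) ({0<..} \<times> D \<times> D)) \<and>
     (\<forall>t>0. \<forall>x\<in>D. \<forall>B\<in>sets borel. B \<subseteq> D \<longrightarrow>
        emeasure (P (Some x)) (Y t -` (Some ` B) \<inter> space \<F>) = (\<integral>\<^sup>+y\<in>B. ennreal (p t x y) \<partial>m)) \<and>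
     (\<forall>s>0. \<forall>t>0. \<forall>x\<in>D. \<forall>y\<in>D.
        ennreal (p (s + t) x y) = (\<integral>\<^sup>+z\<in>D. ennreal (p s x z * p t z y) \<partial>m))"


section \<open>Subordinators\<close>

definition levy_measure :: "real measure \<Rightarrow> bool" where
  "levy_measure \<nu> \<longleftrightarrow>
     sets \<nu> = sets borel \<and> emeasure \<nu> {..0} = 0 \<and> (\<integral>\<^sup>+s. ennreal (min 1 s) \<partial>\<nu>) < \<infinity>"

definition laplace_exponent :: "real measure \<Rightarrow> real \<Rightarrow> real" where
  "laplace_exponent \<nu> l = (\<integral>s. 1 - exp (- l * s) \<partial>\<nu>)"

text \<open>
  A subordinator with Levy measure \<^term>\<open>\<nu>\<close>; it is driftless (hence pure-jump) because its Laplace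
  exponent has no linear term.
\<close>

definition driftless_subordinator ::
    "'w measure \<Rightarrow> (real \<Rightarrow> 'w \<Rightarrow> real) \<Rightarrow> real measure \<Rightarrow> bool" where
  "driftless_subordinator M S \<nu> \<longleftrightarrow>
     prob_space M \<and> levy_measure \<nu> \<and>
     (\<forall>t\<ge>0. S t \<in> borel_measurable M) \<and>
     (AE \<omega> in M. S 0 \<omega> = 0 \<and> mono_on {0..} (\<lambda>t. S t \<omega>) \<and>
        (\<forall>t\<ge>0. continuous (at_right t) (\<lambda>s. S s \<omega>))) \<and>
     (\<forall>s\<ge>0. \<forall>t\<ge>0. distr M borel (\<lambda>\<omega>. S (s + t) \<omega> - S s \<omega>) = distr M borel (S t)) \<and>
     (\<forall>s\<ge>0. \<forall>t\<ge>0. prob_space.indep_set M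
        (sets (gen_sigma (space M) borel S {0..s}))
        {(\<lambda>\<omega>. S (s + t) \<omega> - S s \<omega>) -` B \<inter> space M | B. B \<in> sets borel}) \<and>
     (\<forall>l\<ge>0. - ln (\<integral>\<omega>. exp (- l * S 1 \<omega>) \<partial>M) = laplace_exponent \<nu> l)"

definition tail :: "real measure \<Rightarrow> real \<Rightarrow> real" where
  "tail \<nu> r = measure \<nu> {r<..}"

text \<open>
  The lower bound forces \<^term>\<open>tail \<nu> R > 0\<close> for \<^term>\<open>R < R\<^sub>1\<close>, so the value of \<open>x / 0\<close> is irrelevant.
\<close>

definition Poly_tail :: "real measure \<Rightarrow> ereal \<Rightarrow> real \<Rightarrow> real \<Rightarrow> bool" where
  "Poly_tail \<nu> R\<^sub>1 \<beta>\<^sub>1 \<beta>\<^sub>2 \<longleftrightarrow>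
     0 < R\<^sub>1 \<and> 0 < \<beta>\<^sub>1 \<and> \<beta>\<^sub>1 \<le> \<beta>\<^sub>2 \<and>
     (\<exists>c\<^sub>1>0. \<exists>c\<^sub>2>0. \<forall>r R. 0 < r \<and> r \<le> R \<and> ereal R < R\<^sub>1 \<longrightarrow>
        c\<^sub>1 * (R / r) powr \<beta>\<^sub>1 \<le> tail \<nu> r / tail \<nu> R \<and>
        tail \<nu> r / tail \<nu> R \<le> c\<^sub>2 * (R / r) powr \<beta>\<^sub>2)"

definition psi :: "real measure \<Rightarrow> (real \<Rightarrow> real) \<Rightarrow> real \<Rightarrow> real" where
  "psi \<nu> \<Phi> r = 1 / laplace_exponent \<nu> (1 / \<Phi> r)"


section \<open>Boundary functions\<close>

definition boundary_function ::
    "'a::metric_space set \<Rightarrow> (real \<Rightarrow> real) \<Rightarrow> (real \<Rightarrow> 'a \<Rightarrow> 'a \<Rightarrow> real) \<Rightarrow> bool" where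
  "boundary_function D \<Phi> h \<longleftrightarrow>
     (\<forall>t>0. \<forall>x\<in>D. \<forall>y\<in>D. 0 \<le> h t x y \<and> h t x y \<le> 1) \<and>
     (\<forall>x\<in>D. \<forall>y\<in>D. antimono_on {0<..} (\<lambda>s. h s x y)) \<and>
     (\<exists>c>0. \<exists>\<gamma>\<ge>0. \<forall>s t. 0 < s \<and> s \<le> t \<and> ereal t < 4 * scale_diam \<Phi> D + 1 \<longrightarrow>
        (\<forall>x\<in>D. \<forall>y\<in>D. s powr \<gamma> * h s x y \<le> c * t powr \<gamma> * h t x y))"

definition regular_boundary_function ::
    "'a::metric_space set \<Rightarrow> (real \<Rightarrow> real) \<Rightarrow> (real \<Rightarrow> 'a \<Rightarrow> 'a \<Rightarrow> real) \<Rightarrow> bool" where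
  "regular_boundary_function D \<Phi> h \<longleftrightarrow>
     (\<exists>c>0. \<forall>t. 0 < t \<and> ereal t < 4 * scale_diam \<Phi> D + 1 \<longrightarrow>
        (\<forall>x\<in>D. \<forall>y\<in>D. gen_inv \<Phi> t \<le> delta_min D x y \<longrightarrow> c \<le> h t x y))"

definition H2_star ::
    "'a::metric_space set \<Rightarrow> (real \<Rightarrow> real) \<Rightarrow> (real \<Rightarrow> 'a \<Rightarrow> 'a \<Rightarrow> real) \<Rightarrow> real \<Rightarrow> bool" where
  "H2_star D \<Phi> h \<gamma> \<longleftrightarrow> 0 < \<gamma> \<and>
     (\<exists>c>0. \<forall>x\<in>D. \<forall>y\<in>D. \<forall>s t.
        \<Phi> (delta_max D x y) \<le> s \<and> s \<le> t \<and> ereal t < 2 * scale_diam \<Phi> D \<longrightarrow>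
        c * t powr \<gamma> * h t x y \<le> s powr \<gamma> * h s x y)"

definition H2_star_star ::
    "'a::metric_space set \<Rightarrow> (real \<Rightarrow> real) \<Rightarrow> (real \<Rightarrow> 'a \<Rightarrow> 'a \<Rightarrow> real) \<Rightarrow> real \<Rightarrow> bool" where
  "H2_star_star D \<Phi> h \<beta>\<^sub>1 \<longleftrightarrow>
     (\<exists>c>0. \<exists>\<gamma>. 0 < \<gamma> \<and> \<gamma> < 1 + \<beta>\<^sub>1 \<and>
       (\<forall>x\<in>D. \<forall>y\<in>D. \<forall>s t.
          \<Phi> (delta_min D x y) \<le> s \<and> s \<le> t \<and> t < \<Phi> (delta_max D x y) \<longrightarrow>
          s powr \<gamma> * h s x y \<le> c * t powr \<gamma> * h t x y))"


section \<open>Heat kernel estimates\<close>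

text \<open>
  For \<^term>\<open>x = y\<close> the first summand is \<open>+\<infinity>\<close> in the literature when \<^term>\<open>C\<^sub>0 = 1\<close> and \<open>0\<close> here;
  the minimum is \<open>1 / V(x, \<Phi>\<^sup>-\<^sup>1(t))\<close> either way.
\<close>

definition hk_profile ::
    "'a::metric_space measure \<Rightarrow> (real \<Rightarrow> real) \<Rightarrow> (real \<Rightarrow> real) \<Rightarrow> real \<Rightarrow> real \<Rightarrow>
     real \<Rightarrow> 'a \<Rightarrow> 'a \<Rightarrow> real" where
  "hk_profile m \<Phi> \<Psi> C\<^sub>0 c t x y =
     min (1 / vol m x (gen_inv \<Phi> t))
         (C\<^sub>0 * t / (vol m x (dist x y) * \<Psi> (dist x y)) +
          1 / vol m x (gen_inv \<Phi> t) * exp (- c * (dist x y)\<^sup>2 / (gen_inv \<Phi> t)\<^sup>2))"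

definition hk_two_sided ::
    "real set \<Rightarrow> 'a::metric_space set \<Rightarrow> 'a measure \<Rightarrow> (real \<Rightarrow> real) \<Rightarrow> (real \<Rightarrow> real) \<Rightarrow>
     (real \<Rightarrow> 'a \<Rightarrow> 'a \<Rightarrow> real) \<Rightarrow> (real \<Rightarrow> 'a \<Rightarrow> 'a \<Rightarrow> real) \<Rightarrow> real \<Rightarrow> bool" where
  "hk_two_sided T D m \<Phi> \<Psi> h p C\<^sub>0 \<longleftrightarrow>
     C\<^sub>0 \<in> {0, 1} \<and>
     (\<exists>c\<^sub>1>0. \<exists>c\<^sub>2>0. \<exists>c\<^sub>3>0. \<exists>c\<^sub>4>0. \<forall>t\<in>T. \<forall>x\<in>D. \<forall>y\<in>D.
        c\<^sub>1 * h t x y * hk_profile m \<Phi> \<Psi> C\<^sub>0 c\<^sub>2 t x y \<le> p t x y \<and>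
        p t x y \<le> c\<^sub>3 * h t x y * hk_profile m \<Phi> \<Psi> C\<^sub>0 c\<^sub>4 t x y)"

definition HK_B ::
    "'a::metric_space set \<Rightarrow> 'a measure \<Rightarrow> (real \<Rightarrow> real) \<Rightarrow> (real \<Rightarrow> real) \<Rightarrow>
     (real \<Rightarrow> 'a \<Rightarrow> 'a \<Rightarrow> real) \<Rightarrow> (real \<Rightarrow> 'a \<Rightarrow> 'a \<Rightarrow> real) \<Rightarrow> real \<Rightarrow> bool" where
  "HK_B D m \<Phi> \<Psi> h p C\<^sub>0 \<longleftrightarrow>
     bounded D \<and> hk_two_sided {0<..1} D m \<Phi> \<Psi> h p C\<^sub>0 \<and>
     (\<exists>l>0. comparable_on ({1..} \<times> D \<times> D)
        (\<lambda>(t, x, y). p t x y) (\<lambda>(t, x, y). exp (- l * t) * h 1 x y))"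

definition HK_U ::
    "ereal \<Rightarrow> 'a::metric_space set \<Rightarrow> 'a measure \<Rightarrow> (real \<Rightarrow> real) \<Rightarrow> (real \<Rightarrow> real) \<Rightarrow>
     (real \<Rightarrow> 'a \<Rightarrow> 'a \<Rightarrow> real) \<Rightarrow> (real \<Rightarrow> 'a \<Rightarrow> 'a \<Rightarrow> real) \<Rightarrow> real \<Rightarrow> bool" where
  "HK_U R\<^sub>E D m \<Phi> \<Psi> h p C\<^sub>0 \<longleftrightarrow> R\<^sub>E = \<infinity> \<and> hk_two_sided {0<..} D m \<Phi> \<Psi> h p C\<^sub>0"


section \<open>The subordinate process and its Green function\<close>

text \<open>
  The process and the subordinator live on the same space and are independent under every
  \<^term>\<open>P z\<close>, where \<^term>\<open>z\<close> ranges over \<^term>\<open>D\<close> and the cemetery.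
\<close>

definition independent_subordination ::
    "'a::metric_space set \<Rightarrow> 'w measure \<Rightarrow> ('a option \<Rightarrow> 'w measure) \<Rightarrow>
     (real \<Rightarrow> 'w \<Rightarrow> 'a option) \<Rightarrow> (real \<Rightarrow> 'w \<Rightarrow> real) \<Rightarrow> real measure \<Rightarrow> bool" where
  "independent_subordination D \<F> P Y S \<nu> \<longleftrightarrow>
     hunt_process D \<F> P Y \<and>
     (\<forall>z\<in>topspace (cemetery_top D).
        driftless_subordinator (P z) S \<nu> \<and>
        prob_space.indep_set (P z)
          (sets (gen_sigma (space \<F>) (cemetery_borel D) Y {0..}))
          (sets (gen_sigma (space \<F>) borel S {0..})))"

text \<open>
  The heat kernel of \<open>X\<^sub>t = Y (S\<^sub>t)\<close>. The law of \<^term>\<open>S t\<close> is the same under all \<^term>\<open>P z\<close>, being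
  determined by \<^term>\<open>\<nu>\<close>.
\<close>

definition sub_heat_kernel ::
    "('a option \<Rightarrow> 'w measure) \<Rightarrow> (real \<Rightarrow> 'w \<Rightarrow> real) \<Rightarrow> (real \<Rightarrow> 'a \<Rightarrow> 'a \<Rightarrow> real) \<Rightarrow>
     real \<Rightarrow> 'a \<Rightarrow> 'a \<Rightarrow> ennreal" where
  "sub_heat_kernel P S p t x y =
     (\<integral>\<^sup>+s\<in>{0<..}. ennreal (p s x y) \<partial>(distr (P (Some x)) borel (S t)))"

definition green_function ::
    "('a option \<Rightarrow> 'w measure) \<Rightarrow> (real \<Rightarrow> 'w \<Rightarrow> real) \<Rightarrow> (real \<Rightarrow> 'a \<Rightarrow> 'a \<Rightarrow> real) \<Rightarrow>
     'a \<Rightarrow> 'a \<Rightarrow> ennreal" where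
  "green_function P S p x y = (\<integral>\<^sup>+t\<in>{0<..}. sub_heat_kernel P S p t x y \<partial>lborel)"

text \<open>The three cases exclude each other under the standing assumptions.\<close>

definition g0 ::
    "'a::metric_space set \<Rightarrow> 'a measure \<Rightarrow> real measure \<Rightarrow> (real \<Rightarrow> real) \<Rightarrow>
     real \<Rightarrow> real \<Rightarrow> real \<Rightarrow> real \<Rightarrow> real \<Rightarrow> real \<Rightarrow> 'a \<Rightarrow> 'a \<Rightarrow> real" where
  "g0 D m \<nu> \<Phi> d\<^sub>1 d\<^sub>2 \<alpha>\<^sub>1 \<alpha>\<^sub>2 \<beta>\<^sub>1 \<beta>\<^sub>2 x y =
     (if d\<^sub>1 > \<alpha>\<^sub>2 * min \<beta>\<^sub>2 1 then
        psi \<nu> \<Phi> (dist x y) / vol m x (dist x y)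
      else if d\<^sub>1 = d\<^sub>2 \<and> d\<^sub>2 = \<alpha>\<^sub>1 * \<beta>\<^sub>1 \<and> \<alpha>\<^sub>1 * \<beta>\<^sub>1 = \<alpha>\<^sub>2 * \<beta>\<^sub>2 then
        ln (exp 1 + delta_max D x y / dist x y)
      else if d\<^sub>2 < \<alpha>\<^sub>1 * \<beta>\<^sub>1 then
        psi \<nu> \<Phi> (max (dist x y) (delta_max D x y)) / vol m x (max (dist x y) (delta_max D x y))
      else undefined)"

definition h_bracket ::
    "'a::metric_space set \<Rightarrow> real measure \<Rightarrow> (real \<Rightarrow> real) \<Rightarrow> (real \<Rightarrow> 'a \<Rightarrow> 'a \<Rightarrow> real) \<Rightarrow>
     'a \<Rightarrow> 'a \<Rightarrow> real" where
  "h_bracket D \<nu> \<Phi> h x y =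
     h (\<Phi> (min (dist x y) (delta_max D x y))) x y *
     min 1 (\<Phi> (delta_max D x y) * psi \<nu> \<Phi> (delta_max D x y) /
            (\<Phi> (dist x y) * psi \<nu> \<Phi> (dist x y)))"

end

theory Submission
  imports Defs
begin

text \<open>
  Subordination turns the Green function into a single integral: \<open>G(x,y)\<close> is the integral of
  \<open>s \<mapsto> p(s,x,y)\<close> against the potential measure \<open>U\<close> of the subordinator, \<open>U(B)\<close> being the expected
  time that \<open>S\<close> spends in \<open>B\<close>. With \<open>f(s) = 1/\<phi>(1/s)\<close>, the Laplace transform \<open>\<integral> e\<^sup>-\<^sup>l\<^sup>s U(ds) = 1/\<phi>(l)\<close>
  gives \<open>U[0,s] \<simeq> f(s)\<close>, and the polynomial scaling that \<open>f\<close> inherits from the Levy tail sharpens this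
  to \<open>U(s/K,s] \<simeq> f(s)\<close> for a fixed large \<open>K\<close>. Thus \<open>U\<close> behaves like \<open>f(s) ds/s\<close>, but only on blocks of
  times, so every integral is estimated by a sum over geometric blocks. Such a sum is comparable to
  one of its end terms when the product of the integrand and \<open>f\<close> varies like a nonzero power, and to the
  number of blocks when this product is constant.

  Fix a pair \<open>x, y\<close> and write \<open>\<rho>\<close> for its distance and \<open>\<delta>\<close> for \<open>\<delta>\<^sub>\<or>(x,y)\<close>. Put \<open>T = \<Phi>(\<rho>)\<close>, \<open>\<tau> = \<Phi>(\<delta>)\<close> and
  \<open>v(s) = V(x,\<Phi>\<^sup>-\<^sup>1(s))\<close>. The heat kernel has three pieces.

    \<^item> For \<open>s \<le> T\<close>, the jump part \<open>h(s) s / (V(x,\<rho>) \<Psi>(\<rho>))\<close>. The blocks of \<open>s h(s) f(s)\<close> increase up to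
      \<open>T \<and> \<tau>\<close>, since \<open>h\<close> decays with an exponent below \<open>1 + \<beta>\<^sub>1\<close> there, and decrease from \<open>\<tau>\<close> to \<open>T\<close>, since
      the exponent \<open>\<gamma>\<^sub>*\<close> exceeds \<open>1 + (\<beta>\<^sub>2 \<and> 1)\<close>. The block at \<open>T \<and> \<tau>\<close> is the term with \<open>[h]\<close>.
    \<^item> For \<open>s \<le> T\<close>, the Gaussian part, which decays faster than any power as \<open>s\<close> decreases and is
      therefore dominated by its block at \<open>T\<close>.
    \<^item> For \<open>s \<ge> T\<close>, the on-diagonal part \<open>h(s)/v(s)\<close>, with blocks \<open>h(s) f(s)/v(s)\<close>. After \<open>T \<or> \<tau>\<close> they decrease
      because of \<open>\<gamma>\<^sub>*\<close>. Between \<open>T\<close> and \<open>\<tau>\<close> the function \<open>h\<close> is essentially constant, as either both points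
      are deep inside \<open>D\<close> or \<open>T\<close> and \<open>\<tau>\<close> are comparable, and \<open>f/v\<close> decreases, is constant or increases
      in the three cases of the theorem: the result is the block at \<open>T\<close>, a logarithm, or the block at
      \<open>\<tau>\<close>. This is the term with \<open>g\<^sub>0\<close>.

  The estimates in the time variable form the locale \<open>green_core\<close>; the lemmas \<open>sharp_transient\<close>,
  \<open>sharp_critical\<close> and \<open>sharp_recurrent\<close> are the three cases. In the locale \<open>green_setting\<close> the
  assumptions of \<open>green_core\<close> are derived from the geometric ones, and \<open>green_estimate\<close> translates the result back.

  In a bounded domain these block sums cover only the times below \<open>2 \<Phi>(diam D)\<close>, and the remaining times are
  negligible because the heat kernel decays exponentially. Under \<open>HK_B\<close> this is an assumption. Under
  \<open>HK_U\<close> it is a consequence of volume growth and the Chapman-Kolmogorov equation (lemma \<open>HK_U_imp\<close>).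
\<close>

section \<open>The renewal scale of a subordinator\<close>

text \<open>
  Up to constants this is the expected time that the subordinator spends in \<open>[0,t]\<close>. It is denoted by
  \<open>f\<close> below, and \<open>psi \<nu> \<Phi> r\<close> is its value at \<open>\<Phi> r\<close>.
\<close>

definition renewal_scale :: "real measure \<Rightarrow> real \<Rightarrow> real" where
  "renewal_scale \<nu> t = 1 / laplace_exponent \<nu> (1 / t)"

lemma one_minus_exp_bounds:
  fixes x :: real
  assumes "0 \<le> x"
  shows "1 - exp (- x) \<le> min 1 x" and "min 1 x \<le> 2 * (1 - exp (- x))"
proof -
  show "1 - exp (- x) \<le> min 1 x"
    using exp_ge_add_one_self[of "- x"] by simp
  have "exp (- x) \<le> 1 / (1 + x)"
    using exp_ge_add_one_self[of x] assms by (simp add: exp_minus field_simps)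
  then have "2 * (1 - 1 / (1 + x)) \<le> 2 * (1 - exp (- x))"
    by simp
  moreover have "min 1 x \<le> 2 * (1 - 1 / (1 + x))"
    using assms mult_left_le_one_le[of x x] by (auto simp: min_def field_simps)
  ultimately show "min 1 x \<le> 2 * (1 - exp (- x))"
    by (rule order_trans[rotated])
qed

text \<open>
  A layer-cake formula on the dyadic scale, up to a factor two: if \<open>j\<close> is the first index with
  \<open>2\<^sup>-\<^sup>j t < s\<close>, then the sum is the geometric tail \<open>2\<^sup>1\<^sup>-\<^sup>j\<close>. Integration over \<open>s\<close> expresses the Laplace exponent
  by tails of the Levy measure.
\<close>

lemma min_dyadic_sum:
  fixes s t :: real
  assumes "0 < s" and "0 < t"
  defines "A \<equiv> (\<Sum>k. ennreal ((1/2) ^ k) * indicator {(1/2) ^ k * t<..} s)"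
  shows "ennreal (min 1 (s / t)) \<le> A" and "A \<le> 2 * ennreal (min 1 (s / t))"
proof -
  define j where "j = (LEAST k. (1/2) ^ k * t < s)"
  have ex: "\<exists>k. (1/2) ^ k * t < s"
  proof -
    obtain k where "(1/2::real) ^ k < s / t"
      using real_arch_pow_inv[of "s / t" "1/2"] assms by auto
    then show ?thesis using assms by (auto simp: field_simps)
  qed
  then have j: "(1/2) ^ j * t < s" unfolding j_def by (rule LeastI_ex)
  have iff: "(1/2) ^ k * t < s \<longleftrightarrow> j \<le> k" for k
  proof
    assume "(1/2) ^ k * t < s" then show "j \<le> k" unfolding j_def by (rule Least_le)
  next
    assume "j \<le> k"
    then have "(1/2::real) ^ k \<le> (1/2) ^ j" by (intro power_decreasing) auto
    then have "(1/2) ^ k * t \<le> (1/2) ^ j * t" using assms by simp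
    then show "(1/2) ^ k * t < s" using j by simp
  qed
  have "(\<lambda>k. (1/2) ^ j * (1/2::real) ^ k) sums ((1/2) ^ j * (1 / (1 - 1/2)))"
    by (intro sums_mult geometric_sums) auto
  then have "(\<lambda>k. if j \<le> k + j then (1/2::real) ^ (k + j) else 0) sums (2 * (1/2) ^ j)"
    by (simp add: power_add mult.commute)
  then have "(\<lambda>k. if j \<le> k then (1/2::real) ^ k else 0) sums
      (2 * (1/2) ^ j + (\<Sum>i<j. if j \<le> i then (1/2) ^ i else 0))"
    by (subst (asm) sums_iff_shift) simp
  also have "(\<Sum>i<j. if j \<le> i then (1/2::real) ^ i else 0) = 0"
    by (intro sum.neutral) auto
  finally have "(\<Sum>k. ennreal (if j \<le> k then (1/2) ^ k else 0)) = ennreal (2 * (1/2) ^ j)"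
    by (intro suminf_ennreal_eq) auto
  also have "(\<Sum>k. ennreal (if j \<le> k then (1/2) ^ k else 0)) = A"
    unfolding A_def by (intro suminf_cong) (auto simp: iff indicator_def)
  finally have A: "A = ennreal (2 * (1/2) ^ j)" by simp
  have up: "2 * (1/2) ^ j \<le> 2 * min 1 (s / t)"
    using j assms by (auto simp: min_def field_simps power_le_one)
  have lo: "min 1 (s / t) \<le> 2 * (1/2) ^ j"
  proof (cases j)
    case (Suc i)
    then have "\<not> (1/2) ^ i * t < s" using iff[of i] by simp
    then have "s / t \<le> (1/2) ^ i" using assms by (simp add: field_simps)
    then show ?thesis using Suc by simp
  qed simp
  show "ennreal (min 1 (s / t)) \<le> A" unfolding A by (intro ennreal_leI lo)
  have "ennreal (2 * min 1 (s / t)) = 2 * ennreal (min 1 (s / t))"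
    using assms by (subst ennreal_mult) auto
  then show "A \<le> 2 * ennreal (min 1 (s / t))" unfolding A using ennreal_leI[OF up] by simp
qed

lemma levy_measure_AE_pos: "levy_measure \<nu> \<Longrightarrow> AE s in \<nu>. 0 < s"
  by (rule AE_I[of _ _ "{..0}"]) (auto simp: levy_measure_def sets_eq_imp_space_eq)

lemma levy_measure_tail_finite:
  assumes "levy_measure \<nu>" and "0 < r"
  shows "emeasure \<nu> {r<..} < \<infinity>"
proof -
  have [measurable_cong]: "sets \<nu> = sets borel" using assms by (simp add: levy_measure_def)
  have "ennreal (min 1 r) * emeasure \<nu> {r<..} = (\<integral>\<^sup>+s. ennreal (min 1 r) * indicator {r<..} s \<partial>\<nu>)"
    by (rule nn_integral_cmult_indicator[symmetric]) measurable
  also have "\<dots> \<le> (\<integral>\<^sup>+s. ennreal (min 1 s) \<partial>\<nu>)"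
    by (intro nn_integral_mono) (auto simp: indicator_def intro!: ennreal_leI)
  also have "\<dots> < \<infinity>" using assms by (simp add: levy_measure_def)
  finally show ?thesis using assms(2)
    by (auto simp: ennreal_mult_less_top less_top min_def split: if_splits)
qed

lemma
  assumes \<nu>: "levy_measure \<nu>" and l: "0 \<le> l"
  shows integrable_one_minus_exp: "integrable \<nu> (\<lambda>s. 1 - exp (- l * s))"
    and ennreal_laplace_exponent:
      "ennreal (laplace_exponent \<nu> l) = (\<integral>\<^sup>+s. ennreal (1 - exp (- l * s)) \<partial>\<nu>)"
    and laplace_exponent_nonneg: "0 \<le> laplace_exponent \<nu> l"
proof -
  have [measurable_cong]: "sets \<nu> = sets borel" using \<nu> by (simp add: levy_measure_def)
  have nn: "AE s in \<nu>. 0 \<le> 1 - exp (- l * s)"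
    using levy_measure_AE_pos[OF \<nu>] by eventually_elim (use l in simp)
  have "(\<integral>\<^sup>+s. ennreal (1 - exp (- l * s)) \<partial>\<nu>) \<le> (\<integral>\<^sup>+s. ennreal (max 1 l) * ennreal (min 1 s) \<partial>\<nu>)"
  proof (rule nn_integral_mono_AE)
    show "AE s in \<nu>. ennreal (1 - exp (- l * s)) \<le> ennreal (max 1 l) * ennreal (min 1 s)"
      using levy_measure_AE_pos[OF \<nu>]
    proof eventually_elim
      fix s :: real assume s: "0 < s"
      have "1 - exp (- l * s) \<le> min 1 (l * s)"
        using one_minus_exp_bounds(1)[of "l * s"] s l by simp
      also have "\<dots> \<le> max 1 l * min 1 s"
      proof (cases "s \<le> 1")
        case True
        have "l * s \<le> max 1 l * s" using s by (intro mult_right_mono) auto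
        then show ?thesis using True by simp
      qed auto
      finally show "ennreal (1 - exp (- l * s)) \<le> ennreal (max 1 l) * ennreal (min 1 s)"
        using s by (simp add: ennreal_mult[symmetric] ennreal_leI)
    qed
  qed
  also have "\<dots> = ennreal (max 1 l) * (\<integral>\<^sup>+s. ennreal (min 1 s) \<partial>\<nu>)"
    by (rule nn_integral_cmult) measurable
  also have "\<dots> < \<infinity>" using \<nu> by (simp add: levy_measure_def ennreal_mult_less_top)
  finally show int: "integrable \<nu> (\<lambda>s. 1 - exp (- l * s))"
    by (intro integrableI_nonneg nn) auto
  show "ennreal (laplace_exponent \<nu> l) = (\<integral>\<^sup>+s. ennreal (1 - exp (- l * s)) \<partial>\<nu>)"
    unfolding laplace_exponent_def by (rule nn_integral_eq_integral[OF int nn, symmetric])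
  show "0 \<le> laplace_exponent \<nu> l"
    unfolding laplace_exponent_def by (rule integral_nonneg_AE[OF nn])
qed

lemma laplace_exponent_mono:
  assumes "levy_measure \<nu>" and "0 \<le> l" and "l \<le> l'"
  shows "laplace_exponent \<nu> l \<le> laplace_exponent \<nu> l'"
  unfolding laplace_exponent_def
  using levy_measure_AE_pos[OF assms(1)] assms
  by (intro integral_mono_AE integrable_one_minus_exp) (auto elim!: eventually_mono)

lemma laplace_exponent_truncation:
  assumes \<nu>: "levy_measure \<nu>" and t: "0 < t"
  shows "ennreal (laplace_exponent \<nu> (1 / t)) \<le> (\<integral>\<^sup>+s. ennreal (min 1 (s / t)) \<partial>\<nu>)"
    and "(\<integral>\<^sup>+s. ennreal (min 1 (s / t)) \<partial>\<nu>) \<le> 2 * ennreal (laplace_exponent \<nu> (1 / t))"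
proof -
  have [measurable_cong]: "sets \<nu> = sets borel" using \<nu> by (simp add: levy_measure_def)
  note eq = ennreal_laplace_exponent[OF \<nu>, of "1 / t"]
  show "ennreal (laplace_exponent \<nu> (1 / t)) \<le> (\<integral>\<^sup>+s. ennreal (min 1 (s / t)) \<partial>\<nu>)"
    using t levy_measure_AE_pos[OF \<nu>] one_minus_exp_bounds(1)
    by (subst eq) (auto intro!: nn_integral_mono_AE ennreal_leI elim!: eventually_mono)
  have "(\<integral>\<^sup>+s. ennreal (min 1 (s / t)) \<partial>\<nu>) \<le> (\<integral>\<^sup>+s. 2 * ennreal (1 - exp (- (1 / t) * s)) \<partial>\<nu>)"
  proof (rule nn_integral_mono_AE)
    show "AE s in \<nu>. ennreal (min 1 (s / t)) \<le> 2 * ennreal (1 - exp (- (1 / t) * s))"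
      using levy_measure_AE_pos[OF \<nu>]
    proof eventually_elim
      fix s :: real assume s: "0 < s"
      have "min 1 (s / t) \<le> 2 * (1 - exp (- (1 / t) * s))"
        using one_minus_exp_bounds(2)[of "s / t"] s t by simp
      then have "ennreal (min 1 (s / t)) \<le> ennreal (2 * (1 - exp (- (1 / t) * s)))"
        by (rule ennreal_leI)
      also have "\<dots> = 2 * ennreal (1 - exp (- (1 / t) * s))"
        using s t by (subst ennreal_mult) auto
      finally show "ennreal (min 1 (s / t)) \<le> 2 * ennreal (1 - exp (- (1 / t) * s))" .
    qed
  qed
  also have "\<dots> = 2 * ennreal (laplace_exponent \<nu> (1 / t))"
    using t by (subst eq) (simp_all add: nn_integral_cmult)
  finally show "(\<integral>\<^sup>+s. ennreal (min 1 (s / t)) \<partial>\<nu>) \<le> 2 * ennreal (laplace_exponent \<nu> (1 / t))" .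
qed

lemma laplace_exponent_dyadic:
  assumes \<nu>: "levy_measure \<nu>" and t: "0 < t"
  defines "W \<equiv> (\<Sum>k. ennreal ((1/2) ^ k) * ennreal (tail \<nu> ((1/2) ^ k * t)))"
  shows "ennreal (laplace_exponent \<nu> (1 / t)) \<le> W"
    and "W \<le> 4 * ennreal (laplace_exponent \<nu> (1 / t))"
proof -
  have [measurable_cong]: "sets \<nu> = sets borel" using \<nu> by (simp add: levy_measure_def)
  have fin: "ennreal (measure \<nu> {(1/2) ^ k * t<..}) = emeasure \<nu> {(1/2) ^ k * t<..}" for k
    using levy_measure_tail_finite[OF \<nu>, of "(1/2) ^ k * t"] t
    by (subst emeasure_eq_ennreal_measure) auto
  have W: "W = (\<integral>\<^sup>+s. (\<Sum>k. ennreal ((1/2) ^ k) * indicator {(1/2) ^ k * t<..} s) \<partial>\<nu>)"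
  proof (subst nn_integral_suminf)
    show "W = (\<Sum>k. \<integral>\<^sup>+s. ennreal ((1/2) ^ k) * indicator {(1/2) ^ k * t<..} s \<partial>\<nu>)"
      unfolding W_def tail_def
      by (intro suminf_cong, subst nn_integral_cmult_indicator) (auto simp: fin)
  qed measurable
  have "(\<integral>\<^sup>+s. ennreal (min 1 (s / t)) \<partial>\<nu>) \<le> W"
    unfolding W using min_dyadic_sum(1) t
    by (intro nn_integral_mono_AE eventually_mono[OF levy_measure_AE_pos[OF \<nu>]]) auto
  then show "ennreal (laplace_exponent \<nu> (1 / t)) \<le> W"
    using laplace_exponent_truncation(1)[OF \<nu> t] by (rule order_trans[rotated])
  have "W \<le> (\<integral>\<^sup>+s. 2 * ennreal (min 1 (s / t)) \<partial>\<nu>)"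
    unfolding W using min_dyadic_sum(2) t
    by (intro nn_integral_mono_AE eventually_mono[OF levy_measure_AE_pos[OF \<nu>]]) auto
  also have "\<dots> = 2 * (\<integral>\<^sup>+s. ennreal (min 1 (s / t)) \<partial>\<nu>)"
    by (rule nn_integral_cmult) measurable
  also have "\<dots> \<le> 2 * (2 * ennreal (laplace_exponent \<nu> (1 / t)))"
    by (intro mult_left_mono laplace_exponent_truncation(2)[OF \<nu> t]) auto
  also have "\<dots> = 4 * ennreal (laplace_exponent \<nu> (1 / t))"
    by (simp flip: mult.assoc)
  finally show "W \<le> 4 * ennreal (laplace_exponent \<nu> (1 / t))" .
qed

text \<open>
  Since the Laplace exponent at \<open>1/t\<close> is an average of the Levy tail over \<open>(0,t]\<close>, it inherits
  any comparison of tails that is stable under a common dilation.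
\<close>

lemma laplace_exponent_le_of_tail_le:
  assumes \<nu>: "levy_measure \<nu>" and st: "0 < s" "0 < t" and c: "0 \<le> c"
    and le: "\<And>a. 0 < a \<Longrightarrow> a \<le> 1 \<Longrightarrow> tail \<nu> (a * s) \<le> c * tail \<nu> (a * t)"
  shows "laplace_exponent \<nu> (1 / s) \<le> 4 * c * laplace_exponent \<nu> (1 / t)"
proof -
  have "ennreal (laplace_exponent \<nu> (1 / s)) \<le>
      (\<Sum>k. ennreal ((1/2) ^ k) * ennreal (tail \<nu> ((1/2) ^ k * s)))"
    by (rule laplace_exponent_dyadic(1)[OF \<nu> st(1)])
  also have "\<dots> \<le> (\<Sum>k. ennreal c * (ennreal ((1/2) ^ k) * ennreal (tail \<nu> ((1/2) ^ k * t))))"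
  proof (intro suminf_le summableI)
    fix k :: nat
    have "tail \<nu> ((1/2) ^ k * s) \<le> c * tail \<nu> ((1/2) ^ k * t)"
      by (rule le) (auto simp: power_le_one)
    then have "ennreal (tail \<nu> ((1/2) ^ k * s)) \<le> ennreal c * ennreal (tail \<nu> ((1/2) ^ k * t))"
      using c by (simp add: ennreal_mult[symmetric] tail_def ennreal_leI)
    then show "ennreal ((1/2) ^ k) * ennreal (tail \<nu> ((1/2) ^ k * s)) \<le>
        ennreal c * (ennreal ((1/2) ^ k) * ennreal (tail \<nu> ((1/2) ^ k * t)))"
      by (metis mult.left_commute mult_left_mono zero_le)
  qed
  also have "\<dots> = ennreal c * (\<Sum>k. ennreal ((1/2) ^ k) * ennreal (tail \<nu> ((1/2) ^ k * t)))"
    by simp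
  also have "\<dots> \<le> ennreal c * (4 * ennreal (laplace_exponent \<nu> (1 / t)))"
    by (intro mult_left_mono laplace_exponent_dyadic(2)[OF \<nu> st(2)]) auto
  also have "\<dots> = ennreal (4 * c * laplace_exponent \<nu> (1 / t))"
    using c laplace_exponent_nonneg[OF \<nu>, of "1 / t"] st
    by (simp add: ennreal_mult[symmetric] mult.assoc mult.left_commute flip: ennreal_numeral)
  finally show ?thesis
    using c laplace_exponent_nonneg[OF \<nu>, of "1 / t"] st by (subst (asm) ennreal_le_iff) auto
qed

lemma Poly_tail_pos:
  assumes "Poly_tail \<nu> R\<^sub>1 \<beta>\<^sub>1 \<beta>\<^sub>2" and "0 < r" and "ereal r < R\<^sub>1"
  shows "0 < tail \<nu> r"
proof -
  obtain c where "0 < c" "c * (r / r) powr \<beta>\<^sub>1 \<le> tail \<nu> r / tail \<nu> r"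
    using assms unfolding Poly_tail_def by blast
  then have "tail \<nu> r \<noteq> 0" using assms(2) by auto
  then show ?thesis by (simp add: tail_def zero_less_measure_iff)
qed

lemma laplace_exponent_pos:
  assumes \<nu>: "levy_measure \<nu>" and P: "Poly_tail \<nu> R\<^sub>1 \<beta>\<^sub>1 \<beta>\<^sub>2" and l: "0 < l"
  shows "0 < laplace_exponent \<nu> l"
proof -
  have [measurable_cong]: "sets \<nu> = sets borel" using \<nu> by (simp add: levy_measure_def)
  have "0 < R\<^sub>1" using P by (simp add: Poly_tail_def)
  then obtain r where r: "0 < r" "ereal r < R\<^sub>1"
    using ereal_dense2[of 0 R\<^sub>1] by (metis ereal_less(2))
  have e: "emeasure \<nu> {r<..} \<noteq> 0"
    using Poly_tail_pos[OF P r] by (auto simp: tail_def measure_def)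
  have "laplace_exponent \<nu> l \<noteq> 0"
  proof
    assume "laplace_exponent \<nu> l = 0"
    then have "(\<integral>\<^sup>+s. ennreal (1 - exp (- l * s)) \<partial>\<nu>) = 0"
      using ennreal_laplace_exponent[OF \<nu>, of l] l by simp
    then have "AE s in \<nu>. ennreal (1 - exp (- l * s)) = 0"
      by (subst (asm) nn_integral_0_iff_AE) auto
    then have "AE s in \<nu>. s \<notin> {r<..}"
    proof eventually_elim
      fix s :: real assume "ennreal (1 - exp (- l * s)) = 0"
      then have "s \<le> 0" using l by (simp add: ennreal_eq_0_iff mult_le_0_iff)
      then show "s \<notin> {r<..}" using r by simp
    qed
    then have "emeasure \<nu> {r<..} = 0"
      using emeasure_eq_0_AE[of "\<lambda>s. s \<in> {r<..}" \<nu>] sets_eq_imp_space_eq[of \<nu> borel] \<nu>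
      by (simp add: levy_measure_def greaterThan_def)
    then show False using e by simp
  qed
  then show ?thesis using laplace_exponent_nonneg[OF \<nu>, of l] l by simp
qed

lemma renewal_scale_pos:
  assumes "levy_measure \<nu>" and "Poly_tail \<nu> R\<^sub>1 \<beta>\<^sub>1 \<beta>\<^sub>2" and "0 < t"
  shows "0 < renewal_scale \<nu> t"
  using laplace_exponent_pos[OF assms(1,2), of "1 / t"] assms(3) by (simp add: renewal_scale_def)

lemma renewal_scale_mono:
  assumes "levy_measure \<nu>" and "Poly_tail \<nu> R\<^sub>1 \<beta>\<^sub>1 \<beta>\<^sub>2" and "0 < s" and "s \<le> t"
  shows "renewal_scale \<nu> s \<le> renewal_scale \<nu> t"
  unfolding renewal_scale_def using assms
  by (intro divide_left_mono laplace_exponent_mono mult_pos_pos laplace_exponent_pos[OF assms(1,2)])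
     (auto simp: frac_le)

lemma renewal_scale_linear:
  assumes \<nu>: "levy_measure \<nu>" and P: "Poly_tail \<nu> R\<^sub>1 \<beta>\<^sub>1 \<beta>\<^sub>2" and st: "0 < s" "s \<le> t"
  shows "renewal_scale \<nu> t \<le> 2 * (t / s) * renewal_scale \<nu> s"
proof -
  have [measurable_cong]: "sets \<nu> = sets borel" using \<nu> by (simp add: levy_measure_def)
  have t: "0 < t" using st by simp
  have "ennreal (laplace_exponent \<nu> (1 / s)) \<le> (\<integral>\<^sup>+r. ennreal (min 1 (r / s)) \<partial>\<nu>)"
    by (rule laplace_exponent_truncation[OF \<nu> st(1)])
  also have "\<dots> \<le> (\<integral>\<^sup>+r. ennreal (t / s) * ennreal (min 1 (r / t)) \<partial>\<nu>)"
  proof (rule nn_integral_mono_AE)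
    show "AE r in \<nu>. ennreal (min 1 (r / s)) \<le> ennreal (t / s) * ennreal (min 1 (r / t))"
      using levy_measure_AE_pos[OF \<nu>]
    proof eventually_elim
      fix r :: real assume r: "0 < r"
      have "min 1 (r / s) \<le> t / s * min 1 (r / t)"
        using r st by (auto simp: min_def field_simps)
      then show "ennreal (min 1 (r / s)) \<le> ennreal (t / s) * ennreal (min 1 (r / t))"
        using r st by (simp add: ennreal_mult[symmetric] ennreal_leI)
    qed
  qed
  also have "\<dots> = ennreal (t / s) * (\<integral>\<^sup>+r. ennreal (min 1 (r / t)) \<partial>\<nu>)"
    by (rule nn_integral_cmult) measurable
  also have "\<dots> \<le> ennreal (t / s) * (2 * ennreal (laplace_exponent \<nu> (1 / t)))"
    by (intro mult_left_mono laplace_exponent_truncation(2)[OF \<nu> t]) auto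
  also have "\<dots> = ennreal (2 * (t / s) * laplace_exponent \<nu> (1 / t))"
    using laplace_exponent_nonneg[OF \<nu>, of "1 / t"] st
    by (simp add: ennreal_mult[symmetric] mult.assoc mult.left_commute flip: ennreal_numeral)
  finally have "laplace_exponent \<nu> (1 / s) \<le> 2 * (t / s) * laplace_exponent \<nu> (1 / t)"
    using laplace_exponent_nonneg[OF \<nu>, of "1 / t"] st by (subst (asm) ennreal_le_iff) auto
  then show ?thesis
    using laplace_exponent_pos[OF \<nu> P, of "1 / t"] laplace_exponent_pos[OF \<nu> P, of "1 / s"] st
    by (simp add: renewal_scale_def field_simps)
qed

lemma renewal_scale_power:
  assumes \<nu>: "levy_measure \<nu>" and P: "Poly_tail \<nu> R\<^sub>1 \<beta>\<^sub>1 \<beta>\<^sub>2"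
  shows "\<exists>A>0. \<forall>s t. 0 < s \<and> s \<le> t \<and> ereal t < R\<^sub>1 \<longrightarrow>
    renewal_scale \<nu> s \<le> A * (s / t) powr \<beta>\<^sub>1 * renewal_scale \<nu> t \<and>
    renewal_scale \<nu> t \<le> A * (t / s) powr \<beta>\<^sub>2 * renewal_scale \<nu> s"
proof -
  obtain c\<^sub>1 c\<^sub>2 where c: "0 < c\<^sub>1" "0 < c\<^sub>2"
    and w: "\<And>r R. 0 < r \<Longrightarrow> r \<le> R \<Longrightarrow> ereal R < R\<^sub>1 \<Longrightarrow>
        c\<^sub>1 * (R / r) powr \<beta>\<^sub>1 \<le> tail \<nu> r / tail \<nu> R \<and> tail \<nu> r / tail \<nu> R \<le> c\<^sub>2 * (R / r) powr \<beta>\<^sub>2"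
    using P unfolding Poly_tail_def by blast
  define A where "A = 4 / c\<^sub>1 + 4 * c\<^sub>2"
  have A: "0 < A" "4 / c\<^sub>1 \<le> A" "4 * c\<^sub>2 \<le> A" using c by (auto simp: A_def add_pos_pos)
  show ?thesis
  proof (intro exI[of _ A] conjI allI impI A(1); elim conjE)
    fix s t :: real assume st: "0 < s" "s \<le> t" "ereal t < R\<^sub>1"
    have t: "0 < t" using st by simp
    have l: "0 < laplace_exponent \<nu> (1 / s)" "0 < laplace_exponent \<nu> (1 / t)"
      using laplace_exponent_pos[OF \<nu> P] st by auto
    have sc: "c\<^sub>1 * (t / s) powr \<beta>\<^sub>1 * tail \<nu> (a * t) \<le> tail \<nu> (a * s)
        \<and> tail \<nu> (a * s) \<le> c\<^sub>2 * (t / s) powr \<beta>\<^sub>2 * tail \<nu> (a * t)" if a: "0 < a" "a \<le> 1" for a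
    proof -
      have "a * t \<le> t" using a t by (simp add: mult_left_le_one_le)
      then have r: "ereal (a * t) < R\<^sub>1" using st(3) by (meson ereal_less_eq(3) le_less_trans)
      show ?thesis
        using w[of "a * s" "a * t"] Poly_tail_pos[OF P _ r] a st r by (simp add: field_simps)
    qed
    have "laplace_exponent \<nu> (1 / t) \<le> 4 * ((s / t) powr \<beta>\<^sub>1 / c\<^sub>1) * laplace_exponent \<nu> (1 / s)"
    proof (rule laplace_exponent_le_of_tail_le[OF \<nu> t st(1)])
      fix a :: real assume "0 < a" "a \<le> 1"
      then show "tail \<nu> (a * t) \<le> (s / t) powr \<beta>\<^sub>1 / c\<^sub>1 * tail \<nu> (a * s)"
        using sc[of a] c st t by (simp add: powr_divide field_simps)
    qed (use c in simp)
    then have "renewal_scale \<nu> s \<le> (4 / c\<^sub>1) * ((s / t) powr \<beta>\<^sub>1 * renewal_scale \<nu> t)"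
      using l c by (simp add: renewal_scale_def field_simps)
    also have "\<dots> \<le> A * ((s / t) powr \<beta>\<^sub>1 * renewal_scale \<nu> t)"
      using l by (intro mult_right_mono A) (simp add: renewal_scale_def)
    finally show "renewal_scale \<nu> s \<le> A * (s / t) powr \<beta>\<^sub>1 * renewal_scale \<nu> t"
      by (simp add: mult.assoc)
    have "laplace_exponent \<nu> (1 / s) \<le> 4 * (c\<^sub>2 * (t / s) powr \<beta>\<^sub>2) * laplace_exponent \<nu> (1 / t)"
      by (rule laplace_exponent_le_of_tail_le[OF \<nu> st(1) t]) (use c sc in auto)
    then have "renewal_scale \<nu> t \<le> (4 * c\<^sub>2) * ((t / s) powr \<beta>\<^sub>2 * renewal_scale \<nu> s)"
      using l c by (simp add: renewal_scale_def field_simps)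
    also have "\<dots> \<le> A * ((t / s) powr \<beta>\<^sub>2 * renewal_scale \<nu> s)"
      using l by (intro mult_right_mono A) (simp add: renewal_scale_def)
    finally show "renewal_scale \<nu> t \<le> A * (t / s) powr \<beta>\<^sub>2 * renewal_scale \<nu> s"
      by (simp add: mult.assoc)
  qed
qed

text \<open>
  On a bounded range of times the restriction to \<open>t < R\<^sub>1\<close> disappears: dilating both arguments by
  the same factor moves them below \<open>R\<^sub>1\<close> and changes the scale by a bounded factor. The exponent
  \<open>min \<beta>\<^sub>2 1\<close> combines the tail condition with the linear bound of \<open>renewal_scale_linear\<close>.
\<close>

lemma renewal_scale_scaling:
  assumes \<nu>: "levy_measure \<nu>" and P: "Poly_tail \<nu> R\<^sub>1 \<beta>\<^sub>1 \<beta>\<^sub>2"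
    and L: "L < \<infinity> \<or> R\<^sub>1 = \<infinity>"
  shows "\<exists>A>0. \<forall>s t. 0 < s \<and> s \<le> t \<and> ereal t < L \<longrightarrow>
    renewal_scale \<nu> s \<le> A * (s / t) powr \<beta>\<^sub>1 * renewal_scale \<nu> t \<and>
    renewal_scale \<nu> t \<le> A * (t / s) powr (min \<beta>\<^sub>2 1) * renewal_scale \<nu> s"
proof -
  let ?f = "renewal_scale \<nu>"
  have pos: "0 < ?f t" if "0 < t" for t using renewal_scale_pos[OF \<nu> P that] .
  obtain A where A: "0 < A" and sc: "\<And>s t. 0 < s \<Longrightarrow> s \<le> t \<Longrightarrow> ereal t < R\<^sub>1 \<Longrightarrow>
      ?f s \<le> A * (s / t) powr \<beta>\<^sub>1 * ?f t \<and> ?f t \<le> A * (t / s) powr \<beta>\<^sub>2 * ?f s"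
    using renewal_scale_power[OF \<nu> P] by blast
  obtain B where B: "0 < B" and sc': "\<And>s t. 0 < s \<Longrightarrow> s \<le> t \<Longrightarrow> ereal t < L \<Longrightarrow>
      ?f s \<le> B * (s / t) powr \<beta>\<^sub>1 * ?f t \<and> ?f t \<le> B * (t / s) powr \<beta>\<^sub>2 * ?f s"
  proof (cases "R\<^sub>1 = \<infinity>")
    case True
    then show ?thesis using sc A that[of A] by auto
  next
    case False
    then obtain L' where L': "0 < L'" "\<And>t. ereal t < L \<Longrightarrow> t \<le> L'"
      using L by (cases L) (auto intro: that[of "max 1 (real_of_ereal L)"] that[of 1])
    have "0 < R\<^sub>1" using P by (simp add: Poly_tail_def)
    then obtain r where r: "0 < r" "ereal r < R\<^sub>1"
      using ereal_dense2[of 0 R\<^sub>1] by (metis ereal_less(2))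
    define a where "a = min 1 (r / L')"
    have a: "0 < a" "a \<le> 1" "\<And>t. ereal t < L \<Longrightarrow> 0 < t \<Longrightarrow> ereal (a * t) < R\<^sub>1"
    proof -
      fix t assume t: "ereal t < L" "0 < t"
      have "a * t \<le> r / L' * L'"
        unfolding a_def using L'(2)[OF t(1)] t r L' by (intro mult_mono) auto
      then have "a * t \<le> r" using L' by simp
      then show "ereal (a * t) < R\<^sub>1" using r(2) by (meson ereal_less_eq(3) le_less_trans)
    qed (use r L' in \<open>auto simp: a_def\<close>)
    show ?thesis
    proof (rule that[of "2 * A / a"])
      show "0 < 2 * A / a" using A a by simp
      fix s t assume st: "0 < s" "s \<le> t" "ereal t < L"
      have t: "0 < t" using st by simp
      have dil: "?f u \<le> 2 / a * ?f (a * u)" "?f (a * u) \<le> ?f u" if "0 < u" for u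
        using renewal_scale_linear[OF \<nu> P, of "a * u" u] renewal_scale_mono[OF \<nu> P, of "a * u" u] that a
        by (auto simp: mult_left_le_one_le)
      have scs: "?f (a * s) \<le> A * (s / t) powr \<beta>\<^sub>1 * ?f (a * t)"
          "?f (a * t) \<le> A * (t / s) powr \<beta>\<^sub>2 * ?f (a * s)"
        using sc[of "a * s" "a * t"] a(1,2) a(3)[OF st(3) t] st by auto
      have "?f s \<le> 2 / a * (A * (s / t) powr \<beta>\<^sub>1 * ?f (a * t))"
        by (intro order_trans[OF dil(1)] mult_left_mono scs) (use st a in auto)
      also have "\<dots> \<le> 2 / a * (A * (s / t) powr \<beta>\<^sub>1 * ?f t)"
        by (intro mult_left_mono dil) (use t a A in auto)
      finally have 1: "?f s \<le> 2 * A / a * (s / t) powr \<beta>\<^sub>1 * ?f t" by simp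
      have "?f t \<le> 2 / a * (A * (t / s) powr \<beta>\<^sub>2 * ?f (a * s))"
        by (intro order_trans[OF dil(1)] mult_left_mono scs) (use t a in auto)
      also have "\<dots> \<le> 2 / a * (A * (t / s) powr \<beta>\<^sub>2 * ?f s)"
        by (intro mult_left_mono dil) (use st a A in auto)
      finally have 2: "?f t \<le> 2 * A / a * (t / s) powr \<beta>\<^sub>2 * ?f s" by simp
      show "?f s \<le> 2 * A / a * (s / t) powr \<beta>\<^sub>1 * ?f t \<and> ?f t \<le> 2 * A / a * (t / s) powr \<beta>\<^sub>2 * ?f s"
        using 1 2 by simp
    qed
  qed
  show ?thesis
  proof (intro exI[of _ "max B 2"] conjI allI impI; (elim conjE)?)
    show "0 < max B 2" by simp
    fix s t assume st: "0 < s" "s \<le> t" "ereal t < L"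
    have t: "0 < t" using st by simp
    have "?f s \<le> B * ((s / t) powr \<beta>\<^sub>1 * ?f t)" using sc'[OF st] by (simp add: mult.assoc)
    also have "\<dots> \<le> max B 2 * ((s / t) powr \<beta>\<^sub>1 * ?f t)"
      using pos[OF t] by (intro mult_right_mono) auto
    finally show "?f s \<le> max B 2 * (s / t) powr \<beta>\<^sub>1 * ?f t" by (simp add: mult.assoc)
    show "?f t \<le> max B 2 * (t / s) powr (min \<beta>\<^sub>2 1) * ?f s"
    proof (cases "\<beta>\<^sub>2 \<le> 1")
      case True
      have "?f t \<le> B * ((t / s) powr \<beta>\<^sub>2 * ?f s)" using sc'[OF st] by (simp add: mult.assoc)
      also have "\<dots> \<le> max B 2 * ((t / s) powr \<beta>\<^sub>2 * ?f s)"
        using pos[OF st(1)] by (intro mult_right_mono) auto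
      finally show ?thesis using True by (simp add: mult.assoc)
    next
      case False
      have "?f t \<le> 2 * ((t / s) * ?f s)"
        using renewal_scale_linear[OF \<nu> P st(1,2)] by (simp add: mult.assoc)
      also have "\<dots> \<le> max B 2 * ((t / s) * ?f s)"
        using pos[OF st(1)] st t by (intro mult_right_mono) auto
      finally show ?thesis using False st t by (simp add: mult.assoc)
    qed
  qed
qed

section \<open>The potential measure of a subordinator\<close>

locale subordinator = prob_space M for M :: "'w measure" +
  fixes S :: "real \<Rightarrow> 'w \<Rightarrow> real" and \<nu> :: "real measure"
  assumes subordinator: "driftless_subordinator M S \<nu>"
begin

lemma levy: "levy_measure \<nu>"
  using subordinator by (simp add: driftless_subordinator_def)

lemma S_measurable [measurable]: "0 \<le> t \<Longrightarrow> S t \<in> borel_measurable M"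
  using subordinator by (simp add: driftless_subordinator_def)

lemma increment_measurable [measurable]:
  "0 \<le> s \<Longrightarrow> 0 \<le> t \<Longrightarrow> (\<lambda>\<omega>. S (s + t) \<omega> - S s \<omega>) \<in> borel_measurable M"
  by (intro borel_measurable_diff S_measurable) auto

lemma AE_mono: "0 \<le> s \<Longrightarrow> s \<le> t \<Longrightarrow> AE \<omega> in M. 0 \<le> S s \<omega> \<and> S s \<omega> \<le> S t \<omega>"
proof -
  assume st: "0 \<le> s" "s \<le> t"
  have "AE \<omega> in M. S 0 \<omega> = 0 \<and> mono_on {0..} (\<lambda>t. S t \<omega>) \<and>
        (\<forall>t\<ge>0. continuous (at_right t) (\<lambda>s. S s \<omega>))"
    using subordinator by (simp add: driftless_subordinator_def)
  then show ?thesis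
  proof eventually_elim
    fix \<omega> assume a: "S 0 \<omega> = 0 \<and> mono_on {0..} (\<lambda>t. S t \<omega>) \<and>
        (\<forall>t\<ge>0. continuous (at_right t) (\<lambda>s. S s \<omega>))"
    then have "S 0 \<omega> \<le> S s \<omega>" "S s \<omega> \<le> S t \<omega>"
      using st mono_onD[of "{0..}" "\<lambda>t. S t \<omega>" 0 s] mono_onD[of "{0..}" "\<lambda>t. S t \<omega>" s t] by auto
    then show "0 \<le> S s \<omega> \<and> S s \<omega> \<le> S t \<omega>" using a by simp
  qed
qed

definition laplace :: "real \<Rightarrow> real \<Rightarrow> real" where
  "laplace l t = (\<integral>\<omega>. exp (- l * S t \<omega>) \<partial>M)"

lemma integrable_exp_S:
  assumes "0 \<le> l" and "0 \<le> t"
  shows "integrable M (\<lambda>\<omega>. exp (- l * S t \<omega>))"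
proof (rule integrable_const_bound[where B = 1])
  show "AE \<omega> in M. norm (exp (- l * S t \<omega>)) \<le> 1"
    using AE_mono[OF assms(2) order_refl] by eventually_elim (use assms in simp)
qed (use assms in measurable)

lemma integrable_exp_increment:
  assumes "0 \<le> l" and "0 \<le> s" and "0 \<le> t"
  shows "integrable M (\<lambda>\<omega>. exp (- l * (S (s + t) \<omega> - S s \<omega>)))"
proof (rule integrable_const_bound[where B = 1])
  show "AE \<omega> in M. norm (exp (- l * (S (s + t) \<omega> - S s \<omega>))) \<le> 1"
  proof -
    have "AE \<omega> in M. 0 \<le> S s \<omega> \<and> S s \<omega> \<le> S (s + t) \<omega>"
      by (rule AE_mono) (use assms in auto)
    then show ?thesis by eventually_elim (use assms in simp)
  qed
  show "(\<lambda>\<omega>. exp (- l * (S (s + t) \<omega> - S s \<omega>))) \<in> borel_measurable M"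
    using increment_measurable[OF assms(2,3)] by measurable
qed

lemma indep_increment:
  assumes "0 \<le> s" and "0 \<le> t"
  shows "indep_var borel (S s) borel (\<lambda>\<omega>. S (s + t) \<omega> - S s \<omega>)"
proof -
  let ?X = "{S s -` A \<inter> space M | A. A \<in> sets borel}"
  let ?Y = "{(\<lambda>\<omega>. S (s + t) \<omega> - S s \<omega>) -` B \<inter> space M | B. B \<in> sets borel}"
  have ind: "indep_set (sets (gen_sigma (space M) borel S {0..s})) ?Y"
    using subordinator assms by (simp add: driftless_subordinator_def)
  have sub: "?X \<subseteq> sets (gen_sigma (space M) borel S {0..s})"
    unfolding gen_sigma_def using assms
    by (auto intro!: sigma_sets.Basic) 
  have "indep_set ?X ?Y"
    unfolding indep_sets2_eq using ind sub unfolding indep_sets2_eq by (meson subset_iff)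
  then have "indep_set (sigma_sets (space M) ?X) (sigma_sets (space M) ?Y)"
  proof (rule indep_set_sigma_sets)
    show "Int_stable ?X" unfolding Int_stable_def
    proof safe
      fix A B :: "real set" assume "A \<in> sets borel" "B \<in> sets borel"
      then show "\<exists>C. S s -` A \<inter> space M \<inter> (S s -` B \<inter> space M) = S s -` C \<inter> space M \<and> C \<in> sets borel"
        by (intro exI[of _ "A \<inter> B"]) auto
    qed
    show "Int_stable ?Y" unfolding Int_stable_def
    proof safe
      fix A B :: "real set" assume "A \<in> sets borel" "B \<in> sets borel"
      then show "\<exists>C. (\<lambda>\<omega>. S (s + t) \<omega> - S s \<omega>) -` A \<inter> space M \<inter>
          ((\<lambda>\<omega>. S (s + t) \<omega> - S s \<omega>) -` B \<inter> space M) =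
          (\<lambda>\<omega>. S (s + t) \<omega> - S s \<omega>) -` C \<inter> space M \<and> C \<in> sets borel"
        by (intro exI[of _ "A \<inter> B"]) auto
    qed
  qed
  then show ?thesis
    unfolding indep_var_eq using assms S_measurable increment_measurable by auto
qed

lemma laplace_add:
  assumes l: "0 \<le> l" and st: "0 \<le> s" "0 \<le> t"
  shows "laplace l (s + t) = laplace l s * laplace l t"
proof -
  let ?I = "\<lambda>\<omega>. S (s + t) \<omega> - S s \<omega>"
  have ind: "indep_var borel (\<lambda>\<omega>. exp (- l * S s \<omega>)) borel (\<lambda>\<omega>. exp (- l * ?I \<omega>))"
    using indep_var_compose[OF indep_increment[OF st], of "\<lambda>x. exp (- l * x)" borel "\<lambda>x. exp (- l * x)" borel]
    by (simp add: comp_def)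
  have eq: "distr M borel ?I = distr M borel (S t)"
    using subordinator st by (simp add: driftless_subordinator_def)
  have m: "?I \<in> borel_measurable M" using st by measurable
  have "laplace l t = (\<integral>x. exp (- l * x) \<partial>distr M borel (S t))"
    unfolding laplace_def using st by (subst integral_distr) auto
  also have "\<dots> = (\<integral>\<omega>. exp (- l * ?I \<omega>) \<partial>M)"
    unfolding eq[symmetric] using m by (subst integral_distr) auto
  finally have "laplace l s * laplace l t = (\<integral>\<omega>. exp (- l * S s \<omega>) * exp (- l * ?I \<omega>) \<partial>M)"
    using indep_var_lebesgue_integral[OF ind integrable_exp_S integrable_exp_increment] l st
    by (simp add: laplace_def)
  also have "\<dots> = laplace l (s + t)"
    unfolding laplace_def by (intro Bochner_Integration.integral_cong) (auto simp: exp_add[symmetric] algebra_simps)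
  finally show ?thesis by simp
qed

lemma laplace_antimono:
  assumes "0 \<le> l" and "0 \<le> s" and "s \<le> t"
  shows "laplace l t \<le> laplace l s"
  unfolding laplace_def
proof (rule integral_mono_AE)
  show "AE \<omega> in M. exp (- l * S t \<omega>) \<le> exp (- l * S s \<omega>)"
    using AE_mono[OF assms(2,3)] by eventually_elim (use assms in \<open>auto intro: mult_left_mono\<close>)
qed (use assms integrable_exp_S in auto)

lemma laplace_1:
  assumes "0 \<le> l"
  shows "laplace l 1 = exp (- laplace_exponent \<nu> l)"
proof -
  have "laplace l 1 \<noteq> 0"
  proof
    assume "laplace l 1 = 0"
    then have "AE \<omega> in M. exp (- l * S 1 \<omega>) = 0"
      unfolding laplace_def using integrable_exp_S[OF assms, of 1]
      by (subst (asm) integral_nonneg_eq_0_iff_AE) auto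
    then show False by simp
  qed
  moreover have "0 \<le> laplace l 1" unfolding laplace_def by simp
  moreover have "- ln (laplace l 1) = laplace_exponent \<nu> l"
    using subordinator assms unfolding laplace_def by (simp add: driftless_subordinator_def)
  ultimately show ?thesis by (metis exp_ln less_eq_real_def minus_minus)
qed

text \<open>
  Stationary independent increments make the Laplace transform multiplicative in \<open>t\<close>, which determines
  it at rational times from its value at time one; monotonicity extends this to all times.
\<close>

lemma laplace_eq:
  assumes l: "0 \<le> l" and t: "0 < t" and pos: "0 < laplace_exponent \<nu> l"
  shows "laplace l t = exp (- t * laplace_exponent \<nu> l)"
proof -
  let ?c = "laplace_exponent \<nu> l"
  have nn: "0 \<le> laplace l t" for t unfolding laplace_def by simp
  have pow: "laplace l (real n * t) = laplace l t ^ n" if "0 < n" "0 \<le> t" for n t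
    using that(1)
  proof (induction n rule: nat_induct_non_zero)
    case (Suc n)
    have "laplace l (real (Suc n) * t) = laplace l (t + real n * t)" by (simp add: algebra_simps)
    also have "\<dots> = laplace l t * laplace l (real n * t)" using laplace_add[OF l] that by simp
    finally show ?case using Suc by simp
  qed simp
  have rat: "laplace l q = exp (- q * ?c)" if q: "0 < q" "q \<in> \<rat>" for q
  proof -
    obtain m n where mn: "0 < n" "q = real m / real n"
      using q by (metis Rats_abs_nat_div_natE abs_of_pos neq0_conv)
    then have m: "0 < m" using q by (auto intro!: Nat.gr0I)
    have "laplace l q ^ n = laplace l (real n * q)" using pow[of n q] mn q by simp
    also have "real n * q = real m * 1" using mn by simp
    also have "laplace l (real m * 1) = exp (- ?c) ^ m" using pow[of m 1] m laplace_1[OF l] by simp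
    also have "\<dots> = exp (- q * ?c) ^ n" using mn by (simp add: exp_of_nat_mult[symmetric])
    finally show ?thesis using mn(1) nn[of q] by (simp add: power_eq_iff_eq_base)
  qed
  show ?thesis
  proof (rule antisym)
    show "laplace l t \<le> exp (- t * ?c)"
    proof (rule ccontr)
      assume "\<not> ?thesis"
      then have a: "exp (- t * ?c) < laplace l t" by simp
      then have p: "0 < laplace l t" using exp_gt_zero less_trans by blast
      have "- t * ?c < ln (laplace l t)" using a p by (metis exp_less_cancel_iff exp_ln)
      then have "max 0 (- ln (laplace l t) / ?c) < t" using pos t by (simp add: field_simps)
      then obtain q where q: "q \<in> \<rat>" "max 0 (- ln (laplace l t) / ?c) < q" "q < t"
        using Rats_dense_in_real by blast
      have "laplace l t \<le> exp (- q * ?c)"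
        using laplace_antimono[OF l, of q t] q rat[of q] by simp
      also have "\<dots> < exp (ln (laplace l t))" using q pos by (simp add: field_simps)
      finally show False using p by simp
    qed
    show "exp (- t * ?c) \<le> laplace l t"
    proof (rule ccontr)
      assume "\<not> ?thesis"
      then have a: "laplace l t < exp (- t * ?c)" by simp
      obtain q0 where q0: "q0 \<in> \<rat>" "t < q0" "q0 < t + 1" using Rats_dense_in_real[of t "t + 1"] by auto
      have "0 < laplace l q0" using rat[of q0] q0 t by simp
      then have p: "0 < laplace l t" using laplace_antimono[OF l, of t q0] q0 t by simp
      have "ln (laplace l t) < - t * ?c" using a p by (metis exp_less_cancel_iff exp_ln)
      then have "t < - ln (laplace l t) / ?c" using pos by (simp add: field_simps)
      then obtain q where q: "q \<in> \<rat>" "t < q" "q < - ln (laplace l t) / ?c"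
        using Rats_dense_in_real by blast
      have "laplace l t = exp (ln (laplace l t))" using p by simp
      also have "\<dots> < exp (- q * ?c)" using q pos by (simp add: field_simps)
      also have "\<dots> \<le> laplace l t" using laplace_antimono[OF l, of t q] q rat[of q] t by simp
      finally show False by simp
    qed
  qed
qed

definition law :: "real \<Rightarrow> real measure" where
  "law t = distr M borel (S t)"

definition potential :: "real measure" where
  "potential = restrict_space lborel {0<..} \<bind> law"

text \<open>
  The paths are nondecreasing, so the probability of \<open>S\<^sub>t \<le> a\<close> is a monotone function of \<open>t\<close>; half-lines generate
  the Borel sets.
\<close>

lemma law_measurable [measurable]: "law \<in> restrict_space lborel {0<..} \<rightarrow>\<^sub>M subprob_algebra borel"
proof (rule measurable_subprob_algebra_generated[where G = "range atMost" and \<Omega> = UNIV])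
  show "sets borel = sigma_sets UNIV (range atMost :: real set set)"
    by (subst borel_eq_atMost) (simp add: image_def)
  show "Int_stable (range atMost :: real set set)"
    by (auto simp: Int_stable_def)
  fix t :: real assume "t \<in> space (restrict_space lborel {0<..})"
  then have "S t \<in> borel_measurable M" by (auto simp: space_restrict_space)
  then interpret d: prob_space "law t" unfolding law_def by (rule prob_space_distr)
  show "subprob_space (law t)" by unfold_locales
  show "sets (law t) = sets borel" by (simp add: law_def)
next
  fix A :: "real set" assume "A \<in> range atMost"
  then obtain a where A: "A = {..a}" by auto
  have *: "(\<lambda>t. - measure (law t) {..a}) \<in> borel_measurable (restrict_space borel {0<..})"
  proof (rule borel_measurable_mono_on_fnc, rule mono_onI)
    fix s t :: real assume st: "s \<in> {0<..}" "t \<in> {0<..}" "s \<le> t"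
    have "measure M {\<omega>\<in>space M. S t \<omega> \<le> a} \<le> measure M {\<omega>\<in>space M. S s \<omega> \<le> a}"
    proof (rule finite_measure_mono_AE)
      show "AE \<omega> in M. \<omega> \<in> {\<omega>\<in>space M. S t \<omega> \<le> a} \<longrightarrow> \<omega> \<in> {\<omega>\<in>space M. S s \<omega> \<le> a}"
      proof -
        have "AE \<omega> in M. 0 \<le> S s \<omega> \<and> S s \<omega> \<le> S t \<omega>"
          by (rule AE_mono) (use st in auto)
        then show ?thesis by eventually_elim auto
      qed
      have "S s \<in> borel_measurable M" using st by (intro S_measurable) auto
      then show "{\<omega> \<in> space M. S s \<omega> \<le> a} \<in> sets M" by measurable
    qed
    then show "- measure (law s) {..a} \<le> - measure (law t) {..a}"
      using st by (simp add: law_def measure_distr vimage_def Int_def conj_commute)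
  qed
  have "(\<lambda>t. ennreal (- (- measure (law t) {..a}))) \<in> borel_measurable (restrict_space borel {0<..})"
    by (intro measurable_compose[OF borel_measurable_uminus[OF *] measurable_ennreal])
  moreover have "emeasure (law t) {..a} = ennreal (- (- measure (law t) {..a}))"
    if "t \<in> space (restrict_space borel {0<..})" for t
  proof -
    have "S t \<in> borel_measurable M" using that by (auto simp: space_restrict_space)
    then interpret d: prob_space "law t" unfolding law_def by (rule prob_space_distr)
    show ?thesis by (simp add: d.emeasure_eq_measure)
  qed
  ultimately have "(\<lambda>t. emeasure (law t) {..a}) \<in> borel_measurable (restrict_space borel {0<..})"
    using measurable_cong[of "restrict_space borel {0<..}" "\<lambda>t. emeasure (law t) {..a}"
        "\<lambda>t. ennreal (- (- measure (law t) {..a}))" borel] by blast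
  then show "(\<lambda>t. emeasure (law t) A) \<in> borel_measurable (restrict_space lborel {0<..})"
    unfolding A by (subst measurable_cong_sets[OF _ refl, of _ "restrict_space borel {0<..}"])
      (auto simp: sets_restrict_space cong: measurable_cong)
next
  have "emeasure (law t) UNIV = 1" if "t \<in> space (restrict_space lborel {0<..})" for t
  proof -
    have "S t \<in> borel_measurable M" using that by (auto simp: space_restrict_space)
    then interpret d: prob_space "law t" unfolding law_def by (rule prob_space_distr)
    show ?thesis using d.emeasure_space_1 by (simp add: law_def)
  qed
  then show "(\<lambda>t. emeasure (law t) UNIV) \<in> borel_measurable (restrict_space lborel {0<..})"
    by (subst measurable_cong[where g = "\<lambda>_. 1"]) auto
qed simp

lemma sets_potential [simp, measurable_cong]: "sets potential = sets borel"
  unfolding potential_def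
  by (rule sets_bind) (auto simp: law_def space_restrict_space intro!: exI[of _ 1])

lemma nn_integral_potential:
  assumes "F \<in> borel_measurable borel"
  shows "(\<integral>\<^sup>+s. F s \<partial>potential) = (\<integral>\<^sup>+t\<in>{0<..}. (\<integral>\<^sup>+s. F s \<partial>law t) \<partial>lborel)"
  unfolding potential_def
  by (subst nn_integral_bind[OF assms law_measurable]) (simp add: nn_integral_restrict_space)

text \<open>
  Both bounds on the potential of a half-line come from this formula, the upper one by Markov's
  inequality.
\<close>

lemma nn_integral_exp_law:
  assumes "0 \<le> l" and "0 < t" and "0 < laplace_exponent \<nu> l"
  shows "(\<integral>\<^sup>+s. ennreal (exp (- l * s)) \<partial>law t) = ennreal (exp (- t * laplace_exponent \<nu> l))"
proof -
  have "(\<integral>\<^sup>+s. ennreal (exp (- l * s)) \<partial>law t) = (\<integral>\<^sup>+\<omega>. ennreal (exp (- l * S t \<omega>)) \<partial>M)"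
    unfolding law_def using assms by (subst nn_integral_distr) auto
  also have "\<dots> = ennreal (laplace l t)"
    unfolding laplace_def using integrable_exp_S[of l t] assms by (intro nn_integral_eq_integral) auto
  finally show ?thesis using laplace_eq assms by simp
qed

lemma potential_laplace_le:
  assumes "0 \<le> l" and pos: "0 < laplace_exponent \<nu> l"
  shows "(\<integral>\<^sup>+s. ennreal (exp (- l * s)) \<partial>potential) \<le> ennreal (1 / laplace_exponent \<nu> l)"
proof -
  let ?c = "laplace_exponent \<nu> l"
  interpret e: prob_space "density lborel (exponential_density ?c)"
    by (rule prob_space_exponential_density[OF pos])
  have "(\<integral>\<^sup>+t. ennreal (exponential_density ?c t) \<partial>lborel) = 1"
    using e.emeasure_space_1 by (simp add: emeasure_density)
  have "(\<integral>\<^sup>+s. ennreal (exp (- l * s)) \<partial>potential) =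
      (\<integral>\<^sup>+t\<in>{0<..}. (\<integral>\<^sup>+s. ennreal (exp (- l * s)) \<partial>law t) \<partial>lborel)"
    by (rule nn_integral_potential) measurable
  also have "\<dots> \<le> (\<integral>\<^sup>+t. ennreal (1 / ?c) * ennreal (exponential_density ?c t) \<partial>lborel)"
  proof (rule nn_integral_mono)
    fix t :: real
    show "(\<integral>\<^sup>+s. ennreal (exp (- l * s)) \<partial>law t) * indicator {0<..} t \<le>
        ennreal (1 / ?c) * ennreal (exponential_density ?c t)"
    proof (cases "0 < t")
      case True
      then show ?thesis using nn_integral_exp_law[OF assms(1) True pos] pos
        by (simp add: exponential_density_def ennreal_mult[symmetric])
    qed simp
  qed
  also have "\<dots> = ennreal (1 / ?c) * (\<integral>\<^sup>+t. ennreal (exponential_density ?c t) \<partial>lborel)"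
    by (rule nn_integral_cmult) measurable
  also have "\<dots> = ennreal (1 / ?c)"
    using \<open>(\<integral>\<^sup>+t. ennreal (exponential_density ?c t) \<partial>lborel) = 1\<close> by simp
  finally show ?thesis .
qed

lemma potential_atMost_upper:
  assumes a: "0 < a" and pos: "0 < laplace_exponent \<nu> (1 / a)"
  shows "emeasure potential {..a} \<le> ennreal (exp 1 * renewal_scale \<nu> a)"
proof -
  have "emeasure potential {..a} = (\<integral>\<^sup>+s. indicator {..a} s \<partial>potential)"
    by simp
  also have "\<dots> \<le> (\<integral>\<^sup>+s. ennreal (exp 1) * ennreal (exp (- (1 / a) * s)) \<partial>potential)"
    using a by (intro nn_integral_mono)
      (auto simp: indicator_def ennreal_mult[symmetric] exp_add[symmetric] intro!: ennreal_leI)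
  also have "\<dots> = ennreal (exp 1) * (\<integral>\<^sup>+s. ennreal (exp (- (1 / a) * s)) \<partial>potential)"
    by (rule nn_integral_cmult) measurable
  also have "\<dots> \<le> ennreal (exp 1) * ennreal (1 / laplace_exponent \<nu> (1 / a))"
    using a by (intro mult_left_mono potential_laplace_le pos) auto
  finally show ?thesis using pos by (simp add: renewal_scale_def ennreal_mult[symmetric])
qed

text \<open>
  Up to time \<open>1/(2\<phi>(1/a))\<close> the mean of \<open>exp(-S\<^sub>t/a)\<close> is at least \<open>e\<^sup>-\<^sup>1\<^sup>/\<^sup>2\<close>, which exceeds the bound \<open>e\<^sup>-\<^sup>1\<close> valid on
  \<open>S\<^sub>t > a\<close>; hence \<open>S\<^sub>t \<le> a\<close> has probability at least \<open>e\<^sup>-\<^sup>1\<^sup>/\<^sup>2 - e\<^sup>-\<^sup>1 \<ge> 1/6\<close>.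
\<close>

lemma potential_atMost_lower:
  assumes a: "0 < a" and pos: "0 < laplace_exponent \<nu> (1 / a)"
  shows "ennreal (renewal_scale \<nu> a / 12) \<le> emeasure potential {..a}"
proof -
  let ?c = "laplace_exponent \<nu> (1 / a)"
  have law_lower: "1 / 6 \<le> measure (law t) {..a}" if t: "0 < t" "t \<le> 1 / (2 * ?c)" for t
  proof -
    have "exp (- t * ?c) = (\<integral>\<omega>. exp (- (1 / a) * S t \<omega>) \<partial>M)"
      using laplace_eq[of "1 / a" t] a t pos by (simp add: laplace_def)
    also have "\<dots> \<le> (\<integral>\<omega>. indicator {\<omega>\<in>space M. S t \<omega> \<le> a} \<omega> + exp (- 1) \<partial>M)"
    proof (rule integral_mono_AE)
      show "integrable M (\<lambda>\<omega>. exp (- (1 / a) * S t \<omega>))"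
        by (rule integrable_exp_S) (use a t in auto)
      show "integrable M (\<lambda>\<omega>. indicator {\<omega>\<in>space M. S t \<omega> \<le> a} \<omega> + exp (- 1 :: real))"
        using t by (intro Bochner_Integration.integrable_add integrable_real_indicator) (auto simp: less_top[symmetric])
      show "AE \<omega> in M. exp (- (1 / a) * S t \<omega>) \<le> indicator {\<omega>\<in>space M. S t \<omega> \<le> a} \<omega> + exp (- 1)"
        using AE_mono[OF less_imp_le[OF t(1)] order_refl] AE_space
      proof eventually_elim
        fix \<omega> assume w: "0 \<le> S t \<omega> \<and> S t \<omega> \<le> S t \<omega>" "\<omega> \<in> space M"
        show "exp (- (1 / a) * S t \<omega>) \<le> indicator {\<omega>\<in>space M. S t \<omega> \<le> a} \<omega> + exp (- 1)"
        proof (cases "S t \<omega> \<le> a")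
          case True
          have "exp (- (1 / a) * S t \<omega>) \<le> 1" using w a by simp
          then show ?thesis using True w by (simp add: add_increasing2)
        qed (use w a in \<open>simp add: field_simps\<close>)
      qed
    qed
    also have "\<dots> = measure M {\<omega>\<in>space M. S t \<omega> \<le> a} + exp (- 1)"
      using t by (subst Bochner_Integration.integral_add) (auto simp: less_top[symmetric] prob_space)
    also have "measure M {\<omega>\<in>space M. S t \<omega> \<le> a} = measure (law t) {..a}"
      using t by (simp add: law_def measure_distr vimage_def Int_def conj_commute)
    finally have 1: "exp (- t * ?c) - exp (- 1) \<le> measure (law t) {..a}" by simp
    \<comment> \<open>the bound follows from \<open>u - u\<^sup>2 \<ge> 1/6\<close>, as \<open>1/2 \<le> u \<le> 2/3\<close>\<close>
    define u :: real where "u = exp (- (1/2))"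
    have u: "1/2 \<le> u" "u \<le> 2/3"
      using exp_ge_add_one_self[of "- (1/2) :: real"] exp_ge_add_one_self[of "1/2 :: real"]
      by (auto simp: u_def exp_minus field_simps)
    have "exp (- 1) = u * u" unfolding u_def by (simp add: exp_add[symmetric])
    moreover have "u \<le> exp (- t * ?c)" unfolding u_def using t pos by (simp add: field_simps)
    moreover have "1 / 6 \<le> u * (1 - u)" using mult_mono[of "1/2" u "1/3" "1 - u"] u by simp
    ultimately show ?thesis using 1 by (simp add: algebra_simps)
  qed
  have "ennreal (renewal_scale \<nu> a / 12) = ennreal (1 / 6) * ennreal (1 / (2 * ?c))"
    using pos by (simp add: renewal_scale_def ennreal_mult[symmetric])
  also have "\<dots> = (\<integral>\<^sup>+t. ennreal (1 / 6) * indicator {0<..1 / (2 * ?c)} t \<partial>lborel)"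
    using pos by (subst nn_integral_cmult_indicator) auto
  also have "\<dots> \<le> (\<integral>\<^sup>+t\<in>{0<..}. (\<integral>\<^sup>+s. indicator {..a} s \<partial>law t) \<partial>lborel)"
  proof (rule nn_integral_mono)
    fix t :: real
    show "ennreal (1 / 6) * indicator {0<..1 / (2 * ?c)} t \<le>
        (\<integral>\<^sup>+s. indicator {..a} s \<partial>law t) * indicator {0<..} t"
    proof (cases "t \<in> {0<..1 / (2 * ?c)}")
      case True
      then have "S t \<in> borel_measurable M" by auto
      then interpret d: prob_space "law t" unfolding law_def by (rule prob_space_distr)
      have "ennreal (1 / 6) \<le> emeasure (law t) {..a}"
        using law_lower[of t] True by (simp add: d.emeasure_eq_measure ennreal_leI)
      then show ?thesis using True by (simp add: law_def)
    qed simp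
  qed
  also have "\<dots> = emeasure potential {..a}"
    by (subst nn_integral_potential[symmetric]) auto
  finally show ?thesis .
qed

end

section \<open>Integration against a potential measure by dyadic blocks\<close>

text \<open>
  Integrands are compared with step functions block by block, so that a potential measure enters only
  through its values on the blocks.
\<close>

lemma nn_integral_le_cover:
  fixes G :: "real \<Rightarrow> real" and c :: "nat \<Rightarrow> real"
  assumes "sets U = sets borel" and "\<And>k. B k \<in> sets borel"
    and "\<And>s. 0 < G s \<Longrightarrow> \<exists>k. s \<in> B k \<and> G s \<le> c k"
  shows "(\<integral>\<^sup>+s. ennreal (G s) \<partial>U) \<le> (\<Sum>k. ennreal (c k) * emeasure U (B k))"
proof -
  have [measurable]: "B k \<in> sets U" for k using assms by simp
  have "ennreal (G s) \<le> (\<Sum>k. ennreal (c k) * indicator (B k) s)" for s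
  proof (cases "0 < G s")
    case True
    then obtain k where k: "s \<in> B k" "G s \<le> c k" using assms(3) by blast
    have "ennreal (G s) \<le> (\<Sum>i\<in>{k}. ennreal (c i) * indicator (B i) s)"
      using k by (simp add: ennreal_leI)
    also have "\<dots> \<le> (\<Sum>i. ennreal (c i) * indicator (B i) s)"
      by (intro sum_le_suminf summableI) auto
    finally show ?thesis .
  qed (simp add: ennreal_neg)
  then have "(\<integral>\<^sup>+s. ennreal (G s) \<partial>U) \<le> (\<integral>\<^sup>+s. (\<Sum>k. ennreal (c k) * indicator (B k) s) \<partial>U)"
    by (intro nn_integral_mono)
  also have "\<dots> = (\<Sum>k. ennreal (c k) * emeasure U (B k))"
    by (subst nn_integral_suminf) (simp_all add: nn_integral_cmult_indicator)
  finally show ?thesis .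
qed

lemma dyadic_index_up:
  fixes r :: real
  assumes "1 < r"
  obtains k :: nat where "2 ^ k < r" and "r \<le> 2 ^ Suc k"
proof -
  define n where "n = (LEAST n::nat. r \<le> 2 ^ n)"
  obtain n0 :: nat where "r \<le> 2 ^ n0"
    using real_arch_pow[of 2 r] by (auto dest: less_imp_le)
  then have n: "r \<le> 2 ^ n" unfolding n_def by (rule LeastI)
  have "n \<noteq> 0" using n assms by (auto intro: Nat.gr0I)
  then obtain k where k: "n = Suc k" by (cases n) auto
  have "\<not> r \<le> 2 ^ k" using not_less_Least[of k "\<lambda>n. r \<le> 2 ^ n"] k by (simp add: n_def)
  then show ?thesis using that[of k] n k by simp
qed

lemma dyadic_index_down:
  fixes r :: real
  assumes "1 \<le> r"
  obtains k :: nat where "2 ^ k \<le> r" and "r < 2 ^ Suc k"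
proof -
  define n where "n = (LEAST n::nat. r < 2 ^ n)"
  obtain n0 :: nat where "r < 2 ^ n0"
    using real_arch_pow[of 2 r] by auto
  then have n: "r < 2 ^ n" unfolding n_def by (rule LeastI)
  have "n \<noteq> 0" using n assms by (auto intro: Nat.gr0I)
  then obtain k where k: "n = Suc k" by (cases n) auto
  have "\<not> r < 2 ^ k" using not_less_Least[of k "\<lambda>n. r < 2 ^ n"] k by (simp add: n_def)
  then show ?thesis using that[of k] n k by simp
qed

text \<open>
  A family of measures that share the block asymptotics of a potential measure, uniformly in the
  index \<open>z\<close>: the mass of \<open>{..a}\<close> is at most of order \<open>f a\<close>, and for times \<open>a\<close> in the admissible range \<open>I\<close> the mass
  of the block \<open>{a / K<..a}\<close> is at least of this order.
\<close>

locale potential_family =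
  fixes Z :: "'z set" and I :: "real set" and U :: "'z \<Rightarrow> real measure" and f :: "real \<Rightarrow> real"
    and A\<^sub>U K \<kappa> :: real
  assumes I_pos: "\<And>t. t \<in> I \<Longrightarrow> 0 < t"
    and I_down: "\<And>s t. t \<in> I \<Longrightarrow> 0 < s \<Longrightarrow> s \<le> t \<Longrightarrow> s \<in> I"
    and I_meas [measurable]: "I \<in> sets borel"
    and sets_U: "\<And>z. z \<in> Z \<Longrightarrow> sets (U z) = sets borel"
    and f_pos: "\<And>t. 0 < t \<Longrightarrow> 0 < f t"
    and f_mono: "\<And>s t. 0 < s \<Longrightarrow> s \<le> t \<Longrightarrow> f s \<le> f t"
    and f_lin: "\<And>s t. 0 < s \<Longrightarrow> s \<le> t \<Longrightarrow> f t \<le> 2 * (t / s) * f s"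
    and U_upper: "\<And>z a. z \<in> Z \<Longrightarrow> 0 < a \<Longrightarrow> emeasure (U z) {..a} \<le> ennreal (A\<^sub>U * f a)"
    and U_lower: "\<And>z a. z \<in> Z \<Longrightarrow> a \<in> I \<Longrightarrow> ennreal (\<kappa> * f a) \<le> emeasure (U z) {a / K<..a}"
    and A\<^sub>U: "0 < A\<^sub>U" and K: "1 < K" and \<kappa>: "0 < \<kappa>"
begin

text \<open>
  The functions \<open>lo\<close>, \<open>hi\<close> and \<open>mid\<close> are the majorants for the upper bounds. Division by \<open>f\<close> makes the
  contribution of each dyadic block bounded; the powers in \<open>lo\<close> and \<open>hi\<close> then give geometric sums,
  bounded uniformly in \<open>X\<close>, whereas \<open>mid\<close> counts the blocks between \<open>X\<close> and \<open>Y\<close>.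
\<close>

definition lo :: "real \<Rightarrow> real \<Rightarrow> real \<Rightarrow> real" where
  "lo e X s = indicator {0<..X} s * ((s / X) powr e / f s)"

definition hi :: "real \<Rightarrow> real \<Rightarrow> real \<Rightarrow> real" where
  "hi e X s = indicator {X<..} s * ((X / s) powr e / f s)"

definition mid :: "real \<Rightarrow> real \<Rightarrow> real \<Rightarrow> real" where
  "mid X Y s = indicator {X<..Y} s * (1 / f s)"

lemma f_measurable: "(\<lambda>s. indicator {0<..} s * f s) \<in> borel_measurable borel"
proof -
  have "f \<in> borel_measurable (restrict_space borel {0<..})"
    by (rule borel_measurable_mono_on_fnc) (auto intro!: mono_onI f_mono)
  then show ?thesis by (subst (asm) borel_measurable_restrict_space_iff) auto
qed

lemma
  assumes "0 < X"
  shows lo_measurable: "lo e X \<in> borel_measurable borel"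
    and hi_measurable: "hi e X \<in> borel_measurable borel"
    and mid_measurable: "mid X Y \<in> borel_measurable borel"
proof -
  note [measurable] = f_measurable
  have "lo e X = (\<lambda>s. indicator {0<..X} s * ((s / X) powr e / (indicator {0<..} s * f s)))"
    by (auto simp: lo_def indicator_def)
  also have "\<dots> \<in> borel_measurable borel" by measurable
  finally show "lo e X \<in> borel_measurable borel" .
  have "hi e X = (\<lambda>s. indicator {X<..} s * ((X / s) powr e / (indicator {0<..} s * f s)))"
    using assms by (auto simp: hi_def indicator_def)
  also have "\<dots> \<in> borel_measurable borel" by measurable
  finally show "hi e X \<in> borel_measurable borel" .
  have "mid X Y = (\<lambda>s. indicator {X<..Y} s * (1 / (indicator {0<..} s * f s)))"
    using assms by (auto simp: mid_def indicator_def)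
  also have "\<dots> \<in> borel_measurable borel" by measurable
  finally show "mid X Y \<in> borel_measurable borel" .
qed

lemma
  assumes "0 < X"
  shows lo_nonneg: "0 \<le> lo e X s" and hi_nonneg: "0 \<le> hi e X s" and mid_nonneg: "0 \<le> mid X Y s"
  using assms f_pos[of s] by (auto simp: lo_def hi_def mid_def indicator_def)

text \<open>On a dyadic block the potential measure is at most a multiple of the scale at either end.\<close>

lemma block_upper:
  assumes z: "z \<in> Z" and a: "0 < a" and c: "0 \<le> c"
  shows "ennreal (c / f a) * emeasure (U z) {a<..2 * a} \<le> ennreal (4 * A\<^sub>U * c)"
proof -
  have "emeasure (U z) {a<..2 * a} \<le> emeasure (U z) {..2 * a}"
    using sets_U[OF z] by (intro emeasure_mono) auto
  also have "\<dots> \<le> ennreal (A\<^sub>U * f (2 * a))" using U_upper[OF z] a by simp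
  also have "\<dots> \<le> ennreal (A\<^sub>U * (4 * f a))"
    using f_lin[of a "2 * a"] a A\<^sub>U by (intro ennreal_leI mult_left_mono) auto
  finally have "ennreal (c / f a) * emeasure (U z) {a<..2 * a} \<le> ennreal (c / f a) * ennreal (A\<^sub>U * (4 * f a))"
    by (rule mult_left_mono) simp
  also have "\<dots> = ennreal (4 * A\<^sub>U * c)"
    using f_pos[OF a] c A\<^sub>U by (subst ennreal_mult[symmetric]) auto
  finally show ?thesis .
qed

lemma geometric_blocks:
  assumes "0 < e"
  shows "(\<Sum>k. ennreal (4 * A\<^sub>U * ((1 / 2 ^ k) powr e))) = ennreal (4 * A\<^sub>U / (1 - 2 powr (- e)))"
proof (rule suminf_ennreal_eq)
  have "(1 / 2 ^ k) powr e = (2 powr (- e)) ^ k" for k :: nat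
  proof -
    have "(1 / 2 ^ k :: real) = 2 powr (- real k)" by (simp add: powr_minus powr_realpow field_simps)
    then show ?thesis by (simp add: powr_powr powr_power mult.commute)
  qed
  moreover have "(\<lambda>k. 4 * A\<^sub>U * (2 powr (- e)) ^ k) sums (4 * A\<^sub>U * (1 / (1 - 2 powr (- e))))"
    using assms by (intro sums_mult geometric_sums) (simp add: powr_less_one)
  ultimately show "(\<lambda>k. 4 * A\<^sub>U * ((1 / 2 ^ k) powr e)) sums (4 * A\<^sub>U / (1 - 2 powr (- e)))"
    by simp
qed (use A\<^sub>U in auto)

lemma lo_integral:
  assumes e: "0 < e" and z: "z \<in> Z" and X: "0 < X"
  shows "(\<integral>\<^sup>+s. ennreal (lo e X s) \<partial>U z) \<le> ennreal (4 * A\<^sub>U / (1 - 2 powr (- e)))"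
proof -
  have "(\<integral>\<^sup>+s. ennreal (lo e X s) \<partial>U z) \<le>
      (\<Sum>k. ennreal ((1 / 2 ^ k) powr e / f (X / 2 ^ Suc k)) * emeasure (U z) {X / 2 ^ Suc k<..2 * (X / 2 ^ Suc k)})"
  proof (rule nn_integral_le_cover[OF sets_U[OF z]])
    fix s :: real assume "0 < lo e X s"
    then have s: "0 < s" "s \<le> X" by (auto simp: lo_def split: split_indicator_asm)
    obtain k :: nat where k: "2 ^ k \<le> X / s" "X / s < 2 ^ Suc k"
      using dyadic_index_down[of "X / s"] s by auto
    have a: "X / 2 ^ Suc k < s" "s \<le> X / 2 ^ k" using k s by (auto simp: field_simps)
    have "s / X \<le> 1 / 2 ^ k" using a s by (simp add: field_simps)
    then have "(s / X) powr e \<le> (1 / 2 ^ k) powr e" using s e by (intro powr_mono2) auto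
    moreover have "f (X / 2 ^ Suc k) \<le> f s" using a X by (intro f_mono) auto
    ultimately have "lo e X s \<le> (1 / 2 ^ k) powr e / f (X / 2 ^ Suc k)"
      using s f_pos[of "X / 2 ^ Suc k"] X by (auto simp: lo_def intro!: frac_le)
    then show "\<exists>k. s \<in> {X / 2 ^ Suc k<..2 * (X / 2 ^ Suc k)} \<and> lo e X s \<le> (1 / 2 ^ k) powr e / f (X / 2 ^ Suc k)"
      using a by (intro exI[of _ k]) auto
  qed auto
  also have "\<dots> \<le> (\<Sum>k. ennreal (4 * A\<^sub>U * ((1 / 2 ^ k) powr e)))"
    using X by (intro suminf_le summableI block_upper z) auto
  finally show ?thesis by (simp only: geometric_blocks[OF e])
qed

lemma hi_integral:
  assumes e: "0 < e" and z: "z \<in> Z" and X: "0 < X"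
  shows "(\<integral>\<^sup>+s. ennreal (hi e X s) \<partial>U z) \<le> ennreal (4 * A\<^sub>U / (1 - 2 powr (- e)))"
proof -
  have "(\<integral>\<^sup>+s. ennreal (hi e X s) \<partial>U z) \<le>
      (\<Sum>k. ennreal ((1 / 2 ^ k) powr e / f (X * 2 ^ k)) * emeasure (U z) {X * 2 ^ k<..2 * (X * 2 ^ k)})"
  proof (rule nn_integral_le_cover[OF sets_U[OF z]])
    fix s :: real assume "0 < hi e X s"
    then have s: "X < s" by (auto simp: hi_def split: split_indicator_asm)
    obtain k :: nat where k: "2 ^ k < s / X" "s / X \<le> 2 ^ Suc k"
      using dyadic_index_up[of "s / X"] s X by auto
    have a: "X * 2 ^ k < s" "s \<le> 2 * (X * 2 ^ k)" using k s X by (auto simp: field_simps)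
    have "X / s \<le> 1 / 2 ^ k" using a s X by (simp add: field_simps)
    then have "(X / s) powr e \<le> (1 / 2 ^ k) powr e" using s e X by (intro powr_mono2) auto
    moreover have "f (X * 2 ^ k) \<le> f s" using a X by (intro f_mono) auto
    ultimately have "hi e X s \<le> (1 / 2 ^ k) powr e / f (X * 2 ^ k)"
      using s f_pos[of "X * 2 ^ k"] X by (auto simp: hi_def intro!: frac_le)
    then show "\<exists>k. s \<in> {X * 2 ^ k<..2 * (X * 2 ^ k)} \<and> hi e X s \<le> (1 / 2 ^ k) powr e / f (X * 2 ^ k)"
      using a by (intro exI[of _ k]) auto
  qed auto
  also have "\<dots> \<le> (\<Sum>k. ennreal (4 * A\<^sub>U * ((1 / 2 ^ k) powr e)))"
    using X by (intro suminf_le summableI block_upper z) auto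
  finally show ?thesis by (simp only: geometric_blocks[OF e])
qed

lemma mid_integral:
  assumes z: "z \<in> Z" and X: "0 < X" and XY: "X \<le> Y"
  shows "(\<integral>\<^sup>+s. ennreal (mid X Y s) \<partial>U z) \<le> ennreal (8 * A\<^sub>U * (1 + ln (Y / X)))"
proof -
  define n where "n = nat \<lceil>log 2 (Y / X)\<rceil>"
  have log0: "0 \<le> log 2 (Y / X)" using X XY by simp
  have n: "log 2 (Y / X) \<le> real n" "real n \<le> 1 + log 2 (Y / X)"
    unfolding n_def using log0 by linarith+
  have "(\<integral>\<^sup>+s. ennreal (mid X Y s) \<partial>U z) \<le>
      (\<Sum>k. ennreal ((if k < n then 1 else 0) / f (X * 2 ^ k)) * emeasure (U z) {X * 2 ^ k<..2 * (X * 2 ^ k)})"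
  proof (rule nn_integral_le_cover[OF sets_U[OF z]])
    fix s :: real assume "0 < mid X Y s"
    then have s: "X < s" "s \<le> Y" by (auto simp: mid_def split: split_indicator_asm)
    obtain k :: nat where k: "2 ^ k < s / X" "s / X \<le> 2 ^ Suc k"
      using dyadic_index_up[of "s / X"] s X by auto
    have a: "X * 2 ^ k < s" "s \<le> 2 * (X * 2 ^ k)" using k s X by (auto simp: field_simps)
    have "2 ^ k < Y / X" using k s X by (meson divide_right_mono less_le_trans less_imp_le)
    then have "2 powr real k < 2 powr (log 2 (Y / X))" using X XY by (simp add: powr_realpow)
    then have kn: "k < n" using n by simp
    have "f (X * 2 ^ k) \<le> f s" using a X by (intro f_mono) auto
    then have "mid X Y s \<le> 1 / f (X * 2 ^ k)"
      using s f_pos[of "X * 2 ^ k"] X by (auto simp: mid_def intro!: divide_left_mono f_pos)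
    then show "\<exists>k. s \<in> {X * 2 ^ k<..2 * (X * 2 ^ k)} \<and> mid X Y s \<le> (if k < n then 1 else 0) / f (X * 2 ^ k)"
      using a kn by (intro exI[of _ k]) auto
  qed auto
  also have "\<dots> \<le> (\<Sum>k. ennreal (4 * A\<^sub>U * (if k < n then 1 else 0)))"
    using X by (intro suminf_le summableI block_upper z) auto
  also have "\<dots> = (\<Sum>k<n. ennreal (4 * A\<^sub>U))"
    by (subst suminf_finite[of "{..<n}"]) auto
  also have "\<dots> = ennreal (4 * A\<^sub>U * real n)"
    using A\<^sub>U by (simp add: ennreal_of_nat_eq_real_of_nat ennreal_mult[symmetric] mult.commute)
  also have "\<dots> \<le> ennreal (8 * A\<^sub>U * (1 + ln (Y / X)))"
  proof (rule ennreal_leI)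
    have l2: "1 / 2 \<le> ln (2::real)" using ln2_ge_two_thirds by simp
    have "0 \<le> ln (Y / X)" using X XY by simp
    then have "ln (Y / X) \<le> 2 * ln (Y / X) * ln 2"
      using mult_left_mono[OF l2, of "2 * ln (Y / X)"] by simp
    then have "log 2 (Y / X) \<le> 2 * ln (Y / X)" by (simp add: log_def field_simps)
    then have "real n \<le> 2 * (1 + ln (Y / X))" using n by simp
    then show "4 * A\<^sub>U * real n \<le> 8 * A\<^sub>U * (1 + ln (Y / X))"
      using mult_left_mono[of "real n" "2 * (1 + ln (Y / X))" "4 * A\<^sub>U"] A\<^sub>U by simp
  qed
  finally show ?thesis .
qed

text \<open>
  The blocks \<open>{T K\<^sup>j / K<..T K\<^sup>j}\<close> are disjoint, and each contributes at least \<open>\<kappa> M\<close>.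
\<close>

lemma block_lower:
  assumes z: "z \<in> Z" and T: "T \<in> I" and M: "0 \<le> M"
    and F: "\<And>j s. j \<le> n \<Longrightarrow> T * K ^ j / K < s \<Longrightarrow> s \<le> T * K ^ j \<Longrightarrow> M \<le> F s * f s"
    and Y: "T * K ^ n \<in> I"
  shows "ennreal (\<kappa> * M * real (Suc n)) \<le> (\<integral>\<^sup>+s\<in>I. ennreal (F s) \<partial>U z)"
proof -
  define B where "B j = {T * K ^ j / K<..T * K ^ j}" for j :: nat
  have T0: "0 < T" using I_pos[OF T] .
  have pos: "0 < T * K ^ j" for j using T0 K by simp
  have inI: "T * K ^ j \<in> I" if "j \<le> n" for j
    using I_down[OF Y pos[of j]] that K T0 by (simp add: power_increasing)
  have [measurable]: "B j \<in> sets (U z)" for j using sets_U[OF z] by (simp add: B_def)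
  have "ennreal (\<kappa> * M * real (Suc n)) = (\<Sum>j\<le>n. ennreal (\<kappa> * M))"
  proof -
    have "(\<Sum>j\<le>n. ennreal (\<kappa> * M)) = of_nat (Suc n) * ennreal (\<kappa> * M)" by simp
    also have "\<dots> = ennreal (\<kappa> * M * real (Suc n))"
      using \<kappa> M by (subst ennreal_of_nat_eq_real_of_nat) (simp add: ennreal_mult[symmetric] mult.commute del: of_nat_Suc)
    finally show ?thesis by simp
  qed
  also have "\<dots> \<le> (\<Sum>j\<le>n. ennreal (M / f (T * K ^ j)) * emeasure (U z) (B j))"
  proof (rule sum_mono)
    fix j assume j: "j \<in> {..n}"
    have "ennreal (\<kappa> * M) = ennreal (M / f (T * K ^ j)) * ennreal (\<kappa> * f (T * K ^ j))"
      using f_pos[OF pos[of j]] M \<kappa> by (subst ennreal_mult[symmetric]) auto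
    also have "\<dots> \<le> ennreal (M / f (T * K ^ j)) * emeasure (U z) (B j)"
      unfolding B_def by (intro mult_left_mono U_lower z inI) (use j in auto)
    finally show "ennreal (\<kappa> * M) \<le> ennreal (M / f (T * K ^ j)) * emeasure (U z) (B j)" .
  qed
  also have "\<dots> = (\<integral>\<^sup>+s. (\<Sum>j\<le>n. ennreal (M / f (T * K ^ j)) * indicator (B j) s) \<partial>U z)"
    by (subst nn_integral_sum) (auto simp: nn_integral_cmult_indicator)
  also have "\<dots> \<le> (\<integral>\<^sup>+s\<in>I. ennreal (F s) \<partial>U z)"
  proof (rule nn_integral_mono)
    fix s
    show "(\<Sum>j\<le>n. ennreal (M / f (T * K ^ j)) * indicator (B j) s) \<le> ennreal (F s) * indicator I s"
    proof (cases "\<exists>i\<le>n. s \<in> B i")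
      case True
      then obtain i where i: "i \<le> n" "s \<in> B i" by blast
      have uniq: "j = i" if "s \<in> B j" for j
      proof (rule ccontr)
        assume "j \<noteq> i"
        then consider "Suc j \<le> i" | "Suc i \<le> j" by linarith
        then show False
        proof cases
          case 1
          then have "T * K ^ Suc j \<le> T * K ^ i" using K T0 by (intro mult_left_mono power_increasing) auto
          then have "T * K ^ j \<le> T * K ^ i / K" using K by (simp add: pos_le_divide_eq ac_simps)
          then show False using that i(2) by (simp add: B_def)
        next
          case 2
          then have "T * K ^ Suc i \<le> T * K ^ j" using K T0 by (intro mult_left_mono power_increasing) auto
          then have "T * K ^ i \<le> T * K ^ j / K" using K by (simp add: pos_le_divide_eq ac_simps)
          then show False using that i(2) by (simp add: B_def)
        qed
      qed
      have "0 < T * K ^ i / K" using pos[of i] K by simp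
      also have "\<dots> < s" using i(2) by (simp add: B_def)
      finally have s0: "0 < s" .
      have "(\<Sum>j\<le>n. ennreal (M / f (T * K ^ j)) * indicator (B j) s) =
          (\<Sum>j\<le>n. if j = i then ennreal (M / f (T * K ^ j)) else 0)"
      proof (rule sum.cong[OF refl])
        fix j
        show "ennreal (M / f (T * K ^ j)) * indicator (B j) s =
            (if j = i then ennreal (M / f (T * K ^ j)) else 0)"
        proof (cases "j = i")
          case False
          then have "s \<notin> B j" using uniq[of j] by blast
          then show ?thesis using False by simp
        qed (use i in simp)
      qed
      also have "\<dots> = ennreal (M / f (T * K ^ i))" using i by simp
      also have "\<dots> \<le> ennreal (F s)"
      proof (rule ennreal_leI)
        have "M / f (T * K ^ i) \<le> M / f s"
          using i s0 M by (intro divide_left_mono f_mono mult_pos_pos f_pos pos) (auto simp: B_def)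
        also have "\<dots> \<le> F s" using F[OF i(1), of s] i(2) f_pos[OF s0] by (simp add: B_def field_simps)
        finally show "M / f (T * K ^ i) \<le> F s" .
      qed
      finally show ?thesis using I_down[OF inI[OF i(1)] s0] i(2) by (simp add: B_def)
    next
      case False
      then have "(\<Sum>j\<le>n. ennreal (M / f (T * K ^ j)) * indicator (B j) s) = 0"
        by (intro sum.neutral) auto
      then show ?thesis by simp
    qed
  qed
  finally show ?thesis .
qed

end

section \<open>The Green integral in the time variable\<close>

lemma powr_ratio_flip: "0 < s \<Longrightarrow> 0 < t \<Longrightarrow> ((t::real) / s) powr a = (s / t) powr (- a)"
  by (simp add: powr_minus_divide powr_divide)

text \<open>
  The index \<open>z\<close> stands for a pair of points \<open>x, y\<close> at distance \<open>\<rho>\<close>, and all functions of space are read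
  in the time variable: \<open>T z\<close> is \<open>\<Phi>(\<rho>)\<close>, \<open>\<tau> z\<close> is the time scale of the depth \<open>\<delta>\<^sub>\<or>\<close>, \<open>v z t\<close> is the volume of
  the ball around \<open>x\<close> of radius \<open>\<Phi>\<^sup>-\<^sup>1(t)\<close>, \<open>W z\<close> is \<open>\<Psi>(\<rho>)\<close> and \<open>F z\<close> is the heat kernel. The assumption
  \<open>F_near_upper\<close> has the Gaussian factor replaced by a power that beats the doubling exponent of \<open>h\<close>.
\<close>

locale green_core = potential_family Z I U f A\<^sub>U K \<kappa>
  for Z :: "'z set" and I U f A\<^sub>U K \<kappa> +
  fixes h v F :: "'z \<Rightarrow> real \<Rightarrow> real" and T \<tau> W :: "'z \<Rightarrow> real"
    and \<beta> b \<eta>\<^sub>1 \<eta>\<^sub>2 \<gamma> \<gamma>\<^sub>s \<gamma>\<^sub>s\<^sub>s A\<^sub>f A\<^sub>v A\<^sub>h A\<^sub>s A\<^sub>s\<^sub>s A\<^sub>l A\<^sub>F a\<^sub>F :: real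
  assumes f_lower: "\<And>s t. 0 < s \<Longrightarrow> s \<le> t \<Longrightarrow> t \<in> I \<Longrightarrow> f s \<le> A\<^sub>f * (s / t) powr \<beta> * f t"
    and f_upper: "\<And>s t. 0 < s \<Longrightarrow> s \<le> t \<Longrightarrow> t \<in> I \<Longrightarrow> f t \<le> A\<^sub>f * (t / s) powr b * f s"
    and v_pos: "\<And>z t. z \<in> Z \<Longrightarrow> t \<in> I \<Longrightarrow> 0 < v z t"
    and v_lower: "\<And>z s t. z \<in> Z \<Longrightarrow> 0 < s \<Longrightarrow> s \<le> t \<Longrightarrow> t \<in> I \<Longrightarrow> (t / s) powr \<eta>\<^sub>1 * v z s \<le> A\<^sub>v * v z t"
    and v_upper: "\<And>z s t. z \<in> Z \<Longrightarrow> 0 < s \<Longrightarrow> s \<le> t \<Longrightarrow> t \<in> I \<Longrightarrow> v z t \<le> A\<^sub>v * (t / s) powr \<eta>\<^sub>2 * v z s"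
    and h_nonneg: "\<And>z t. z \<in> Z \<Longrightarrow> t \<in> I \<Longrightarrow> 0 \<le> h z t"
    and h_antimono: "\<And>z s t. z \<in> Z \<Longrightarrow> 0 < s \<Longrightarrow> s \<le> t \<Longrightarrow> t \<in> I \<Longrightarrow> h z t \<le> h z s"
    and h_doubling: "\<And>z s t. z \<in> Z \<Longrightarrow> 0 < s \<Longrightarrow> s \<le> t \<Longrightarrow> t \<in> I \<Longrightarrow> h z s \<le> A\<^sub>h * (t / s) powr \<gamma> * h z t"
    and h_decay: "\<And>z s t. z \<in> Z \<Longrightarrow> \<tau> z \<le> s \<Longrightarrow> s \<le> t \<Longrightarrow> t \<in> I \<Longrightarrow> h z t \<le> A\<^sub>s * (s / t) powr \<gamma>\<^sub>s * h z s"
    and h_growth: "\<And>z s t. z \<in> Z \<Longrightarrow> 0 < s \<Longrightarrow> s \<le> t \<Longrightarrow> t \<le> \<tau> z \<Longrightarrow> h z s \<le> A\<^sub>s\<^sub>s * (t / s) powr \<gamma>\<^sub>s\<^sub>s * h z t"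
    and h_flat: "\<And>z. z \<in> Z \<Longrightarrow> T z \<le> \<tau> z \<Longrightarrow> h z (T z) \<le> A\<^sub>l * h z (\<tau> z)"
    and T_I: "\<And>z. z \<in> Z \<Longrightarrow> T z \<in> I" and \<tau>_I: "\<And>z. z \<in> Z \<Longrightarrow> \<tau> z \<in> I" and W_pos: "\<And>z. z \<in> Z \<Longrightarrow> 0 < W z"
    and F_far_upper: "\<And>z s. z \<in> Z \<Longrightarrow> T z \<le> s \<Longrightarrow> s \<in> I \<Longrightarrow> F z s \<le> A\<^sub>F * h z s / v z s"
    and F_near_upper: "\<And>z s. z \<in> Z \<Longrightarrow> 0 < s \<Longrightarrow> s \<le> T z \<Longrightarrow>
          F z s \<le> A\<^sub>F * h z s * (s / (v z (T z) * W z) + (s / T z) powr (\<gamma> + 1) / v z (T z))"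
    and F_far_lower: "\<And>z s. z \<in> Z \<Longrightarrow> T z \<le> s \<Longrightarrow> s \<in> I \<Longrightarrow> a\<^sub>F * h z s / v z s \<le> F z s"
    and F_diagonal_lower: "\<And>z s. z \<in> Z \<Longrightarrow> T z / K \<le> s \<Longrightarrow> s \<le> T z \<Longrightarrow> a\<^sub>F * h z s / v z (T z) \<le> F z s"
    and F_jump_lower: "\<And>z s. z \<in> Z \<Longrightarrow> 0 < s \<Longrightarrow> s \<le> T z \<Longrightarrow> a\<^sub>F * h z s * (s / (v z (T z) * W z)) \<le> F z s"
    and pos: "0 < A\<^sub>f" "0 < A\<^sub>v" "0 < A\<^sub>h" "0 < A\<^sub>s" "0 < A\<^sub>s\<^sub>s" "0 < A\<^sub>l" "0 < A\<^sub>F" "0 < a\<^sub>F"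
    and exps: "0 < b" "0 < \<eta>\<^sub>1" "\<gamma>\<^sub>s\<^sub>s < 1 + \<beta>" "1 + b < \<gamma>\<^sub>s"
begin

text \<open>
  Without the boundary factor, this is the order of the on-diagonal contribution of one block of
  times at \<open>s\<close>.
\<close>

definition q :: "'z \<Rightarrow> real \<Rightarrow> real" where
  "q z s = f s / v z s"

definition bracket :: "'z \<Rightarrow> real" where
  "bracket z = h z (min (T z) (\<tau> z)) * min 1 (\<tau> z * f (\<tau> z) / (T z * f (T z)))"

definition jump :: "'z \<Rightarrow> real" where
  "jump z = bracket z * (T z / W z) * q z (T z)"

lemma T_pos: "z \<in> Z \<Longrightarrow> 0 < T z" and \<tau>_pos: "z \<in> Z \<Longrightarrow> 0 < \<tau> z"
  using T_I \<tau>_I I_pos by auto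

lemma q_pos: "z \<in> Z \<Longrightarrow> t \<in> I \<Longrightarrow> 0 < q z t"
  using v_pos f_pos I_pos by (simp add: q_def)

lemma tf_mono: "0 < s \<Longrightarrow> s \<le> t \<Longrightarrow> s * f s \<le> t * f t"
  using f_mono[of s t] f_pos[of s] by (intro mult_mono) auto

lemma jump_eq:
  assumes z: "z \<in> Z"
  defines "m \<equiv> min (T z) (\<tau> z)"
  shows "jump z = h z m * (m * f m) / (v z (T z) * W z)"
proof -
  have p: "0 < T z" "0 < \<tau> z" "0 < f (T z)" "0 < f (\<tau> z)" "0 < v z (T z)" "0 < W z"
    using z T_pos \<tau>_pos f_pos v_pos T_I W_pos by auto
  have "min 1 (\<tau> z * f (\<tau> z) / (T z * f (T z))) * (T z * f (T z)) = m * f m"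
  proof (cases "T z \<le> \<tau> z")
    case True
    then show ?thesis using tf_mono[OF p(1) True] p by (simp add: m_def min_def)
  next
    case False
    then have "\<tau> z * f (\<tau> z) \<le> T z * f (T z)" using tf_mono[OF p(2)] by simp
    then show ?thesis using False p by (simp add: m_def min_def)
  qed
  then show ?thesis
    unfolding jump_def bracket_def q_def m_def[symmetric] using p
    by (simp add: field_simps)
qed

lemma jump_nonneg: "z \<in> Z \<Longrightarrow> 0 \<le> jump z"
proof -
  assume z: "z \<in> Z"
  have m: "min (T z) (\<tau> z) \<in> I" using z T_I \<tau>_I by (simp add: min_def)
  show ?thesis
    unfolding jump_eq[OF z] using h_nonneg[OF z m] I_pos[OF m] f_pos[OF I_pos[OF m]] v_pos[OF z T_I[OF z]] W_pos[OF z]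
    by (intro divide_nonneg_pos mult_nonneg_nonneg mult_pos_pos) auto
qed

lemma q_upper:
  assumes "z \<in> Z" and "0 < s" and "s \<le> t" and "t \<in> I"
  shows "q z t \<le> A\<^sub>f * A\<^sub>v * (s / t) powr (\<eta>\<^sub>1 - b) * q z s"
proof -
  have t: "0 < t" and s: "s \<in> I" using assms I_pos I_down[OF assms(4,2,3)] by auto
  have p: "0 < v z s" "0 < v z t" "0 < f s" "0 < f t"
    using v_pos[OF assms(1)] f_pos s assms t by auto
  have "f t * ((t / s) powr \<eta>\<^sub>1 * v z s) \<le> (A\<^sub>f * (t / s) powr b * f s) * (A\<^sub>v * v z t)"
    using p pos by (intro mult_mono f_upper v_lower assms) auto
  then have "f t / v z t * (t / s) powr \<eta>\<^sub>1 \<le> A\<^sub>f * A\<^sub>v * (t / s) powr b * (f s / v z s)"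
    using p by (simp add: field_simps)
  then have "f t / v z t \<le> A\<^sub>f * A\<^sub>v * (t / s) powr b * (f s / v z s) / (t / s) powr \<eta>\<^sub>1"
    using assms t by (subst pos_le_divide_eq) auto
  also have "\<dots> = A\<^sub>f * A\<^sub>v * ((t / s) powr b / (t / s) powr \<eta>\<^sub>1) * (f s / v z s)"
    by simp
  also have "(t / s) powr b / (t / s) powr \<eta>\<^sub>1 = (s / t) powr (\<eta>\<^sub>1 - b)"
    using powr_ratio_flip[of s t "b - \<eta>\<^sub>1"] assms t by (simp add: powr_diff)
  finally show ?thesis by (simp add: q_def)
qed

lemma q_lower:
  assumes "z \<in> Z" and "0 < s" and "s \<le> t" and "t \<in> I"
  shows "q z s \<le> A\<^sub>f * A\<^sub>v * (s / t) powr (\<beta> - \<eta>\<^sub>2) * q z t"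
proof -
  have t: "0 < t" and s: "s \<in> I" using assms I_pos I_down[OF assms(4,2,3)] by auto
  have p: "0 < v z s" "0 < v z t" "0 < f s" "0 < f t"
    using v_pos[OF assms(1)] f_pos s assms t by auto
  have "f s * v z t \<le> (A\<^sub>f * (s / t) powr \<beta> * f t) * (A\<^sub>v * (t / s) powr \<eta>\<^sub>2 * v z s)"
    using p pos by (intro mult_mono f_lower v_upper assms) auto
  then have "f s / v z s \<le> A\<^sub>f * A\<^sub>v * ((s / t) powr \<beta> * (t / s) powr \<eta>\<^sub>2) * (f t / v z t)"
    using p by (simp add: field_simps)
  also have "(s / t) powr \<beta> * (t / s) powr \<eta>\<^sub>2 = (s / t) powr (\<beta> - \<eta>\<^sub>2)"
    using powr_ratio_flip[of s t \<eta>\<^sub>2] assms t by (simp add: powr_add[symmetric])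
  finally show ?thesis by (simp add: q_def)
qed

subsection \<open>Upper bounds\<close>

text \<open>
  Below \<open>T \<and> \<tau>\<close> the growth exponent of \<open>h\<close> towards small times is less than \<open>1 + \<beta>\<close>, the exponent of
  \<open>s f(s)\<close>; the contributions of the blocks thus increase with \<open>s\<close>.
\<close>

lemma jump_upper_below:
  assumes z: "z \<in> Z" and s: "0 < s" "s \<le> min (T z) (\<tau> z)"
  shows "h z s * (s / (v z (T z) * W z)) \<le>
    A\<^sub>s\<^sub>s * A\<^sub>f * jump z * lo (1 + \<beta> - \<gamma>\<^sub>s\<^sub>s) (min (T z) (\<tau> z)) s"
proof -
  define m where "m = min (T z) (\<tau> z)"
  have m: "m \<in> I" "m \<le> \<tau> z" "s \<le> m" using z T_I \<tau>_I s by (auto simp: m_def min_def)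
  have p: "0 < m" "0 < f s" "0 < f m" "0 < v z (T z) * W z"
    using m I_pos f_pos s v_pos[OF z T_I[OF z]] W_pos[OF z] by auto
  have hn: "0 \<le> h z m" "0 \<le> h z s" using h_nonneg[OF z m(1)] h_nonneg[OF z I_down[OF m(1) s(1) m(3)]] by auto
  have pw: "(s / m) powr \<beta> * (m / s) powr \<gamma>\<^sub>s\<^sub>s * (s / m) = (s / m) powr (1 + \<beta> - \<gamma>\<^sub>s\<^sub>s)"
    using powr_ratio_flip[of s m \<gamma>\<^sub>s\<^sub>s] s p by (simp add: powr_add powr_diff powr_minus_divide mult_ac)
  have "f s * h z s \<le> (A\<^sub>f * (s / m) powr \<beta> * f m) * (A\<^sub>s\<^sub>s * (m / s) powr \<gamma>\<^sub>s\<^sub>s * h z m)"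
    using p pos hn by (intro mult_mono f_lower h_growth z s m) auto
  then have "f s * h z s * s \<le> (A\<^sub>f * (s / m) powr \<beta> * f m) * (A\<^sub>s\<^sub>s * (m / s) powr \<gamma>\<^sub>s\<^sub>s * h z m) * s"
    using s by (intro mult_right_mono) auto
  also have "\<dots> = A\<^sub>s\<^sub>s * A\<^sub>f * (h z m * (m * f m)) * ((s / m) powr \<beta> * (m / s) powr \<gamma>\<^sub>s\<^sub>s * (s / m))"
    using p by simp
  finally have "h z s * s \<le> A\<^sub>s\<^sub>s * A\<^sub>f * (h z m * (m * f m)) * ((s / m) powr (1 + \<beta> - \<gamma>\<^sub>s\<^sub>s) / f s)"
    unfolding pw using p by (simp add: field_simps)
  then have "h z s * s / (v z (T z) * W z) \<le>
      A\<^sub>s\<^sub>s * A\<^sub>f * (h z m * (m * f m)) * ((s / m) powr (1 + \<beta> - \<gamma>\<^sub>s\<^sub>s) / f s) / (v z (T z) * W z)"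
    using p by (intro divide_right_mono) auto
  then show ?thesis
    unfolding jump_eq[OF z] m_def[symmetric] lo_def using s m by (simp add: mult_ac)
qed

text \<open>
  Between \<open>\<tau>\<close> and \<open>T\<close> the function \<open>h\<close> decays with an exponent larger than \<open>1 + b\<close>, the largest exponent of
  \<open>s f(s)\<close>; the contributions of the blocks thus decrease in \<open>s\<close>.
\<close>

lemma jump_upper_above:
  assumes z: "z \<in> Z" and s: "\<tau> z < s" "s \<le> T z"
  shows "h z s * (s / (v z (T z) * W z)) \<le> A\<^sub>s * A\<^sub>f * jump z * hi (\<gamma>\<^sub>s - 1 - b) (\<tau> z) s"
proof -
  let ?t = "\<tau> z"
  have m: "min (T z) ?t = ?t" using s by simp
  have sI: "s \<in> I" using I_down[OF T_I[OF z]] s \<tau>_pos[OF z] by simp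
  have p: "0 < ?t" "0 < s" "0 < f s" "0 < f ?t" "0 < v z (T z) * W z"
    using \<tau>_pos[OF z] f_pos s v_pos[OF z T_I[OF z]] W_pos[OF z] by auto
  have hn: "0 \<le> h z ?t" "0 \<le> h z s" using h_nonneg z \<tau>_I[OF z] sI by auto
  have pw: "(s / ?t) powr b * (?t / s) powr \<gamma>\<^sub>s * (s / ?t) = (?t / s) powr (\<gamma>\<^sub>s - 1 - b)"
    using powr_ratio_flip[of ?t s b] p by (simp add: powr_diff powr_minus_divide)
  have "f s * h z s \<le> (A\<^sub>f * (s / ?t) powr b * f ?t) * (A\<^sub>s * (?t / s) powr \<gamma>\<^sub>s * h z ?t)"
    using p pos hn s by (intro mult_mono f_upper h_decay z sI) auto
  then have "f s * h z s * s \<le> (A\<^sub>f * (s / ?t) powr b * f ?t) * (A\<^sub>s * (?t / s) powr \<gamma>\<^sub>s * h z ?t) * s"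
    using p by (intro mult_right_mono) auto
  also have "\<dots> = A\<^sub>s * A\<^sub>f * (h z ?t * (?t * f ?t)) * ((s / ?t) powr b * (?t / s) powr \<gamma>\<^sub>s * (s / ?t))"
    using p by simp
  finally have "h z s * s \<le> A\<^sub>s * A\<^sub>f * (h z ?t * (?t * f ?t)) * ((?t / s) powr (\<gamma>\<^sub>s - 1 - b) / f s)"
    unfolding pw using p by (simp add: field_simps)
  then have "h z s * s / (v z (T z) * W z) \<le>
      A\<^sub>s * A\<^sub>f * (h z ?t * (?t * f ?t)) * ((?t / s) powr (\<gamma>\<^sub>s - 1 - b) / f s) / (v z (T z) * W z)"
    using p by (intro divide_right_mono) auto
  then show ?thesis
    unfolding jump_eq[OF z] m hi_def using s by (simp add: mult_ac)
qed

lemma diffusion_upper: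
  assumes z: "z \<in> Z" and s: "0 < s" "s \<le> T z"
  shows "h z s * ((s / T z) powr (\<gamma> + 1) / v z (T z)) \<le> A\<^sub>h * (h z (T z) * q z (T z)) * lo 1 (T z) s"
proof -
  let ?t = "T z"
  have sI: "s \<in> I" using I_down[OF T_I[OF z]] s by simp
  have p: "0 < ?t" "0 < f s" "0 < f ?t" "0 < v z ?t"
    using T_pos[OF z] f_pos s v_pos[OF z T_I[OF z]] by auto
  have hn: "0 \<le> h z ?t" "0 \<le> h z s" using h_nonneg z T_I[OF z] sI by auto
  have pw: "(?t / s) powr \<gamma> * (s / ?t) powr (\<gamma> + 1) = s / ?t"
    using powr_ratio_flip[of s ?t \<gamma>] p s by (simp add: powr_add[symmetric])
  have "f s * h z s \<le> f ?t * (A\<^sub>h * (?t / s) powr \<gamma> * h z ?t)"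
    using p hn by (intro mult_mono f_mono h_doubling z s T_I) auto
  then have "f s * h z s * (s / ?t) powr (\<gamma> + 1) \<le>
      f ?t * (A\<^sub>h * (?t / s) powr \<gamma> * h z ?t) * (s / ?t) powr (\<gamma> + 1)"
    by (intro mult_right_mono) auto
  also have "\<dots> = A\<^sub>h * h z ?t * f ?t * ((?t / s) powr \<gamma> * (s / ?t) powr (\<gamma> + 1))"
    by simp
  finally have "h z s * (s / ?t) powr (\<gamma> + 1) \<le> A\<^sub>h * h z ?t * f ?t * (s / ?t / f s)"
    unfolding pw using p by (simp add: field_simps)
  then have "h z s * (s / ?t) powr (\<gamma> + 1) / v z ?t \<le> A\<^sub>h * h z ?t * f ?t * (s / ?t / f s) / v z ?t"
    using p by (intro divide_right_mono) auto
  then show ?thesis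
    unfolding q_def lo_def using s p by (simp add: mult_ac)
qed

lemma near_upper:
  "\<exists>C>0. \<forall>z\<in>Z. \<forall>s. 0 < s \<and> s \<le> T z \<longrightarrow>
    F z s \<le> C * jump z * (lo (1 + \<beta> - \<gamma>\<^sub>s\<^sub>s) (min (T z) (\<tau> z)) s + hi (\<gamma>\<^sub>s - 1 - b) (\<tau> z) s)
      + C * (h z (T z) * q z (T z)) * lo 1 (T z) s"
proof (intro exI conjI ballI allI impI; (elim conjE)?)
  let ?C = "A\<^sub>F * (A\<^sub>s\<^sub>s * A\<^sub>f + A\<^sub>s * A\<^sub>f + A\<^sub>h)"
  show "0 < ?C" using pos by (intro mult_pos_pos add_pos_pos) auto
  fix z s assume z: "z \<in> Z" and s: "0 < s" "s \<le> T z"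
  let ?J = "lo (1 + \<beta> - \<gamma>\<^sub>s\<^sub>s) (min (T z) (\<tau> z)) s + hi (\<gamma>\<^sub>s - 1 - b) (\<tau> z) s"
  have nn: "0 \<le> jump z" "0 \<le> lo (1 + \<beta> - \<gamma>\<^sub>s\<^sub>s) (min (T z) (\<tau> z)) s" "0 \<le> hi (\<gamma>\<^sub>s - 1 - b) (\<tau> z) s"
      "0 \<le> lo 1 (T z) s" "0 \<le> h z (T z) * q z (T z)"
    using jump_nonneg z lo_nonneg hi_nonneg T_pos \<tau>_pos h_nonneg T_I q_pos
    by (auto simp: less_imp_le)
  have J: "h z s * (s / (v z (T z) * W z)) \<le> (A\<^sub>s\<^sub>s * A\<^sub>f + A\<^sub>s * A\<^sub>f + A\<^sub>h) * (jump z * ?J)"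
  proof (cases "s \<le> min (T z) (\<tau> z)")
    case True
    have "h z s * (s / (v z (T z) * W z)) \<le> (A\<^sub>s\<^sub>s * A\<^sub>f) * (jump z * lo (1 + \<beta> - \<gamma>\<^sub>s\<^sub>s) (min (T z) (\<tau> z)) s)"
      using jump_upper_below[OF z s(1) True] by (simp add: mult_ac)
    also have "\<dots> \<le> (A\<^sub>s\<^sub>s * A\<^sub>f + A\<^sub>s * A\<^sub>f + A\<^sub>h) * (jump z * ?J)"
      using nn pos by (intro mult_mono mult_left_mono) (auto intro!: add_nonneg_nonneg)
    finally show ?thesis .
  next
    case False
    have "h z s * (s / (v z (T z) * W z)) \<le> (A\<^sub>s * A\<^sub>f) * (jump z * hi (\<gamma>\<^sub>s - 1 - b) (\<tau> z) s)"
      using jump_upper_above[OF z _ s(2)] False s by (simp add: mult_ac)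
    also have "\<dots> \<le> (A\<^sub>s\<^sub>s * A\<^sub>f + A\<^sub>s * A\<^sub>f + A\<^sub>h) * (jump z * ?J)"
      using nn pos by (intro mult_mono mult_left_mono) (auto intro!: add_nonneg_nonneg)
    finally show ?thesis .
  qed
  have D: "h z s * ((s / T z) powr (\<gamma> + 1) / v z (T z)) \<le>
      (A\<^sub>s\<^sub>s * A\<^sub>f + A\<^sub>s * A\<^sub>f + A\<^sub>h) * (h z (T z) * q z (T z) * lo 1 (T z) s)"
  proof -
    have "h z s * ((s / T z) powr (\<gamma> + 1) / v z (T z)) \<le> A\<^sub>h * (h z (T z) * q z (T z) * lo 1 (T z) s)"
      using diffusion_upper[OF z s] by (simp add: mult_ac)
    also have "\<dots> \<le> (A\<^sub>s\<^sub>s * A\<^sub>f + A\<^sub>s * A\<^sub>f + A\<^sub>h) * (h z (T z) * q z (T z) * lo 1 (T z) s)"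
      using nn pos by (intro mult_right_mono) auto
    finally show ?thesis .
  qed
  have "F z s \<le> A\<^sub>F * (h z s * (s / (v z (T z) * W z)) + h z s * ((s / T z) powr (\<gamma> + 1) / v z (T z)))"
    using F_near_upper[OF z s] by (simp add: algebra_simps)
  also have "\<dots> \<le> A\<^sub>F * ((A\<^sub>s\<^sub>s * A\<^sub>f + A\<^sub>s * A\<^sub>f + A\<^sub>h) * (jump z * ?J)
      + (A\<^sub>s\<^sub>s * A\<^sub>f + A\<^sub>s * A\<^sub>f + A\<^sub>h) * (h z (T z) * q z (T z) * lo 1 (T z) s))"
    using pos by (intro mult_left_mono add_mono J D) auto
  also have "\<dots> = ?C * jump z * ?J + ?C * (h z (T z) * q z (T z)) * lo 1 (T z) s"
    by (simp add: algebra_simps)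
  finally show "F z s \<le> ?C * jump z * ?J + ?C * (h z (T z) * q z (T z)) * lo 1 (T z) s" .
qed

text \<open>
  It remains to majorize the integrand at the times after \<open>T\<close>; the profile \<open>P\<close> used there is what
  distinguishes the three dimensional regimes.
\<close>

lemma upper_from_far_profile:
  fixes P :: "'z \<Rightarrow> real \<Rightarrow> real" and k w :: "'z \<Rightarrow> real"
  assumes P: "\<And>z. z \<in> Z \<Longrightarrow> P z \<in> borel_measurable borel" "\<And>z s. z \<in> Z \<Longrightarrow> 0 \<le> P z s"
    and C: "0 < Ci" "0 < Cf" "0 < Cn"
    and int_P: "\<And>z. z \<in> Z \<Longrightarrow> (\<integral>\<^sup>+s. ennreal (P z s) \<partial>U z) \<le> ennreal (Ci * w z)"
    and nn: "\<And>z. z \<in> Z \<Longrightarrow> 0 \<le> w z" "\<And>z. z \<in> Z \<Longrightarrow> 0 \<le> k z"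
    and far: "\<And>z s. z \<in> Z \<Longrightarrow> T z < s \<Longrightarrow> s \<in> I \<Longrightarrow> F z s \<le> Cf * k z * P z s"
    and near: "\<And>z. z \<in> Z \<Longrightarrow> h z (T z) * q z (T z) \<le> Cn * (k z * w z)"
  shows "\<exists>C>0. \<forall>z\<in>Z. (\<integral>\<^sup>+s\<in>I. ennreal (F z s) \<partial>U z) \<le> ennreal (C * (jump z + k z * w z))"
proof -
  obtain C where C': "0 < C" and nearF: "\<And>z s. z \<in> Z \<Longrightarrow> 0 < s \<Longrightarrow> s \<le> T z \<Longrightarrow>
    F z s \<le> C * jump z * (lo (1 + \<beta> - \<gamma>\<^sub>s\<^sub>s) (min (T z) (\<tau> z)) s + hi (\<gamma>\<^sub>s - 1 - b) (\<tau> z) s)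
      + C * (h z (T z) * q z (T z)) * lo 1 (T z) s"
    using near_upper by blast
  define G where "G e = 4 * A\<^sub>U / (1 - 2 powr (- e))" for e :: real
  have G: "0 < G e" if "0 < e" for e
    using that A\<^sub>U unfolding G_def by (intro divide_pos_pos) (auto simp: powr_less_one)
  let ?e1 = "1 + \<beta> - \<gamma>\<^sub>s\<^sub>s" and ?e2 = "\<gamma>\<^sub>s - 1 - b"
  have e: "0 < ?e1" "0 < ?e2" using exps by auto
  let ?D = "C * (G ?e1 + G ?e2) + C * Cn * G 1 + Cf * Ci"
  show ?thesis
  proof (intro exI[of _ ?D] conjI ballI)
    show "0 < ?D" using C C' G e by (intro add_pos_pos mult_pos_pos) auto
    fix z assume z: "z \<in> Z"
    let ?m = "min (T z) (\<tau> z)"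
    have Tp: "0 < T z" "0 < \<tau> z" "0 < ?m" using T_pos \<tau>_pos z by auto
    note [measurable] = lo_measurable[OF Tp(3)] lo_measurable[OF Tp(1)] hi_measurable[OF Tp(2)] P(1)[OF z]
    have ms: "sets (U z) = sets borel" by (rule sets_U[OF z])
    have [measurable]: "g \<in> borel_measurable (U z)" if "g \<in> borel_measurable borel" for g :: "real \<Rightarrow> real"
      using that measurable_cong_sets[OF ms refl, of "borel :: real measure"] by simp
    have hq: "0 \<le> h z (T z) * q z (T z)" using h_nonneg z T_I q_pos by (simp add: less_imp_le)
    let ?a1 = "C * jump z" and ?a2 = "C * (h z (T z) * q z (T z))" and ?a3 = "Cf * k z"
    have a: "0 \<le> ?a1" "0 \<le> ?a2" "0 \<le> ?a3" using C C' jump_nonneg[OF z] hq nn z by auto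
    have "(\<integral>\<^sup>+s\<in>I. ennreal (F z s) \<partial>U z) \<le>
        (\<integral>\<^sup>+s. ennreal ?a1 * ennreal (lo ?e1 ?m s) + (ennreal ?a1 * ennreal (hi ?e2 (\<tau> z) s)
          + (ennreal ?a2 * ennreal (lo 1 (T z) s) + ennreal ?a3 * ennreal (P z s))) \<partial>U z)"
    proof (rule nn_integral_mono)
      fix s
      have l: "0 \<le> lo ?e1 ?m s" "0 \<le> hi ?e2 (\<tau> z) s" "0 \<le> lo 1 (T z) s" "0 \<le> P z s"
        by (rule lo_nonneg[OF Tp(3)] hi_nonneg[OF Tp(2)] lo_nonneg[OF Tp(1)] P(2)[OF z])+
      have "ennreal (F z s) * indicator I s \<le>
          ennreal (?a1 * lo ?e1 ?m s + (?a1 * hi ?e2 (\<tau> z) s + (?a2 * lo 1 (T z) s + ?a3 * P z s)))"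
      proof (cases "s \<in> I")
        case True
        have "F z s \<le> ?a1 * lo ?e1 ?m s + (?a1 * hi ?e2 (\<tau> z) s + (?a2 * lo 1 (T z) s + ?a3 * P z s))"
        proof (cases "s \<le> T z")
          case s: True
          have "F z s \<le> ?a1 * (lo ?e1 ?m s + hi ?e2 (\<tau> z) s) + ?a2 * lo 1 (T z) s"
            using nearF[OF z I_pos[OF True] s] by simp
          then show ?thesis using mult_nonneg_nonneg[OF a(3) l(4)] by (simp add: algebra_simps)
        next
          case False
          then have "F z s \<le> ?a3 * P z s" using far[OF z _ True] by simp
          then show ?thesis
            using mult_nonneg_nonneg[OF a(1) l(1)] mult_nonneg_nonneg[OF a(1) l(2)] mult_nonneg_nonneg[OF a(2) l(3)]
            by simp
        qed
        then show ?thesis using True by (simp add: ennreal_leI)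
      qed simp
      also have "\<dots> = ennreal ?a1 * ennreal (lo ?e1 ?m s) + (ennreal ?a1 * ennreal (hi ?e2 (\<tau> z) s)
          + (ennreal ?a2 * ennreal (lo 1 (T z) s) + ennreal ?a3 * ennreal (P z s)))"
        using a l by (simp add: ennreal_mult del: mult_eq_0_iff)
      finally show "ennreal (F z s) * indicator I s \<le> ennreal ?a1 * ennreal (lo ?e1 ?m s) +
          (ennreal ?a1 * ennreal (hi ?e2 (\<tau> z) s) + (ennreal ?a2 * ennreal (lo 1 (T z) s) + ennreal ?a3 * ennreal (P z s)))" .
    qed
    also have "\<dots> = ennreal ?a1 * (\<integral>\<^sup>+s. ennreal (lo ?e1 ?m s) \<partial>U z) + (ennreal ?a1 * (\<integral>\<^sup>+s. ennreal (hi ?e2 (\<tau> z) s) \<partial>U z)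
        + (ennreal ?a2 * (\<integral>\<^sup>+s. ennreal (lo 1 (T z) s) \<partial>U z) + ennreal ?a3 * (\<integral>\<^sup>+s. ennreal (P z s) \<partial>U z)))"
      by (simp add: nn_integral_add nn_integral_cmult)
    also have "\<dots> \<le> ennreal ?a1 * ennreal (G ?e1) + (ennreal ?a1 * ennreal (G ?e2)
        + (ennreal ?a2 * ennreal (G 1) + ennreal ?a3 * ennreal (Ci * w z)))"
      unfolding G_def
      by (intro add_mono mult_left_mono lo_integral hi_integral int_P z e Tp) auto
    also have "\<dots> = ennreal (?a1 * G ?e1 + (?a1 * G ?e2 + (?a2 * G 1 + ?a3 * (Ci * w z))))"
      using a G[OF e(1)] G[OF e(2)] G[of 1] C nn(1)[OF z]
      by (simp add: ennreal_mult[symmetric] ennreal_plus[symmetric] del: ennreal_plus)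
    also have "\<dots> \<le> ennreal (?D * (jump z + k z * w z))"
    proof (rule ennreal_leI)
      have kw: "0 \<le> k z * w z" using nn z by simp
      have "?a2 * G 1 \<le> C * (Cn * (k z * w z)) * G 1"
        using near[OF z] C' G[of 1] by (intro mult_right_mono mult_left_mono) auto
      then have "?a1 * G ?e1 + (?a1 * G ?e2 + (?a2 * G 1 + ?a3 * (Ci * w z))) \<le>
          (C * (G ?e1 + G ?e2)) * jump z + (C * Cn * G 1 + Cf * Ci) * (k z * w z)"
        by (simp add: algebra_simps)
      also have "\<dots> \<le> ?D * jump z + ?D * (k z * w z)"
        using C C' G[OF e(1)] G[OF e(2)] G[of 1] jump_nonneg[OF z] kw
        by (intro add_mono mult_right_mono) auto
      finally show "?a1 * G ?e1 + (?a1 * G ?e2 + (?a2 * G 1 + ?a3 * (Ci * w z))) \<le> ?D * (jump z + k z * w z)"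
        by (simp add: algebra_simps)
    qed
    finally show "(\<integral>\<^sup>+s\<in>I. ennreal (F z s) \<partial>U z) \<le> ennreal (?D * (jump z + k z * w z))" .
  qed
qed

end

context green_core
begin

abbreviation Mx :: "'z \<Rightarrow> real" where "Mx z \<equiv> max (T z) (\<tau> z)"

lemma Mx_I: "z \<in> Z \<Longrightarrow> Mx z \<in> I" and Mx_pos: "z \<in> Z \<Longrightarrow> 0 < Mx z"
  using T_I \<tau>_I T_pos \<tau>_pos by (auto simp: max_def)

lemma h_antimono_T: "z \<in> Z \<Longrightarrow> T z \<le> s \<Longrightarrow> s \<in> I \<Longrightarrow> h z s \<le> h z (T z)"
  using h_antimono T_pos by auto

lemma F_far_q: "z \<in> Z \<Longrightarrow> T z \<le> s \<Longrightarrow> s \<in> I \<Longrightarrow> F z s \<le> A\<^sub>F * (h z s * q z s) / f s"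
  using F_far_upper[of z s] f_pos[OF I_pos[of s]] by (simp add: q_def)

text \<open>
  After both \<open>T\<close> and \<open>\<tau>\<close> the decay of \<open>h\<close> alone makes the blocks summable, whatever the volume exponents
  are.
\<close>

lemma far_upper:
  assumes z: "z \<in> Z" and s: "s \<in> I" "Mx z < s"
  shows "F z s \<le> A\<^sub>F * (A\<^sub>s * A\<^sub>f * A\<^sub>v) * (h z (T z) * q z (Mx z)) * hi 1 (Mx z) s"
proof -
  let ?M = "Mx z"
  note M = Mx_I[OF z] Mx_pos[OF z]
  have p: "0 < s" "0 < f s" "0 < q z s" "0 < q z ?M" "0 \<le> h z s" "0 \<le> h z (T z)"
    using I_pos[OF s(1)] f_pos q_pos[OF z] M s h_nonneg[OF z] T_I[OF z] by auto
  have "h z s \<le> A\<^sub>s * (?M / s) powr \<gamma>\<^sub>s * h z ?M"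
    using s by (intro h_decay z) auto
  also have "\<dots> \<le> A\<^sub>s * (?M / s) powr \<gamma>\<^sub>s * h z (T z)"
    using pos by (intro mult_left_mono h_antimono_T z M) auto
  finally have "h z s * q z s \<le>
      (A\<^sub>s * (?M / s) powr \<gamma>\<^sub>s * h z (T z)) * (A\<^sub>f * A\<^sub>v * (?M / s) powr (\<eta>\<^sub>1 - b) * q z ?M)"
    using p pos s M by (intro mult_mono q_upper[OF z]) auto
  also have "\<dots> = (A\<^sub>s * A\<^sub>f * A\<^sub>v * (h z (T z) * q z ?M)) * (?M / s) powr (\<gamma>\<^sub>s + (\<eta>\<^sub>1 - b))"
    by (simp add: powr_add mult_ac)
  also have "\<dots> \<le> (A\<^sub>s * A\<^sub>f * A\<^sub>v * (h z (T z) * q z ?M)) * (?M / s) powr 1"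
    using p pos s M exps by (intro mult_left_mono powr_mono' mult_nonneg_nonneg) auto
  finally have "A\<^sub>F * (h z s * q z s) / f s \<le>
      A\<^sub>F * ((A\<^sub>s * A\<^sub>f * A\<^sub>v * (h z (T z) * q z ?M)) * (?M / s) powr 1) / f s"
    using p pos by (intro divide_right_mono mult_left_mono) auto
  then show ?thesis
    using F_far_q[OF z _ s(1)] s by (simp add: hi_def mult_ac)
qed

abbreviation green :: "'z \<Rightarrow> ennreal" where
  "green z \<equiv> (\<integral>\<^sup>+s\<in>I. ennreal (F z s) \<partial>U z)"

lemma hq_nonneg: "z \<in> Z \<Longrightarrow> t \<in> I \<Longrightarrow> u \<in> I \<Longrightarrow> 0 \<le> h z t * q z u"
  using h_nonneg q_pos by (simp add: less_imp_le)

text \<open>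
  If the volume exponent exceeds that of \<open>f\<close>, the blocks decrease from \<open>T\<close> on.
\<close>

lemma upper_transient:
  assumes "b < \<eta>\<^sub>1"
  shows "\<exists>C>0. \<forall>z\<in>Z. green z \<le> ennreal (C * (jump z + h z (T z) * q z (T z)))"
proof -
  have "\<exists>C>0. \<forall>z\<in>Z. green z \<le> ennreal (C * (jump z + (h z (T z) * q z (T z)) * 1))"
  proof (rule upper_from_far_profile[where P = "\<lambda>z. hi (\<eta>\<^sub>1 - b) (T z)"
        and Ci = "4 * A\<^sub>U / (1 - 2 powr (- (\<eta>\<^sub>1 - b)))" and Cf = "A\<^sub>F * (A\<^sub>f * A\<^sub>v)" and Cn = 1])
    show "0 < 4 * A\<^sub>U / (1 - 2 powr (- (\<eta>\<^sub>1 - b)))"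
      using assms A\<^sub>U by (intro divide_pos_pos) (auto simp: powr_less_one)
    fix z assume z: "z \<in> Z"
    show "hi (\<eta>\<^sub>1 - b) (T z) \<in> borel_measurable borel" by (rule hi_measurable[OF T_pos[OF z]])
    show "0 \<le> hi (\<eta>\<^sub>1 - b) (T z) s" for s by (rule hi_nonneg[OF T_pos[OF z]])
    show "(\<integral>\<^sup>+s. ennreal (hi (\<eta>\<^sub>1 - b) (T z) s) \<partial>U z) \<le> ennreal (4 * A\<^sub>U / (1 - 2 powr (- (\<eta>\<^sub>1 - b))) * 1)"
      using hi_integral[OF _ z T_pos[OF z], of "\<eta>\<^sub>1 - b"] assms by simp
    fix s assume s: "T z < s" "s \<in> I"
    have p: "0 < s" "0 < f s" "0 < q z s" "0 \<le> h z (T z)"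
      using I_pos[OF s(2)] f_pos q_pos[OF z] s h_nonneg[OF z] T_I[OF z] by auto
    have "h z s * q z s \<le> h z (T z) * (A\<^sub>f * A\<^sub>v * (T z / s) powr (\<eta>\<^sub>1 - b) * q z (T z))"
      using p s T_pos[OF z] by (intro mult_mono h_antimono_T q_upper z) auto
    then have "A\<^sub>F * (h z s * q z s) / f s \<le>
        A\<^sub>F * (h z (T z) * (A\<^sub>f * A\<^sub>v * (T z / s) powr (\<eta>\<^sub>1 - b) * q z (T z))) / f s"
      using p pos by (intro divide_right_mono mult_left_mono) auto
    then show "F z s \<le> A\<^sub>F * (A\<^sub>f * A\<^sub>v) * (h z (T z) * q z (T z)) * hi (\<eta>\<^sub>1 - b) (T z) s"
      using F_far_q[OF z _ s(2)] s by (simp add: hi_def mult_ac)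
  qed (use pos hq_nonneg T_I in auto)
  then show ?thesis by simp
qed

text \<open>
  In the critical case \<open>f/v\<close> is constant up to factors, so that each of the blocks between \<open>T\<close> and \<open>\<tau>\<close>
  contributes equally; their number gives the logarithm.
\<close>

lemma upper_critical:
  assumes "b \<le> \<eta>\<^sub>1" and "\<eta>\<^sub>2 \<le> \<beta>"
  shows "\<exists>C>0. \<forall>z\<in>Z. green z \<le>
    ennreal (C * (jump z + (h z (T z) * q z (T z)) * (1 + ln (Mx z / T z))))"
proof -
  let ?G = "4 * A\<^sub>U / (1 - 2 powr (- 1))"
  have G: "0 < ?G" using A\<^sub>U by (intro divide_pos_pos) (auto simp: powr_less_one)
  have ln0: "0 \<le> ln (Mx z / T z)" if "z \<in> Z" for z
    using T_pos[OF that] by (intro ln_ge_zero) (auto simp: le_divide_eq)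
  have q_le: "q z s \<le> A\<^sub>f * A\<^sub>v * q z (T z)" if "z \<in> Z" "T z \<le> s" "s \<in> I" for z s
  proof -
    have "q z s \<le> A\<^sub>f * A\<^sub>v * (T z / s) powr (\<eta>\<^sub>1 - b) * q z (T z)"
      using that T_pos by (intro q_upper) auto
    also have "\<dots> \<le> A\<^sub>f * A\<^sub>v * 1 * q z (T z)"
      using that T_pos[OF that(1)] I_pos[OF that(3)] assms pos q_pos[OF that(1) T_I[OF that(1)]]
      by (intro mult_right_mono mult_left_mono powr_le1) auto
    finally show ?thesis by simp
  qed
  show ?thesis
  proof (rule upper_from_far_profile[where P = "\<lambda>z s. mid (T z) (Mx z) s + hi 1 (Mx z) s"
        and Ci = "8 * A\<^sub>U + ?G" and Cf = "A\<^sub>F * (A\<^sub>f * A\<^sub>v) + A\<^sub>F * (A\<^sub>s * A\<^sub>f * A\<^sub>v) * (A\<^sub>f * A\<^sub>v)" and Cn = 1])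
    fix z assume z: "z \<in> Z"
    note Tp = T_pos[OF z] Mx_pos[OF z]
    note [measurable] = mid_measurable[OF Tp(1), of "Mx z"] hi_measurable[OF Tp(2), of 1]
    show "(\<lambda>s. mid (T z) (Mx z) s + hi 1 (Mx z) s) \<in> borel_measurable borel" by measurable
    have nn: "0 \<le> mid (T z) (Mx z) s" "0 \<le> hi 1 (Mx z) s" for s
      by (rule mid_nonneg[OF Tp(1)] hi_nonneg[OF Tp(2)])+
    show "0 \<le> mid (T z) (Mx z) s + hi 1 (Mx z) s" for s using nn by simp
    have ms: "sets (U z) = sets borel" by (rule sets_U[OF z])
    have [measurable]: "g \<in> borel_measurable (U z)" if "g \<in> borel_measurable borel" for g :: "real \<Rightarrow> real"
      using that measurable_cong_sets[OF ms refl, of "borel :: real measure"] by simp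
    have "(\<integral>\<^sup>+s. ennreal (mid (T z) (Mx z) s + hi 1 (Mx z) s) \<partial>U z) =
        (\<integral>\<^sup>+s. ennreal (mid (T z) (Mx z) s) \<partial>U z) + (\<integral>\<^sup>+s. ennreal (hi 1 (Mx z) s) \<partial>U z)"
      using nn by (simp add: nn_integral_add)
    also have "\<dots> \<le> ennreal (8 * A\<^sub>U * (1 + ln (Mx z / T z))) + ennreal ?G"
      by (intro add_mono mid_integral hi_integral z Tp) auto
    also have "\<dots> = ennreal (8 * A\<^sub>U * (1 + ln (Mx z / T z)) + ?G)"
      using G ln0[OF z] A\<^sub>U by (intro ennreal_plus[symmetric]) auto
    also have "\<dots> \<le> ennreal ((8 * A\<^sub>U + ?G) * (1 + ln (Mx z / T z)))"
      using mult_nonneg_nonneg[OF less_imp_le[OF G] ln0[OF z]] by (intro ennreal_leI) (simp add: algebra_simps)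
    finally show "(\<integral>\<^sup>+s. ennreal (mid (T z) (Mx z) s + hi 1 (Mx z) s) \<partial>U z) \<le>
        ennreal ((8 * A\<^sub>U + ?G) * (1 + ln (Mx z / T z)))" .
    show "h z (T z) * q z (T z) \<le> 1 * (h z (T z) * q z (T z) * (1 + ln (Mx z / T z)))"
      using mult_nonneg_nonneg[OF hq_nonneg[OF z T_I[OF z] T_I[OF z]] ln0[OF z]] by (simp add: algebra_simps)
    fix s assume s: "T z < s" "s \<in> I"
    have p: "0 < s" "0 < f s" "0 < q z s" "0 < q z (T z)" "0 \<le> h z (T z)"
      using I_pos[OF s(2)] f_pos q_pos[OF z] s h_nonneg[OF z] T_I[OF z] by auto
    let ?C = "A\<^sub>F * (A\<^sub>f * A\<^sub>v) + A\<^sub>F * (A\<^sub>s * A\<^sub>f * A\<^sub>v) * (A\<^sub>f * A\<^sub>v)"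
    let ?k = "h z (T z) * q z (T z)"
    show "F z s \<le> ?C * ?k * (mid (T z) (Mx z) s + hi 1 (Mx z) s)"
    proof (cases "s \<le> Mx z")
      case True
      have "h z s * q z s \<le> h z (T z) * (A\<^sub>f * A\<^sub>v * q z (T z))"
        using p s by (intro mult_mono h_antimono_T q_le z) auto
      then have "A\<^sub>F * (h z s * q z s) / f s \<le> A\<^sub>F * (h z (T z) * (A\<^sub>f * A\<^sub>v * q z (T z))) / f s"
        using p pos by (intro divide_right_mono mult_left_mono) auto
      then have "F z s \<le> A\<^sub>F * (A\<^sub>f * A\<^sub>v) * ?k * mid (T z) (Mx z) s"
        using F_far_q[OF z _ s(2)] s True by (simp add: mid_def mult_ac)
      also have "\<dots> \<le> ?C * ?k * (mid (T z) (Mx z) s + hi 1 (Mx z) s)"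
        using p pos nn by (intro mult_mono) auto
      finally show ?thesis .
    next
      case False
      then have "F z s \<le> A\<^sub>F * (A\<^sub>s * A\<^sub>f * A\<^sub>v) * (h z (T z) * q z (Mx z)) * hi 1 (Mx z) s"
        by (intro far_upper z s) auto
      also have "\<dots> \<le> A\<^sub>F * (A\<^sub>s * A\<^sub>f * A\<^sub>v) * (h z (T z) * (A\<^sub>f * A\<^sub>v * q z (T z))) * hi 1 (Mx z) s"
        using p pos nn by (intro mult_right_mono mult_left_mono q_le z Mx_I) auto
      also have "\<dots> = A\<^sub>F * (A\<^sub>s * A\<^sub>f * A\<^sub>v) * (A\<^sub>f * A\<^sub>v) * ?k * hi 1 (Mx z) s" by simp
      also have "\<dots> \<le> ?C * ?k * (mid (T z) (Mx z) s + hi 1 (Mx z) s)"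
        using p pos nn by (intro mult_mono) auto
      finally show ?thesis .
    qed
  qed (use pos A\<^sub>U G hq_nonneg T_I ln0 in \<open>auto intro!: add_pos_pos add_nonneg_nonneg\<close>)
qed

text \<open>
  If \<open>f\<close> grows faster than the volume, the blocks increase up to \<open>T \<or> \<tau>\<close> and decrease afterwards.
\<close>

lemma upper_recurrent:
  assumes "\<eta>\<^sub>2 < \<beta>"
  shows "\<exists>C>0. \<forall>z\<in>Z. green z \<le> ennreal (C * (jump z + h z (T z) * q z (Mx z)))"
proof -
  let ?G = "\<lambda>e. 4 * A\<^sub>U / (1 - 2 powr (- e))"
  let ?e = "\<beta> - \<eta>\<^sub>2"
  have G: "0 < ?G 1" "0 < ?G ?e"
    using A\<^sub>U assms by (auto intro!: divide_pos_pos simp: powr_less_one)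
  have "\<exists>C>0. \<forall>z\<in>Z. green z \<le> ennreal (C * (jump z + (h z (T z) * q z (Mx z)) * 1))"
  proof (rule upper_from_far_profile[where P = "\<lambda>z s. lo ?e (Mx z) s + hi 1 (Mx z) s"
        and Ci = "?G ?e + ?G 1" and Cf = "A\<^sub>F * (A\<^sub>f * A\<^sub>v) + A\<^sub>F * (A\<^sub>s * A\<^sub>f * A\<^sub>v)" and Cn = "A\<^sub>f * A\<^sub>v"])
    show "0 < ?G ?e + ?G 1" using G by simp
    fix z assume z: "z \<in> Z"
    note Tp = T_pos[OF z] Mx_pos[OF z]
    note [measurable] = lo_measurable[OF Tp(2), of ?e] hi_measurable[OF Tp(2), of 1]
    show "(\<lambda>s. lo ?e (Mx z) s + hi 1 (Mx z) s) \<in> borel_measurable borel" by measurable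
    have nn: "0 \<le> lo ?e (Mx z) s" "0 \<le> hi 1 (Mx z) s" for s
      by (rule lo_nonneg[OF Tp(2)] hi_nonneg[OF Tp(2)])+
    show "0 \<le> lo ?e (Mx z) s + hi 1 (Mx z) s" for s using nn by simp
    have ms: "sets (U z) = sets borel" by (rule sets_U[OF z])
    have [measurable]: "g \<in> borel_measurable (U z)" if "g \<in> borel_measurable borel" for g :: "real \<Rightarrow> real"
      using that measurable_cong_sets[OF ms refl, of "borel :: real measure"] by simp
    have "(\<integral>\<^sup>+s. ennreal (lo ?e (Mx z) s + hi 1 (Mx z) s) \<partial>U z) =
        (\<integral>\<^sup>+s. ennreal (lo ?e (Mx z) s) \<partial>U z) + (\<integral>\<^sup>+s. ennreal (hi 1 (Mx z) s) \<partial>U z)"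
      using nn by (simp add: nn_integral_add)
    also have "\<dots> \<le> ennreal (?G ?e) + ennreal (?G 1)"
      using assms by (intro add_mono lo_integral hi_integral z Tp) auto
    also have "\<dots> = ennreal ((?G ?e + ?G 1) * 1)"
      using G by (simp only: mult_1_right) (intro ennreal_plus[symmetric], auto)
    finally show "(\<integral>\<^sup>+s. ennreal (lo ?e (Mx z) s + hi 1 (Mx z) s) \<partial>U z) \<le> ennreal ((?G ?e + ?G 1) * 1)" .
    have q_le: "q z s \<le> A\<^sub>f * A\<^sub>v * (s / Mx z) powr ?e * q z (Mx z)" if "0 < s" "s \<le> Mx z" for s
      using that by (intro q_lower z Mx_I)
    have "q z (T z) \<le> A\<^sub>f * A\<^sub>v * (T z / Mx z) powr ?e * q z (Mx z)"
      using Tp by (intro q_le) auto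
    also have "\<dots> \<le> A\<^sub>f * A\<^sub>v * 1 * q z (Mx z)"
      using Tp assms pos q_pos[OF z Mx_I[OF z]]
      by (intro mult_right_mono mult_left_mono powr_le1) (auto simp: divide_le_eq)
    finally have "h z (T z) * q z (T z) \<le> h z (T z) * (A\<^sub>f * A\<^sub>v * 1 * q z (Mx z))"
      using h_nonneg[OF z T_I[OF z]] by (rule mult_left_mono)
    then show "h z (T z) * q z (T z) \<le> A\<^sub>f * A\<^sub>v * (h z (T z) * q z (Mx z) * 1)" by (simp add: mult_ac)
    fix s assume s: "T z < s" "s \<in> I"
    have p: "0 < s" "0 < f s" "0 < q z s" "0 < q z (Mx z)" "0 \<le> h z (T z)"
      using I_pos[OF s(2)] f_pos q_pos[OF z] s h_nonneg[OF z] T_I[OF z] Mx_I[OF z] by auto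
    let ?C = "A\<^sub>F * (A\<^sub>f * A\<^sub>v) + A\<^sub>F * (A\<^sub>s * A\<^sub>f * A\<^sub>v)"
    let ?k = "h z (T z) * q z (Mx z)"
    show "F z s \<le> ?C * ?k * (lo ?e (Mx z) s + hi 1 (Mx z) s)"
    proof (cases "s \<le> Mx z")
      case True
      have "h z s * q z s \<le> h z (T z) * (A\<^sub>f * A\<^sub>v * (s / Mx z) powr ?e * q z (Mx z))"
        using p s True by (intro mult_mono h_antimono_T q_le z) auto
      then have "A\<^sub>F * (h z s * q z s) / f s \<le> A\<^sub>F * (h z (T z) * (A\<^sub>f * A\<^sub>v * (s / Mx z) powr ?e * q z (Mx z))) / f s"
        using p pos by (intro divide_right_mono mult_left_mono) auto
      then have "F z s \<le> A\<^sub>F * (A\<^sub>f * A\<^sub>v) * ?k * lo ?e (Mx z) s"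
        using F_far_q[OF z _ s(2)] s True p by (simp add: lo_def mult_ac)
      also have "\<dots> \<le> ?C * ?k * (lo ?e (Mx z) s + hi 1 (Mx z) s)"
        using p pos nn by (intro mult_mono) auto
      finally show ?thesis .
    next
      case False
      then have "F z s \<le> A\<^sub>F * (A\<^sub>s * A\<^sub>f * A\<^sub>v) * ?k * hi 1 (Mx z) s"
        by (intro far_upper z s) auto
      also have "\<dots> \<le> ?C * ?k * (lo ?e (Mx z) s + hi 1 (Mx z) s)"
        using p pos nn by (intro mult_mono) auto
      finally show ?thesis .
    qed
  qed (use pos hq_nonneg T_I Mx_I in \<open>auto intro!: add_pos_pos\<close>)
  then show ?thesis by simp
qed

subsection \<open>Lower bounds\<close>

lemma f_block: "0 < t \<Longrightarrow> t / K < s \<Longrightarrow> s \<le> t \<Longrightarrow> f t / (2 * K) \<le> f s"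
proof -
  assume t: "0 < t" "t / K < s" "s \<le> t"
  have "0 < t / K" using t K by simp
  then have s: "0 < s" using t by linarith
  have "f t \<le> 2 * (t / s) * f s" using f_lin[OF s t(3)] .
  also have "\<dots> \<le> 2 * K * f s"
    using t K s f_pos[OF s] by (intro mult_right_mono) (auto simp: field_simps)
  finally show ?thesis using K by (simp add: field_simps)
qed

lemma single_block_lower:
  assumes "z \<in> Z" and "t \<in> I" and "0 \<le> M" and "\<And>s. t / K < s \<Longrightarrow> s \<le> t \<Longrightarrow> M \<le> F z s * f s"
  shows "ennreal (\<kappa> * M) \<le> green z"
  using block_lower[OF assms(1,2,3), of 0 "F z"] assms by simp

lemma jump_lower: "z \<in> Z \<Longrightarrow> ennreal (\<kappa> * (a\<^sub>F / (2 * K * K)) * jump z) \<le> green z"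
proof -
  assume z: "z \<in> Z"
  define m where "m = min (T z) (\<tau> z)"
  have m: "m \<in> I" "m \<le> T z" using z T_I \<tau>_I by (auto simp: m_def min_def)
  have p: "0 < m" "0 < f m" "0 < v z (T z) * W z" "0 \<le> h z m"
    using m I_pos f_pos v_pos[OF z T_I[OF z]] W_pos[OF z] h_nonneg[OF z m(1)] by auto
  have "ennreal (\<kappa> * (a\<^sub>F / (2 * K * K) * jump z)) \<le> green z"
  proof (rule single_block_lower[OF z m(1)])
    show "0 \<le> a\<^sub>F / (2 * K * K) * jump z" using pos K jump_nonneg[OF z] by simp
    fix s assume s: "m / K < s" "s \<le> m"
    have "0 < m / K" using p K by simp
    then have s0: "0 < s" using s by linarith
    have "h z m * (m / K) * (f m / (2 * K)) \<le> h z s * s * f s"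
      using p s s0 K h_nonneg[OF z I_down[OF m(1) s0 s(2)]]
      by (intro mult_mono h_antimono z m f_block) auto
    then have "a\<^sub>F * (h z m * (m / K) * (f m / (2 * K))) / (v z (T z) * W z) \<le> a\<^sub>F * (h z s * s * f s) / (v z (T z) * W z)"
      using p pos by (intro divide_right_mono mult_left_mono) auto
    also have "\<dots> = a\<^sub>F * h z s * (s / (v z (T z) * W z)) * f s" by simp
    also have "\<dots> \<le> F z s * f s"
      using s m s0 by (intro mult_right_mono F_jump_lower z) (auto intro: less_imp_le f_pos)
    finally show "a\<^sub>F / (2 * K * K) * jump z \<le> F z s * f s"
      unfolding jump_eq[OF z] m_def[symmetric] by (simp add: mult_ac)
  qed
  then show ?thesis by (simp add: mult.assoc)
qed

text \<open>
  This single estimate covers blocks on both sides of \<open>T\<close>: below \<open>T\<close> a block reaches down to \<open>T / K\<close> at most,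
  where the kernel is still comparable to its on-diagonal value.
\<close>

lemma q_block:
  assumes z: "z \<in> Z" and t: "t \<in> I" "T z \<le> t" and s: "t / K < s" "s \<le> t"
  shows "a\<^sub>F / (2 * K * A\<^sub>v) * (h z t * q z t) \<le> F z s * f s"
proof -
  have t0: "0 < t" using I_pos[OF t(1)] .
  have "0 < t / K" using t0 K by simp
  then have s0: "0 < s" using s by linarith
  have sI: "s \<in> I" using I_down[OF t(1) s0 s(2)] .
  have v_le: "v z u \<le> A\<^sub>v * v z t" if "0 < u" "u \<le> t" for u
  proof -
    have "1 * v z u \<le> (t / u) powr \<eta>\<^sub>1 * v z u"
      using that exps v_pos[OF z I_down[OF t(1) that]] by (intro mult_right_mono ge_one_powr_ge_zero) auto
    then show ?thesis using v_lower[OF z that t(1)] by simp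
  qed
  have hs: "h z t \<le> h z s" "0 \<le> h z t" "0 \<le> h z s"
    using h_antimono[OF z s0 s(2) t(1)] h_nonneg[OF z] t(1) sI by auto
  have vp: "0 < v z t" "0 < v z s" "0 < v z (T z)" using v_pos[OF z] t sI T_I[OF z] by auto
  have low: "a\<^sub>F * h z t / (A\<^sub>v * v z t) \<le> F z s"
  proof (cases "T z \<le> s")
    case True
    have "a\<^sub>F * h z t / (A\<^sub>v * v z t) \<le> a\<^sub>F * h z s / v z s"
      using v_le[OF s0 s(2)] hs vp pos by (intro frac_le mult_left_mono) auto
    then show ?thesis using F_far_lower[OF z True sI] by simp
  next
    case False
    have "a\<^sub>F * h z t / (A\<^sub>v * v z t) \<le> a\<^sub>F * h z s / v z (T z)"
      using v_le[OF T_pos[OF z] t(2)] hs vp pos by (intro frac_le mult_left_mono) auto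
    moreover have "T z / K \<le> s" using t(2) s(1) K by (meson divide_right_mono less_imp_le less_trans zero_less_one order_trans)
    ultimately show ?thesis using F_diagonal_lower[OF z, of s] False by simp
  qed
  have "a\<^sub>F * h z t / (A\<^sub>v * v z t) * (f t / (2 * K)) \<le> F z s * f s"
    using low f_block[OF t0 s] hs vp pos f_pos[OF t0] K
    by (intro mult_mono) (auto intro!: divide_nonneg_nonneg mult_nonneg_nonneg order_trans[OF _ low])
  then show ?thesis by (simp add: q_def mult_ac)
qed

text \<open>
  The case \<open>t = T\<close> gives the lower bound in the transient regime, \<open>t = T \<or> \<tau>\<close> that in the recurrent one, and
  the largest relevant time in a bounded domain is used to absorb the part of the integral beyond \<open>I\<close>.
\<close>

lemma q_lower_bound:
  assumes "z \<in> Z" and "t \<in> I" and "T z \<le> t"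
  shows "ennreal (\<kappa> * (a\<^sub>F / (2 * K * A\<^sub>v)) * (h z t * q z t)) \<le> green z"
proof -
  have "ennreal (\<kappa> * (a\<^sub>F / (2 * K * A\<^sub>v) * (h z t * q z t))) \<le> green z"
    by (rule single_block_lower) (use assms pos K hq_nonneg[of z t t] q_block in auto)
  then show ?thesis by (simp add: mult.assoc)
qed

lemma h_T_le_Mx: "z \<in> Z \<Longrightarrow> h z (T z) \<le> max 1 A\<^sub>l * h z (Mx z)"
proof (cases "T z \<le> \<tau> z")
  case True
  assume z: "z \<in> Z"
  have "h z (T z) \<le> A\<^sub>l * h z (\<tau> z)" by (rule h_flat[OF z True])
  also have "\<dots> \<le> max 1 A\<^sub>l * h z (\<tau> z)" using h_nonneg[OF z \<tau>_I[OF z]] by (intro mult_right_mono) auto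
  finally show ?thesis using True by (simp add: max_def)
next
  case False
  assume z: "z \<in> Z"
  then show ?thesis
    using False h_nonneg[OF z T_I[OF z]] mult_right_mono[of 1 "max 1 A\<^sub>l" "h z (T z)"] by (simp add: max_def split: if_splits)
qed

text \<open>
  Every \<open>K\<close>-adic block between \<open>T\<close> and \<open>T \<or> \<tau>\<close> contributes at least a constant multiple of the block at
  \<open>T\<close>, by flatness of \<open>h\<close> and of \<open>f/v\<close>.
\<close>

lemma lower_critical:
  assumes "\<eta>\<^sub>2 \<le> \<beta>"
  shows "\<exists>c>0. \<forall>z\<in>Z. ennreal (c * ((h z (T z) * q z (T z)) * (1 + ln (Mx z / T z)))) \<le> green z"
proof -
  define c where "c = a\<^sub>F / (2 * K * A\<^sub>v) / (max 1 A\<^sub>l * (A\<^sub>f * A\<^sub>v))"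
  have c: "0 < c" using pos K by (simp add: c_def)
  have lK: "0 < ln K" using K by simp
  show ?thesis
  proof (intro exI[of _ "\<kappa> * c / (1 + ln K)"] conjI ballI)
    show "0 < \<kappa> * c / (1 + ln K)" using \<kappa> c lK by simp
    fix z assume z: "z \<in> Z"
    note Tp = T_pos[OF z] Mx_pos[OF z]
    \<comment> \<open>the number of full blocks above \<open>T\<close>; together with the block ending at \<open>T\<close> there are \<open>n + 1\<close>\<close>
    define n where "n = nat \<lfloor>log K (Mx z / T z)\<rfloor>"
    have MT: "1 \<le> Mx z / T z" using Tp by (simp add: le_divide_eq)
    then have log0: "0 \<le> log K (Mx z / T z)" using K by simp
    have n: "real n \<le> log K (Mx z / T z)" "log K (Mx z / T z) \<le> real n + 1"
      unfolding n_def using log0 by linarith+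
    let ?k = "h z (T z) * q z (T z)"
    have k: "0 \<le> ?k" by (rule hq_nonneg[OF z T_I[OF z] T_I[OF z]])
    have "K powr real n \<le> K powr (log K (Mx z / T z))" using K n by simp
    also have "\<dots> = Mx z / T z" using K MT by (intro powr_log_cancel) auto
    finally have "K ^ n \<le> Mx z / T z" using K by (simp add: powr_realpow)
    then have top: "T z * K ^ n \<le> Mx z" using Tp by (simp add: field_simps)
    have tj: "T z * K ^ j \<in> I" "T z \<le> T z * K ^ j" "T z * K ^ j \<le> Mx z" if "j \<le> n" for j
    proof -
      have "T z * K ^ j \<le> T z * K ^ n" using that K Tp by (simp add: power_increasing)
      then show 1: "T z * K ^ j \<le> Mx z" using top by simp
      show "T z * K ^ j \<in> I" by (rule I_down[OF Mx_I[OF z] _ 1]) (use Tp K in simp)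
      show "T z \<le> T z * K ^ j" using Tp K by simp
    qed
    have "ennreal (\<kappa> * (c * ?k) * real (Suc n)) \<le> green z"
    proof (rule block_lower[OF z T_I[OF z]])
      show "0 \<le> c * ?k" using c k by simp
      show "T z * K ^ n \<in> I" using tj by simp
      fix j s assume j: "j \<le> n" and s: "T z * K ^ j / K < s" "s \<le> T z * K ^ j"
      let ?t = "T z * K ^ j"
      note tj = tj[OF j]
      have hT: "h z (T z) \<le> max 1 A\<^sub>l * h z ?t"
      proof -
        have "h z (Mx z) \<le> h z ?t" using tj Mx_I[OF z] Tp K by (intro h_antimono z) auto
        then show ?thesis using h_T_le_Mx[OF z] by (meson max.cobounded1 mult_left_mono order_trans zero_le_one)
      qed
      have "q z (T z) \<le> A\<^sub>f * A\<^sub>v * (T z / ?t) powr (\<beta> - \<eta>\<^sub>2) * q z ?t"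
        using tj Tp by (intro q_lower z) auto
      also have "\<dots> \<le> A\<^sub>f * A\<^sub>v * 1 * q z ?t"
        using Tp K assms pos q_pos[OF z tj(1)] tj
        by (intro mult_right_mono mult_left_mono powr_le1) (auto simp: divide_le_eq)
      finally have "?k \<le> (max 1 A\<^sub>l * h z ?t) * (A\<^sub>f * A\<^sub>v * q z ?t)"
        using hT h_nonneg[OF z tj(1)] h_nonneg[OF z T_I[OF z]] q_pos[OF z T_I[OF z]]
        by (intro mult_mono) auto
      then have "c * ?k \<le> c * ((max 1 A\<^sub>l * h z ?t) * (A\<^sub>f * A\<^sub>v * q z ?t))"
        using c by (intro mult_left_mono) auto
      also have "\<dots> = a\<^sub>F / (2 * K * A\<^sub>v) * (h z ?t * q z ?t)"
      proof -
        have "max 1 A\<^sub>l * (A\<^sub>f * A\<^sub>v) \<noteq> 0" using pos by auto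
        then show ?thesis unfolding c_def by (simp add: field_simps)
      qed
      also have "\<dots> \<le> F z s * f s" by (rule q_block[OF z tj(1,2) s])
      finally show "c * ?k \<le> F z s * f s" .
    qed
    moreover have "\<kappa> * c / (1 + ln K) * (?k * (1 + ln (Mx z / T z))) \<le> \<kappa> * (c * ?k) * real (Suc n)"
    proof -
      have "ln (Mx z / T z) \<le> (real n + 1) * ln K" using n(2) lK by (simp add: log_def field_simps)
      then have "1 + ln (Mx z / T z) \<le> real (Suc n) * (1 + ln K)" by (simp add: algebra_simps)
      then have "(1 + ln (Mx z / T z)) / (1 + ln K) \<le> real (Suc n)" using lK by (simp add: field_simps)
      then have "\<kappa> * c * ?k * ((1 + ln (Mx z / T z)) / (1 + ln K)) \<le> \<kappa> * c * ?k * real (Suc n)"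
        using \<kappa> c k by (intro mult_left_mono) auto
      then show ?thesis by (simp add: mult_ac)
    qed
    ultimately show "ennreal (\<kappa> * c / (1 + ln K) * (?k * (1 + ln (Mx z / T z)))) \<le> green z"
      by (meson ennreal_leI order_trans)
  qed
qed

lemma lower_recurrent: "\<exists>c>0. \<forall>z\<in>Z. ennreal (c * (h z (T z) * q z (Mx z))) \<le> green z"
proof (intro exI[of _ "\<kappa> * (a\<^sub>F / (2 * K * A\<^sub>v)) / max 1 A\<^sub>l"] conjI ballI)
  show "0 < \<kappa> * (a\<^sub>F / (2 * K * A\<^sub>v)) / max 1 A\<^sub>l" using \<kappa> pos K by simp
  fix z assume z: "z \<in> Z"
  have "h z (T z) / max 1 A\<^sub>l \<le> h z (Mx z)" using h_T_le_Mx[OF z] by (simp add: field_simps)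
  then have "\<kappa> * (a\<^sub>F / (2 * K * A\<^sub>v)) * (h z (T z) / max 1 A\<^sub>l * q z (Mx z)) \<le>
      \<kappa> * (a\<^sub>F / (2 * K * A\<^sub>v)) * (h z (Mx z) * q z (Mx z))"
    using \<kappa> pos K q_pos[OF z Mx_I[OF z]] by (intro mult_left_mono mult_right_mono) auto
  then have "ennreal (\<kappa> * (a\<^sub>F / (2 * K * A\<^sub>v)) / max 1 A\<^sub>l * (h z (T z) * q z (Mx z))) \<le>
      ennreal (\<kappa> * (a\<^sub>F / (2 * K * A\<^sub>v)) * (h z (Mx z) * q z (Mx z)))"
    by (intro ennreal_leI) (simp add: mult_ac)
  also have "\<dots> \<le> green z" by (rule q_lower_bound[OF z Mx_I[OF z]]) simp
  finally show "ennreal (\<kappa> * (a\<^sub>F / (2 * K * A\<^sub>v)) / max 1 A\<^sub>l * (h z (T z) * q z (Mx z))) \<le> green z" .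
qed

subsection \<open>Two-sided estimates\<close>

definition sharp :: "('z \<Rightarrow> real) \<Rightarrow> bool" where
  "sharp g \<longleftrightarrow> ecomparable_on Z green (\<lambda>z. jump z + h z (T z) * g z)"

lemma sharpI:
  assumes nn: "\<And>z. z \<in> Z \<Longrightarrow> 0 \<le> g z"
    and "\<exists>c>0. \<forall>z\<in>Z. ennreal (c * (h z (T z) * g z)) \<le> green z"
    and "\<exists>C>0. \<forall>z\<in>Z. green z \<le> ennreal (C * (jump z + h z (T z) * g z))"
  shows "sharp g"
proof -
  obtain c where c: "0 < c" "\<And>z. z \<in> Z \<Longrightarrow> ennreal (c * (h z (T z) * g z)) \<le> green z"
    using assms by blast
  define a where "a = \<kappa> * (a\<^sub>F / (2 * K * K))"
  have a: "0 < a" using \<kappa> pos K by (simp add: a_def)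
  have "ennreal (min a c / 2 * (jump z + h z (T z) * g z)) \<le> green z" if z: "z \<in> Z" for z
  proof -
    have nn': "0 \<le> jump z" "0 \<le> h z (T z) * g z" using nn[OF z] jump_nonneg[OF z] h_nonneg[OF z T_I[OF z]] by auto
    have "min a c / 2 * (jump z + h z (T z) * g z) \<le> max (a * jump z) (c * (h z (T z) * g z))"
      using mult_right_mono[of "min a c" a "jump z"] mult_right_mono[of "min a c" c "h z (T z) * g z"] nn'
      by (simp add: algebra_simps max_def)
    then consider "min a c / 2 * (jump z + h z (T z) * g z) \<le> a * jump z"
      | "min a c / 2 * (jump z + h z (T z) * g z) \<le> c * (h z (T z) * g z)"
      by (auto simp: le_max_iff_disj)
    then show ?thesis
    proof cases
      case 1
      have "ennreal (a * jump z) \<le> green z" using jump_lower[OF z] by (simp only: a_def)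
      then show ?thesis using ennreal_leI[OF 1] by (rule order_trans[rotated])
    next
      case 2
      show ?thesis using ennreal_leI[OF 2] c(2)[OF z] by (rule order_trans)
    qed
  qed
  then have "\<forall>z\<in>Z. ennreal (min a c / 2 * (jump z + h z (T z) * g z)) \<le> green z" by blast
  moreover have "0 < min a c / 2" using a c(1) by simp
  moreover obtain C where "0 < C" "\<forall>z\<in>Z. green z \<le> ennreal (C * (jump z + h z (T z) * g z))"
    using assms(3) by blast
  ultimately show ?thesis
    unfolding sharp_def ecomparable_on_def by blast
qed

lemma sharp_transient: "b < \<eta>\<^sub>1 \<Longrightarrow> sharp (\<lambda>z. q z (T z))"
proof (rule sharpI)
  show "\<exists>c>0. \<forall>z\<in>Z. ennreal (c * (h z (T z) * q z (T z))) \<le> green z"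
    using q_lower_bound[OF _ T_I order_refl] \<kappa> pos K
    by (intro exI[of _ "\<kappa> * (a\<^sub>F / (2 * K * A\<^sub>v))"]) auto
qed (use upper_transient q_pos T_I in \<open>auto intro: less_imp_le\<close>)

lemma sharp_critical:
  assumes "b \<le> \<eta>\<^sub>1" and "\<eta>\<^sub>2 \<le> \<beta>"
  shows "sharp (\<lambda>z. q z (T z) * (1 + ln (Mx z / T z)))"
proof (rule sharpI)
  fix z assume z: "z \<in> Z"
  have "0 \<le> ln (Mx z / T z)" using T_pos[OF z] by (intro ln_ge_zero) (auto simp: le_divide_eq)
  then show "0 \<le> q z (T z) * (1 + ln (Mx z / T z))" using q_pos[OF z T_I[OF z]] by simp
qed (use upper_critical[OF assms] lower_critical[OF assms(2)] in \<open>simp_all add: mult.assoc\<close>)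

lemma sharp_recurrent: "\<eta>\<^sub>2 < \<beta> \<Longrightarrow> sharp (\<lambda>z. q z (Mx z))"
  by (rule sharpI[OF _ lower_recurrent upper_recurrent]) (use q_pos Mx_I in \<open>auto intro: less_imp_le\<close>)

lemma bracket_nonneg: "z \<in> Z \<Longrightarrow> 0 \<le> bracket z"
proof -
  assume z: "z \<in> Z"
  have m: "min (T z) (\<tau> z) \<in> I" using z T_I \<tau>_I by (simp add: min_def)
  show ?thesis
    unfolding bracket_def
    using h_nonneg[OF z m] T_pos[OF z] \<tau>_pos[OF z] f_pos[OF T_pos[OF z]] f_pos[OF \<tau>_pos[OF z]]
    by (intro mult_nonneg_nonneg) simp_all
qed

lemma bracket_eq: "z \<in> Z \<Longrightarrow> T z \<le> \<tau> z \<Longrightarrow> bracket z = h z (T z)"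
  unfolding bracket_def using tf_mono[of "T z" "\<tau> z"] T_pos[of z] f_pos[of "T z"]
  by (simp add: min_def)

text \<open>
  The exponent condition on the decay of \<open>h\<close> says that \<open>h\<close> falls off faster than the energy scale
  \<open>t f(t)\<close> grows, so that the bracket, which decays like the reciprocal of that scale, wins.
\<close>

lemma h_le_bracket: "\<exists>C>0. \<forall>z\<in>Z. h z (T z) \<le> C * bracket z"
proof (intro exI[of _ "1 + A\<^sub>s * (1 + A\<^sub>f)"] conjI ballI)
  show "0 < 1 + A\<^sub>s * (1 + A\<^sub>f)" using pos by (simp add: add_pos_pos)
  fix z assume z: "z \<in> Z"
  have br: "0 \<le> bracket z" by (rule bracket_nonneg[OF z])
  show "h z (T z) \<le> (1 + A\<^sub>s * (1 + A\<^sub>f)) * bracket z"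
  proof (cases "T z \<le> \<tau> z")
    case True
    have "1 * bracket z \<le> (1 + A\<^sub>s * (1 + A\<^sub>f)) * bracket z"
      using br pos by (intro mult_right_mono) auto
    then show ?thesis using bracket_eq[OF z True] by simp
  next
    case False
    let ?r = "\<tau> z / T z"
    have p: "0 < T z" "0 < \<tau> z" "0 < f (T z)" "0 < f (\<tau> z)" "0 < ?r" "?r \<le> 1" "0 \<le> h z (\<tau> z)"
      using T_pos[OF z] \<tau>_pos[OF z] f_pos False h_nonneg[OF z \<tau>_I[OF z]] by auto
    have "f (T z) \<le> A\<^sub>f * (T z / \<tau> z) powr b * f (\<tau> z)"
      using False p by (intro f_upper T_I z) auto
    also have "(T z / \<tau> z) powr b = 1 / ?r powr b"
      using powr_ratio_flip[of "\<tau> z" "T z" b] p by (simp add: powr_minus_divide)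
    finally have fb: "?r powr b \<le> A\<^sub>f * (f (\<tau> z) / f (T z))" using p by (simp add: field_simps)
    have "?r powr \<gamma>\<^sub>s \<le> ?r powr (1 + b)" using p exps by (intro powr_mono') auto
    also have "\<dots> = ?r * ?r powr b" using p by (simp add: powr_add)
    also have "\<dots> \<le> ?r * (A\<^sub>f * (f (\<tau> z) / f (T z)))" using fb p by (intro mult_left_mono) auto
    also have "\<dots> = A\<^sub>f * (\<tau> z * f (\<tau> z) / (T z * f (T z)))" by simp
    finally have le: "?r powr \<gamma>\<^sub>s \<le> A\<^sub>f * (\<tau> z * f (\<tau> z) / (T z * f (T z)))" .
    have le1: "?r powr \<gamma>\<^sub>s \<le> 1" using p exps by (intro powr_le1) auto
    have "?r powr \<gamma>\<^sub>s \<le> (1 + A\<^sub>f) * min 1 x" if "?r powr \<gamma>\<^sub>s \<le> A\<^sub>f * x" "0 \<le> x" for x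
      using that le1 pos(1) by (cases "x \<le> 1") (auto simp: min_def algebra_simps)
    from this[OF le] have "?r powr \<gamma>\<^sub>s \<le> (1 + A\<^sub>f) * min 1 (\<tau> z * f (\<tau> z) / (T z * f (T z)))"
      using p by simp
    then have "A\<^sub>s * ?r powr \<gamma>\<^sub>s * h z (\<tau> z) \<le>
        A\<^sub>s * ((1 + A\<^sub>f) * min 1 (\<tau> z * f (\<tau> z) / (T z * f (T z)))) * h z (\<tau> z)"
      using pos p by (intro mult_right_mono mult_left_mono) auto
    then have "h z (T z) \<le> A\<^sub>s * (1 + A\<^sub>f) * bracket z"
      using h_decay[OF z order_refl _ T_I[OF z]] False by (simp add: bracket_def min_def mult_ac)
    also have "\<dots> \<le> (1 + A\<^sub>s * (1 + A\<^sub>f)) * bracket z" using br by (intro mult_right_mono) auto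
    finally show ?thesis .
  qed
qed

end

section \<open>Scale functions and volumes\<close>

text \<open>
  A scale function may jump, so the generalized inverse is an inverse on one side only; on the other
  side \<open>\<Phi>(\<Phi>\<^sup>-\<^sup>1(t))\<close> is comparable to \<open>t\<close>, by doubling.
\<close>

locale scale_function =
  fixes \<Phi> :: "real \<Rightarrow> real" and a b :: real
  assumes strict: "strict_mono_on {0..} \<Phi>" and nonneg: "\<And>r. 0 \<le> r \<Longrightarrow> 0 \<le> \<Phi> r"
    and scaling: "weak_scaling \<Phi> a b"
begin

lemma less_iff: "0 \<le> r \<Longrightarrow> 0 \<le> s \<Longrightarrow> \<Phi> r < \<Phi> s \<longleftrightarrow> r < s"
  and le_iff: "0 \<le> r \<Longrightarrow> 0 \<le> s \<Longrightarrow> \<Phi> r \<le> \<Phi> s \<longleftrightarrow> r \<le> s"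
  using strict by (auto simp: strict_mono_on_less strict_mono_on_less_eq)

lemma \<Phi>_pos: "0 < r \<Longrightarrow> 0 < \<Phi> r"
  using less_iff[of 0 r] nonneg[of 0] by simp

lemma ab: "0 < a" "0 < b"
  using scaling by (auto simp: weak_scaling_def)

lemma ratio_bounds:
  obtains c C where "0 < c" "0 < C"
    "\<And>r R. 0 < r \<Longrightarrow> r \<le> R \<Longrightarrow> c * (R / r) powr a \<le> \<Phi> R / \<Phi> r \<and> \<Phi> R / \<Phi> r \<le> C * (R / r) powr b"
  using scaling unfolding weak_scaling_def by blast

lemma unbounded: "\<exists>r\<ge>0. t \<le> \<Phi> r"
proof -
  obtain c C where c: "0 < c" "\<And>r R. 0 < r \<Longrightarrow> r \<le> R \<Longrightarrow> c * (R / r) powr a \<le> \<Phi> R / \<Phi> r"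
    using ratio_bounds by metis
  have p: "0 < c * \<Phi> 1" using c \<Phi>_pos by simp
  define r where "r = (max 1 (t / (c * \<Phi> 1))) powr (1 / a)"
  have "1 \<le> r" unfolding r_def using ab by (intro ge_one_powr_ge_zero) auto
  then have "c * r powr a \<le> \<Phi> r / \<Phi> 1" using c(2)[of 1 r] by simp
  then have "c * \<Phi> 1 * r powr a \<le> \<Phi> r" using \<Phi>_pos[of 1] by (simp add: field_simps)
  moreover have "r powr a = max 1 (t / (c * \<Phi> 1))" unfolding r_def using ab by (simp add: powr_powr)
  moreover have "t \<le> c * \<Phi> 1 * max 1 (t / (c * \<Phi> 1))"
    by (metis max.cobounded2 mult.commute p pos_divide_le_eq)
  ultimately have "t \<le> \<Phi> r" by simp
  then show ?thesis using \<open>1 \<le> r\<close> by (intro exI[of _ r]) auto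
qed

lemma small: "0 < t \<Longrightarrow> \<exists>r>0. \<Phi> r < t"
proof -
  assume t: "0 < t"
  obtain c C where c: "0 < c" "\<And>r R. 0 < r \<Longrightarrow> r \<le> R \<Longrightarrow> c * (R / r) powr a \<le> \<Phi> R / \<Phi> r"
    using ratio_bounds by metis
  define u where "u = max 1 (2 * \<Phi> 1 / (c * t))"
  define r where "r = 1 / u powr (1 / a)"
  have u: "1 \<le> u" by (simp add: u_def)
  then have r: "0 < r" "r \<le> 1" unfolding r_def using ab by (auto simp: divide_le_eq intro!: ge_one_powr_ge_zero)
  have "(1 / r) powr a = u" unfolding r_def using ab u by (simp add: powr_powr)
  then have "c * u \<le> \<Phi> 1 / \<Phi> r" using c(2)[of r 1] r by simp
  then have "\<Phi> r * (c * u) \<le> \<Phi> 1" using \<Phi>_pos[OF r(1)] by (simp add: field_simps)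
  moreover have "2 * \<Phi> 1 / (c * t) \<le> u" by (simp add: u_def)
  then have "2 * \<Phi> 1 \<le> c * u * t" using c t by (simp add: field_simps)
  ultimately have "2 * (\<Phi> r * (c * u)) \<le> t * (c * u)" by (simp add: mult_ac)
  then have "2 * \<Phi> r \<le> t" using c u by (simp add: mult.assoc[symmetric])
  then have "\<Phi> r < t" using \<Phi>_pos[OF r(1)] by simp
  then show ?thesis using r by blast
qed

abbreviation g :: "real \<Rightarrow> real" where "g \<equiv> gen_inv \<Phi>"

lemma gen_inv_le: "0 \<le> r \<Longrightarrow> t \<le> \<Phi> r \<Longrightarrow> g t \<le> r"
  unfolding gen_inv_def by (rule cInf_lower) (auto intro!: bdd_belowI[of _ 0])

lemma gen_inv_ge: "0 \<le> r \<Longrightarrow> \<Phi> r < t \<Longrightarrow> r \<le> g t"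
  unfolding gen_inv_def
proof (rule cInf_greatest)
  show "{r. 0 \<le> r \<and> t \<le> \<Phi> r} \<noteq> {}" using unbounded[of t] by auto
  fix s assume "0 \<le> r" "\<Phi> r < t" "s \<in> {r. 0 \<le> r \<and> t \<le> \<Phi> r}"
  then have "\<Phi> r < \<Phi> s" by auto
  then show "r \<le> s" using less_iff[of r s] \<open>0 \<le> r\<close> \<open>s \<in> _\<close> by auto
qed

lemma gen_inv_pos: "0 < t \<Longrightarrow> 0 < g t"
  using small[of t] gen_inv_ge by (meson less_imp_le less_le_trans)

lemma gen_inv_mono: "s \<le> t \<Longrightarrow> g s \<le> g t"
  unfolding gen_inv_def using unbounded[of t]
  by (intro cInf_superset_mono) (auto intro!: bdd_belowI[of _ 0])

lemma gen_inv_\<Phi>: "0 \<le> r \<Longrightarrow> g (\<Phi> r) = r"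
  by (rule gen_inv_left_inverse[OF strict])

lemma \<Phi>_gen_inv: "\<exists>C>0. \<forall>t>0. t / C \<le> \<Phi> (g t) \<and> \<Phi> (g t) \<le> C * t"
proof -
  obtain c C where C: "0 < C" "\<And>r R. 0 < r \<Longrightarrow> r \<le> R \<Longrightarrow> \<Phi> R / \<Phi> r \<le> C * (R / r) powr b"
    using ratio_bounds by metis
  define A where "A = C * 2 powr b"
  have A: "0 < A" using C by (simp add: A_def)
  have dbl: "\<Phi> (2 * r) \<le> A * \<Phi> r" if "0 < r" for r
    using C(2)[of r "2 * r"] that \<Phi>_pos[OF that] by (simp add: A_def field_simps)
  show ?thesis
  proof (intro exI[of _ A] conjI allI impI A)
    fix t :: real assume t: "0 < t"
    note p = gen_inv_pos[OF t]
    have "\<not> \<Phi> (2 * g t) < t" using gen_inv_ge[of "2 * g t" t] p by auto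
    then have "t \<le> A * \<Phi> (g t)" using dbl[OF p] by simp
    then show "t / A \<le> \<Phi> (g t)" using A by (simp add: field_simps)
    have "\<not> t \<le> \<Phi> (g t / 2)" using gen_inv_le[of "g t / 2" t] p by auto
    then have "A * \<Phi> (g t / 2) \<le> A * t" using A by simp
    then show "\<Phi> (g t) \<le> A * t" using dbl[of "g t / 2"] p by simp
  qed
qed

lemma gen_inv_ratio:
  "\<exists>C>0. \<forall>s t. 0 < s \<and> s \<le> t \<longrightarrow> (t / s) powr (1 / b) \<le> C * (g t / g s) \<and> g t / g s \<le> C * (t / s) powr (1 / a)"
proof -
  obtain c C where C: "0 < c" "0 < C" and sc: "\<And>r R. 0 < r \<Longrightarrow> r \<le> R \<Longrightarrow>
      c * (R / r) powr a \<le> \<Phi> R / \<Phi> r \<and> \<Phi> R / \<Phi> r \<le> C * (R / r) powr b"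
    using ratio_bounds by blast
  obtain A where A: "0 < A" and inv: "\<And>t. 0 < t \<Longrightarrow> t / A \<le> \<Phi> (g t) \<and> \<Phi> (g t) \<le> A * t"
    using \<Phi>_gen_inv by blast
  define B where "B = (A * A * C) powr (1 / b) + (A * A / c) powr (1 / a)"
  have B1: "(A * A * C) powr (1 / b) \<le> B" "(A * A / c) powr (1 / a) \<le> B" "0 < B"
    using A C by (auto simp: B_def add_pos_pos)
  show ?thesis
  proof (intro exI[of _ B] conjI allI impI B1; elim conjE)
    fix s t :: real assume st: "0 < s" "s \<le> t"
    then have t: "0 < t" by simp
    define R where "R = g t / g s"
    have gs: "0 < g s" "g s \<le> g t" using gen_inv_pos gen_inv_mono st by auto
    then have R: "1 \<le> R" by (simp add: R_def)
    have \<Phi>p: "0 < \<Phi> (g s)" "0 < \<Phi> (g t)" using \<Phi>_pos gs by auto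
    have rt: "\<Phi> (g t) / \<Phi> (g s) \<le> (A * t) / (s / A)" "(t / A) / (A * s) \<le> \<Phi> (g t) / \<Phi> (g s)"
      using inv[OF st(1)] inv[OF t] A st t \<Phi>p by (intro frac_le; simp)+
    have "t / s \<le> A * A * C * R powr b"
    proof -
      have "(t / A) / (A * s) \<le> C * R powr b"
        using order_trans[OF rt(2)] sc[OF gs] unfolding R_def by blast
      then show ?thesis using A st by (simp add: field_simps)
    qed
    then have "(t / s) powr (1 / b) \<le> (A * A * C * R powr b) powr (1 / b)"
      using st t ab by (intro powr_mono2) auto
    also have "\<dots> = (A * A * C) powr (1 / b) * R"
      using A C ab R by (simp add: powr_mult powr_powr)
    also have "\<dots> \<le> B * R" using B1 R by (intro mult_right_mono) auto
    finally show "(t / s) powr (1 / b) \<le> B * (g t / g s)" by (simp add: R_def)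
    have "c * R powr a \<le> (A * t) / (s / A)" using order_trans[OF _ rt(1)] sc[OF gs] by (simp add: R_def)
    then have "R powr a \<le> (A * A / c) * (t / s)" using A C st by (simp add: field_simps)
    then have "(R powr a) powr (1 / a) \<le> ((A * A / c) * (t / s)) powr (1 / a)"
      using ab by (intro powr_mono2) auto
    also have "\<dots> = (A * A / c) powr (1 / a) * (t / s) powr (1 / a)"
      by (rule powr_mult)
    also have "\<dots> \<le> B * (t / s) powr (1 / a)" using B1 by (intro mult_right_mono) auto
    finally show "g t / g s \<le> B * (t / s) powr (1 / a)" using R ab gs by (simp add: R_def powr_powr)
  qed
qed

end

locale volume_space =
  fixes m :: "'a::metric_space measure" and R\<^sub>E :: ereal and d\<^sub>1 d\<^sub>2 :: real
  assumes proper: "proper_metric_measure_space m" and volume: "volume_scaling m R\<^sub>E d\<^sub>1 d\<^sub>2"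
begin

lemma sets_m [simp, measurable_cong]: "sets m = sets borel"
  using proper by (simp add: proper_metric_measure_space_def)

lemma emeasure_bounded: "bounded A \<Longrightarrow> emeasure m A < \<infinity>"
proof -
  assume "bounded A"
  then have "bounded (closure A)" by (rule bounded_closure)
  then have "compact (closure A)"
    using proper closed_closure[of A] unfolding proper_metric_measure_space_def by blast
  then have "emeasure m (closure A) < \<infinity>"
    using proper by (simp add: proper_metric_measure_space_def)
  moreover have "emeasure m A \<le> emeasure m (closure A)"
    by (intro emeasure_mono closure_subset) simp
  ultimately show ?thesis by (rule le_less_trans[rotated])
qed

lemma vol_pos: "0 < r \<Longrightarrow> 0 < vol m x r"
proof -
  assume r: "0 < r"
  have "0 < emeasure m (ball x r)"
    using proper r centre_in_ball[of x r] unfolding proper_metric_measure_space_def by (metis empty_iff open_ball)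
  then show ?thesis
    using emeasure_bounded[OF bounded_ball, of x r] unfolding vol_def
    by (simp add: measure_def enn2real_positive_iff less_top)
qed

lemma vol_subset: "ball x r \<subseteq> ball y s \<Longrightarrow> vol m x r \<le> vol m y s"
  unfolding vol_def measure_def
  using emeasure_bounded[OF bounded_ball, of y s] by (intro enn2real_mono emeasure_mono) auto

lemma vol_mono: "r \<le> s \<Longrightarrow> vol m x r \<le> vol m x s"
  by (intro vol_subset) auto

lemma d_pos: "0 < d\<^sub>1" "d\<^sub>1 \<le> d\<^sub>2" "0 < d\<^sub>2"
  using volume by (auto simp: volume_scaling_def)

text \<open>
  The parameter \<open>a\<close> in the volume condition allows any bounded range of radii, also beyond \<open>R\<^sub>E\<close>.
\<close>

lemma vol_scaling:
  assumes B: "B < \<infinity> \<or> R\<^sub>E = \<infinity>"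
  shows "\<exists>C\<ge>1. \<forall>x r R. 0 < r \<and> r \<le> R \<and> ereal R < B \<longrightarrow>
    (R / r) powr d\<^sub>1 * vol m x r \<le> C * vol m x R \<and> vol m x R \<le> C * (R / r) powr d\<^sub>2 * vol m x r"
proof -
  have RE: "0 < R\<^sub>E" using volume by (simp add: volume_scaling_def)
  obtain a :: real where a: "1 \<le> a" "\<And>R. 0 < R \<Longrightarrow> ereal R < B \<Longrightarrow> ereal R < ereal a * R\<^sub>E"
  proof (cases "R\<^sub>E = \<infinity>")
    case True
    then show ?thesis using that[of 1] by simp
  next
    case False
    then obtain e where e: "R\<^sub>E = ereal e" "0 < e" using RE by (cases R\<^sub>E) auto
    obtain B' where B': "B \<le> ereal B'" using B False by (cases B) auto
    show ?thesis
    proof (rule that[of "max 1 (B' / e)"])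
      fix R assume "0 < R" "ereal R < B"
      then have "R < B'" using B' by (meson ereal_less(2) less_ereal.simps(1) less_le_trans)
      also have "B' = B' / e * e" using e by simp
      also have "\<dots> \<le> max 1 (B' / e) * e" using e by (intro mult_right_mono) auto
      finally show "ereal R < ereal (max 1 (B' / e)) * R\<^sub>E"
        unfolding e(1) times_ereal.simps by simp
    qed simp
  qed
  obtain C where C: "1 \<le> C" and sc: "\<And>x r R. 0 < r \<Longrightarrow> r \<le> R \<Longrightarrow> ereal R < ereal a * R\<^sub>E \<Longrightarrow>
      inverse C * (R / r) powr d\<^sub>1 \<le> vol m x R / vol m x r \<and> vol m x R / vol m x r \<le> C * (R / r) powr d\<^sub>2"
    using volume a(1) unfolding volume_scaling_def by blast
  show ?thesis
  proof (intro exI[of _ C] conjI allI impI C; elim conjE)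
    fix x r R assume r: "0 < r" "r \<le> R" "ereal R < B"
    note s = sc[OF r(1,2) a(2)[OF _ r(3)], of x] and p = vol_pos[OF r(1), of x]
    show "(R / r) powr d\<^sub>1 * vol m x r \<le> C * vol m x R"
      using s r p C by (simp add: field_simps)
    show "vol m x R \<le> C * (R / r) powr d\<^sub>2 * vol m x r"
      using s r p C by (simp add: field_simps)
  qed
qed

lemma vol_bounded_region:
  assumes D: "bounded D" and r: "0 < r\<^sub>0"
  shows "\<exists>c>0. \<exists>C>0. \<forall>x\<in>D. \<forall>r. r\<^sub>0 \<le> r \<and> r \<le> r\<^sub>1 \<longrightarrow> c \<le> vol m x r \<and> vol m x r \<le> C"
proof (cases "D = {}")
  case False
  then obtain x\<^sub>0 where x0: "x\<^sub>0 \<in> D" by auto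
  define \<Delta> where "\<Delta> = diameter D + max r\<^sub>0 r\<^sub>1 + 1"
  have dO: "dist x x\<^sub>0 \<le> diameter D" if "x \<in> D" for x
    using diameter_bounded_bound[OF D that x0] .
  have "0 \<le> diameter D" using dO[OF x0] by simp
  then have \<Delta>: "0 < \<Delta>" "r\<^sub>0 \<le> \<Delta>" "r\<^sub>1 + diameter D \<le> \<Delta>" "diameter D + r\<^sub>0 \<le> \<Delta>"
    using r by (auto simp: \<Delta>_def)
  obtain C where C: "1 \<le> C" and sc: "\<And>x r R. 0 < r \<Longrightarrow> r \<le> R \<Longrightarrow> ereal R < ereal (\<Delta> + 1) \<Longrightarrow>
      vol m x R \<le> C * (R / r) powr d\<^sub>2 * vol m x r"
    using vol_scaling[of "ereal (\<Delta> + 1)"] by auto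
  define c where "c = vol m x\<^sub>0 r\<^sub>0 / (C * (\<Delta> / r\<^sub>0) powr d\<^sub>2)"
  have "c \<le> vol m x r' \<and> vol m x r' \<le> vol m x\<^sub>0 \<Delta>"
    if x: "x \<in> D" and r': "r\<^sub>0 \<le> r'" "r' \<le> r\<^sub>1" for x r'
  proof
    have "vol m x\<^sub>0 r\<^sub>0 \<le> vol m x \<Delta>"
    proof (rule vol_subset, rule subsetI)
      fix y assume "y \<in> ball x\<^sub>0 r\<^sub>0"
      then have "dist x y < diameter D + r\<^sub>0"
        using dO[OF x] dist_triangle[of x y x\<^sub>0] by simp
      then show "y \<in> ball x \<Delta>" using \<Delta> by simp
    qed
    also have "\<dots> \<le> C * (\<Delta> / r\<^sub>0) powr d\<^sub>2 * vol m x r\<^sub>0" using sc[of r\<^sub>0 \<Delta> x] r \<Delta> by simp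
    finally have "c \<le> vol m x r\<^sub>0" using C \<Delta> r by (simp add: c_def field_simps)
    also have "\<dots> \<le> vol m x r'" using r'(1) by (rule vol_mono)
    finally show "c \<le> vol m x r'" .
    show "vol m x r' \<le> vol m x\<^sub>0 \<Delta>"
    proof (rule vol_subset, rule subsetI)
      fix y assume "y \<in> ball x r'"
      then have "dist x\<^sub>0 y < diameter D + r\<^sub>1"
        using dO[OF x] dist_triangle[of x\<^sub>0 y x] r' by (simp add: dist_commute)
      then show "y \<in> ball x\<^sub>0 \<Delta>" using \<Delta> by simp
    qed
  qed
  moreover have "0 < c" using vol_pos[OF r] C \<Delta> r by (simp add: c_def)
  moreover have "0 < vol m x\<^sub>0 \<Delta>" using vol_pos \<Delta> by simp
  ultimately show ?thesis by blast
qed (auto intro: exI[of _ 1])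

end

section \<open>The geometric setting\<close>

text \<open>
  The form in which the heat kernel estimates are used: two-sided bounds for \<open>t < 2 \<Phi>(diam D)\<close>, which
  means for all times if \<open>D\<close> is unbounded, and exponential decay afterwards if \<open>D\<close> is bounded.
\<close>

locale green_setting = scale_function \<Phi> \<alpha>\<^sub>1 \<alpha>\<^sub>2 + volume_space m R\<^sub>E d\<^sub>1 d\<^sub>2
  for \<Phi> :: "real \<Rightarrow> real" and \<alpha>\<^sub>1 \<alpha>\<^sub>2 :: real and m :: "'a::metric_space measure"
    and R\<^sub>E :: ereal and d\<^sub>1 d\<^sub>2 :: real +
  fixes D :: "'a set" and P :: "'a option \<Rightarrow> 'w measure" and S :: "real \<Rightarrow> 'w \<Rightarrow> real"
    and \<nu> :: "real measure" and p h :: "real \<Rightarrow> 'a \<Rightarrow> 'a \<Rightarrow> real" and \<Psi> :: "real \<Rightarrow> real"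
    and R\<^sub>1 :: ereal and \<beta>\<^sub>1 \<beta>\<^sub>2 \<gamma>\<^sub>s :: real
  assumes open_D: "open D" and D_proper: "D \<noteq> UNIV"
    and sub: "\<And>x. x \<in> D \<Longrightarrow> driftless_subordinator (P (Some x)) S \<nu>"
    and levy: "levy_measure \<nu>"
    and p_measurable: "\<And>x y. x \<in> D \<Longrightarrow> y \<in> D \<Longrightarrow>
          (\<lambda>s. indicator {0<..} s * p s x y) \<in> borel_measurable borel"
    and \<Psi>_ge: "\<And>r. 0 \<le> r \<Longrightarrow> \<Phi> r \<le> \<Psi> r"
    and h_boundary: "boundary_function D \<Phi> h" and h_regular: "regular_boundary_function D \<Phi> h"
    and h_star: "H2_star D \<Phi> h \<gamma>\<^sub>s" and \<gamma>\<^sub>s: "min \<beta>\<^sub>2 1 + 1 < \<gamma>\<^sub>s" and h_star_star: "H2_star_star D \<Phi> h \<beta>\<^sub>1"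
    and Poly: "Poly_tail \<nu> R\<^sub>1 \<beta>\<^sub>1 \<beta>\<^sub>2"
    and hk: "hk_two_sided {t. 0 < t \<and> ereal t < 2 * scale_diam \<Phi> D} D m \<Phi> \<Psi> h p 1"
    and extent: "\<not> bounded D \<and> R\<^sub>E = \<infinity> \<and> R\<^sub>1 = \<infinity> \<or>
          bounded D \<and> 0 < diameter D \<and> (\<exists>C>0. \<exists>l>0. \<forall>t\<ge>2 * \<Phi> (diameter D). \<forall>x\<in>D. \<forall>y\<in>D.
            p t x y \<le> C * exp (- l * t) * h (\<Phi> (diameter D)) x y)"
begin

definition times :: "real set" where
  "times = {t. 0 < t \<and> ereal t < 2 * scale_diam \<Phi> D}"

definition pairs :: "('a \<times> 'a) set" where
  "pairs = {(x, y). x \<in> D \<and> y \<in> D \<and> x \<noteq> y}"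

text \<open>
  In a bounded domain the distance to the complement can exceed the diameter, whereas the conditions
  on \<open>h\<close> are restricted to times of order \<open>\<Phi>(diam D)\<close>. The truncated distance stays in this range and is
  comparable to \<open>\<delta>\<^sub>\<or>\<close>, see \<open>depth_ge\<close>.
\<close>

definition depth :: "'a \<times> 'a \<Rightarrow> real" where
  "depth z = (if bounded D then min (delta_max D (fst z) (snd z)) (diameter D)
    else delta_max D (fst z) (snd z))"

abbreviation rho :: "'a \<times> 'a \<Rightarrow> real" where "rho z \<equiv> dist (fst z) (snd z)"

lemma pairsD: "z \<in> pairs \<Longrightarrow> fst z \<in> D \<and> snd z \<in> D \<and> 0 < rho z"
  by (auto simp: pairs_def)

lemma diameter_pos: "bounded D \<Longrightarrow> 0 < diameter D"
  using extent by auto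

lemma times_bounded: "bounded D \<Longrightarrow> times = {0<..<2 * \<Phi> (diameter D)}"
proof -
  assume D: "bounded D"
  have "2 * ereal (\<Phi> (diameter D)) = ereal (2 * \<Phi> (diameter D))"
    by (metis numeral_eq_ereal times_ereal.simps(1))
  then show ?thesis using D by (auto simp: times_def scale_diam_def)
qed

lemma times_unbounded: "\<not> bounded D \<Longrightarrow> times = {0<..}"
  by (auto simp: times_def scale_diam_def)

lemma times_pos: "t \<in> times \<Longrightarrow> 0 < t"
  by (simp add: times_def)

lemma times_down: "t \<in> times \<Longrightarrow> 0 < s \<Longrightarrow> s \<le> t \<Longrightarrow> s \<in> times"
  by (auto simp: times_def intro: le_less_trans[of "ereal s" "ereal t"])

lemma times_range: "t \<in> times \<Longrightarrow> ereal t < 4 * scale_diam \<Phi> D + 1"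
proof (cases "bounded D")
  case True
  assume t: "t \<in> times"
  have "0 < \<Phi> (diameter D)" using \<Phi>_pos[OF diameter_pos[OF True]] .
  moreover have "4 * ereal (\<Phi> (diameter D)) + 1 = ereal (4 * \<Phi> (diameter D) + 1)"
    by (metis numeral_eq_ereal times_ereal.simps(1) plus_ereal.simps(1) one_ereal_def)
  ultimately show ?thesis using t True times_bounded by (auto simp: scale_diam_def)
qed (simp add: scale_diam_def)

lemma times_top: "bounded D \<Longrightarrow> \<Phi> (diameter D) \<in> times"
  using \<Phi>_pos[OF diameter_pos] by (simp add: times_bounded)

lemma rho_diameter: "bounded D \<Longrightarrow> z \<in> pairs \<Longrightarrow> rho z \<le> diameter D"
  using pairsD by (blast intro: diameter_bounded_bound)

lemma \<Phi>_times: "0 < r \<Longrightarrow> (bounded D \<Longrightarrow> r \<le> diameter D) \<Longrightarrow> \<Phi> r \<in> times"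
proof (cases "bounded D")
  case True
  assume r: "0 < r" "bounded D \<Longrightarrow> r \<le> diameter D"
  have "\<Phi> r \<le> \<Phi> (diameter D)" using r True by (simp add: le_iff)
  then show ?thesis using times_down[OF times_top[OF True]] \<Phi>_pos r by blast
qed (simp add: times_unbounded \<Phi>_pos)

lemma delta_pos: "x \<in> D \<Longrightarrow> y \<in> D \<Longrightarrow> 0 < delta_min D x y"
proof -
  have "0 < dist_compl D x" if "x \<in> D" for x
  proof -
    have "- D \<noteq> {}" "closed (- D)" using D_proper open_D by auto
    then have "infdist x (- D) \<noteq> 0" using in_closed_iff_infdist_zero[of "- D" x] that by auto
    then show ?thesis using infdist_nonneg[of x "- D"] by (simp add: dist_compl_def)
  qed
  then show "x \<in> D \<Longrightarrow> y \<in> D \<Longrightarrow> 0 < delta_min D x y" by (simp add: delta_min_def)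
qed

lemma delta_lipschitz: "delta_max D x y \<le> delta_min D x y + dist x y"
  using infdist_triangle[of x "- D" y] infdist_triangle[of y "- D" x]
  by (auto simp: delta_max_def delta_min_def dist_compl_def dist_commute)

lemma delta_min_le: "delta_min D x y \<le> delta_max D x y"
  by (simp add: delta_min_def delta_max_def)

lemma depth_pos: "z \<in> pairs \<Longrightarrow> 0 < depth z"
  using pairsD[of z] delta_pos[of "fst z" "snd z"] delta_min_le[of "fst z" "snd z"] diameter_pos
  by (auto simp: depth_def)

lemma depth_le: "depth z \<le> delta_max D (fst z) (snd z)" "bounded D \<Longrightarrow> depth z \<le> diameter D"
  by (auto simp: depth_def)

lemma depth_cases:
  obtains "depth z = delta_max D (fst z) (snd z)"
    | "bounded D" "depth z = diameter D" "diameter D < delta_max D (fst z) (snd z)"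
  using that by (cases "bounded D \<and> diameter D < delta_max D (fst z) (snd z)") (auto simp: depth_def min_def)

subsection \<open>The boundary function\<close>

lemma h_nonneg: "z \<in> pairs \<Longrightarrow> 0 < t \<Longrightarrow> 0 \<le> h t (fst z) (snd z)"
  and h_le_1: "z \<in> pairs \<Longrightarrow> 0 < t \<Longrightarrow> h t (fst z) (snd z) \<le> 1"
  using h_boundary pairsD by (auto simp: boundary_function_def)

lemma h_antimono: "z \<in> pairs \<Longrightarrow> 0 < s \<Longrightarrow> s \<le> t \<Longrightarrow> h t (fst z) (snd z) \<le> h s (fst z) (snd z)"
  using h_boundary pairsD[of z] unfolding boundary_function_def monotone_on_def by auto

lemma h_doubling: "\<exists>A>0. \<exists>\<gamma>\<ge>0. \<forall>z\<in>pairs. \<forall>s t. 0 < s \<and> s \<le> t \<and> ereal t < 4 * scale_diam \<Phi> D + 1 \<longrightarrow>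
    h s (fst z) (snd z) \<le> A * (t / s) powr \<gamma> * h t (fst z) (snd z)"
proof -
  obtain A \<gamma> where A: "0 < A" "0 \<le> \<gamma>" and H: "\<And>s t x y. 0 < s \<Longrightarrow> s \<le> t \<Longrightarrow>
      ereal t < 4 * scale_diam \<Phi> D + 1 \<Longrightarrow> x \<in> D \<Longrightarrow> y \<in> D \<Longrightarrow> s powr \<gamma> * h s x y \<le> A * t powr \<gamma> * h t x y"
    using h_boundary unfolding boundary_function_def by blast
  have "h s (fst z) (snd z) \<le> A * (t / s) powr \<gamma> * h t (fst z) (snd z)"
    if "z \<in> pairs" "0 < s" "s \<le> t" "ereal t < 4 * scale_diam \<Phi> D + 1" for z s t
    using H[OF that(2-4)] pairsD[OF that(1)] that(2,3) by (simp add: powr_divide field_simps)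
  then show ?thesis using A by blast
qed

lemma h_interior: "\<exists>c>0. \<forall>z\<in>pairs. \<forall>t\<in>times. t \<le> \<Phi> (delta_min D (fst z) (snd z)) \<longrightarrow> c \<le> h t (fst z) (snd z)"
proof -
  obtain c where c: "0 < c" and H: "\<And>t x y. 0 < t \<Longrightarrow> ereal t < 4 * scale_diam \<Phi> D + 1 \<Longrightarrow>
      x \<in> D \<Longrightarrow> y \<in> D \<Longrightarrow> g t \<le> delta_min D x y \<Longrightarrow> c \<le> h t x y"
    using h_regular unfolding regular_boundary_function_def by blast
  have "c \<le> h t (fst z) (snd z)" if z: "z \<in> pairs" and t: "t \<in> times" "t \<le> \<Phi> (delta_min D (fst z) (snd z))" for z t
    using H[OF times_pos[OF t(1)] times_range[OF t(1)]] pairsD[OF z] t(2)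
      gen_inv_le[of "delta_min D (fst z) (snd z)" t] delta_pos[of "fst z" "snd z"] by auto
  then show ?thesis using c by blast
qed

lemma h_decay: "\<exists>A>0. \<forall>z\<in>pairs. \<forall>s t. \<Phi> (depth z) \<le> s \<and> s \<le> t \<and> t \<in> times \<longrightarrow>
    h t (fst z) (snd z) \<le> A * (s / t) powr \<gamma>\<^sub>s * h s (fst z) (snd z)"
proof -
  obtain c where c: "0 < c" and H: "\<And>x y s t. x \<in> D \<Longrightarrow> y \<in> D \<Longrightarrow> \<Phi> (delta_max D x y) \<le> s \<Longrightarrow> s \<le> t \<Longrightarrow>
      ereal t < 2 * scale_diam \<Phi> D \<Longrightarrow> c * t powr \<gamma>\<^sub>s * h t x y \<le> s powr \<gamma>\<^sub>s * h s x y"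
    using h_star unfolding H2_star_def by blast
  have g0: "0 < \<gamma>\<^sub>s" using h_star by (simp add: H2_star_def)
  define A where "A = 1 / c + 2 powr \<gamma>\<^sub>s"
  have A: "0 < A" "1 / c \<le> A" "2 powr \<gamma>\<^sub>s \<le> A" using c by (auto simp: A_def add_pos_pos)
  have "h t (fst z) (snd z) \<le> A * (s / t) powr \<gamma>\<^sub>s * h s (fst z) (snd z)"
    if z: "z \<in> pairs" and st: "\<Phi> (depth z) \<le> s" "s \<le> t" "t \<in> times" for z s t
  proof -
    have s: "0 < s" "0 < t" using \<Phi>_pos[OF depth_pos[OF z]] st by auto
    have hs: "0 \<le> h s (fst z) (snd z)" using h_nonneg[OF z s(1)] .
    show ?thesis
    proof (cases rule: depth_cases[of z])
      case 1
      then have "c * t powr \<gamma>\<^sub>s * h t (fst z) (snd z) \<le> s powr \<gamma>\<^sub>s * h s (fst z) (snd z)"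
        using H[of "fst z" "snd z" s t] pairsD[OF z] st by (auto simp: times_def)
      then have "h t (fst z) (snd z) \<le> (1 / c) * ((s / t) powr \<gamma>\<^sub>s * h s (fst z) (snd z))"
        using c s by (simp add: powr_divide field_simps)
      also have "\<dots> \<le> A * ((s / t) powr \<gamma>\<^sub>s * h s (fst z) (snd z))"
        using A hs by (intro mult_right_mono) auto
      finally show ?thesis by (simp add: mult.assoc)
    next
      case 2
      \<comment> \<open>both times lie in the last octave before \<open>2 * \<Phi> (diameter D)\<close>, where monotonicity suffices\<close>
      then have "t < 2 * s" using st times_bounded by auto
      then have "1 \<le> (2 * (s / t)) powr \<gamma>\<^sub>s" using s g0 by (intro ge_one_powr_ge_zero) auto
      also have "\<dots> = 2 powr \<gamma>\<^sub>s * (s / t) powr \<gamma>\<^sub>s" by (rule powr_mult)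
      also have "\<dots> \<le> A * (s / t) powr \<gamma>\<^sub>s" using A by (intro mult_right_mono) auto
      finally have "1 * h s (fst z) (snd z) \<le> A * (s / t) powr \<gamma>\<^sub>s * h s (fst z) (snd z)"
        using hs by (rule mult_right_mono)
      then show ?thesis using h_antimono[OF z s(1) st(2)] by simp
    qed
  qed
  then show ?thesis using A(1) by blast
qed

text \<open>
  The condition on \<open>h\<close> between \<open>\<Phi>(\<delta>\<^sub>\<and>)\<close> and \<open>\<Phi>(\<delta>\<^sub>\<or>)\<close> extends to all smaller times, since \<open>h\<close> is bounded below up to
  \<open>\<Phi>(\<delta>\<^sub>\<and>)\<close> by regularity, and to the endpoint \<open>\<Phi>(\<delta>\<^sub>\<or>)\<close> itself by doubling.
\<close>

lemma h_growth: "\<exists>A>0. \<exists>\<gamma><1 + \<beta>\<^sub>1. \<forall>z\<in>pairs. \<forall>s t. 0 < s \<and> s \<le> t \<and> t \<le> \<Phi> (depth z) \<longrightarrow>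
    h s (fst z) (snd z) \<le> A * (t / s) powr \<gamma> * h t (fst z) (snd z)"
proof -
  obtain c \<gamma> where c: "0 < c" "0 < \<gamma>" "\<gamma> < 1 + \<beta>\<^sub>1"
    and H: "\<And>x y s t. x \<in> D \<Longrightarrow> y \<in> D \<Longrightarrow> \<Phi> (delta_min D x y) \<le> s \<Longrightarrow> s \<le> t \<Longrightarrow>
      t < \<Phi> (delta_max D x y) \<Longrightarrow> s powr \<gamma> * h s x y \<le> c * t powr \<gamma> * h t x y"
    using h_star_star unfolding H2_star_star_def by blast
  obtain c' where c': "0 < c'" and int: "\<And>z t. z \<in> pairs \<Longrightarrow> t \<in> times \<Longrightarrow>
      t \<le> \<Phi> (delta_min D (fst z) (snd z)) \<Longrightarrow> c' \<le> h t (fst z) (snd z)"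
    using h_interior by blast
  obtain A \<gamma>' where A: "0 < A" "0 \<le> \<gamma>'" and dbl: "\<And>z s t. z \<in> pairs \<Longrightarrow> 0 < s \<Longrightarrow> s \<le> t \<Longrightarrow> ereal t < 4 * scale_diam \<Phi> D + 1 \<Longrightarrow>
      h s (fst z) (snd z) \<le> A * (t / s) powr \<gamma>' * h t (fst z) (snd z)"
    using h_doubling by blast
  define B where "B = 1 / c' + c + c / c'"
  have B: "0 < B" "1 / c' \<le> B" "c \<le> B" "c / c' \<le> B" using c c' by (auto simp: B_def add_pos_pos)
  have tI: "t \<in> times" if "z \<in> pairs" "0 < t" "t \<le> \<Phi> (depth z)" for z t
    using times_down[OF \<Phi>_times[OF depth_pos[OF that(1)] depth_le(2)] that(2,3)] .
  have strict: "h s (fst z) (snd z) \<le> B * ((t / s) powr \<gamma> * h t (fst z) (snd z))"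
    if z: "z \<in> pairs" and st: "0 < s" "s \<le> t" "t \<le> \<Phi> (depth z)" "t < \<Phi> (delta_max D (fst z) (snd z))" for z s t
  proof -
    let ?k = "\<Phi> (delta_min D (fst z) (snd z))"
    have t: "0 < t" "t \<in> times" using tI[OF z _ st(3)] st by auto
    have xy: "fst z \<in> D" "snd z \<in> D" using pairsD[OF z] by auto
    have k0: "0 < ?k" using \<Phi>_pos delta_pos[OF xy] by simp
    have hn: "0 \<le> h t (fst z) (snd z)" "h s (fst z) (snd z) \<le> 1" using h_nonneg[OF z t(1)] h_le_1[OF z st(1)] by auto
    have one: "1 \<le> (t / s) powr \<gamma>" using st c by (intro ge_one_powr_ge_zero) auto
    consider "t \<le> ?k" | "?k \<le> s" | "s \<le> ?k" "?k \<le> t" by linarith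
    then show ?thesis
    proof cases
      case 1
      then have "1 \<le> 1 / c' * h t (fst z) (snd z)" using int[OF z t(2)] c' by (simp add: field_simps)
      also have "\<dots> \<le> B * ((t / s) powr \<gamma> * h t (fst z) (snd z))"
        using B c' hn mult_right_mono[OF one hn(1)] by (intro mult_mono) auto
      finally show ?thesis using hn by simp
    next
      case 2
      have "h s (fst z) (snd z) \<le> c * ((t / s) powr \<gamma> * h t (fst z) (snd z))"
        using H[OF xy 2 st(2,4)] st t by (simp add: powr_divide field_simps)
      also have "\<dots> \<le> B * ((t / s) powr \<gamma> * h t (fst z) (snd z))"
        using B hn by (intro mult_right_mono) auto
      finally show ?thesis .
    next
      case 3
      have "c' \<le> h ?k (fst z) (snd z)" using int[OF z times_down[OF t(2) k0 3(2)]] by simp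
      also have "\<dots> \<le> c * ((t / ?k) powr \<gamma> * h t (fst z) (snd z))"
        using H[OF xy order_refl 3(2) st(4)] k0 t by (simp add: powr_divide field_simps)
      also have "\<dots> \<le> c * ((t / s) powr \<gamma> * h t (fst z) (snd z))"
        using c hn st t k0 3 by (intro mult_left_mono mult_right_mono powr_mono2 divide_left_mono) auto
      finally have "1 \<le> c / c' * ((t / s) powr \<gamma> * h t (fst z) (snd z))" using c' by (simp add: field_simps)
      also have "\<dots> \<le> B * ((t / s) powr \<gamma> * h t (fst z) (snd z))"
        using B hn by (intro mult_right_mono) auto
      finally show ?thesis using hn by simp
    qed
  qed
  define E where "E = A * 2 powr \<gamma>' * (1 + B)"
  have E: "0 < E" using A B by (simp add: E_def)
  have "h s (fst z) (snd z) \<le> E * (t / s) powr \<gamma> * h t (fst z) (snd z)"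
    if z: "z \<in> pairs" and st: "0 < s" "s \<le> t" "t \<le> \<Phi> (depth z)" for z s t
  proof -
    have t: "0 < t" "t \<in> times" using tI[OF z _ st(3)] st by auto
    have hn: "0 \<le> h t (fst z) (snd z)" using h_nonneg[OF z t(1)] .
    have one: "1 \<le> (t / s) powr \<gamma>" using st c by (intro ge_one_powr_ge_zero) auto
    have half: "h u (fst z) (snd z) \<le> A * 2 powr \<gamma>' * h t (fst z) (snd z)" if "t / 2 \<le> u" "u \<le> t" for u
    proof -
      have "h u (fst z) (snd z) \<le> A * (t / u) powr \<gamma>' * h t (fst z) (snd z)"
        using dbl[OF z _ that(2) times_range[OF t(2)]] that t by simp
      also have "\<dots> \<le> A * 2 powr \<gamma>' * h t (fst z) (snd z)"
        using that t A hn by (intro mult_right_mono mult_left_mono powr_mono2) (auto simp: field_simps)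
      finally show ?thesis .
    qed
    show ?thesis
    proof (cases "t / 2 \<le> s")
      case True
      have "A * 2 powr \<gamma>' * 1 * (1 * h t (fst z) (snd z)) \<le> A * 2 powr \<gamma>' * (1 + B) * ((t / s) powr \<gamma> * h t (fst z) (snd z))"
        using A B one hn by (intro mult_mono mult_left_mono mult_right_mono) auto
      then show ?thesis using half[OF True st(2)] by (simp add: E_def mult.assoc)
    next
      case False
      have "\<Phi> (depth z) \<le> \<Phi> (delta_max D (fst z) (snd z))"
        using depth_le(1)[of z] depth_pos[OF z] by (simp add: le_iff)
      then have "h s (fst z) (snd z) \<le> B * ((t / 2 / s) powr \<gamma> * h (t / 2) (fst z) (snd z))"
        using strict[OF z st(1), of "t / 2"] False st t by simp
      also have "\<dots> \<le> (1 + B) * ((t / s) powr \<gamma> * (A * 2 powr \<gamma>' * h t (fst z) (snd z)))"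
        using half[of "t / 2"] t st B c h_nonneg[OF z, of "t / 2"]
        by (intro mult_mono powr_mono2) (auto simp: field_simps)
      finally show ?thesis by (simp add: E_def mult_ac)
    qed
  qed
  then show ?thesis using E c by blast
qed

text \<open>
  If \<open>\<rho>\<close> is less than half the depth, both points are deep inside \<open>D\<close> and \<open>h\<close> is bounded below by regularity.
  Otherwise the two times differ by a bounded factor and doubling applies.
\<close>

lemma h_flat: "\<exists>A>0. \<forall>z\<in>pairs. rho z \<le> depth z \<longrightarrow>
    h (\<Phi> (rho z)) (fst z) (snd z) \<le> A * h (\<Phi> (depth z)) (fst z) (snd z)"
proof -
  obtain c' where c': "0 < c'" and int: "\<And>z t. z \<in> pairs \<Longrightarrow> t \<in> times \<Longrightarrow>
      t \<le> \<Phi> (delta_min D (fst z) (snd z)) \<Longrightarrow> c' \<le> h t (fst z) (snd z)"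
    using h_interior by blast
  obtain A \<gamma> where A: "0 < A" "0 \<le> \<gamma>" and dbl: "\<And>z s t. z \<in> pairs \<Longrightarrow> 0 < s \<Longrightarrow> s \<le> t \<Longrightarrow> ereal t < 4 * scale_diam \<Phi> D + 1 \<Longrightarrow>
      h s (fst z) (snd z) \<le> A * (t / s) powr \<gamma> * h t (fst z) (snd z)"
    using h_doubling by blast
  obtain C where C: "0 < C" "\<And>r R. 0 < r \<Longrightarrow> r \<le> R \<Longrightarrow> \<Phi> R / \<Phi> r \<le> C * (R / r) powr \<alpha>\<^sub>2"
    using ratio_bounds by metis
  define B where "B = (1 + 1 / c') * (A * (C * 2 powr \<alpha>\<^sub>2) powr \<gamma>)"
  have B: "0 < B" using c' A C by (simp add: B_def add_pos_pos)
  have "h (\<Phi> (rho z)) (fst z) (snd z) \<le> B * h (\<Phi> (depth z)) (fst z) (snd z)"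
    if z: "z \<in> pairs" and le: "rho z \<le> depth z" for z
  proof -
    \<comment> \<open>half of the depth is the threshold: nearer than this, both points have distance at least \<open>depth z / 2\<close> to the complement\<close>
    let ?t = "\<Phi> (depth z / 2)"
    have dp: "0 < depth z" by (rule depth_pos[OF z])
    have tI: "?t \<in> times" using dp depth_le(2)[of z] by (intro \<Phi>_times) auto
    have t0: "0 < ?t" using times_pos[OF tI] .
    have ht: "0 \<le> h ?t (fst z) (snd z)" by (rule h_nonneg[OF z t0])
    have "h (\<Phi> (rho z)) (fst z) (snd z) \<le> (1 + 1 / c') * h ?t (fst z) (snd z)"
    proof (cases "depth z / 2 \<le> rho z")
      case True
      then have "?t \<le> \<Phi> (rho z)" using dp by (simp add: le_iff)
      then have "h (\<Phi> (rho z)) (fst z) (snd z) \<le> h ?t (fst z) (snd z)" by (rule h_antimono[OF z t0])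
      also have "\<dots> \<le> (1 + 1 / c') * h ?t (fst z) (snd z)"
        using ht c' mult_right_mono[of 1 "1 + 1 / c'" "h ?t (fst z) (snd z)"] by simp
      finally show ?thesis .
    next
      case False
      then have "depth z / 2 \<le> delta_min D (fst z) (snd z)"
        using delta_lipschitz[of "fst z" "snd z"] depth_le(1)[of z] by simp
      then have "c' \<le> h ?t (fst z) (snd z)" using dp by (intro int[OF z tI]) (simp add: le_iff)
      then have "1 \<le> 1 / c' * h ?t (fst z) (snd z)" using c' by (simp add: field_simps)
      also have "\<dots> \<le> (1 + 1 / c') * h ?t (fst z) (snd z)" using ht by (intro mult_right_mono) auto
      finally show ?thesis using h_le_1[OF z \<Phi>_pos] pairsD[OF z] by (meson order_trans)
    qed
    also have "h ?t (fst z) (snd z) \<le> A * (C * 2 powr \<alpha>\<^sub>2) powr \<gamma> * h (\<Phi> (depth z)) (fst z) (snd z)"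
    proof -
      have dI: "\<Phi> (depth z) \<in> times" using dp depth_le(2) by (intro \<Phi>_times) auto
      have "h ?t (fst z) (snd z) \<le> A * (\<Phi> (depth z) / ?t) powr \<gamma> * h (\<Phi> (depth z)) (fst z) (snd z)"
        using dp by (intro dbl z t0 times_range dI) (simp add: le_iff)
      also have "\<dots> \<le> A * (C * 2 powr \<alpha>\<^sub>2) powr \<gamma> * h (\<Phi> (depth z)) (fst z) (snd z)"
        using C(2)[of "depth z / 2" "depth z"] dp A t0 times_pos[OF dI] h_nonneg[OF z times_pos[OF dI]]
        by (intro mult_right_mono mult_left_mono powr_mono2) auto
      finally show ?thesis .
    qed
    finally show ?thesis using c' by (simp add: B_def mult.assoc mult_left_mono add_nonneg_nonneg)
  qed
  then show ?thesis using B by blast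
qed

end

lemma exp_neg_le_powr:
  fixes x M :: real
  assumes "0 < x" and "0 < M"
  shows "exp (- x) \<le> (M / x) powr M"
proof -
  have "x / M \<le> exp (x / M)" using exp_ge_add_one_self[of "x / M"] by linarith
  then have "(x / M) powr M \<le> exp (x / M) powr M" using assms by (intro powr_mono2) auto
  also have "\<dots> = exp x" using assms by (simp add: exp_powr_real)
  finally have "(x / M) powr M \<le> exp x" .
  then show ?thesis using assms by (simp add: powr_divide exp_minus field_simps)
qed

context green_setting
begin

abbreviation hz :: "'a \<times> 'a \<Rightarrow> real \<Rightarrow> real" where "hz z s \<equiv> h s (fst z) (snd z)"
abbreviation vz :: "'a \<times> 'a \<Rightarrow> real \<Rightarrow> real" where "vz z s \<equiv> vol m (fst z) (g s)"
abbreviation pz :: "'a \<times> 'a \<Rightarrow> real \<Rightarrow> real" where "pz z s \<equiv> p s (fst z) (snd z)"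
abbreviation Tz :: "'a \<times> 'a \<Rightarrow> real" where "Tz z \<equiv> \<Phi> (rho z)"
abbreviation \<tau>z :: "'a \<times> 'a \<Rightarrow> real" where "\<tau>z z \<equiv> \<Phi> (depth z)"
abbreviation Wz :: "'a \<times> 'a \<Rightarrow> real" where "Wz z \<equiv> \<Psi> (rho z)"
abbreviation Uz :: "'a \<times> 'a \<Rightarrow> real measure" where
  "Uz z \<equiv> subordinator.potential (P (Some (fst z))) S"

subsection \<open>Volumes and the heat kernel in the time variable\<close>

lemma vz_pos: "0 < t \<Longrightarrow> 0 < vz z t"
  by (intro vol_pos gen_inv_pos)

lemma vz_mono: "s \<le> t \<Longrightarrow> vz z s \<le> vz z t"
  by (intro vol_mono gen_inv_mono)

lemma vz_T: "vz z (Tz z) = vol m (fst z) (rho z)"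
  by (simp add: gen_inv_\<Phi>)

lemma T_times: "z \<in> pairs \<Longrightarrow> Tz z \<in> times"
  using pairsD rho_diameter by (intro \<Phi>_times) auto

lemma depth_times: "z \<in> pairs \<Longrightarrow> \<tau>z z \<in> times"
  using depth_pos depth_le by (intro \<Phi>_times) auto

lemma v_scaling:
  "\<exists>A>0. \<forall>z s t. 0 < s \<and> s \<le> t \<and> t \<in> times \<longrightarrow>
    (t / s) powr (d\<^sub>1 / \<alpha>\<^sub>2) * vz z s \<le> A * vz z t \<and> vz z t \<le> A * (t / s) powr (d\<^sub>2 / \<alpha>\<^sub>1) * vz z s"
proof -
  define B where "B = (if bounded D then ereal (g (2 * \<Phi> (diameter D)) + 1) else \<infinity>)"
  have B: "B < \<infinity> \<or> R\<^sub>E = \<infinity>" using extent by (auto simp: B_def)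
  have gB: "ereal (g t) < B" if "t \<in> times" for t
    using gen_inv_mono[of t "2 * \<Phi> (diameter D)"] that times_bounded by (auto simp: B_def)
  obtain C where C: "1 \<le> C" and vs: "\<And>x r R. 0 < r \<Longrightarrow> r \<le> R \<Longrightarrow> ereal R < B \<Longrightarrow>
      (R / r) powr d\<^sub>1 * vol m x r \<le> C * vol m x R \<and> vol m x R \<le> C * (R / r) powr d\<^sub>2 * vol m x r"
    using vol_scaling[OF B] by blast
  obtain E where E: "0 < E" and gr: "\<And>s t. 0 < s \<Longrightarrow> s \<le> t \<Longrightarrow>
      (t / s) powr (1 / \<alpha>\<^sub>2) \<le> E * (g t / g s) \<and> g t / g s \<le> E * (t / s) powr (1 / \<alpha>\<^sub>1)"
    using gen_inv_ratio by blast
  define A where "A = C * (E powr d\<^sub>1 + E powr d\<^sub>2)"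
  have A: "0 < A" "E powr d\<^sub>1 * C \<le> A" "C * E powr d\<^sub>2 \<le> A"
    using C E by (auto simp: A_def add_pos_pos algebra_simps)
  have "(t / s) powr (d\<^sub>1 / \<alpha>\<^sub>2) * vz z s \<le> A * vz z t \<and> vz z t \<le> A * (t / s) powr (d\<^sub>2 / \<alpha>\<^sub>1) * vz z s"
    if st: "0 < s" "s \<le> t" "t \<in> times" for z s t
  proof
    have t: "0 < t" using st by simp
    have gs: "0 < g s" "g s \<le> g t" "0 < g t" using gen_inv_pos gen_inv_mono st t by auto
    note v = vs[OF gs(1,2) gB[OF st(3)], of "fst z"] and p = vz_pos[OF st(1), of z] vz_pos[OF t, of z]
    let ?R = "g t / g s"
    have "(t / s) powr (d\<^sub>1 / \<alpha>\<^sub>2) = ((t / s) powr (1 / \<alpha>\<^sub>2)) powr d\<^sub>1" by (simp add: powr_powr)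
    also have "\<dots> \<le> (E * ?R) powr d\<^sub>1" using gr[OF st(1,2)] d_pos by (intro powr_mono2) auto
    also have "\<dots> = E powr d\<^sub>1 * ?R powr d\<^sub>1" by (rule powr_mult)
    finally have "(t / s) powr (d\<^sub>1 / \<alpha>\<^sub>2) * vz z s \<le> E powr d\<^sub>1 * ?R powr d\<^sub>1 * vz z s"
      using p by (intro mult_right_mono) auto
    also have "\<dots> \<le> E powr d\<^sub>1 * (C * vz z t)" using v by (simp add: mult.assoc mult_left_mono)
    also have "\<dots> \<le> A * vz z t" using A p by (simp add: mult.assoc[symmetric] mult_right_mono)
    finally show "(t / s) powr (d\<^sub>1 / \<alpha>\<^sub>2) * vz z s \<le> A * vz z t" .
    have "?R powr d\<^sub>2 \<le> (E * (t / s) powr (1 / \<alpha>\<^sub>1)) powr d\<^sub>2"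
      using gr[OF st(1,2)] gs d_pos by (intro powr_mono2) auto
    also have "\<dots> = E powr d\<^sub>2 * (t / s) powr (d\<^sub>2 / \<alpha>\<^sub>1)" by (simp add: powr_mult powr_powr)
    finally have R: "?R powr d\<^sub>2 \<le> E powr d\<^sub>2 * (t / s) powr (d\<^sub>2 / \<alpha>\<^sub>1)" .
    have "vz z t \<le> C * ?R powr d\<^sub>2 * vz z s" using v by simp
    also have "\<dots> \<le> C * (E powr d\<^sub>2 * (t / s) powr (d\<^sub>2 / \<alpha>\<^sub>1)) * vz z s"
      using R C p by (intro mult_right_mono mult_left_mono) auto
    also have "\<dots> = (C * E powr d\<^sub>2) * ((t / s) powr (d\<^sub>2 / \<alpha>\<^sub>1) * vz z s)" by simp
    also have "\<dots> \<le> A * ((t / s) powr (d\<^sub>2 / \<alpha>\<^sub>1) * vz z s)" using A p by (intro mult_right_mono) auto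
    finally show "vz z t \<le> A * (t / s) powr (d\<^sub>2 / \<alpha>\<^sub>1) * vz z s" by (simp add: mult.assoc)
  qed
  then show ?thesis using A(1) by blast
qed

lemma profile_eq:
  "hk_profile m \<Phi> \<Psi> 1 c t (fst z) (snd z) =
    min (1 / vz z t) (t / (vz z (Tz z) * Wz z) + 1 / vz z t * exp (- c * (rho z / g t)\<^sup>2))"
  by (simp add: hk_profile_def vz_T power_divide)

lemma W_pos: "z \<in> pairs \<Longrightarrow> 0 < Wz z" and T_le_W: "z \<in> pairs \<Longrightarrow> Tz z \<le> Wz z"
  using \<Psi>_ge[of "rho z"] \<Phi>_pos[of "rho z"] pairsD[of z] by auto

text \<open>
  The Gaussian factor is smaller than any power of \<open>s / T\<close>, in particular than the power \<open>N\<close> corrected by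
  the change from \<open>v(s)\<close> to \<open>v(T)\<close>.
\<close>

lemma p_upper:
  assumes N: "0 < N"
  shows "\<exists>A>0. \<forall>z\<in>pairs. \<forall>s\<in>times. (Tz z \<le> s \<longrightarrow> pz z s \<le> A * hz z s / vz z s) \<and>
    (s \<le> Tz z \<longrightarrow> pz z s \<le> A * hz z s * (s / (vz z (Tz z) * Wz z) + (s / Tz z) powr N / vz z (Tz z)))"
proof -
  obtain c\<^sub>3 c\<^sub>4 where c: "0 < c\<^sub>3" "0 < c\<^sub>4" and up: "\<And>t x y. t \<in> times \<Longrightarrow> x \<in> D \<Longrightarrow> y \<in> D \<Longrightarrow>
      p t x y \<le> c\<^sub>3 * h t x y * hk_profile m \<Phi> \<Psi> 1 c\<^sub>4 t x y"
    using hk unfolding hk_two_sided_def times_def[symmetric] by metis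
  obtain A where A: "0 < A" and vs: "\<And>z s t. 0 < s \<Longrightarrow> s \<le> t \<Longrightarrow> t \<in> times \<Longrightarrow>
      vz z t \<le> A * (t / s) powr (d\<^sub>2 / \<alpha>\<^sub>1) * vz z s"
    using v_scaling by blast
  obtain E where E: "0 < E" and gr: "\<And>s t. 0 < s \<Longrightarrow> s \<le> t \<Longrightarrow> (t / s) powr (1 / \<alpha>\<^sub>2) \<le> E * (g t / g s)"
    using gen_inv_ratio by blast
  define N' where "N' = N + d\<^sub>2 / \<alpha>\<^sub>1"
  have N': "0 < N'" using N d_pos ab by (simp add: N'_def add_pos_nonneg)
  define M where "M = N' * \<alpha>\<^sub>2 / 2"
  have M: "0 < M" using N' ab by (simp add: M_def)
  define G where "G = (M * E\<^sup>2 / c\<^sub>4) powr M"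
  have G: "0 < G" using M E c by (simp add: G_def)
  define B where "B = c\<^sub>3 * (1 + A * G)"
  have B: "0 < B" "c\<^sub>3 \<le> B" using c A G by (auto simp: B_def add_pos_pos)
  have "(Tz z \<le> s \<longrightarrow> pz z s \<le> B * hz z s / vz z s) \<and>
    (s \<le> Tz z \<longrightarrow> pz z s \<le> B * hz z s * (s / (vz z (Tz z) * Wz z) + (s / Tz z) powr N / vz z (Tz z)))"
    if z: "z \<in> pairs" and s: "s \<in> times" for z s
  proof (intro conjI impI)
    have s0: "0 < s" using times_pos[OF s] .
    have xy: "fst z \<in> D" "snd z \<in> D" "0 < rho z" using pairsD[OF z] by auto
    have T0: "0 < Tz z" using \<Phi>_pos xy by simp
    have hn: "0 \<le> hz z s" by (rule h_nonneg[OF z s0])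
    have vp: "0 < vz z s" "0 < vz z (Tz z)" using vz_pos s0 T0 by auto
    have U: "pz z s \<le> c\<^sub>3 * hz z s * y" if "hk_profile m \<Phi> \<Psi> 1 c\<^sub>4 s (fst z) (snd z) \<le> y" for y
      by (rule order_trans[OF up[OF s xy(1,2)] mult_left_mono[OF that]]) (use c hn in simp)
    have "pz z s \<le> c\<^sub>3 * hz z s * (1 / vz z s)"
      by (rule U) (simp add: profile_eq)
    also have "\<dots> \<le> B * hz z s * (1 / vz z s)" using B hn vp by (intro mult_right_mono) auto
    finally show "pz z s \<le> B * hz z s / vz z s" by simp
    assume sT: "s \<le> Tz z"
    have "(Tz z / s) powr (1 / \<alpha>\<^sub>2) \<le> E * (rho z / g s)"
      using gr[OF s0 sT] xy by (simp add: gen_inv_\<Phi>)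
    then have "((Tz z / s) powr (1 / \<alpha>\<^sub>2))\<^sup>2 \<le> (E * (rho z / g s))\<^sup>2" by (intro power_mono) auto
    also have "((Tz z / s) powr (1 / \<alpha>\<^sub>2))\<^sup>2 = (Tz z / s) powr (2 / \<alpha>\<^sub>2)"
      using powr_powr[of "Tz z / s" "1 / \<alpha>\<^sub>2" 2] by (simp add: powr_numeral)
    finally have "(Tz z / s) powr (2 / \<alpha>\<^sub>2) / E\<^sup>2 \<le> (rho z / g s)\<^sup>2"
      using E by (simp add: power_mult_distrib field_simps)
    then have low: "c\<^sub>4 / E\<^sup>2 * (Tz z / s) powr (2 / \<alpha>\<^sub>2) \<le> c\<^sub>4 * (rho z / g s)\<^sup>2"
      using mult_left_mono[of _ _ c\<^sub>4] c by fastforce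
    let ?x = "c\<^sub>4 / E\<^sup>2 * (Tz z / s) powr (2 / \<alpha>\<^sub>2)"
    have x: "0 < ?x" using c E T0 s0 by simp
    have "exp (- c\<^sub>4 * (rho z / g s)\<^sup>2) \<le> exp (- ?x)" using low by simp
    also have "\<dots> \<le> (M / ?x) powr M" by (rule exp_neg_le_powr[OF x M])
    also have "M / ?x = (M * E\<^sup>2 / c\<^sub>4) * (s / Tz z) powr (2 / \<alpha>\<^sub>2)"
      using c E T0 s0 powr_ratio_flip[of s "Tz z" "2 / \<alpha>\<^sub>2"] by (simp add: powr_minus_divide field_simps)
    also have "\<dots> powr M = G * ((s / Tz z) powr (2 / \<alpha>\<^sub>2)) powr M"
      unfolding G_def by (rule powr_mult)
    also have "((s / Tz z) powr (2 / \<alpha>\<^sub>2)) powr M = (s / Tz z) powr N'"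
      using ab by (simp add: powr_powr M_def)
    finally have ex: "exp (- c\<^sub>4 * (rho z / g s)\<^sup>2) \<le> G * (s / Tz z) powr N'" .
    have "1 / vz z s \<le> A * (Tz z / s) powr (d\<^sub>2 / \<alpha>\<^sub>1) / vz z (Tz z)"
      using vs[OF s0 sT T_times[OF z], of z] vp by (simp add: field_simps)
    then have "1 / vz z s * exp (- c\<^sub>4 * (rho z / g s)\<^sup>2) \<le>
        A * (Tz z / s) powr (d\<^sub>2 / \<alpha>\<^sub>1) / vz z (Tz z) * (G * (s / Tz z) powr N')"
      using ex vp A by (intro mult_mono) auto
    also have "\<dots> = A * G * ((s / Tz z) powr N / vz z (Tz z))"
      using powr_ratio_flip[of s "Tz z" "d\<^sub>2 / \<alpha>\<^sub>1"] T0 s0 by (simp add: N'_def powr_add powr_minus_divide)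
    finally have e2: "1 / vz z s * exp (- c\<^sub>4 * (rho z / g s)\<^sup>2) \<le> A * G * ((s / Tz z) powr N / vz z (Tz z))" .
    have nn: "0 \<le> s / (vz z (Tz z) * Wz z)" "0 \<le> (s / Tz z) powr N / vz z (Tz z)"
      using s0 vp W_pos[OF z] by auto
    have "pz z s \<le> c\<^sub>3 * hz z s * (s / (vz z (Tz z) * Wz z) + A * G * ((s / Tz z) powr N / vz z (Tz z)))"
      by (rule U) (use e2 in \<open>simp add: profile_eq min_le_iff_disj\<close>)
    also have "\<dots> \<le> c\<^sub>3 * hz z s * ((1 + A * G) * (s / (vz z (Tz z) * Wz z) + (s / Tz z) powr N / vz z (Tz z)))"
    proof -
      have "x + k * y \<le> (1 + k) * (x + y)" if "0 \<le> x" "0 \<le> y" "0 \<le> k" for x y k :: real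
        using that by (simp add: algebra_simps)
      from this[OF nn, of "A * G"] show ?thesis using c hn A G by (intro mult_left_mono) auto
    qed
    finally show "pz z s \<le> B * hz z s * (s / (vz z (Tz z) * Wz z) + (s / Tz z) powr N / vz z (Tz z))"
      by (simp add: B_def mult_ac)
  qed
  then show ?thesis using B(1) by blast
qed

text \<open>
  As long as \<open>s \<ge> T / K\<close>, the exponent in the Gaussian factor is bounded. The jump bound for \<open>s \<le> T\<close> does not
  exceed \<open>1/v(s)\<close> because \<open>\<Phi> \<le> \<Psi>\<close>.
\<close>

lemma p_lower:
  assumes K: "1 < K"
  shows "\<exists>a>0. \<forall>z\<in>pairs. \<forall>s\<in>times. (Tz z \<le> s \<longrightarrow> a * hz z s / vz z s \<le> pz z s) \<and>
    (Tz z / K \<le> s \<and> s \<le> Tz z \<longrightarrow> a * hz z s / vz z (Tz z) \<le> pz z s) \<and>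
    (s \<le> Tz z \<longrightarrow> a * hz z s * (s / (vz z (Tz z) * Wz z)) \<le> pz z s)"
proof -
  obtain c\<^sub>1 c\<^sub>2 where c: "0 < c\<^sub>1" "0 < c\<^sub>2" and lo: "\<And>t x y. t \<in> times \<Longrightarrow> x \<in> D \<Longrightarrow> y \<in> D \<Longrightarrow>
      c\<^sub>1 * h t x y * hk_profile m \<Phi> \<Psi> 1 c\<^sub>2 t x y \<le> p t x y"
    using hk unfolding hk_two_sided_def times_def[symmetric] by metis
  obtain E where E: "0 < E" and gr: "\<And>s t. 0 < s \<Longrightarrow> s \<le> t \<Longrightarrow> g t / g s \<le> E * (t / s) powr (1 / \<alpha>\<^sub>1)"
    using gen_inv_ratio by blast
  define L where "L = max 1 (E * K powr (1 / \<alpha>\<^sub>1))"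
  define a where "a = c\<^sub>1 * exp (- c\<^sub>2 * L\<^sup>2)"
  have L: "1 \<le> L" by (simp add: L_def)
  have a: "0 < a" "a \<le> c\<^sub>1" using c by (auto simp: a_def mult_le_cancel_left1)
  have "(Tz z \<le> s \<longrightarrow> a * hz z s / vz z s \<le> pz z s) \<and>
    (Tz z / K \<le> s \<and> s \<le> Tz z \<longrightarrow> a * hz z s / vz z (Tz z) \<le> pz z s) \<and>
    (s \<le> Tz z \<longrightarrow> a * hz z s * (s / (vz z (Tz z) * Wz z)) \<le> pz z s)"
    if z: "z \<in> pairs" and s: "s \<in> times" for z s
  proof -
    have s0: "0 < s" using times_pos[OF s] .
    have xy: "fst z \<in> D" "snd z \<in> D" "0 < rho z" using pairsD[OF z] by auto
    have T0: "0 < Tz z" using \<Phi>_pos xy by simp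
    have hn: "0 \<le> hz z s" by (rule h_nonneg[OF z s0])
    have vp: "0 < vz z s" "0 < vz z (Tz z)" "0 < g s" using vz_pos s0 T0 gen_inv_pos by auto
    have sW: "0 \<le> s / (vz z (Tz z) * Wz z)" using s0 vp W_pos[OF z] by simp
    have low: "c\<^sub>1 * hz z s * y \<le> pz z s" if "y \<le> hk_profile m \<Phi> \<Psi> 1 c\<^sub>2 s (fst z) (snd z)" for y
      by (rule order_trans[OF mult_left_mono[OF that] lo[OF s xy(1,2)]]) (use c hn in simp)
    have diag: "a * hz z s / vz z s \<le> pz z s" if "rho z / g s \<le> L"
    proof -
      have "(rho z / g s)\<^sup>2 \<le> L\<^sup>2" using that xy vp by (intro power_mono) auto
      then have "exp (- c\<^sub>2 * L\<^sup>2) \<le> exp (- c\<^sub>2 * (rho z / g s)\<^sup>2)" using c by simp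
      then have "1 / vz z s * exp (- c\<^sub>2 * L\<^sup>2) \<le> 1 / vz z s * exp (- c\<^sub>2 * (rho z / g s)\<^sup>2)"
        using vp by (intro mult_left_mono) auto
      moreover have "1 / vz z s * exp (- c\<^sub>2 * L\<^sup>2) \<le> 1 / vz z s * 1"
        using vp c by (intro mult_left_mono) auto
      ultimately have "1 / vz z s * exp (- c\<^sub>2 * L\<^sup>2) \<le> hk_profile m \<Phi> \<Psi> 1 c\<^sub>2 s (fst z) (snd z)"
        unfolding profile_eq using sW by simp
      then have "c\<^sub>1 * hz z s * (1 / vz z s * exp (- c\<^sub>2 * L\<^sup>2)) \<le> pz z s"
        by (rule low)
      then show ?thesis by (simp add: a_def mult_ac)
    qed
    show ?thesis
    proof (intro conjI impI)
      assume "Tz z \<le> s"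
      then have "rho z \<le> g s" using gen_inv_mono[of "Tz z" s] xy by (simp add: gen_inv_\<Phi>)
      then have "rho z / g s \<le> L" using vp L by (simp add: divide_le_eq order_trans[of _ "1 * g s"] mult_right_mono)
      then show "a * hz z s / vz z s \<le> pz z s" by (rule diag)
    next
      assume A: "Tz z / K \<le> s \<and> s \<le> Tz z"
      have "rho z / g s \<le> E * (Tz z / s) powr (1 / \<alpha>\<^sub>1)"
        using gr[OF s0, of "Tz z"] A xy by (simp add: gen_inv_\<Phi>)
      also have "\<dots> \<le> E * K powr (1 / \<alpha>\<^sub>1)"
        using A E s0 T0 K ab by (intro mult_left_mono powr_mono2) (auto simp: field_simps)
      also have "\<dots> \<le> L" by (simp add: L_def)
      finally have "a * hz z s / vz z s \<le> pz z s" by (rule diag)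
      moreover have "a * hz z s / vz z (Tz z) \<le> a * hz z s / vz z s"
        using vz_mono[of s "Tz z" z] A vp a hn by (intro divide_left_mono) auto
      ultimately show "a * hz z s / vz z (Tz z) \<le> pz z s" by simp
    next
      assume A: "s \<le> Tz z"
      have "s / (vz z (Tz z) * Wz z) \<le> 1 / vz z (Tz z)"
        using A T_le_W[OF z] W_pos[OF z] vp by (simp add: field_simps)
      also have "\<dots> \<le> 1 / vz z s" using vz_mono[OF A, of z] vp by (intro divide_left_mono) auto
      finally have "s / (vz z (Tz z) * Wz z) \<le> hk_profile m \<Phi> \<Psi> 1 c\<^sub>2 s (fst z) (snd z)"
        unfolding profile_eq using vp by simp
      then have "c\<^sub>1 * hz z s * (s / (vz z (Tz z) * Wz z)) \<le> pz z s"
        by (rule low)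
      moreover have "a * hz z s * (s / (vz z (Tz z) * Wz z)) \<le> c\<^sub>1 * hz z s * (s / (vz z (Tz z) * Wz z))"
        using a hn sW by (intro mult_right_mono) auto
      ultimately show "a * hz z s * (s / (vz z (Tz z) * Wz z)) \<le> pz z s" by simp
    qed
  qed
  then show ?thesis using a(1) by blast
qed

subsection \<open>The potential measure\<close>

lemma \<beta>\<^sub>1_pos: "0 < \<beta>\<^sub>1" "\<beta>\<^sub>1 \<le> \<beta>\<^sub>2"
  using Poly by (auto simp: Poly_tail_def)

lemma subordinator: "x \<in> D \<Longrightarrow> subordinator (P (Some x)) S \<nu>"
  using sub by (auto simp: driftless_subordinator_def intro!: subordinator.intro subordinator_axioms.intro)

lemma sets_Uz: "z \<in> pairs \<Longrightarrow> sets (Uz z) = sets borel"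
  using subordinator.sets_potential[OF subordinator] pairsD by blast

abbreviation f :: "real \<Rightarrow> real" where "f \<equiv> renewal_scale \<nu>"

lemma f_pos: "0 < t \<Longrightarrow> 0 < f t"
  by (rule renewal_scale_pos[OF levy Poly])

lemma laplace_pos: "0 < l \<Longrightarrow> 0 < laplace_exponent \<nu> l"
  by (rule laplace_exponent_pos[OF levy Poly])

lemma f_scaling: "\<exists>A>0. \<forall>s t. 0 < s \<and> s \<le> t \<and> t \<in> times \<longrightarrow>
    f s \<le> A * (s / t) powr \<beta>\<^sub>1 * f t \<and> f t \<le> A * (t / s) powr (min \<beta>\<^sub>2 1) * f s"
proof -
  have "2 * scale_diam \<Phi> D < \<infinity> \<or> R\<^sub>1 = \<infinity>"
  proof (cases "bounded D")
    case True
    have "2 * ereal (\<Phi> (diameter D)) = ereal (2 * \<Phi> (diameter D))"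
      by (metis numeral_eq_ereal times_ereal.simps(1))
    then show ?thesis using True by (simp add: scale_diam_def)
  qed (use extent in auto)
  from renewal_scale_scaling[OF levy Poly this] show ?thesis by (auto simp: times_def)
qed

lemma Uz_upper: "z \<in> pairs \<Longrightarrow> 0 < a \<Longrightarrow> emeasure (Uz z) {..a} \<le> ennreal (exp 1 * f a)"
  using subordinator.potential_atMost_upper[OF subordinator, of "fst z" a] pairsD[of z] laplace_pos[of "1 / a"] by simp

text \<open>
  By the scaling of \<open>f\<close>, the upper bound for \<open>{..a / K}\<close> is at most half of the lower bound for \<open>{..a}\<close> once
  \<open>K\<close> is large.
\<close>

lemma Uz_lower: "\<exists>K>1. \<forall>z\<in>pairs. \<forall>a\<in>times. ennreal (1 / 24 * f a) \<le> emeasure (Uz z) {a / K<..a}"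
proof -
  obtain A where A: "0 < A" and sc: "\<And>s t. 0 < s \<Longrightarrow> s \<le> t \<Longrightarrow> t \<in> times \<Longrightarrow> f s \<le> A * (s / t) powr \<beta>\<^sub>1 * f t"
    using f_scaling by blast
  define K where "K = max 2 ((24 * exp 1 * A) powr (1 / \<beta>\<^sub>1))"
  have K: "1 < K" by (simp add: K_def)
  have "24 * exp 1 * A = ((24 * exp 1 * A) powr (1 / \<beta>\<^sub>1)) powr \<beta>\<^sub>1"
    using A \<beta>\<^sub>1_pos by (simp add: powr_powr)
  also have "\<dots> \<le> K powr \<beta>\<^sub>1" using \<beta>\<^sub>1_pos by (intro powr_mono2) (auto simp: K_def)
  finally have K2: "24 * exp 1 * A \<le> K powr \<beta>\<^sub>1" .
  have "ennreal (1 / 24 * f a) \<le> emeasure (Uz z) {a / K<..a}" if z: "z \<in> pairs" and a: "a \<in> times" for z a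
  proof -
    have a0: "0 < a" "0 < a / K" "a / K \<le> a" using times_pos[OF a] K by (auto simp: field_simps)
    have fa: "0 < f a" using f_pos a0 by simp
    have "f (a / K) \<le> A * (a / K / a) powr \<beta>\<^sub>1 * f a" by (rule sc[OF a0(2,3) a])
    also have "(a / K / a) powr \<beta>\<^sub>1 = 1 / K powr \<beta>\<^sub>1" using a0 K by (simp add: powr_divide)
    finally have "exp 1 * f (a / K) \<le> exp 1 * (A * (1 / K powr \<beta>\<^sub>1) * f a)" by (intro mult_left_mono) auto
    also have "\<dots> = (24 * exp 1 * A) / K powr \<beta>\<^sub>1 * (f a / 24)" by simp
    also have "\<dots> \<le> 1 * (f a / 24)" using K2 K fa by (intro mult_right_mono) (auto simp: divide_le_eq)
    finally have small: "exp 1 * f (a / K) \<le> f a / 24" by simp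
    have "ennreal (f a / 12) \<le> emeasure (Uz z) {..a}"
      using subordinator.potential_atMost_lower[OF subordinator, of "fst z" a] pairsD[OF z] laplace_pos[of "1 / a"] a0 by simp
    also have "{..a} = {..a / K} \<union> {a / K<..a}" using a0 by auto
    also have "emeasure (Uz z) \<dots> \<le> emeasure (Uz z) {..a / K} + emeasure (Uz z) {a / K<..a}"
      using sets_Uz[OF z] by (intro emeasure_subadditive) auto
    also have "emeasure (Uz z) {..a / K} \<le> ennreal (f a / 24)"
      using order_trans[OF Uz_upper[OF z a0(2)] ennreal_leI[OF small]] .
    finally have split: "ennreal (f a / 12) \<le> ennreal (f a / 24) + emeasure (Uz z) {a / K<..a}"
      by (simp add: add_right_mono)
    show ?thesis
    proof (cases "emeasure (Uz z) {a / K<..a}" rule: ennreal_cases)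
      case (real r)
      then show ?thesis using split fa
        by (simp add: ennreal_plus[symmetric] del: ennreal_plus)
    qed simp
  qed
  then show ?thesis using K by blast
qed

subsection \<open>Reduction to the time variable\<close>

lemma core:
  obtains K \<gamma> \<gamma>' A\<^sub>f A\<^sub>v A\<^sub>h A\<^sub>s A\<^sub>s\<^sub>s A\<^sub>l A\<^sub>F a\<^sub>F where
    "green_core pairs times Uz f (exp 1) K (1 / 24) hz vz pz Tz \<tau>z Wz
      \<beta>\<^sub>1 (min \<beta>\<^sub>2 1) (d\<^sub>1 / \<alpha>\<^sub>2) (d\<^sub>2 / \<alpha>\<^sub>1) \<gamma> \<gamma>\<^sub>s \<gamma>' A\<^sub>f A\<^sub>v A\<^sub>h A\<^sub>s A\<^sub>s\<^sub>s A\<^sub>l A\<^sub>F a\<^sub>F"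
proof -
  obtain A\<^sub>f where f: "0 < A\<^sub>f" "\<And>s t. 0 < s \<Longrightarrow> s \<le> t \<Longrightarrow> t \<in> times \<Longrightarrow>
      f s \<le> A\<^sub>f * (s / t) powr \<beta>\<^sub>1 * f t \<and> f t \<le> A\<^sub>f * (t / s) powr (min \<beta>\<^sub>2 1) * f s"
    using f_scaling by blast
  obtain A\<^sub>v where v: "0 < A\<^sub>v" "\<And>z s t. 0 < s \<Longrightarrow> s \<le> t \<Longrightarrow> t \<in> times \<Longrightarrow>
      (t / s) powr (d\<^sub>1 / \<alpha>\<^sub>2) * vz z s \<le> A\<^sub>v * vz z t \<and> vz z t \<le> A\<^sub>v * (t / s) powr (d\<^sub>2 / \<alpha>\<^sub>1) * vz z s"
    using v_scaling by blast
  obtain A\<^sub>h \<gamma> where hd: "0 < A\<^sub>h" "0 \<le> \<gamma>" "\<And>z s t. z \<in> pairs \<Longrightarrow> 0 < s \<Longrightarrow> s \<le> t \<Longrightarrow>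
      ereal t < 4 * scale_diam \<Phi> D + 1 \<Longrightarrow> hz z s \<le> A\<^sub>h * (t / s) powr \<gamma> * hz z t"
    using h_doubling by blast
  obtain A\<^sub>s where hs: "0 < A\<^sub>s" "\<And>z s t. z \<in> pairs \<Longrightarrow> \<tau>z z \<le> s \<Longrightarrow> s \<le> t \<Longrightarrow> t \<in> times \<Longrightarrow>
      hz z t \<le> A\<^sub>s * (s / t) powr \<gamma>\<^sub>s * hz z s"
    using h_decay by blast
  obtain A\<^sub>s\<^sub>s \<gamma>' where hg: "0 < A\<^sub>s\<^sub>s" "\<gamma>' < 1 + \<beta>\<^sub>1" "\<And>z s t. z \<in> pairs \<Longrightarrow> 0 < s \<Longrightarrow> s \<le> t \<Longrightarrow> t \<le> \<tau>z z \<Longrightarrow>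
      hz z s \<le> A\<^sub>s\<^sub>s * (t / s) powr \<gamma>' * hz z t"
    using h_growth by blast
  obtain A\<^sub>l where hl: "0 < A\<^sub>l" "\<And>z. z \<in> pairs \<Longrightarrow> rho z \<le> depth z \<Longrightarrow> hz z (Tz z) \<le> A\<^sub>l * hz z (\<tau>z z)"
    using h_flat by blast
  obtain K where K: "1 < K" "\<And>z a. z \<in> pairs \<Longrightarrow> a \<in> times \<Longrightarrow> ennreal (1 / 24 * f a) \<le> emeasure (Uz z) {a / K<..a}"
    using Uz_lower by blast
  have N: "0 < \<gamma> + 1" using hd by simp
  obtain A\<^sub>F where pu: "0 < A\<^sub>F" "\<And>z s. z \<in> pairs \<Longrightarrow> s \<in> times \<Longrightarrow> (Tz z \<le> s \<longrightarrow> pz z s \<le> A\<^sub>F * hz z s / vz z s) \<and>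
      (s \<le> Tz z \<longrightarrow> pz z s \<le> A\<^sub>F * hz z s * (s / (vz z (Tz z) * Wz z) + (s / Tz z) powr (\<gamma> + 1) / vz z (Tz z)))"
    using p_upper[OF N] by blast
  obtain a\<^sub>F where pl: "0 < a\<^sub>F" "\<And>z s. z \<in> pairs \<Longrightarrow> s \<in> times \<Longrightarrow> (Tz z \<le> s \<longrightarrow> a\<^sub>F * hz z s / vz z s \<le> pz z s) \<and>
      (Tz z / K \<le> s \<and> s \<le> Tz z \<longrightarrow> a\<^sub>F * hz z s / vz z (Tz z) \<le> pz z s) \<and>
      (s \<le> Tz z \<longrightarrow> a\<^sub>F * hz z s * (s / (vz z (Tz z) * Wz z)) \<le> pz z s)"
    using p_lower[OF K(1)] by blast
  have T0: "0 < Tz z" if "z \<in> pairs" for z using T_times[OF that] times_pos by blast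
  have near: "s \<in> times" if "z \<in> pairs" "0 < s" "s \<le> Tz z" for z s
    using times_down[OF T_times[OF that(1)] that(2,3)] .
  show ?thesis
  proof (rule that, unfold_locales)
    show "times \<in> sets borel"
      by (cases "bounded D") (simp_all add: times_bounded times_unbounded)
    fix z s t
    show "t \<in> times \<Longrightarrow> 0 < t" by (rule times_pos)
    show "t \<in> times \<Longrightarrow> 0 < s \<Longrightarrow> s \<le> t \<Longrightarrow> s \<in> times" by (rule times_down)
    show "z \<in> pairs \<Longrightarrow> sets (Uz z) = sets borel" by (rule sets_Uz)
    show "0 < t \<Longrightarrow> 0 < f t" by (rule f_pos)
    show "0 < s \<Longrightarrow> s \<le> t \<Longrightarrow> f s \<le> f t" by (rule renewal_scale_mono[OF levy Poly])
    show "0 < s \<Longrightarrow> s \<le> t \<Longrightarrow> f t \<le> 2 * (t / s) * f s" by (rule renewal_scale_linear[OF levy Poly])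
    show "z \<in> pairs \<Longrightarrow> 0 < t \<Longrightarrow> emeasure (Uz z) {..t} \<le> ennreal (exp 1 * f t)" by (rule Uz_upper)
    show "z \<in> pairs \<Longrightarrow> t \<in> times \<Longrightarrow> ennreal (1 / 24 * f t) \<le> emeasure (Uz z) {t / K<..t}" by (rule K(2))
    show "0 < s \<Longrightarrow> s \<le> t \<Longrightarrow> t \<in> times \<Longrightarrow> f s \<le> A\<^sub>f * (s / t) powr \<beta>\<^sub>1 * f t" using f(2) by blast
    show "0 < s \<Longrightarrow> s \<le> t \<Longrightarrow> t \<in> times \<Longrightarrow> f t \<le> A\<^sub>f * (t / s) powr (min \<beta>\<^sub>2 1) * f s" using f(2) by blast
    show "z \<in> pairs \<Longrightarrow> t \<in> times \<Longrightarrow> 0 < vz z t" using vz_pos times_pos by blast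
    show "z \<in> pairs \<Longrightarrow> 0 < s \<Longrightarrow> s \<le> t \<Longrightarrow> t \<in> times \<Longrightarrow> (t / s) powr (d\<^sub>1 / \<alpha>\<^sub>2) * vz z s \<le> A\<^sub>v * vz z t"
      using v(2) by blast
    show "z \<in> pairs \<Longrightarrow> 0 < s \<Longrightarrow> s \<le> t \<Longrightarrow> t \<in> times \<Longrightarrow> vz z t \<le> A\<^sub>v * (t / s) powr (d\<^sub>2 / \<alpha>\<^sub>1) * vz z s"
      using v(2) by blast
    show "z \<in> pairs \<Longrightarrow> t \<in> times \<Longrightarrow> 0 \<le> hz z t" using h_nonneg times_pos by blast
    show "z \<in> pairs \<Longrightarrow> 0 < s \<Longrightarrow> s \<le> t \<Longrightarrow> t \<in> times \<Longrightarrow> hz z t \<le> hz z s" using h_antimono by blast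
    show "z \<in> pairs \<Longrightarrow> 0 < s \<Longrightarrow> s \<le> t \<Longrightarrow> t \<in> times \<Longrightarrow> hz z s \<le> A\<^sub>h * (t / s) powr \<gamma> * hz z t"
      using hd(3) times_range by blast
    show "z \<in> pairs \<Longrightarrow> \<tau>z z \<le> s \<Longrightarrow> s \<le> t \<Longrightarrow> t \<in> times \<Longrightarrow> hz z t \<le> A\<^sub>s * (s / t) powr \<gamma>\<^sub>s * hz z s"
      by (rule hs(2))
    show "z \<in> pairs \<Longrightarrow> 0 < s \<Longrightarrow> s \<le> t \<Longrightarrow> t \<le> \<tau>z z \<Longrightarrow> hz z s \<le> A\<^sub>s\<^sub>s * (t / s) powr \<gamma>' * hz z t"
      by (rule hg(3))
    show "z \<in> pairs \<Longrightarrow> Tz z \<le> \<tau>z z \<Longrightarrow> hz z (Tz z) \<le> A\<^sub>l * hz z (\<tau>z z)"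
      using hl(2) depth_pos[of z] by (simp add: le_iff)
    show "z \<in> pairs \<Longrightarrow> Tz z \<in> times" by (rule T_times)
    show "z \<in> pairs \<Longrightarrow> \<tau>z z \<in> times" by (rule depth_times)
    show "z \<in> pairs \<Longrightarrow> 0 < Wz z" by (rule W_pos)
    show "z \<in> pairs \<Longrightarrow> Tz z \<le> s \<Longrightarrow> s \<in> times \<Longrightarrow> pz z s \<le> A\<^sub>F * hz z s / vz z s" using pu(2) by blast
    show "z \<in> pairs \<Longrightarrow> 0 < s \<Longrightarrow> s \<le> Tz z \<Longrightarrow> pz z s \<le> A\<^sub>F * hz z s *
        (s / (vz z (Tz z) * Wz z) + (s / Tz z) powr (\<gamma> + 1) / vz z (Tz z))" using pu(2) near by blast
    show "z \<in> pairs \<Longrightarrow> Tz z \<le> s \<Longrightarrow> s \<in> times \<Longrightarrow> a\<^sub>F * hz z s / vz z s \<le> pz z s" using pl(2) by blast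
    show "a\<^sub>F * hz z s / vz z (Tz z) \<le> pz z s" if z: "z \<in> pairs" and s: "Tz z / K \<le> s" "s \<le> Tz z"
    proof -
      have "0 < Tz z / K" using T0[OF z] K by simp
      then have "s \<in> times" using s by (intro near[OF z]) auto
      then show ?thesis using pl(2)[OF z] s by blast
    qed
    show "z \<in> pairs \<Longrightarrow> 0 < s \<Longrightarrow> s \<le> Tz z \<Longrightarrow> a\<^sub>F * hz z s * (s / (vz z (Tz z) * Wz z)) \<le> pz z s"
      using pl(2) near by blast
  qed (use f(1) v(1) hd(1) hs(1) hg(1,2) hl(1) pu(1) pl(1) K(1) \<beta>\<^sub>1_pos d_pos ab \<gamma>\<^sub>s in auto)
qed

end

section \<open>From the time variable back to space\<close>

lemma comparable_onI:
  assumes "0 < a" and "0 < b" and "\<And>z. z \<in> A \<Longrightarrow> a * g z \<le> f z" and "\<And>z. z \<in> A \<Longrightarrow> f z \<le> b * g z"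
  shows "comparable_on A f g"
  using assms unfolding comparable_on_def by blast

lemma ecomparable_on_trans:
  assumes "ecomparable_on A F X" and "comparable_on A X X'"
  shows "ecomparable_on A F X'"
proof -
  obtain a b where a: "0 < a" "0 < b" "\<And>z. z \<in> A \<Longrightarrow> ennreal (a * X z) \<le> F z \<and> F z \<le> ennreal (b * X z)"
    using assms(1) unfolding ecomparable_on_def by blast
  obtain c d where c: "0 < c" "0 < d" "\<And>z. z \<in> A \<Longrightarrow> c * X' z \<le> X z \<and> X z \<le> d * X' z"
    using assms(2) unfolding comparable_on_def by blast
  have "ennreal (a * c * X' z) \<le> F z \<and> F z \<le> ennreal (b * d * X' z)" if z: "z \<in> A" for z
  proof
    have "a * c * X' z \<le> a * X z" using a(1) c(3)[OF z] by (simp add: mult.assoc)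
    then show "ennreal (a * c * X' z) \<le> F z" using a(3)[OF z] ennreal_leI order_trans by blast
    have "b * X z \<le> b * d * X' z" using a(2) c(3)[OF z] by (simp add: mult.assoc)
    then show "F z \<le> ennreal (b * d * X' z)" using a(3)[OF z] ennreal_leI order_trans by blast
  qed
  then show ?thesis using a c unfolding ecomparable_on_def by (meson mult_pos_pos)
qed

context green_core
begin

text \<open>
  If \<open>W\<close> is comparable to \<open>T\<close>, the jump term is the bracket times \<open>q T\<close>. It is dominated by the bracket
  times \<open>g\<close> and dominates it for \<open>\<tau> < T\<close>, where \<open>g\<close> and \<open>q T\<close> are comparable; for \<open>T \<le> \<tau>\<close> the bracket is \<open>h(T)\<close>, and the other
  term takes over.
\<close>

lemma sharp_bracket:
  assumes g: "sharp g" "\<And>z. z \<in> Z \<Longrightarrow> 0 \<le> g z"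
    and q_le: "\<exists>C>0. \<forall>z\<in>Z. q z (T z) \<le> C * g z"
    and le_q: "\<exists>C>0. \<forall>z\<in>Z. \<tau> z < T z \<longrightarrow> g z \<le> C * q z (T z)"
    and W: "\<exists>c>0. \<forall>z\<in>Z. c \<le> T z / W z \<and> T z / W z \<le> 1"
  shows "ecomparable_on Z green (\<lambda>z. bracket z * g z)"
proof (rule ecomparable_on_trans[OF g(1)[unfolded sharp_def]])
  obtain C\<^sub>1 C\<^sub>2 C\<^sub>3 c where C: "0 < C\<^sub>1" "0 < C\<^sub>2" "0 < C\<^sub>3" "0 < c"
    and q_le: "\<And>z. z \<in> Z \<Longrightarrow> q z (T z) \<le> C\<^sub>1 * g z"
    and le_q: "\<And>z. z \<in> Z \<Longrightarrow> \<tau> z < T z \<Longrightarrow> g z \<le> C\<^sub>2 * q z (T z)"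
    and h_le: "\<And>z. z \<in> Z \<Longrightarrow> h z (T z) \<le> C\<^sub>3 * bracket z"
    and W: "\<And>z. z \<in> Z \<Longrightarrow> c \<le> T z / W z \<and> T z / W z \<le> 1"
    using q_le le_q h_le_bracket W by metis
  show "comparable_on Z (\<lambda>z. jump z + h z (T z) * g z) (\<lambda>z. bracket z * g z)"
  proof (rule comparable_onI[where a = "min 1 (c / C\<^sub>2)" and b = "C\<^sub>1 + C\<^sub>3"])
    show "0 < min 1 (c / C\<^sub>2)" "0 < C\<^sub>1 + C\<^sub>3" using C by auto
    fix z assume z: "z \<in> Z"
    note br = bracket_nonneg[OF z] and gz = g(2)[OF z] and Wz = W[OF z]
    have qp: "0 < q z (T z)" by (rule q_pos[OF z T_I[OF z]])
    have hn: "0 \<le> h z (T z)" by (rule h_nonneg[OF z T_I[OF z]])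
    have "jump z \<le> bracket z * 1 * q z (T z)"
      unfolding jump_def using br Wz qp by (intro mult_right_mono mult_left_mono) auto
    also have "\<dots> \<le> bracket z * (C\<^sub>1 * g z)" using br q_le[OF z] by (simp add: mult_left_mono)
    finally have "jump z \<le> C\<^sub>1 * (bracket z * g z)" by (simp add: mult_ac)
    moreover have "h z (T z) * g z \<le> C\<^sub>3 * (bracket z * g z)"
      using mult_right_mono[OF h_le[OF z] gz] by (simp add: mult_ac)
    ultimately show "jump z + h z (T z) * g z \<le> (C\<^sub>1 + C\<^sub>3) * (bracket z * g z)"
      by (simp add: algebra_simps)
    have bg: "0 \<le> bracket z * g z" using br gz by simp
    show "min 1 (c / C\<^sub>2) * (bracket z * g z) \<le> jump z + h z (T z) * g z"
    proof (cases "T z \<le> \<tau> z")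
      case True
      have "min 1 (c / C\<^sub>2) * (bracket z * g z) \<le> 1 * (bracket z * g z)"
        using bg by (intro mult_right_mono) auto
      then show ?thesis using bracket_eq[OF z True] jump_nonneg[OF z] by simp
    next
      case False
      have "min 1 (c / C\<^sub>2) * (bracket z * g z) \<le> c / C\<^sub>2 * (bracket z * g z)"
        using bg by (intro mult_right_mono) auto
      also have "\<dots> \<le> c / C\<^sub>2 * (bracket z * (C\<^sub>2 * q z (T z)))"
        using C br le_q[OF z] False by (intro mult_left_mono) auto
      also have "\<dots> = bracket z * c * q z (T z)" using C by simp
      also have "\<dots> \<le> jump z"
        unfolding jump_def using br Wz qp by (intro mult_right_mono mult_left_mono) auto
      finally show ?thesis using mult_nonneg_nonneg[OF hn gz] by simp
    qed
  qed
qed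

end

lemma (in green_setting) delta_bounded:
  assumes "bounded D"
  shows "\<exists>C>0. \<forall>x\<in>D. \<forall>y\<in>D. delta_max D x y \<le> C"
proof (cases "D = {}")
  case False
  then obtain x\<^sub>0 where x0: "x\<^sub>0 \<in> D" by auto
  obtain a where a: "a \<in> - D" using D_proper by auto
  have "dist_compl D x \<le> diameter D + dist x\<^sub>0 a" if "x \<in> D" for x
    using infdist_le[OF a, of x] dist_triangle[of x a x\<^sub>0] diameter_bounded_bound[OF assms that x0]
    by (simp add: dist_compl_def)
  then show ?thesis using diameter_pos[OF assms]
    by (intro exI[of _ "diameter D + dist x\<^sub>0 a"]) (auto simp: delta_max_def add_pos_nonneg)
qed (auto intro: exI[of _ 1])

lemma (in green_setting) green_eq:
  assumes z: "z \<in> pairs"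
  shows "green_function P S p (fst z) (snd z) = (\<integral>\<^sup>+s. ennreal (indicator {0<..} s * pz z s) \<partial>Uz z)"
proof -
  have xy: "fst z \<in> D" "snd z \<in> D" using pairsD[OF z] by auto
  interpret s: subordinator "P (Some (fst z))" S \<nu> by (rule subordinator[OF xy(1)])
  have meas: "(\<lambda>s. ennreal (indicator {0<..} s * pz z s)) \<in> borel_measurable borel"
    using p_measurable[OF xy] by measurable
  have "(\<integral>\<^sup>+s. ennreal (indicator {0<..} s * pz z s) \<partial>Uz z) =
      (\<integral>\<^sup>+t\<in>{0<..}. (\<integral>\<^sup>+s. ennreal (indicator {0<..} s * pz z s) \<partial>s.law t) \<partial>lborel)"
    by (rule s.nn_integral_potential[OF meas])
  also have "\<dots> = green_function P S p (fst z) (snd z)"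
    unfolding green_function_def sub_heat_kernel_def s.law_def
    by (intro nn_integral_cong arg_cong2[where f = "(*)"] refl) (simp split: split_indicator)
  finally show ?thesis ..
qed

text \<open>
  The constants of \<open>green_core\<close> exist by lemma \<open>core\<close>; fixing them makes the results in the time variable
  available in the geometric setting.
\<close>

locale green_setting_core = green_setting \<Phi> \<alpha>\<^sub>1 \<alpha>\<^sub>2 m R\<^sub>E d\<^sub>1 d\<^sub>2 D P S \<nu> p h \<Psi> R\<^sub>1 \<beta>\<^sub>1 \<beta>\<^sub>2 \<gamma>\<^sub>s
  for \<Phi> \<alpha>\<^sub>1 \<alpha>\<^sub>2 and m :: "'a::metric_space measure" and R\<^sub>E d\<^sub>1 d\<^sub>2 D
    and P :: "'a option \<Rightarrow> 'w measure" and S \<nu> p h \<Psi> R\<^sub>1 \<beta>\<^sub>1 \<beta>\<^sub>2 \<gamma>\<^sub>s +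
  fixes K \<gamma> \<gamma>' A\<^sub>f A\<^sub>v A\<^sub>h A\<^sub>s A\<^sub>s\<^sub>s A\<^sub>l A\<^sub>F a\<^sub>F :: real
  assumes core: "green_core pairs times Uz f (exp 1) K (1 / 24) hz vz pz Tz \<tau>z Wz
      \<beta>\<^sub>1 (min \<beta>\<^sub>2 1) (d\<^sub>1 / \<alpha>\<^sub>2) (d\<^sub>2 / \<alpha>\<^sub>1) \<gamma> \<gamma>\<^sub>s \<gamma>' A\<^sub>f A\<^sub>v A\<^sub>h A\<^sub>s A\<^sub>s\<^sub>s A\<^sub>l A\<^sub>F a\<^sub>F"
begin

sublocale c: green_core pairs times Uz f "exp 1" K "1 / 24" hz vz pz Tz \<tau>z Wz
      \<beta>\<^sub>1 "min \<beta>\<^sub>2 1" "d\<^sub>1 / \<alpha>\<^sub>2" "d\<^sub>2 / \<alpha>\<^sub>1" \<gamma> \<gamma>\<^sub>s \<gamma>' A\<^sub>f A\<^sub>v A\<^sub>h A\<^sub>s A\<^sub>s\<^sub>s A\<^sub>l A\<^sub>F a\<^sub>F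
  by (rule core)

abbreviation G :: "'a \<times> 'a \<Rightarrow> ennreal" where
  "G z \<equiv> green_function P S p (fst z) (snd z)"

abbreviation gz :: "'a \<times> 'a \<Rightarrow> real" where
  "gz z \<equiv> g0 D m \<nu> \<Phi> d\<^sub>1 d\<^sub>2 \<alpha>\<^sub>1 \<alpha>\<^sub>2 \<beta>\<^sub>1 \<beta>\<^sub>2 (fst z) (snd z)"

text \<open>
  In a bounded domain the times after \<open>2 \<Phi>(diam D)\<close> contribute no more than one dyadic block of
  times just before.
\<close>

lemma green_times_comparable: "\<exists>C>0. \<forall>z\<in>pairs. c.green z \<le> G z \<and> G z \<le> ennreal C * c.green z"
proof (cases "bounded D")
  case False
  have "G z = c.green z" if z: "z \<in> pairs" for z
    unfolding green_eq[OF z] times_unbounded[OF False]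
    by (intro nn_integral_cong) (simp split: split_indicator)
  then show ?thesis by (intro exI[of _ 1]) simp
next
  case True
  let ?b = "\<Phi> (diameter D)"
  obtain C l where C: "0 < C" "0 < l" and tail: "\<And>t x y. 2 * ?b \<le> t \<Longrightarrow> x \<in> D \<Longrightarrow> y \<in> D \<Longrightarrow>
      p t x y \<le> C * exp (- l * t) * h ?b x y"
    using extent True by blast
  obtain V where V: "0 < V" "\<And>x. x \<in> D \<Longrightarrow> vol m x (diameter D) \<le> V"
    using vol_bounded_region[OF True diameter_pos[OF True], of "diameter D"] by auto
  have b: "?b \<in> times" "0 < ?b" using times_top[OF True] times_pos by auto
  define k where "k = 1 / 24 * (a\<^sub>F / (2 * K * A\<^sub>v)) * (f ?b / V)"
  have k: "0 < k" using c.pos c.K V(1) f_pos[OF b(2)] by (simp add: k_def)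
  have lp: "0 < laplace_exponent \<nu> l" by (rule laplace_pos[OF C(2)])
  define E where "E = C / laplace_exponent \<nu> l / k"
  have E: "0 < E" using C lp k by (simp add: E_def)
  have "c.green z \<le> G z \<and> G z \<le> ennreal (1 + E) * c.green z" if z: "z \<in> pairs" for z
  proof
    have xy: "fst z \<in> D" "snd z \<in> D" using pairsD[OF z] by auto
    interpret s: subordinator "P (Some (fst z))" S \<nu> by (rule subordinator[OF xy(1)])
    have hb: "0 \<le> hz z ?b" by (rule h_nonneg[OF z b(2)])
    show "c.green z \<le> G z"
      unfolding green_eq[OF z] by (intro nn_integral_mono) (auto simp: times_pos split: split_indicator)
    have "G z \<le> (\<integral>\<^sup>+s. ennreal (indicator {0<..} s * pz z s) * indicator times s
        + ennreal (C * hz z ?b) * ennreal (exp (- l * s)) \<partial>Uz z)"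
      unfolding green_eq[OF z]
    proof (rule nn_integral_mono)
      fix s
      show "ennreal (indicator {0<..} s * pz z s) \<le> ennreal (indicator {0<..} s * pz z s) * indicator times s
        + ennreal (C * hz z ?b) * ennreal (exp (- l * s))"
      proof (cases "s \<in> times \<or> s \<le> 0")
        case True
        then show ?thesis by (auto simp: add_increasing2)
      next
        case False
        then have "2 * ?b \<le> s" using times_bounded[OF True] by auto
        from tail[OF this xy] have "ennreal (pz z s) \<le> ennreal ((C * hz z ?b) * exp (- l * s))"
          by (intro ennreal_leI) (simp add: mult_ac)
        then show ?thesis using False C hb by (simp add: ennreal_mult)
      qed
    qed
    also have "\<dots> = (\<integral>\<^sup>+s. ennreal (indicator {0<..} s * pz z s) * indicator times s \<partial>Uz z)
        + (\<integral>\<^sup>+s. ennreal (C * hz z ?b) * ennreal (exp (- l * s)) \<partial>Uz z)"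
    proof (rule nn_integral_add)
      note [measurable] = p_measurable[OF xy] c.I_meas
      have "(\<lambda>s. ennreal (indicator {0<..} s * pz z s) * indicator times s) \<in> borel_measurable borel"
        by measurable
      then show "(\<lambda>s. ennreal (indicator {0<..} s * pz z s) * indicator times s) \<in> borel_measurable (Uz z)"
        using measurable_cong_sets[OF sets_Uz[OF z] refl, of "borel :: ennreal measure"] by simp
      have "(\<lambda>s. ennreal (C * hz z ?b) * ennreal (exp (- l * s))) \<in> borel_measurable borel"
        by measurable
      then show "(\<lambda>s. ennreal (C * hz z ?b) * ennreal (exp (- l * s))) \<in> borel_measurable (Uz z)"
        using measurable_cong_sets[OF sets_Uz[OF z] refl, of "borel :: ennreal measure"] by simp
    qed
    also have "(\<integral>\<^sup>+s. ennreal (indicator {0<..} s * pz z s) * indicator times s \<partial>Uz z) = c.green z"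
      by (intro nn_integral_cong) (auto simp: times_pos split: split_indicator)
    also have "(\<integral>\<^sup>+s. ennreal (C * hz z ?b) * ennreal (exp (- l * s)) \<partial>Uz z) =
        ennreal (C * hz z ?b) * (\<integral>\<^sup>+s. ennreal (exp (- l * s)) \<partial>Uz z)"
      by (rule nn_integral_cmult) measurable
    also have "\<dots> \<le> ennreal (C * hz z ?b) * ennreal (1 / laplace_exponent \<nu> l)"
      using C lp by (intro mult_left_mono s.potential_laplace_le) auto
    also have "\<dots> = ennreal (E * (k * hz z ?b))"
      using C lp k hb by (simp add: ennreal_mult[symmetric] E_def mult_ac)
    also have "\<dots> \<le> ennreal E * c.green z"
    proof -
      have "vz z ?b \<le> V" using V(2)[OF xy(1)] diameter_pos[OF True] by (simp add: gen_inv_\<Phi>)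
      then have "f ?b / V \<le> c.q z ?b"
        unfolding c.q_def using f_pos[OF b(2)] vz_pos[OF b(2), of z] by (intro divide_left_mono) auto
      then have "k * hz z ?b \<le> 1 / 24 * (a\<^sub>F / (2 * K * A\<^sub>v)) * (hz z ?b * c.q z ?b)"
        unfolding k_def mult.assoc mult.commute[of "hz z ?b"] using c.pos c.K hb
        by (intro mult_left_mono mult_right_mono) auto
      then have "ennreal (k * hz z ?b) \<le> ennreal (1 / 24 * (a\<^sub>F / (2 * K * A\<^sub>v)) * (hz z ?b * c.q z ?b))"
        by (rule ennreal_leI)
      also have "\<dots> \<le> c.green z"
        using rho_diameter[OF True z] diameter_pos[OF True] by (intro c.q_lower_bound z b) (simp add: le_iff)
      finally have "ennreal E * ennreal (k * hz z ?b) \<le> ennreal E * c.green z" by (rule mult_left_mono) simp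
      then show ?thesis using E k hb by (simp add: ennreal_mult)
    qed
    finally have "G z \<le> c.green z + ennreal E * c.green z" by (simp add: add_left_mono)
    also have "\<dots> = ennreal (1 + E) * c.green z" using E by (simp add: distrib_right)
    finally show "G z \<le> ennreal (1 + E) * c.green z" .
  qed
  then show ?thesis using E by (intro exI[of _ "1 + E"]) auto
qed

lemma ecomparable_green: "ecomparable_on pairs c.green X \<Longrightarrow> ecomparable_on pairs G X"
proof -
  assume "ecomparable_on pairs c.green X"
  then obtain a b where a: "0 < a" "0 < b" "\<And>z. z \<in> pairs \<Longrightarrow> ennreal (a * X z) \<le> c.green z \<and> c.green z \<le> ennreal (b * X z)"
    unfolding ecomparable_on_def by blast
  obtain C where C: "0 < C" "\<And>z. z \<in> pairs \<Longrightarrow> c.green z \<le> G z \<and> G z \<le> ennreal C * c.green z"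
    using green_times_comparable by blast
  have "ennreal (a * X z) \<le> G z \<and> G z \<le> ennreal (C * b * X z)" if z: "z \<in> pairs" for z
  proof
    show "ennreal (a * X z) \<le> G z" using a(3)[OF z] C(2)[OF z] order_trans by blast
    have "G z \<le> ennreal C * ennreal (b * X z)"
      using C(2)[OF z] a(3)[OF z] mult_left_mono[of "c.green z" "ennreal (b * X z)" "ennreal C"] order_trans by fastforce
    then show "G z \<le> ennreal (C * b * X z)" using C(1) by (simp add: ennreal_mult' mult.assoc)
  qed
  then show ?thesis using a C unfolding ecomparable_on_def by (meson mult_pos_pos)
qed

lemma psi_eq: "psi \<nu> \<Phi> r = f (\<Phi> r)"
  by (simp add: psi_def renewal_scale_def)

text \<open>
  Truncation of the depth is invisible here: where it is effective, \<open>\<rho>\<close> is at most either depth, and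
  both sides equal \<open>h(\<Phi>(\<rho>))\<close>.
\<close>

lemma bracket_eq_h_bracket:
  assumes z: "z \<in> pairs"
  shows "c.bracket z = h_bracket D \<nu> \<Phi> h (fst z) (snd z)"
proof -
  let ?d = "delta_max D (fst z) (snd z)"
  have p: "0 < rho z" "0 < depth z" "0 < ?d"
    using pairsD[OF z] depth_pos[OF z] depth_le(1)[of z] by auto
  show ?thesis
  proof (cases rule: depth_cases[of z])
    case 1
    have "\<Phi> (min (rho z) ?d) = min (Tz z) (\<tau>z z)" using p 1 by (auto simp: min_def le_iff)
    then show ?thesis unfolding c.bracket_def h_bracket_def psi_eq using 1 by simp
  next
    case 2
    have le: "rho z \<le> depth z" "rho z \<le> ?d" using rho_diameter[OF 2(1) z] 2 by auto
    then have "c.bracket z = hz z (Tz z)" using p by (intro c.bracket_eq z) (simp add: le_iff)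
    moreover have "Tz z * f (Tz z) \<le> \<Phi> ?d * f (\<Phi> ?d)"
      using p le by (intro c.tf_mono \<Phi>_pos) (auto simp: le_iff)
    then have "1 \<le> \<Phi> ?d * f (\<Phi> ?d) / (Tz z * f (Tz z))"
      using p f_pos \<Phi>_pos by (simp add: le_divide_eq)
    ultimately show ?thesis unfolding h_bracket_def psi_eq using le by (simp add: min_def)
  qed
qed

subsection \<open>The three regimes\<close>

text \<open>
  The function \<open>k\<close> is a sharp on-diagonal term in the time variable, it is comparable to \<open>g\<^sub>0\<close>, and
  it has the two relations to \<open>q T\<close> needed in \<open>sharp_bracket\<close>.
\<close>

definition matches :: "('a \<times> 'a \<Rightarrow> real) \<Rightarrow> bool" where
  "matches k \<longleftrightarrow> c.sharp k \<and> (\<forall>z\<in>pairs. 0 \<le> k z) \<and> comparable_on pairs k gz \<and>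
    (\<exists>C>0. \<forall>z\<in>pairs. c.q z (Tz z) \<le> C * k z) \<and>
    (\<exists>C>0. \<forall>z\<in>pairs. \<tau>z z < Tz z \<longrightarrow> k z \<le> C * c.q z (Tz z))"

lemma q_T: "z \<in> pairs \<Longrightarrow> c.q z (Tz z) = psi \<nu> \<Phi> (rho z) / vol m (fst z) (rho z)"
  by (simp add: c.q_def psi_eq gen_inv_\<Phi>)

lemma matches_transient:
  assumes "d\<^sub>1 > \<alpha>\<^sub>2 * min \<beta>\<^sub>2 1"
  shows "matches (\<lambda>z. c.q z (Tz z))"
proof -
  have "c.sharp (\<lambda>z. c.q z (Tz z))"
    using assms ab by (intro c.sharp_transient) (simp add: less_divide_eq mult.commute)
  moreover have "comparable_on pairs (\<lambda>z. c.q z (Tz z)) gz"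
    unfolding comparable_on_def using assms
    by (intro exI[of _ 1] conjI) (auto simp: g0_def q_T)
  ultimately show ?thesis
    unfolding matches_def using c.q_pos[OF _ c.T_I] by (auto intro!: exI[of _ 1] less_imp_le)
qed

lemma matches_recurrent:
  assumes "\<not> d\<^sub>1 > \<alpha>\<^sub>2 * min \<beta>\<^sub>2 1" and "\<not> (d\<^sub>1 = d\<^sub>2 \<and> d\<^sub>2 = \<alpha>\<^sub>1 * \<beta>\<^sub>1 \<and> \<alpha>\<^sub>1 * \<beta>\<^sub>1 = \<alpha>\<^sub>2 * \<beta>\<^sub>2)"
    and lt: "d\<^sub>2 < \<alpha>\<^sub>1 * \<beta>\<^sub>1"
  shows "matches (\<lambda>z. c.q z (c.Mx z))"
proof -
  have lt': "d\<^sub>2 / \<alpha>\<^sub>1 < \<beta>\<^sub>1" using lt ab by (simp add: divide_less_eq mult.commute)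
  have gz: "gz z = f (\<Phi> (max (rho z) (delta_max D (fst z) (snd z)))) / vol m (fst z) (max (rho z) (delta_max D (fst z) (snd z)))" for z
    using assms by (simp only: g0_def if_False if_True psi_eq)
  have q: "c.q z (c.Mx z) = f (\<Phi> (max (rho z) (depth z))) / vol m (fst z) (max (rho z) (depth z))" if z: "z \<in> pairs" for z
  proof -
    have "c.Mx z = \<Phi> (max (rho z) (depth z))" using pairsD[OF z] depth_pos[OF z] by (auto simp: max_def le_iff)
    moreover have "0 \<le> max (rho z) (depth z)" by (simp add: le_max_iff_disj)
    ultimately show ?thesis by (simp add: c.q_def gen_inv_\<Phi>)
  qed
  have "comparable_on pairs (\<lambda>z. c.q z (c.Mx z)) gz"
  proof (cases "bounded D")
    case False
    then have "c.q z (c.Mx z) = gz z" if "z \<in> pairs" for z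
      using q[OF that] gz[of z] by (simp add: depth_def)
    then show ?thesis by (intro comparable_onI[of 1 1]) (simp_all only: mult_1_left order_refl zero_less_one)
  next
    case True
    let ?d = "diameter D"
    have dp: "0 < ?d" by (rule diameter_pos[OF True])
    obtain \<Delta> where \<Delta>: "0 < \<Delta>" "\<And>x y. x \<in> D \<Longrightarrow> y \<in> D \<Longrightarrow> delta_max D x y \<le> \<Delta>"
      using delta_bounded[OF True] by blast
    obtain c C where cC: "0 < c" "0 < C" "\<And>x r. x \<in> D \<Longrightarrow> ?d \<le> r \<Longrightarrow> r \<le> max ?d \<Delta> \<Longrightarrow> c \<le> vol m x r \<and> vol m x r \<le> C"
      using vol_bounded_region[OF True dp] by metis
    define B where "B = f (\<Phi> (max ?d \<Delta>)) / f (\<Phi> ?d)"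
    have fp: "0 < f (\<Phi> r)" if "0 < r" for r using f_pos \<Phi>_pos that by blast
    have fm: "f (\<Phi> r) \<le> f (\<Phi> s)" if "0 < r" "r \<le> s" for r s
      using that by (intro c.f_mono \<Phi>_pos) (auto simp: le_iff)
    have B: "0 < B" using fp dp by (auto simp: B_def max_def)
    have main: "c.q z (c.Mx z) \<le> (1 + C / c) * gz z \<and> gz z \<le> (1 + B) * c.q z (c.Mx z)" if z: "z \<in> pairs" for z
    proof (cases rule: depth_cases[of z])
      case 1
      then have eq: "c.q z (c.Mx z) = gz z" using q[OF z] gz[of z] by simp
      have "0 \<le> c.q z (c.Mx z)" using c.q_pos[OF z c.Mx_I[OF z]] by simp
      then show ?thesis using eq cC B mult_right_mono[of 1 "1 + C / c" "gz z"] mult_right_mono[of 1 "1 + B" "gz z"] by simp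
    next
      case 2
      let ?e = "delta_max D (fst z) (snd z)"
      have x: "fst z \<in> D" "snd z \<in> D" using pairsD[OF z] by auto
      have r: "rho z \<le> ?d" using rho_diameter[OF True z] .
      have e: "?d \<le> ?e" "?e \<le> max ?d \<Delta>" using 2 \<Delta>(2)[OF x] by auto
      have qz: "c.q z (c.Mx z) = f (\<Phi> ?d) / vol m (fst z) ?d" using q[OF z] 2 r by (simp add: max_def)
      have gzz: "gz z = f (\<Phi> ?e) / vol m (fst z) ?e" using gz[of z] 2 r by (simp add: max_def)
      have vd: "c \<le> vol m (fst z) ?d" and ve: "vol m (fst z) ?e \<le> C"
        using cC(3)[OF x(1)] e by auto
      have vp: "0 < vol m (fst z) ?d" "0 < vol m (fst z) ?e" "vol m (fst z) ?d \<le> vol m (fst z) ?e"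
        using vol_pos vol_mono dp e by auto
      have "f (\<Phi> ?d) / vol m (fst z) ?d \<le> f (\<Phi> ?e) / c"
        using fm[OF dp e(1)] fp[OF dp] fp[of ?e] dp e vd cC by (intro frac_le) auto
      also have "\<dots> = f (\<Phi> ?e) / C * (C / c)" using cC by simp
      also have "\<dots> \<le> f (\<Phi> ?e) / vol m (fst z) ?e * (1 + C / c)"
        using ve vp cC fp[of ?e] dp e by (intro mult_mono divide_left_mono) auto
      finally have 1: "c.q z (c.Mx z) \<le> (1 + C / c) * gz z" by (simp add: qz gzz mult.commute)
      have "f (\<Phi> ?e) \<le> f (\<Phi> (max ?d \<Delta>))" using dp e by (intro fm) auto
      then have "f (\<Phi> ?e) \<le> B * f (\<Phi> ?d)" using fp[OF dp] by (simp add: B_def)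
      then have "f (\<Phi> ?e) / vol m (fst z) ?e \<le> B * f (\<Phi> ?d) / vol m (fst z) ?d"
        using vp fp[OF dp] fp[of ?e] dp e B by (intro frac_le) auto
      also have "\<dots> = B * c.q z (c.Mx z)" by (simp add: qz)
      also have "\<dots> \<le> (1 + B) * c.q z (c.Mx z)"
        using c.q_pos[OF z c.Mx_I[OF z]] by (intro mult_right_mono) auto
      finally have 2: "gz z \<le> (1 + B) * c.q z (c.Mx z)" by (simp add: gzz)
      show ?thesis using 1 2 by simp
    qed
    show ?thesis
    proof (rule comparable_onI[where a = "1 / (1 + B)" and b = "1 + C / c"])
      show "0 < 1 / (1 + B)" "0 < 1 + C / c" using B cC by (auto intro: add_pos_pos)
      fix z assume z: "z \<in> pairs"
      show "1 / (1 + B) * gz z \<le> c.q z (c.Mx z)"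
        using main[OF z] B by (simp add: pos_divide_le_eq mult.commute)
      show "c.q z (c.Mx z) \<le> (1 + C / c) * gz z" using main[OF z] by simp
    qed
  qed
  moreover have "c.q z (Tz z) \<le> (A\<^sub>f * A\<^sub>v) * c.q z (c.Mx z)" if z: "z \<in> pairs" for z
  proof -
    have "c.q z (Tz z) \<le> A\<^sub>f * A\<^sub>v * (Tz z / c.Mx z) powr (\<beta>\<^sub>1 - d\<^sub>2 / \<alpha>\<^sub>1) * c.q z (c.Mx z)"
      using c.T_pos[OF z] by (intro c.q_lower z c.Mx_I) auto
    also have "\<dots> \<le> A\<^sub>f * A\<^sub>v * 1 * c.q z (c.Mx z)"
    proof -
      have e: "0 \<le> \<beta>\<^sub>1 - d\<^sub>2 / \<alpha>\<^sub>1" using lt' by simp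
      have "x powr (\<beta>\<^sub>1 - d\<^sub>2 / \<alpha>\<^sub>1) \<le> 1" if "0 \<le> x" "x \<le> 1" for x
        using that e by (intro powr_le1) auto
      moreover have "0 \<le> Tz z / c.Mx z" "Tz z / c.Mx z \<le> 1"
        using c.T_pos[OF z] c.Mx_pos[OF z] by (auto simp: divide_le_eq)
      ultimately have "(Tz z / c.Mx z) powr (\<beta>\<^sub>1 - d\<^sub>2 / \<alpha>\<^sub>1) \<le> 1" by blast
      then show ?thesis using c.pos c.q_pos[OF z c.Mx_I[OF z]]
        by (intro mult_right_mono mult_left_mono) simp_all
    qed
    finally show ?thesis by simp
  qed
  then have "\<exists>C>0. \<forall>z\<in>pairs. c.q z (Tz z) \<le> C * c.q z (c.Mx z)"
    using c.pos by (intro exI[of _ "A\<^sub>f * A\<^sub>v"]) auto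
  moreover have "\<exists>C>0. \<forall>z\<in>pairs. \<tau>z z < Tz z \<longrightarrow> c.q z (c.Mx z) \<le> C * c.q z (Tz z)"
    by (intro exI[of _ 1]) (auto simp: max_def)
  ultimately show ?thesis
    unfolding matches_def using c.sharp_recurrent[OF lt'] c.q_pos[OF _ c.Mx_I] by (auto intro: less_imp_le)
qed

text \<open>
  In the critical case \<open>q\<close> is constant in time up to factors. For its independence of the point, two
  points are compared at the time scale of their distance, where their balls have comparable volumes;
  in a bounded domain the scale of the diameter serves for all points.
\<close>

lemma q_bounded:
  assumes "min \<beta>\<^sub>2 1 \<le> d\<^sub>1 / \<alpha>\<^sub>2" and "d\<^sub>2 / \<alpha>\<^sub>1 \<le> \<beta>\<^sub>1"
  shows "\<exists>a>0. \<exists>b>0. \<forall>z\<in>pairs. \<forall>t\<in>times. a \<le> c.q z t \<and> c.q z t \<le> b"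
proof -
  let ?B = "A\<^sub>f * A\<^sub>v"
  have B: "0 < ?B" using c.pos by simp
  have flat: "c.q z s \<le> ?B * c.q z t" if z: "z \<in> pairs" and st: "s \<in> times" "t \<in> times" for z s t
  proof -
    have p: "0 < s" "0 < t" "0 < c.q z t" using times_pos st c.q_pos[OF z st(2)] by auto
    consider "s \<le> t" | "t \<le> s" by linarith
    then have "\<exists>e\<ge>0. \<exists>r. 0 \<le> r \<and> r \<le> 1 \<and> c.q z s \<le> ?B * r powr e * c.q z t"
    proof cases
      case 1
      then show ?thesis using c.q_lower[OF z p(1) 1 st(2)] assms(2) p
        by (intro exI[of _ "\<beta>\<^sub>1 - d\<^sub>2 / \<alpha>\<^sub>1"] conjI exI[of _ "s / t"]) auto
    next
      case 2
      then show ?thesis using c.q_upper[OF z p(2) 2 st(1)] assms(1) p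
        by (intro exI[of _ "d\<^sub>1 / \<alpha>\<^sub>2 - min \<beta>\<^sub>2 1"] conjI exI[of _ "t / s"]) auto
    qed
    then obtain e r where er: "0 \<le> e" "0 \<le> r" "r \<le> 1" "c.q z s \<le> ?B * r powr e * c.q z t" by blast
    have "?B * r powr e * c.q z t \<le> ?B * 1 * c.q z t"
      using er p B by (intro mult_right_mono mult_left_mono powr_le1) auto
    then show ?thesis using er by simp
  qed
  obtain a b where ab: "0 < a" "0 < b" and ref: "\<And>z. z \<in> pairs \<Longrightarrow> \<exists>t\<in>times. a \<le> c.q z t \<and> c.q z t \<le> b"
  proof (cases "bounded D")
    case True
    let ?b = "\<Phi> (diameter D)"
    obtain c C where cC: "0 < c" "0 < C" "\<And>x. x \<in> D \<Longrightarrow> c \<le> vol m x (diameter D) \<and> vol m x (diameter D) \<le> C"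
      using vol_bounded_region[OF True diameter_pos[OF True], of "diameter D"] by auto
    have fb: "0 < f ?b" using f_pos times_pos[OF times_top[OF True]] by blast
    show ?thesis
    proof (rule that[of "f ?b / C" "f ?b / c"])
      fix z assume z: "z \<in> pairs"
      have "c.q z ?b = f ?b / vol m (fst z) (diameter D)"
        using diameter_pos[OF True] by (simp add: c.q_def gen_inv_\<Phi>)
      moreover have "c \<le> vol m (fst z) (diameter D)" "vol m (fst z) (diameter D) \<le> C"
        using cC(3) pairsD[OF z] by auto
      ultimately have "f ?b / C \<le> c.q z ?b \<and> c.q z ?b \<le> f ?b / c"
        using fb cC by (auto intro!: divide_left_mono)
      then show "\<exists>t\<in>times. f ?b / C \<le> c.q z t \<and> c.q z t \<le> f ?b / c"
        using times_top[OF True] by blast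
    qed (use fb cC in auto)
  next
    case False
    show ?thesis
    proof (cases "pairs = {}")
      case True
      then show ?thesis using that[of 1 1] by auto
    next
      case ne: False
      then obtain z0 where z0: "z0 \<in> pairs" by auto
      let ?o = "fst z0"
      obtain C where C: "1 \<le> C" and vs: "\<And>x r R. 0 < r \<Longrightarrow> r \<le> R \<Longrightarrow> vol m x R \<le> C * (R / r) powr d\<^sub>2 * vol m x r"
        using vol_scaling[of \<infinity>] extent False by auto
      define E where "E = C * 2 powr d\<^sub>2"
      have E: "0 < E" using C by (simp add: E_def)
      have dbl: "vol m x R \<le> E * vol m y R" if "dist x y \<le> R" "0 < R" for x y R
      proof -
        have "vol m x R \<le> vol m y (2 * R)"
        proof (rule vol_subset, rule subsetI)
          fix w assume "w \<in> ball x R"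
          then show "w \<in> ball y (2 * R)" using dist_triangle[of y w x] that by (simp add: dist_commute)
        qed
        also have "\<dots> \<le> E * vol m y R" using vs[of R "2 * R" y] that by (simp add: E_def)
        finally show ?thesis .
      qed
      have one: "1 \<in> times" using times_unbounded[OF False] by simp
      have q0: "0 < c.q z0 1" by (rule c.q_pos[OF z0 one])
      show ?thesis
      proof (rule that[of "c.q z0 1 / ?B / E" "?B * c.q z0 1 * E"])
        fix z assume z: "z \<in> pairs"
        define R where "R = dist (fst z) ?o + 1"
        have R: "0 < R" "dist (fst z) ?o \<le> R" "dist ?o (fst z) \<le> R"
          by (auto simp: R_def dist_commute intro: add_nonneg_pos)
        have t: "\<Phi> R \<in> times" using times_unbounded[OF False] \<Phi>_pos[OF R(1)] by simp
        have qR: "c.q w (\<Phi> R) = f (\<Phi> R) / vol m (fst w) R" for w using R by (simp add: c.q_def gen_inv_\<Phi>)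
        have fR: "0 < f (\<Phi> R)" using f_pos times_pos[OF t] by blast
        have vp: "0 < vol m (fst z) R" "0 < vol m ?o R" using vol_pos R by auto
        have "c.q z0 (\<Phi> R) / E \<le> c.q z (\<Phi> R)"
          using dbl[OF R(2,1)] vp E fR unfolding qR by (simp add: field_simps)
        moreover have "c.q z0 1 / ?B \<le> c.q z0 (\<Phi> R)" using flat[OF z0 one t] B by (simp add: field_simps)
        then have "c.q z0 1 / ?B / E \<le> c.q z0 (\<Phi> R) / E" using E by (intro divide_right_mono) auto
        moreover have "c.q z (\<Phi> R) \<le> c.q z0 (\<Phi> R) * E"
          using dbl[OF R(3,1)] vp E fR unfolding qR by (simp add: field_simps)
        moreover have "c.q z0 (\<Phi> R) * E \<le> ?B * c.q z0 1 * E"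
          using flat[OF z0 t one] E by (intro mult_right_mono) auto
        ultimately have "c.q z0 1 / ?B / E \<le> c.q z (\<Phi> R) \<and> c.q z (\<Phi> R) \<le> ?B * c.q z0 1 * E" by linarith
        then show "\<exists>t\<in>times. c.q z0 1 / ?B / E \<le> c.q z t \<and> c.q z t \<le> ?B * c.q z0 1 * E" using t by blast
      qed (use q0 B E in auto)
    qed
  qed
  have "a / ?B \<le> c.q z t \<and> c.q z t \<le> ?B * b" if z: "z \<in> pairs" and t: "t \<in> times" for z t
  proof -
    obtain s where s: "s \<in> times" "a \<le> c.q z s" "c.q z s \<le> b" using ref[OF z] by blast
    have "a \<le> ?B * c.q z t" using flat[OF z s(1) t] s by simp
    moreover have "c.q z t \<le> ?B * b"
      using flat[OF z t s(1)] mult_left_mono[OF s(3), of ?B] B by simp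
    ultimately show ?thesis using B by (simp add: field_simps)
  qed
  then show ?thesis using ab B by (intro exI[of _ "a / ?B"] conjI exI[of _ "?B * b"]) auto
qed

lemma depth_ge: "\<exists>B\<ge>1. \<forall>z\<in>pairs. delta_max D (fst z) (snd z) \<le> B * depth z"
proof (cases "bounded D")
  case False
  then show ?thesis by (intro exI[of _ 1]) (simp add: depth_def)
next
  case True
  obtain \<Delta> where \<Delta>: "0 < \<Delta>" "\<And>x y. x \<in> D \<Longrightarrow> y \<in> D \<Longrightarrow> delta_max D x y \<le> \<Delta>"
    using delta_bounded[OF True] by blast
  note dp = diameter_pos[OF True]
  have "delta_max D (fst z) (snd z) \<le> (1 + \<Delta> / diameter D) * depth z" if z: "z \<in> pairs" for z
  proof (cases rule: depth_cases[of z])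
    case 1
    then show ?thesis using depth_pos[OF z] \<Delta> dp mult_right_mono[of 1 "1 + \<Delta> / diameter D" "depth z"] by simp
  next
    case 2
    have "delta_max D (fst z) (snd z) \<le> \<Delta>" using \<Delta>(2) pairsD[OF z] by blast
    also have "\<dots> \<le> (1 + \<Delta> / diameter D) * depth z" using 2 dp by (simp add: algebra_simps)
    finally show ?thesis .
  qed
  then show ?thesis using \<Delta> dp by (intro exI[of _ "1 + \<Delta> / diameter D"]) auto
qed

text \<open>
  Both logarithms are comparable to \<open>1 + ln r\<close>, where \<open>r = max 1 (depth / \<rho>)\<close>, by the power bounds for \<open>\<Phi>\<close>.
\<close>

lemma matches_critical:
  assumes nt: "\<not> d\<^sub>1 > \<alpha>\<^sub>2 * min \<beta>\<^sub>2 1"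
    and eq: "d\<^sub>1 = d\<^sub>2" "d\<^sub>2 = \<alpha>\<^sub>1 * \<beta>\<^sub>1" "\<alpha>\<^sub>1 * \<beta>\<^sub>1 = \<alpha>\<^sub>2 * \<beta>\<^sub>2"
  shows "matches (\<lambda>z. c.q z (Tz z) * (1 + ln (c.Mx z / Tz z)))"
proof -
  let ?L = "\<lambda>z. ln (c.Mx z / Tz z)"
  have le: "min \<beta>\<^sub>2 1 \<le> d\<^sub>1 / \<alpha>\<^sub>2" "d\<^sub>2 / \<alpha>\<^sub>1 \<le> \<beta>\<^sub>1" using eq ab by (auto simp: field_simps)
  have gz: "gz z = ln (exp 1 + delta_max D (fst z) (snd z) / rho z)" for z
    using nt eq by (simp only: g0_def if_False if_True simp_thms)
  obtain a b where ab': "0 < a" "0 < b" and q: "\<And>z t. z \<in> pairs \<Longrightarrow> t \<in> times \<Longrightarrow> a \<le> c.q z t \<and> c.q z t \<le> b"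
    using q_bounded[OF le] by blast
  obtain B where B: "1 \<le> B" and dB: "\<And>z. z \<in> pairs \<Longrightarrow> delta_max D (fst z) (snd z) \<le> B * depth z"
    using depth_ge by blast
  obtain c C where cC: "0 < c" "0 < C" and sc: "\<And>r R. 0 < r \<Longrightarrow> r \<le> R \<Longrightarrow>
      c * (R / r) powr \<alpha>\<^sub>1 \<le> \<Phi> R / \<Phi> r \<and> \<Phi> R / \<Phi> r \<le> C * (R / r) powr \<alpha>\<^sub>2"
    using ratio_bounds by blast
  define k1 where "k1 = 2 * (1 + \<bar>ln C\<bar> + \<alpha>\<^sub>2)"
  define k2 where "k2 = ln (exp 1 + B) + (1 + \<bar>ln c\<bar>) / \<alpha>\<^sub>1"
  have k1: "0 < k1" using ab by (simp add: k1_def add_pos_pos)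
  have lB: "0 < ln (exp 1 + B)" using B exp_ge_add_one_self[of 1] by (intro ln_gt_zero) simp
  have k2: "0 < k2" using lB ab by (simp add: k2_def add_pos_nonneg)
  have logs: "0 \<le> ?L z \<and> 1 + ?L z \<le> k1 * gz z \<and> gz z \<le> k2 * (1 + ?L z)" if z: "z \<in> pairs" for z
  proof -
    let ?d = "delta_max D (fst z) (snd z)"
    have p: "0 < rho z" "0 < depth z" using pairsD[OF z] depth_pos[OF z] by auto
    define R where "R = max (rho z) (depth z)"
    define r where "r = R / rho z"
    have R: "rho z \<le> R" "0 < R" using p by (auto simp: R_def)
    have r: "1 \<le> r" "depth z / rho z \<le> r" using p by (auto simp: r_def R_def divide_right_mono le_divide_eq)
    have Mx: "c.Mx z = \<Phi> R" unfolding R_def using p by (auto simp: max_def le_iff)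
    have L0: "0 \<le> ?L z" using c.T_pos[OF z] by (intro ln_ge_zero) (auto simp: le_divide_eq)
    have lr: "0 \<le> ln r" using r by simp
    note s = sc[OF p(1) R(1), folded Mx r_def]
    have MT: "0 < c.Mx z / Tz z" using c.Mx_pos[OF z] c.T_pos[OF z] by simp
    have "?L z \<le> ln (C * r powr \<alpha>\<^sub>2)" using s MT by (intro ln_mono) auto
    also have "\<dots> = ln C + \<alpha>\<^sub>2 * ln r" using cC r by (simp add: ln_mult ln_powr)
    finally have up: "?L z \<le> \<bar>ln C\<bar> + \<alpha>\<^sub>2 * ln r" by simp
    have "ln (c * r powr \<alpha>\<^sub>1) \<le> ?L z" using s cC r MT by (intro ln_mono) auto
    moreover have "ln (c * r powr \<alpha>\<^sub>1) = ln c + \<alpha>\<^sub>1 * ln r" using cC r by (simp add: ln_mult ln_powr)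
    ultimately have "\<alpha>\<^sub>1 * ln r \<le> ?L z + \<bar>ln c\<bar>" by simp
    then have lo: "ln r \<le> (?L z + \<bar>ln c\<bar>) / \<alpha>\<^sub>1" using ab by (simp add: field_simps)
    have d0: "0 \<le> ?d" "depth z \<le> ?d" using depth_le(1)[of z] p by auto
    have e1: "1 \<le> (exp 1 :: real)" by simp
    have "?d / rho z \<le> B * depth z / rho z" using dB[OF z] p by (intro divide_right_mono) auto
    also have "\<dots> \<le> B * r" using r B by (simp add: mult_left_mono flip: times_divide_eq_right)
    finally have "?d / rho z \<le> B * r" .
    moreover have "exp 1 * 1 \<le> exp 1 * r" using r(1) by (rule mult_left_mono) simp
    ultimately have "exp 1 + ?d / rho z \<le> exp 1 * r + B * r" by linarith
    then have "gz z \<le> ln ((exp 1 + B) * r)"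
      unfolding gz using d0 p by (intro ln_mono) (auto simp: algebra_simps add_pos_nonneg)
    also have "\<dots> = ln (exp 1 + B) + ln r" using r B by (intro ln_mult_pos) (auto simp: add_pos_nonneg)
    also have "\<dots> \<le> ln (exp 1 + B) + (?L z + \<bar>ln c\<bar>) / \<alpha>\<^sub>1" using lo by simp
    also have "\<dots> \<le> k2 * (1 + ?L z)"
    proof -
      have "(?L z + \<bar>ln c\<bar>) / \<alpha>\<^sub>1 \<le> (1 + \<bar>ln c\<bar>) / \<alpha>\<^sub>1 * (1 + ?L z)"
      proof -
        have "?L z + \<bar>ln c\<bar> \<le> (1 + \<bar>ln c\<bar>) * (1 + ?L z)"
          using L0 mult_nonneg_nonneg[OF abs_ge_zero[of "ln c"] L0] by (simp add: algebra_simps)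
        then have "(?L z + \<bar>ln c\<bar>) / \<alpha>\<^sub>1 \<le> (1 + \<bar>ln c\<bar>) * (1 + ?L z) / \<alpha>\<^sub>1"
          using ab by (intro divide_right_mono) auto
        then show ?thesis by simp
      qed
      moreover have "ln (exp 1 + B) \<le> ln (exp 1 + B) * (1 + ?L z)" using L0 lB by simp
      ultimately show ?thesis by (simp add: k2_def distrib_right)
    qed
    finally have g2: "gz z \<le> k2 * (1 + ?L z)" .
    have "1 \<le> gz z" unfolding gz using d0 p by (simp add: ln_ge_iff add_pos_nonneg)
    moreover have "ln r \<le> gz z" unfolding gz
    proof (rule ln_mono)
      have "depth z / rho z \<le> ?d / rho z" using d0 p by (intro divide_right_mono) auto
      moreover have "r \<le> max 1 (depth z / rho z)" using p by (auto simp: r_def R_def max_def)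
      ultimately show "r \<le> exp 1 + ?d / rho z" using e1 d0 p by (smt (verit) divide_nonneg_pos exp_gt_zero)
    qed (use r in auto)
    ultimately have "1 + ln r \<le> 2 * gz z" by simp
    then have "(1 + \<bar>ln C\<bar> + \<alpha>\<^sub>2) * (1 + ln r) \<le> (1 + \<bar>ln C\<bar> + \<alpha>\<^sub>2) * (2 * gz z)"
      using ab by (intro mult_left_mono) auto
    moreover have "1 + ?L z \<le> (1 + \<bar>ln C\<bar> + \<alpha>\<^sub>2) * (1 + ln r)"
    proof -
      have "(1 + \<bar>ln C\<bar> + \<alpha>\<^sub>2) * (1 + ln r) = 1 + \<bar>ln C\<bar> + \<alpha>\<^sub>2 + ln r + \<bar>ln C\<bar> * ln r + \<alpha>\<^sub>2 * ln r"
        by (simp add: algebra_simps)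
      moreover have "0 \<le> \<bar>ln C\<bar> * ln r" using lr by simp
      ultimately show ?thesis using up lr ab by linarith
    qed
    ultimately have "1 + ?L z \<le> (1 + \<bar>ln C\<bar> + \<alpha>\<^sub>2) * (2 * gz z)" by (rule order_trans[rotated])
    also have "\<dots> = k1 * gz z" by (simp add: k1_def)
    finally have g1: "1 + ?L z \<le> k1 * gz z" .
    show ?thesis using L0 g1 g2 by simp
  qed
  have "comparable_on pairs (\<lambda>z. c.q z (Tz z) * (1 + ?L z)) gz"
  proof (rule comparable_onI[where a = "a / k2" and b = "b * k1"])
    show "0 < a / k2" "0 < b * k1" using ab' k1 k2 by auto
    fix z assume z: "z \<in> pairs"
    note l = logs[OF z] and qz = q[OF z T_times[OF z]]
    have "gz z / k2 \<le> 1 + ?L z" using l k2 by (simp add: pos_divide_le_eq mult.commute)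
    then have "a * (gz z / k2) \<le> a * (1 + ?L z)" using ab' by (intro mult_left_mono) auto
    then have "a / k2 * gz z \<le> a * (1 + ?L z)" by simp
    also have "\<dots> \<le> c.q z (Tz z) * (1 + ?L z)" using l qz by (intro mult_right_mono) auto
    finally show "a / k2 * gz z \<le> c.q z (Tz z) * (1 + ?L z)" .
    have "c.q z (Tz z) * (1 + ?L z) \<le> b * (k1 * gz z)" using l qz ab' by (intro mult_mono) auto
    then show "c.q z (Tz z) * (1 + ?L z) \<le> b * k1 * gz z" by simp
  qed
  moreover have "c.q z (Tz z) \<le> 1 * (c.q z (Tz z) * (1 + ?L z))" "0 \<le> c.q z (Tz z) * (1 + ?L z)" if z: "z \<in> pairs" for z
    using logs[OF z] c.q_pos[OF z T_times[OF z]] by (auto simp: algebra_simps)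
  then have "\<exists>C>0. \<forall>z\<in>pairs. c.q z (Tz z) \<le> C * (c.q z (Tz z) * (1 + ?L z))"
    "\<forall>z\<in>pairs. 0 \<le> c.q z (Tz z) * (1 + ?L z)"
    by (blast intro: zero_less_one)+
  moreover have "\<exists>C>0. \<forall>z\<in>pairs. \<tau>z z < Tz z \<longrightarrow> c.q z (Tz z) * (1 + ?L z) \<le> C * c.q z (Tz z)"
    using c.T_pos by (intro exI[of _ 1]) (auto simp: max_def)
  ultimately show ?thesis
    unfolding matches_def using c.sharp_critical[OF le] by blast
qed

lemma green_estimate:
  assumes "d\<^sub>1 > \<alpha>\<^sub>2 * min \<beta>\<^sub>2 1 \<or> (d\<^sub>1 = d\<^sub>2 \<and> d\<^sub>2 = \<alpha>\<^sub>1 * \<beta>\<^sub>1 \<and> \<alpha>\<^sub>1 * \<beta>\<^sub>1 = \<alpha>\<^sub>2 * \<beta>\<^sub>2) \<or> d\<^sub>2 < \<alpha>\<^sub>1 * \<beta>\<^sub>1"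
  shows "ecomparable_on pairs G (\<lambda>z. h_bracket D \<nu> \<Phi> h (fst z) (snd z) * (\<Phi> (rho z) / \<Psi> (rho z)) *
      (psi \<nu> \<Phi> (rho z) / vol m (fst z) (rho z)) + h (\<Phi> (rho z)) (fst z) (snd z) * gz z)"
    and "comparable_on {0<..} \<Psi> \<Phi> \<Longrightarrow>
      ecomparable_on pairs G (\<lambda>z. h_bracket D \<nu> \<Phi> h (fst z) (snd z) * gz z)"
proof -
  have "\<exists>k. matches k"
    using matches_transient matches_critical matches_recurrent assms by blast
  then obtain k where k: "c.sharp k" "\<And>z. z \<in> pairs \<Longrightarrow> 0 \<le> k z" "comparable_on pairs k gz"
      "\<exists>C>0. \<forall>z\<in>pairs. c.q z (Tz z) \<le> C * k z" "\<exists>C>0. \<forall>z\<in>pairs. \<tau>z z < Tz z \<longrightarrow> k z \<le> C * c.q z (Tz z)"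
    unfolding matches_def by blast
  obtain a b where ab': "0 < a" "0 < b" and kg: "\<And>z. z \<in> pairs \<Longrightarrow> a * gz z \<le> k z \<and> k z \<le> b * gz z"
    using k(3) unfolding comparable_on_def by blast
  have gz0: "0 \<le> gz z" if z: "z \<in> pairs" for z
  proof -
    have "0 \<le> b * gz z" using kg[OF z] k(2)[OF z] by linarith
    then show ?thesis using ab' by (simp add: zero_le_mult_iff)
  qed
  have "ecomparable_on pairs G (\<lambda>z. c.jump z + hz z (Tz z) * gz z)"
  proof (rule ecomparable_on_trans[OF ecomparable_green[OF k(1)[unfolded c.sharp_def]]])
    show "comparable_on pairs (\<lambda>z. c.jump z + hz z (Tz z) * k z) (\<lambda>z. c.jump z + hz z (Tz z) * gz z)"
    proof (rule comparable_onI[where a = "min 1 a" and b = "max 1 b"])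
      show "0 < min 1 a" "0 < max 1 b" using ab' by auto
      fix z assume z: "z \<in> pairs"
      have J: "0 \<le> c.jump z" by (rule c.jump_nonneg[OF z])
      have H: "0 \<le> hz z (Tz z)" by (rule h_nonneg[OF z c.T_pos[OF z]])
      have "min 1 a * gz z \<le> a * gz z" using gz0[OF z] by (intro mult_right_mono) auto
      then have "hz z (Tz z) * (min 1 a * gz z) \<le> hz z (Tz z) * k z"
        using kg[OF z] H by (intro mult_left_mono) auto
      moreover have "min 1 a * c.jump z \<le> 1 * c.jump z" using J by (intro mult_right_mono) auto
      ultimately show "min 1 a * (c.jump z + hz z (Tz z) * gz z) \<le> c.jump z + hz z (Tz z) * k z"
        by (simp add: algebra_simps)
      have "b * gz z \<le> max 1 b * gz z" using gz0[OF z] by (intro mult_right_mono) auto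
      then have "hz z (Tz z) * k z \<le> hz z (Tz z) * (max 1 b * gz z)"
        using kg[OF z] H by (intro mult_left_mono) auto
      moreover have "1 * c.jump z \<le> max 1 b * c.jump z" using J by (intro mult_right_mono) auto
      ultimately show "c.jump z + hz z (Tz z) * k z \<le> max 1 b * (c.jump z + hz z (Tz z) * gz z)"
        by (simp add: algebra_simps)
    qed
  qed
  then show "ecomparable_on pairs G (\<lambda>z. h_bracket D \<nu> \<Phi> h (fst z) (snd z) * (\<Phi> (rho z) / \<Psi> (rho z)) *
      (psi \<nu> \<Phi> (rho z) / vol m (fst z) (rho z)) + h (\<Phi> (rho z)) (fst z) (snd z) * gz z)"
  proof (rule ecomparable_on_trans)
    have "c.jump z = h_bracket D \<nu> \<Phi> h (fst z) (snd z) * (\<Phi> (rho z) / \<Psi> (rho z)) *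
        (psi \<nu> \<Phi> (rho z) / vol m (fst z) (rho z))" if "z \<in> pairs" for z
      unfolding c.jump_def bracket_eq_h_bracket[OF that] q_T[OF that] ..
    then show "comparable_on pairs (\<lambda>z. c.jump z + hz z (Tz z) * gz z)
        (\<lambda>z. h_bracket D \<nu> \<Phi> h (fst z) (snd z) * (\<Phi> (rho z) / \<Psi> (rho z)) *
          (psi \<nu> \<Phi> (rho z) / vol m (fst z) (rho z)) + h (\<Phi> (rho z)) (fst z) (snd z) * gz z)"
      by (intro comparable_onI[of 1 1]) (simp_all only: mult_1_left order_refl zero_less_one)
  qed
  assume "comparable_on {0<..} \<Psi> \<Phi>"
  then obtain C where C: "0 < C" "\<And>r. 0 < r \<Longrightarrow> \<Psi> r \<le> C * \<Phi> r"
    unfolding comparable_on_def by auto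
  have W: "\<exists>c>0. \<forall>z\<in>pairs. c \<le> Tz z / Wz z \<and> Tz z / Wz z \<le> 1"
  proof (intro exI[of _ "1 / C"] conjI ballI)
    show "0 < 1 / C" using C by simp
    fix z assume z: "z \<in> pairs"
    show "1 / C \<le> Tz z / Wz z" using C(2)[of "rho z"] pairsD[OF z] W_pos[OF z] C(1) by (simp add: field_simps)
    show "Tz z / Wz z \<le> 1" using T_le_W[OF z] W_pos[OF z] by simp
  qed
  have "ecomparable_on pairs G (\<lambda>z. c.bracket z * k z)"
    by (intro ecomparable_green c.sharp_bracket k W)
  moreover have "comparable_on pairs (\<lambda>z. c.bracket z * k z) (\<lambda>z. h_bracket D \<nu> \<Phi> h (fst z) (snd z) * gz z)"
  proof (rule comparable_onI[OF ab'])
    fix z assume z: "z \<in> pairs"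
    note e = bracket_eq_h_bracket[OF z, symmetric] and n = c.bracket_nonneg[OF z]
    show "a * (h_bracket D \<nu> \<Phi> h (fst z) (snd z) * gz z) \<le> c.bracket z * k z"
      using mult_left_mono[OF conjunct1[OF kg[OF z]] n] by (simp add: e mult_ac)
    show "c.bracket z * k z \<le> b * (h_bracket D \<nu> \<Phi> h (fst z) (snd z) * gz z)"
      using mult_left_mono[OF conjunct2[OF kg[OF z]] n] by (simp add: e mult_ac)
  qed
  ultimately show "ecomparable_on pairs G (\<lambda>z. h_bracket D \<nu> \<Phi> h (fst z) (snd z) * gz z)"
    by (rule ecomparable_on_trans)
qed

end

section \<open>Heat kernels on bounded domains\<close>

lemma hk_two_sided_subset:
  assumes "hk_two_sided T D m \<Phi> \<Psi> h p C" and "T' \<subseteq> T"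
  shows "hk_two_sided T' D m \<Phi> \<Psi> h p C"
proof -
  obtain c\<^sub>1 c\<^sub>2 c\<^sub>3 c\<^sub>4 where c: "0 < c\<^sub>1" "0 < c\<^sub>2" "0 < c\<^sub>3" "0 < c\<^sub>4" "C \<in> {0, 1}"
    and main: "\<forall>t\<in>T. \<forall>x\<in>D. \<forall>y\<in>D. c\<^sub>1 * h t x y * hk_profile m \<Phi> \<Psi> C c\<^sub>2 t x y \<le> p t x y \<and>
        p t x y \<le> c\<^sub>3 * h t x y * hk_profile m \<Phi> \<Psi> C c\<^sub>4 t x y"
    using assms(1) unfolding hk_two_sided_def by blast
  have "\<forall>t\<in>T'. \<forall>x\<in>D. \<forall>y\<in>D. c\<^sub>1 * h t x y * hk_profile m \<Phi> \<Psi> C c\<^sub>2 t x y \<le> p t x y \<and>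
        p t x y \<le> c\<^sub>3 * h t x y * hk_profile m \<Phi> \<Psi> C c\<^sub>4 t x y"
    using main assms(2) by blast
  then show ?thesis using c unfolding hk_two_sided_def by blast
qed

lemma heat_kernel_measurable:
  assumes "heat_kernel D m \<F> P Y p" and xy: "x \<in> D" "y \<in> D"
  shows "(\<lambda>s. indicator {0<..} s * p s x y) \<in> borel_measurable borel"
    and "0 < t \<Longrightarrow> D \<in> sets borel \<Longrightarrow> (\<lambda>z. indicator D z * p t x z) \<in> borel_measurable borel"
    and "0 < t \<Longrightarrow> D \<in> sets borel \<Longrightarrow> (\<lambda>z. indicator D z * p t z y) \<in> borel_measurable borel"
proof -
  let ?B = "restrict_space (borel \<Otimes>\<^sub>M borel \<Otimes>\<^sub>M borel) ({0<..} \<times> D \<times> D)"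
  have p: "(\<lambda>(t, x, y). p t x y) \<in> borel_measurable ?B"
    using assms(1) by (simp add: heat_kernel_def)
  have "(\<lambda>s. (s, x, y)) \<in> restrict_space borel {0<..} \<rightarrow>\<^sub>M ?B"
    by (intro measurable_restrict_space2 measurable_restrict_space1) (use xy in \<open>auto simp: space_restrict_space\<close>)
  from measurable_compose[OF this p] show "(\<lambda>s. indicator {0<..} s * p s x y) \<in> borel_measurable borel"
    by (simp add: borel_measurable_restrict_space_iff)
  assume t: "0 < t" and D: "D \<in> sets borel"
  have "(\<lambda>z. (t, x, z)) \<in> restrict_space borel D \<rightarrow>\<^sub>M ?B"
    by (intro measurable_restrict_space2 measurable_restrict_space1) (use xy t in \<open>auto simp: space_restrict_space\<close>)
  from measurable_compose[OF this p] show "(\<lambda>z. indicator D z * p t x z) \<in> borel_measurable borel"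
    using D by (simp add: borel_measurable_restrict_space_iff)
  have "(\<lambda>z. (t, z, y)) \<in> restrict_space borel D \<rightarrow>\<^sub>M ?B"
    by (intro measurable_restrict_space2 measurable_restrict_space1) (use xy t in \<open>auto simp: space_restrict_space\<close>)
  from measurable_compose[OF this p] show "(\<lambda>z. indicator D z * p t z y) \<in> borel_measurable borel"
    using D by (simp add: borel_measurable_restrict_space_iff)
qed

locale bounded_domain = scale_function \<Phi> \<alpha>\<^sub>1 \<alpha>\<^sub>2 + volume_space m R\<^sub>E d\<^sub>1 d\<^sub>2
  for \<Phi> :: "real \<Rightarrow> real" and \<alpha>\<^sub>1 \<alpha>\<^sub>2 :: real and m :: "'a::metric_space measure"
    and R\<^sub>E :: ereal and d\<^sub>1 d\<^sub>2 :: real +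
  fixes D :: "'a set" and h :: "real \<Rightarrow> 'a \<Rightarrow> 'a \<Rightarrow> real" and \<Psi> :: "real \<Rightarrow> real"
  assumes D_bounded: "bounded D" and diam: "0 < diameter D"
    and \<Psi>_ge: "\<And>r. 0 \<le> r \<Longrightarrow> \<Phi> r \<le> \<Psi> r"
    and h_boundary: "boundary_function D \<Phi> h"
begin

abbreviation b\<^sub>0 :: real where "b\<^sub>0 \<equiv> \<Phi> (diameter D)"

lemma b0: "0 < b\<^sub>0"
  by (rule \<Phi>_pos[OF diam])

lemma range_iff: "ereal t < 4 * scale_diam \<Phi> D + 1 \<longleftrightarrow> t < 4 * b\<^sub>0 + 1"
  "ereal t < 2 * scale_diam \<Phi> D \<longleftrightarrow> t < 2 * b\<^sub>0"
proof -
  have "4 * ereal b\<^sub>0 + 1 = ereal (4 * b\<^sub>0 + 1)"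
    by (metis numeral_eq_ereal times_ereal.simps(1) plus_ereal.simps(1) one_ereal_def)
  then show "ereal t < 4 * scale_diam \<Phi> D + 1 \<longleftrightarrow> t < 4 * b\<^sub>0 + 1"
    using D_bounded by (simp add: scale_diam_def)
  have "2 * ereal b\<^sub>0 = ereal (2 * b\<^sub>0)"
    by (metis numeral_eq_ereal times_ereal.simps(1))
  then show "ereal t < 2 * scale_diam \<Phi> D \<longleftrightarrow> t < 2 * b\<^sub>0"
    using D_bounded by (simp add: scale_diam_def)
qed

lemma h_nonneg: "x \<in> D \<Longrightarrow> y \<in> D \<Longrightarrow> 0 < t \<Longrightarrow> 0 \<le> h t x y"
  using h_boundary by (simp add: boundary_function_def)

lemma h_antimono: "x \<in> D \<Longrightarrow> y \<in> D \<Longrightarrow> 0 < s \<Longrightarrow> s \<le> t \<Longrightarrow> h t x y \<le> h s x y"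
  using h_boundary unfolding boundary_function_def monotone_on_def by auto

lemma h_compare:
  assumes a: "0 < a"
  shows "\<exists>A>0. \<forall>x\<in>D. \<forall>y\<in>D. \<forall>s\<ge>a. \<forall>t. 0 < t \<and> t < 4 * b\<^sub>0 + 1 \<longrightarrow> h s x y \<le> A * h t x y"
proof -
  obtain c \<gamma> where c: "0 < c" "0 \<le> \<gamma>" and H: "\<And>s t x y. 0 < s \<Longrightarrow> s \<le> t \<Longrightarrow>
      t < 4 * b\<^sub>0 + 1 \<Longrightarrow> x \<in> D \<Longrightarrow> y \<in> D \<Longrightarrow> s powr \<gamma> * h s x y \<le> c * t powr \<gamma> * h t x y"
    using h_boundary unfolding boundary_function_def range_iff by blast
  define A where "A = 1 + c * ((4 * b\<^sub>0 + 1) / a) powr \<gamma>"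
  have A: "1 \<le> A" using c by (simp add: A_def)
  have "h s x y \<le> A * h t x y" if xy: "x \<in> D" "y \<in> D" and s: "a \<le> s" and t: "0 < t" "t < 4 * b\<^sub>0 + 1" for x y s t
  proof (cases "t \<le> s")
    case True
    have "h s x y \<le> 1 * h t x y" using h_antimono[OF xy t(1) True] by simp
    also have "\<dots> \<le> A * h t x y" using A h_nonneg[OF xy t(1)] by (intro mult_right_mono) auto
    finally show ?thesis .
  next
    case False
    have s0: "0 < s" using s a by simp
    have "s powr \<gamma> * h s x y \<le> c * t powr \<gamma> * h t x y" using H s0 False t xy by simp
    then have "h s x y \<le> c * (t / s) powr \<gamma> * h t x y"
      using s0 t by (simp add: powr_divide field_simps)
    also have "\<dots> \<le> c * ((4 * b\<^sub>0 + 1) / a) powr \<gamma> * h t x y"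
      using s s0 t a c b0 h_nonneg[OF xy t(1)]
      by (intro mult_right_mono mult_left_mono powr_mono2 frac_le) auto
    also have "\<dots> \<le> A * h t x y" using h_nonneg[OF xy t(1)] by (intro mult_right_mono) (auto simp: A_def)
    finally show ?thesis .
  qed
  then show ?thesis using A by (intro exI[of _ A]) auto
qed

text \<open>
  In a bounded domain the balls of radius in a compact subinterval of \<open>(0,\<infinity>)\<close> have volumes of constant
  order, and the Gaussian factor is bounded below.
\<close>

lemma profile_bounds:
  assumes a: "0 < a" and c: "0 < c"
  shows "\<exists>k>0. \<exists>k'>0. \<forall>t x y. a \<le> t \<and> t \<le> b \<and> x \<in> D \<and> y \<in> D \<longrightarrow>
    k \<le> hk_profile m \<Phi> \<Psi> 1 c t x y \<and> hk_profile m \<Phi> \<Psi> 1 c t x y \<le> k'"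
proof -
  obtain v V where v: "0 < v" "0 < V" "\<And>x r. x \<in> D \<Longrightarrow> g a \<le> r \<Longrightarrow> r \<le> g b \<Longrightarrow> v \<le> vol m x r \<and> vol m x r \<le> V"
    using vol_bounded_region[OF D_bounded gen_inv_pos[OF a], of "g b"] by metis
  define E where "E = exp (- c * (diameter D)\<^sup>2 / (g a)\<^sup>2)"
  have E: "0 < E" by (simp add: E_def)
  have "1 / V * E \<le> hk_profile m \<Phi> \<Psi> 1 c t x y \<and> hk_profile m \<Phi> \<Psi> 1 c t x y \<le> 1 / v"
    if t: "a \<le> t" "t \<le> b" and xy: "x \<in> D" "y \<in> D" for t x y
  proof -
    have ga: "0 < g a" "g a \<le> g t" "g t \<le> g b" using gen_inv_pos[OF a] gen_inv_mono t by auto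
    have vt: "v \<le> vol m x (g t)" "vol m x (g t) \<le> V" using v(3)[OF xy(1) ga(2,3)] by auto
    have vp: "0 < vol m x (g t)" using vt v by simp
    have "dist x y \<le> diameter D" using diameter_bounded_bound[OF D_bounded xy] .
    then have "c * (dist x y)\<^sup>2 / (g t)\<^sup>2 \<le> c * (diameter D)\<^sup>2 / (g a)\<^sup>2"
      using c ga by (intro frac_le mult_left_mono power_mono) auto
    then have ex: "E \<le> exp (- c * (dist x y)\<^sup>2 / (g t)\<^sup>2)" by (simp add: E_def)
    have "exp (- c * (dist x y)\<^sup>2 / (g t)\<^sup>2) \<le> 1" using c by simp
    then have "E \<le> 1" using ex by linarith
    have "0 \<le> \<Psi> (dist x y)" using \<Psi>_ge[of "dist x y"] nonneg[of "dist x y"] by simp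
    then have first: "0 \<le> 1 * t / (vol m x (dist x y) * \<Psi> (dist x y))"
      using t a by (intro divide_nonneg_nonneg mult_nonneg_nonneg) (auto simp: vol_def)
    have "1 / V * E \<le> 1 / vol m x (g t) * exp (- c * (dist x y)\<^sup>2 / (g t)\<^sup>2)"
      using vt vp v ex E by (intro mult_mono divide_left_mono) auto
    moreover have "1 / V * E \<le> 1 / vol m x (g t) * 1"
      using vt vp v E \<open>E \<le> 1\<close> by (intro mult_mono divide_left_mono) auto
    moreover have "1 / vol m x (g t) \<le> 1 / v" using vt vp v by (intro divide_left_mono) auto
    ultimately show ?thesis using first unfolding hk_profile_def by (auto simp: min_le_iff_disj)
  qed
  then show ?thesis using v E by (intro exI[of _ "1 / V * E"] conjI exI[of _ "1 / v"]) auto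
qed

text \<open>
  At times bounded away from zero and infinity the small-time and the large-time forms of the
  estimates agree, because there the profile is of constant order.
\<close>

lemma HK_B_imp:
  assumes "HK_B D m \<Phi> \<Psi> h p 1"
  shows "hk_two_sided {t. 0 < t \<and> ereal t < 2 * scale_diam \<Phi> D} D m \<Phi> \<Psi> h p 1"
    and "\<exists>C>0. \<exists>l>0. \<forall>t\<ge>2 * b\<^sub>0. \<forall>x\<in>D. \<forall>y\<in>D. p t x y \<le> C * exp (- l * t) * h b\<^sub>0 x y"
proof -
  have "hk_two_sided {0<..1} D m \<Phi> \<Psi> h p 1" using assms by (simp add: HK_B_def)
  then obtain c\<^sub>1 c\<^sub>2 c\<^sub>3 c\<^sub>4 where c: "0 < c\<^sub>1" "0 < c\<^sub>2" "0 < c\<^sub>3" "0 < c\<^sub>4"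
    and hk: "\<And>t x y. 0 < t \<Longrightarrow> t \<le> 1 \<Longrightarrow> x \<in> D \<Longrightarrow> y \<in> D \<Longrightarrow>
      c\<^sub>1 * h t x y * hk_profile m \<Phi> \<Psi> 1 c\<^sub>2 t x y \<le> p t x y \<and> p t x y \<le> c\<^sub>3 * h t x y * hk_profile m \<Phi> \<Psi> 1 c\<^sub>4 t x y"
    unfolding hk_two_sided_def by (auto simp: Ball_def)
  obtain l where l0: "0 < l" "comparable_on ({1..} \<times> D \<times> D)
        (\<lambda>(t, x, y). p t x y) (\<lambda>(t, x, y). exp (- l * t) * h 1 x y)"
    using assms unfolding HK_B_def by blast
  then obtain a b where l: "0 < l" "0 < a" "0 < b" and ab: "\<forall>w\<in>{1..} \<times> D \<times> D.
      a * (case w of (t, x, y) \<Rightarrow> exp (- l * t) * h 1 x y) \<le> (case w of (t, x, y) \<Rightarrow> p t x y) \<and>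
      (case w of (t, x, y) \<Rightarrow> p t x y) \<le> b * (case w of (t, x, y) \<Rightarrow> exp (- l * t) * h 1 x y)"
    unfolding comparable_on_def by blast
  have lt: "a * (exp (- l * t) * h 1 x y) \<le> p t x y \<and> p t x y \<le> b * (exp (- l * t) * h 1 x y)"
    if "1 \<le> t" "x \<in> D" "y \<in> D" for t x y
    using bspec[OF ab, of "(t, x, y)"] that by simp
  obtain A where A: "0 < A" and cmp: "\<And>x y s t. x \<in> D \<Longrightarrow> y \<in> D \<Longrightarrow> min 1 b\<^sub>0 \<le> s \<Longrightarrow> 0 < t \<Longrightarrow> t < 4 * b\<^sub>0 + 1 \<Longrightarrow>
      h s x y \<le> A * h t x y"
    using h_compare[of "min 1 b\<^sub>0"] b0 by auto
  let ?L = "2 * b\<^sub>0"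
  obtain k k' where k: "0 < k" "0 < k'" and prof2: "\<And>t x y. 1 \<le> t \<Longrightarrow> t \<le> ?L \<Longrightarrow> x \<in> D \<Longrightarrow> y \<in> D \<Longrightarrow>
      k \<le> hk_profile m \<Phi> \<Psi> 1 c\<^sub>2 t x y \<and> hk_profile m \<Phi> \<Psi> 1 c\<^sub>2 t x y \<le> k'"
    using profile_bounds[OF zero_less_one c(2), of ?L] by blast
  have m10: "0 < min 1 b\<^sub>0" using b0 by simp
  obtain r r' where r: "0 < r" "0 < r'" and prof4: "\<And>t x y. min 1 b\<^sub>0 \<le> t \<Longrightarrow> t \<le> max 1 ?L \<Longrightarrow> x \<in> D \<Longrightarrow> y \<in> D \<Longrightarrow>
      r \<le> hk_profile m \<Phi> \<Psi> 1 c\<^sub>4 t x y \<and> hk_profile m \<Phi> \<Psi> 1 c\<^sub>4 t x y \<le> r'"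
    using profile_bounds[OF m10 c(4), of "max 1 ?L"] by blast
  define a' where "a' = min c\<^sub>1 (a * exp (- l * ?L) / A / k')"
  define b' where "b' = max c\<^sub>3 (b * A / r)"
  have ab': "0 < a'" "0 < b'" using c l A k r by (auto simp: a'_def b'_def)
  have main: "a' * h t x y * hk_profile m \<Phi> \<Psi> 1 c\<^sub>2 t x y \<le> p t x y \<and> p t x y \<le> b' * h t x y * hk_profile m \<Phi> \<Psi> 1 c\<^sub>4 t x y"
    if t: "0 < t" "t < ?L" and xy: "x \<in> D" "y \<in> D" for t x y
  proof -
    have hn: "0 \<le> h t x y" by (rule h_nonneg[OF xy t(1)])
    have pn: "0 \<le> hk_profile m \<Phi> \<Psi> 1 c t x y" if c0: "0 < c" for c
    proof -
      obtain k :: real where "0 < k" "k \<le> hk_profile m \<Phi> \<Psi> 1 c t x y"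
        using profile_bounds[OF t(1) c0, of t] xy order_refl[of t] by blast
      then show ?thesis by simp
    qed
    show ?thesis
    proof (cases "t \<le> 1")
      case True
      have "a' * (h t x y * hk_profile m \<Phi> \<Psi> 1 c\<^sub>2 t x y) \<le> c\<^sub>1 * (h t x y * hk_profile m \<Phi> \<Psi> 1 c\<^sub>2 t x y)"
        using pn[OF c(2)] hn by (intro mult_right_mono) (auto simp: a'_def)
      moreover have "c\<^sub>3 * (h t x y * hk_profile m \<Phi> \<Psi> 1 c\<^sub>4 t x y) \<le> b' * (h t x y * hk_profile m \<Phi> \<Psi> 1 c\<^sub>4 t x y)"
        using pn[OF c(4)] hn by (intro mult_right_mono) (auto simp: b'_def)
      ultimately show ?thesis using hk[OF t(1) True xy] by (simp add: mult.assoc)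
    next
      case False
      have h1: "h t x y \<le> A * h 1 x y" "h 1 x y \<le> A * h t x y"
        using cmp[OF xy, of t 1] cmp[OF xy, of 1 t] False t b0 by auto
      have h10: "0 \<le> h 1 x y" by (rule h_nonneg[OF xy zero_less_one])
      note lt' = lt[of t, OF _ xy]
      have P2: "k \<le> hk_profile m \<Phi> \<Psi> 1 c\<^sub>2 t x y" "hk_profile m \<Phi> \<Psi> 1 c\<^sub>2 t x y \<le> k'"
        using prof2[of t x y] False t xy by auto
      have P4: "r \<le> hk_profile m \<Phi> \<Psi> 1 c\<^sub>4 t x y" using prof4[of t x y] False t xy by auto
      have "a' * h t x y * hk_profile m \<Phi> \<Psi> 1 c\<^sub>2 t x y \<le> (a * exp (- l * ?L) / A / k') * (A * h 1 x y) * k'"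
        using P2 k h1 h10 hn l A ab' by (intro mult_mono) (auto simp: a'_def)
      also have "\<dots> = a * (exp (- l * ?L) * h 1 x y)" using A k by simp
      also have "\<dots> \<le> a * (exp (- l * t) * h 1 x y)"
        using l t h10 by (intro mult_left_mono mult_right_mono) auto
      also have "\<dots> \<le> p t x y" using lt' False by simp
      finally have 1: "a' * h t x y * hk_profile m \<Phi> \<Psi> 1 c\<^sub>2 t x y \<le> p t x y" .
      have "p t x y \<le> b * (exp (- l * t) * h 1 x y)" using lt' False by simp
      also have "\<dots> \<le> b * (1 * (A * h t x y))"
        using l t h10 h1 by (intro mult_left_mono mult_mono) auto
      also have "\<dots> = (b * A / r) * h t x y * r" using r by simp
      also have "\<dots> \<le> b' * h t x y * hk_profile m \<Phi> \<Psi> 1 c\<^sub>4 t x y"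
        using P4 r hn l A ab' by (intro mult_mono) (auto simp: b'_def)
      finally show ?thesis using 1 by simp
    qed
  qed
  show "hk_two_sided {t. 0 < t \<and> ereal t < 2 * scale_diam \<Phi> D} D m \<Phi> \<Psi> h p 1"
  proof -
    have "\<forall>t\<in>{t. 0 < t \<and> ereal t < 2 * scale_diam \<Phi> D}. \<forall>x\<in>D. \<forall>y\<in>D.
        a' * h t x y * hk_profile m \<Phi> \<Psi> 1 c\<^sub>2 t x y \<le> p t x y \<and> p t x y \<le> b' * h t x y * hk_profile m \<Phi> \<Psi> 1 c\<^sub>4 t x y"
      unfolding range_iff using main by blast
    then show ?thesis using ab' c(2,4) unfolding hk_two_sided_def by blast
  qed
  define C where "C = b * A + c\<^sub>3 * r' * exp l"
  have C: "0 < C" using l A c r by (simp add: C_def add_pos_pos)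
  have "p t x y \<le> C * exp (- l * t) * h b\<^sub>0 x y" if t: "?L \<le> t" and xy: "x \<in> D" "y \<in> D" for t x y
  proof -
    have hb: "0 \<le> h b\<^sub>0 x y" by (rule h_nonneg[OF xy b0])
    show ?thesis
    proof (cases "1 \<le> t")
      case True
      have "p t x y \<le> b * (exp (- l * t) * h 1 x y)" using lt[OF True xy] by simp
      also have "\<dots> \<le> b * (exp (- l * t) * (A * h b\<^sub>0 x y))"
        using cmp[OF xy, of 1 b\<^sub>0] b0 l by (intro mult_left_mono) auto
      also have "\<dots> = b * A * (exp (- l * t) * h b\<^sub>0 x y)" by simp
      also have "\<dots> \<le> C * (exp (- l * t) * h b\<^sub>0 x y)"
        using hb c r by (intro mult_right_mono) (auto simp: C_def)
      finally show ?thesis by (simp add: mult.assoc)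
    next
      case False
      have t0: "0 < t" "b\<^sub>0 \<le> t" using t b0 by auto
      have "p t x y \<le> c\<^sub>3 * h t x y * hk_profile m \<Phi> \<Psi> 1 c\<^sub>4 t x y" using hk[OF t0(1) _ xy] False by simp
      also have "\<dots> \<le> c\<^sub>3 * h b\<^sub>0 x y * r'"
        using prof4[of t x y] t0 False xy c r hb h_antimono[OF xy b0 t0(2)] h_nonneg[OF xy t0(1)]
        by (intro mult_mono) (auto intro: order_trans[of 0 r])
      also have "\<dots> = c\<^sub>3 * r' * (1 * h b\<^sub>0 x y)" by simp
      also have "\<dots> \<le> c\<^sub>3 * r' * (exp (l - l * t) * h b\<^sub>0 x y)"
        using False l c r hb by (intro mult_left_mono mult_right_mono) auto
      also have "\<dots> = c\<^sub>3 * r' * exp l * (exp (- l * t) * h b\<^sub>0 x y)" by (simp add: exp_diff exp_minus field_simps)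
      also have "\<dots> \<le> C * (exp (- l * t) * h b\<^sub>0 x y)"
        using hb l A by (intro mult_right_mono) (auto simp: C_def)
      finally show ?thesis by (simp add: mult.assoc)
    qed
  qed
  then show "\<exists>C>0. \<exists>l>0. \<forall>t\<ge>?L. \<forall>x\<in>D. \<forall>y\<in>D. p t x y \<le> C * exp (- l * t) * h b\<^sub>0 x y"
    using C l by blast
qed

text \<open>
  If the estimates hold for all times on a bounded domain, then volume growth forces the heat
  kernel to be eventually a small multiple of its value at a fixed time, and the Chapman-Kolmogorov
  equation iterates this to exponential decay.
\<close>

lemma HK_U_imp:
  assumes U: "HK_U R\<^sub>E D m \<Phi> \<Psi> h p 1" and hk: "heat_kernel D m \<F> P Y p" and D: "open D"
  shows "\<exists>C>0. \<exists>l>0. \<forall>t\<ge>2 * b\<^sub>0. \<forall>x\<in>D. \<forall>y\<in>D. p t x y \<le> C * exp (- l * t) * h b\<^sub>0 x y"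
proof -
  have RE: "R\<^sub>E = \<infinity>" using U by (simp add: HK_U_def)
  have "hk_two_sided {0<..} D m \<Phi> \<Psi> h p 1" using U by (simp add: HK_U_def)
  then obtain c\<^sub>1 c\<^sub>2 c\<^sub>3 c\<^sub>4 where c: "0 < c\<^sub>1" "0 < c\<^sub>2" "0 < c\<^sub>3" "0 < c\<^sub>4"
    and est: "\<And>t x y. 0 < t \<Longrightarrow> x \<in> D \<Longrightarrow> y \<in> D \<Longrightarrow>
      c\<^sub>1 * h t x y * hk_profile m \<Phi> \<Psi> 1 c\<^sub>2 t x y \<le> p t x y \<and> p t x y \<le> c\<^sub>3 * h t x y * hk_profile m \<Phi> \<Psi> 1 c\<^sub>4 t x y"
    unfolding hk_two_sided_def by (auto simp: Ball_def)
  obtain k where k: "0 < k" and prof: "\<And>x y. x \<in> D \<Longrightarrow> y \<in> D \<Longrightarrow> k \<le> hk_profile m \<Phi> \<Psi> 1 c\<^sub>2 b\<^sub>0 x y"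
    using profile_bounds[OF b0 c(2), of b\<^sub>0] by auto
  obtain k' where k': "0 < k'" and prof': "\<And>x y. x \<in> D \<Longrightarrow> y \<in> D \<Longrightarrow> hk_profile m \<Phi> \<Psi> 1 c\<^sub>4 b\<^sub>0 x y \<le> k'"
    using profile_bounds[OF b0 c(4), of b\<^sub>0] by auto
  obtain v where v: "0 < v" "\<And>x. x \<in> D \<Longrightarrow> v \<le> vol m x (diameter D)"
    using vol_bounded_region[OF D_bounded diam, of "diameter D"] by auto
  obtain C where C: "1 \<le> C" and vs: "\<And>x r R. 0 < r \<Longrightarrow> r \<le> R \<Longrightarrow> (R / r) powr d\<^sub>1 * vol m x r \<le> C * vol m x R"
    using vol_scaling[of \<infinity>] RE by auto
  have gb: "g b\<^sub>0 = diameter D" using diam by (simp add: gen_inv_\<Phi>)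
  \<comment> \<open>the factor in \<open>p t \<le> \<theta> t * p b\<^sub>0\<close>; it tends to zero because volumes of balls tend to infinity\<close>
  define \<theta> where "\<theta> t = c\<^sub>3 * C / (c\<^sub>1 * k * v) / (g t / diameter D) powr d\<^sub>1" for t
  have gt: "0 < g t / diameter D" "1 \<le> g t / diameter D" if "b\<^sub>0 \<le> t" for t
    using gen_inv_mono[OF that] gb diam by auto
  have \<theta>0: "0 \<le> \<theta> t" for t using c C k v by (simp add: \<theta>_def)
  have p0: "0 \<le> p t x y" if "0 < t" "x \<in> D" "y \<in> D" for t x y
    using hk that by (simp add: heat_kernel_def)
  have small: "p t x y \<le> \<theta> t * p b\<^sub>0 x y" if t: "b\<^sub>0 \<le> t" and xy: "x \<in> D" "y \<in> D" for t x y
  proof -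
    have t0: "0 < t" using t b0 by simp
    let ?R = "(g t / diameter D) powr d\<^sub>1"
    have R: "0 < ?R" using gt(1)[OF t] by (metis less_irrefl powr_gt_zero)
    have "?R * v \<le> ?R * vol m x (diameter D)" using v(2)[OF xy(1)] by (intro mult_left_mono) auto
    also have "\<dots> \<le> C * vol m x (g t)" using vs[OF diam, of "g t" x] gen_inv_mono[OF t] gb by simp
    finally have V: "1 / vol m x (g t) \<le> C / (v * ?R)"
      using R v C vol_pos[OF gen_inv_pos[OF t0], of x] by (simp add: field_simps)
    have hb: "0 \<le> h b\<^sub>0 x y" by (rule h_nonneg[OF xy b0])
    have hp: "h b\<^sub>0 x y \<le> p b\<^sub>0 x y / (c\<^sub>1 * k)"
    proof -
      have "c\<^sub>1 * h b\<^sub>0 x y * k \<le> c\<^sub>1 * h b\<^sub>0 x y * hk_profile m \<Phi> \<Psi> 1 c\<^sub>2 b\<^sub>0 x y"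
        using prof[OF xy] c hb by (intro mult_left_mono) auto
      also have "\<dots> \<le> p b\<^sub>0 x y" using est[OF b0 xy] by simp
      finally show ?thesis using c k by (simp add: field_simps)
    qed
    have "hk_profile m \<Phi> \<Psi> 1 c\<^sub>4 t x y \<le> 1 / vol m x (g t)" by (simp add: hk_profile_def)
    then have "c\<^sub>3 * h t x y * hk_profile m \<Phi> \<Psi> 1 c\<^sub>4 t x y \<le> c\<^sub>3 * h t x y * (1 / vol m x (g t))"
      using c h_nonneg[OF xy t0] by (intro mult_left_mono) auto
    also have "\<dots> \<le> c\<^sub>3 * h b\<^sub>0 x y * (C / (v * ?R))"
      using h_antimono[OF xy b0 t] h_nonneg[OF xy t0] V c hb vol_pos[OF gen_inv_pos[OF t0], of x] by (intro mult_mono) auto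
    also have "\<dots> \<le> c\<^sub>3 * (p b\<^sub>0 x y / (c\<^sub>1 * k)) * (C / (v * ?R))"
      using hp c C v R by (intro mult_right_mono mult_left_mono) auto
    also have "\<dots> = \<theta> t * p b\<^sub>0 x y" by (simp add: \<theta>_def mult_ac)
    finally show ?thesis using est[OF t0 xy] by simp
  qed
  have comp: "p (s + t) x y \<le> M * N * \<theta> (2 * b\<^sub>0) * p b\<^sub>0 x y"
    if st: "b\<^sub>0 \<le> s" "b\<^sub>0 \<le> t" and xy: "x \<in> D" "y \<in> D" and M: "0 \<le> M" "0 \<le> N"
      and s: "\<And>x y. x \<in> D \<Longrightarrow> y \<in> D \<Longrightarrow> p s x y \<le> M * p b\<^sub>0 x y"
      and t: "\<And>x y. x \<in> D \<Longrightarrow> y \<in> D \<Longrightarrow> p t x y \<le> N * p b\<^sub>0 x y" for s t x y M N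
  proof -
    have st0: "0 < s" "0 < t" using st b0 by auto
    have CK: "ennreal (p (s + t) x y) = (\<integral>\<^sup>+z\<in>D. ennreal (p s x z * p t z y) \<partial>m)"
      if "0 < s" "0 < t" for s t
      using hk that xy unfolding heat_kernel_def by blast
    have DB: "D \<in> sets borel" using D by simp
    note [measurable] = heat_kernel_measurable(2)[OF hk xy b0 DB] heat_kernel_measurable(3)[OF hk xy b0 DB]
    have "ennreal (p (s + t) x y) \<le> (\<integral>\<^sup>+z. ennreal (M * N) * ennreal ((indicator D z * p b\<^sub>0 x z) * (indicator D z * p b\<^sub>0 z y)) \<partial>m)"
      unfolding CK[OF st0]
    proof (rule nn_integral_mono)
      fix z
      show "ennreal (p s x z * p t z y) * indicator D z \<le>
          ennreal (M * N) * ennreal ((indicator D z * p b\<^sub>0 x z) * (indicator D z * p b\<^sub>0 z y))"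
      proof (cases "z \<in> D")
        case True
        have "p s x z * p t z y \<le> (M * p b\<^sub>0 x z) * (N * p b\<^sub>0 z y)"
          using s[OF xy(1) True] t[OF True xy(2)] p0[OF st0(1) xy(1) True] p0[OF st0(2) True xy(2)]
            p0[OF b0 xy(1) True] M by (intro mult_mono) auto
        then have "ennreal (p s x z * p t z y) \<le> ennreal ((M * N) * (p b\<^sub>0 x z * p b\<^sub>0 z y))"
          by (intro ennreal_leI) (simp add: mult_ac)
        then show ?thesis using True M by (simp add: ennreal_mult')
      qed simp
    qed
    also have "\<dots> = ennreal (M * N) * (\<integral>\<^sup>+z. ennreal ((indicator D z * p b\<^sub>0 x z) * (indicator D z * p b\<^sub>0 z y)) \<partial>m)"
    proof (rule nn_integral_cmult)
      have "(\<lambda>z. ennreal ((indicator D z * p b\<^sub>0 x z) * (indicator D z * p b\<^sub>0 z y))) \<in> borel_measurable borel"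
        by measurable
      then show "(\<lambda>z. ennreal ((indicator D z * p b\<^sub>0 x z) * (indicator D z * p b\<^sub>0 z y))) \<in> borel_measurable m"
        using measurable_cong_sets[OF sets_m refl, of "borel :: ennreal measure"] by simp
    qed
    also have "(\<integral>\<^sup>+z. ennreal ((indicator D z * p b\<^sub>0 x z) * (indicator D z * p b\<^sub>0 z y)) \<partial>m) = ennreal (p (b\<^sub>0 + b\<^sub>0) x y)"
      unfolding CK[OF b0 b0] by (intro nn_integral_cong) (simp split: split_indicator)
    also have "ennreal (M * N) * ennreal (p (b\<^sub>0 + b\<^sub>0) x y) = ennreal (M * N * p (2 * b\<^sub>0) x y)"
      using M by (simp add: ennreal_mult')
    finally have "p (s + t) x y \<le> M * N * p (2 * b\<^sub>0) x y"
      using M p0[of "2 * b\<^sub>0" x y] xy b0 by (subst (asm) ennreal_le_iff) auto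
    also have "\<dots> \<le> M * N * (\<theta> (2 * b\<^sub>0) * p b\<^sub>0 x y)"
      using M b0 by (intro mult_left_mono small xy) auto
    finally show ?thesis by (simp add: mult.assoc)
  qed
  obtain t\<^sub>1 where t1: "b\<^sub>0 \<le> t\<^sub>1" "\<theta> t\<^sub>1 * \<theta> (2 * b\<^sub>0) \<le> 1 / 2"
  proof -
    \<comment> \<open>chosen so that \<open>\<theta> t\<^sub>1 * \<theta> (2 * b\<^sub>0) = x / (1 + 2 * x)\<close> for some \<open>x \<ge> 0\<close>, where \<open>t\<^sub>1 = \<Phi> R\<close>\<close>
    define Q where "Q = 1 + 2 * (c\<^sub>3 * C / (c\<^sub>1 * k * v)) * \<theta> (2 * b\<^sub>0)"
    have Q: "1 \<le> Q" using c C k v \<theta>0 by (simp add: Q_def)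
    define R where "R = diameter D * Q powr (1 / d\<^sub>1)"
    have q1: "1 \<le> Q powr (1 / d\<^sub>1)" using Q d_pos by (intro ge_one_powr_ge_zero) auto
    have R: "diameter D \<le> R" using mult_left_mono[OF q1, of "diameter D"] diam by (simp add: R_def)
    have "(g (\<Phi> R) / diameter D) powr d\<^sub>1 = Q"
      using R diam d_pos Q by (simp add: gen_inv_\<Phi> R_def powr_powr)
    then have "\<theta> (\<Phi> R) * \<theta> (2 * b\<^sub>0) = (c\<^sub>3 * C / (c\<^sub>1 * k * v)) * \<theta> (2 * b\<^sub>0) / Q" by (simp add: \<theta>_def)
    also have "\<dots> \<le> 1 / 2"
    proof -
      have "x / (1 + 2 * x) \<le> 1 / 2" if "0 \<le> x" for x :: real
        using that by (simp add: divide_le_eq)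
      from this[of "(c\<^sub>3 * C / (c\<^sub>1 * k * v)) * \<theta> (2 * b\<^sub>0)"] show ?thesis
        using c C k v \<theta>0 by (simp add: Q_def mult.assoc)
    qed
    finally show ?thesis using that[of "\<Phi> R"] R diam by (simp add: le_iff)
  qed
  have t1p: "0 < t\<^sub>1" using t1 b0 by simp
  have \<theta>le: "\<theta> t \<le> \<theta> b\<^sub>0" if "b\<^sub>0 \<le> t" for t
  proof -
    have "1 \<le> (g t / diameter D) powr d\<^sub>1" using gt[OF that] d_pos by (intro ge_one_powr_ge_zero) auto
    then have "c\<^sub>3 * C / (c\<^sub>1 * k * v) / (g t / diameter D) powr d\<^sub>1 \<le> c\<^sub>3 * C / (c\<^sub>1 * k * v) / 1"
      using c C k v by (intro divide_left_mono) auto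
    then show ?thesis using gb diam by (simp add: \<theta>_def)
  qed
  have iter: "p t x y \<le> (\<theta> b\<^sub>0 * (1 / 2) ^ n) * p b\<^sub>0 x y"
    if "b\<^sub>0 + real n * t\<^sub>1 \<le> t" "x \<in> D" "y \<in> D" for n t x y
    using that
  proof (induction n arbitrary: t x y)
    case 0
    have "p t x y \<le> \<theta> t * p b\<^sub>0 x y" using 0 by (intro small) auto
    also have "\<dots> \<le> \<theta> b\<^sub>0 * p b\<^sub>0 x y" using 0 p0[OF b0] by (intro mult_right_mono \<theta>le) auto
    finally show ?case by simp
  next
    case (Suc n)
    have s: "b\<^sub>0 + real n * t\<^sub>1 \<le> t - t\<^sub>1" using Suc.prems(1) by (simp add: algebra_simps)
    have "0 \<le> real n * t\<^sub>1" using t1p by simp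
    then have s': "b\<^sub>0 \<le> t - t\<^sub>1" using s by linarith
    have "p (t\<^sub>1 + (t - t\<^sub>1)) x y \<le> \<theta> t\<^sub>1 * (\<theta> b\<^sub>0 * (1 / 2) ^ n) * \<theta> (2 * b\<^sub>0) * p b\<^sub>0 x y"
      using \<theta>0 by (intro comp t1(1) s' Suc.prems(2,3) small Suc.IH s) auto
    also have "\<dots> = (\<theta> t\<^sub>1 * \<theta> (2 * b\<^sub>0)) * ((\<theta> b\<^sub>0 * (1 / 2) ^ n) * p b\<^sub>0 x y)" by simp
    also have "\<dots> \<le> 1 / 2 * ((\<theta> b\<^sub>0 * (1 / 2) ^ n) * p b\<^sub>0 x y)"
      using t1(2) \<theta>0[of b\<^sub>0] p0[OF b0 Suc.prems(2,3)] by (intro mult_right_mono) auto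
    finally show ?case by simp
  qed
  define l where "l = ln 2 / t\<^sub>1"
  have l: "0 < l" using t1p by (simp add: l_def)
  define E where "E = \<theta> b\<^sub>0 * 2 * exp (l * b\<^sub>0) * (c\<^sub>3 * k') + 1"
  have E: "0 < E" "\<theta> b\<^sub>0 * 2 * exp (l * b\<^sub>0) * (c\<^sub>3 * k') \<le> E"
    using \<theta>0[of b\<^sub>0] c k' by (auto simp: E_def intro!: add_nonneg_pos mult_nonneg_nonneg)
  have "p t x y \<le> E * exp (- l * t) * h b\<^sub>0 x y" if t: "2 * b\<^sub>0 \<le> t" and xy: "x \<in> D" "y \<in> D" for t x y
  proof -
    define n where "n = nat \<lfloor>(t - b\<^sub>0) / t\<^sub>1\<rfloor>"
    have q0: "0 \<le> (t - b\<^sub>0) / t\<^sub>1" using t t1p b0 by simp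
    have n: "real n \<le> (t - b\<^sub>0) / t\<^sub>1" "(t - b\<^sub>0) / t\<^sub>1 \<le> real n + 1"
      unfolding n_def using q0 by linarith+
    have hb: "0 \<le> h b\<^sub>0 x y" by (rule h_nonneg[OF xy b0])
    have "b\<^sub>0 + real n * t\<^sub>1 \<le> t" using n(1) t1p by (simp add: field_simps)
    then have "p t x y \<le> (\<theta> b\<^sub>0 * (1 / 2) ^ n) * p b\<^sub>0 x y" by (rule iter[OF _ xy])
    also have "\<dots> \<le> (\<theta> b\<^sub>0 * (2 * exp (l * b\<^sub>0) * exp (- l * t))) * (c\<^sub>3 * k' * h b\<^sub>0 x y)"
    proof (intro mult_mono mult_left_mono)
      have "(1 / 2 :: real) ^ n = exp (- (real n * ln 2))"
        by (simp add: exp_minus exp_of_nat_mult power_one_over inverse_eq_divide)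
      also have "\<dots> \<le> exp (ln 2 + l * b\<^sub>0 - l * t)"
      proof -
        have "((t - b\<^sub>0) / t\<^sub>1) * ln 2 \<le> (real n + 1) * ln 2" using n(2) by (intro mult_right_mono) auto
        then show ?thesis by (simp add: l_def algebra_simps diff_divide_distrib)
      qed
      also have "\<dots> = 2 * exp (l * b\<^sub>0) * exp (- l * t)" by (simp add: exp_add exp_diff exp_minus field_simps)
      finally show "(1 / 2) ^ n \<le> 2 * exp (l * b\<^sub>0) * exp (- l * t)" .
      have "p b\<^sub>0 x y \<le> c\<^sub>3 * h b\<^sub>0 x y * hk_profile m \<Phi> \<Psi> 1 c\<^sub>4 b\<^sub>0 x y" using est[OF b0 xy] by simp
      also have "\<dots> \<le> c\<^sub>3 * h b\<^sub>0 x y * k'" using prof'[OF xy] c hb by (intro mult_left_mono) auto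
      finally show "p b\<^sub>0 x y \<le> c\<^sub>3 * k' * h b\<^sub>0 x y" by (simp add: mult_ac)
    qed (use \<theta>0 p0[OF b0 xy] in auto)
    also have "\<dots> = \<theta> b\<^sub>0 * 2 * exp (l * b\<^sub>0) * (c\<^sub>3 * k') * (exp (- l * t) * h b\<^sub>0 x y)" by simp
    also have "\<dots> \<le> E * (exp (- l * t) * h b\<^sub>0 x y)" using E hb by (intro mult_right_mono) auto
    finally show ?thesis by (simp add: mult.assoc)
  qed
  then show ?thesis using E l by blast
qed

end

section \<open>The Green function estimate\<close>

theorem theorem5p10:
  fixes m :: "'a::metric_space measure"
    and D :: "'a set"
    and R\<^sub>E R\<^sub>1 :: ereal
    and d\<^sub>1 d\<^sub>2 \<alpha>\<^sub>1 \<alpha>\<^sub>2 \<alpha>\<^sub>3 \<alpha>\<^sub>4 \<beta>\<^sub>1 \<beta>\<^sub>2 \<gamma>\<^sub>s C\<^sub>0 :: real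
    and \<Phi> \<Psi> :: "real \<Rightarrow> real"
    and \<F> :: "'w measure"
    and P :: "'a option \<Rightarrow> 'w measure"
    and Y :: "real \<Rightarrow> 'w \<Rightarrow> 'a option"
    and S :: "real \<Rightarrow> 'w \<Rightarrow> real"
    and \<nu> :: "real measure"
    and p h :: "real \<Rightarrow> 'a \<Rightarrow> 'a \<Rightarrow> real"
  assumes "proper_metric_measure_space m"
    and "volume_scaling m R\<^sub>E d\<^sub>1 d\<^sub>2"
    and "open D" and "D \<noteq> UNIV"
    and "independent_subordination D \<F> P Y S \<nu>"
    and "heat_kernel D m \<F> P Y p"
    and "scale_functions \<Phi> \<Psi> \<alpha>\<^sub>1 \<alpha>\<^sub>2 \<alpha>\<^sub>3 \<alpha>\<^sub>4"
    and "boundary_function D \<Phi> h"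
    and "(Poly_tail \<nu> R\<^sub>1 \<beta>\<^sub>1 \<beta>\<^sub>2 \<and> HK_B D m \<Phi> \<Psi> h p C\<^sub>0 \<and> scale_diam \<Phi> D < R\<^sub>1 / 8)
       \<or> (Poly_tail \<nu> \<infinity> \<beta>\<^sub>1 \<beta>\<^sub>2 \<and> HK_U R\<^sub>E D m \<Phi> \<Psi> h p C\<^sub>0)"
    and "C\<^sub>0 = 1"
    and "regular_boundary_function D \<Phi> h"
    and "H2_star D \<Phi> h \<gamma>\<^sub>s" and "\<gamma>\<^sub>s > min \<beta>\<^sub>2 1 + 1"
    and "H2_star_star D \<Phi> h \<beta>\<^sub>1"
    and "d\<^sub>1 > \<alpha>\<^sub>2 * min \<beta>\<^sub>2 1
       \<or> (d\<^sub>1 = d\<^sub>2 \<and> d\<^sub>2 = \<alpha>\<^sub>1 * \<beta>\<^sub>1 \<and> \<alpha>\<^sub>1 * \<beta>\<^sub>1 = \<alpha>\<^sub>2 * \<beta>\<^sub>2)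
       \<or> d\<^sub>2 < \<alpha>\<^sub>1 * \<beta>\<^sub>1"
  shows "ecomparable_on {(x, y). x \<in> D \<and> y \<in> D \<and> x \<noteq> y}
           (\<lambda>(x, y). green_function P S p x y)
           (\<lambda>(x, y). h_bracket D \<nu> \<Phi> h x y * (\<Phi> (dist x y) / \<Psi> (dist x y)) *
                       (psi \<nu> \<Phi> (dist x y) / vol m x (dist x y)) +
                     h (\<Phi> (dist x y)) x y * g0 D m \<nu> \<Phi> d\<^sub>1 d\<^sub>2 \<alpha>\<^sub>1 \<alpha>\<^sub>2 \<beta>\<^sub>1 \<beta>\<^sub>2 x y)
       \<and> (comparable_on {0<..} \<Psi> \<Phi> \<longrightarrow>
           ecomparable_on {(x, y). x \<in> D \<and> y \<in> D \<and> x \<noteq> y}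
             (\<lambda>(x, y). green_function P S p x y)
             (\<lambda>(x, y). h_bracket D \<nu> \<Phi> h x y * g0 D m \<nu> \<Phi> d\<^sub>1 d\<^sub>2 \<alpha>\<^sub>1 \<alpha>\<^sub>2 \<beta>\<^sub>1 \<beta>\<^sub>2 x y))"
proof (cases "{(x, y). x \<in> D \<and> y \<in> D \<and> x \<noteq> y} = {}")
  case True
  then show ?thesis by (auto simp: ecomparable_on_def intro!: exI[of _ 1])
next
  case False
  then obtain x\<^sub>0 y\<^sub>0 where xy: "x\<^sub>0 \<in> D" "y\<^sub>0 \<in> D" "x\<^sub>0 \<noteq> y\<^sub>0" by auto
  let ?I = "{t. 0 < t \<and> ereal t < 2 * scale_diam \<Phi> D}"
  have sub: "driftless_subordinator (P (Some x)) S \<nu>" if "x \<in> D" for x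
    using assms(5) that by (simp add: independent_subordination_def cemetery_top_def)
  have levy: "levy_measure \<nu>" using sub[OF xy(1)] by (simp add: driftless_subordinator_def)
  have \<Psi>: "\<Phi> r \<le> \<Psi> r" if "0 \<le> r" for r using assms(7) that by (simp add: scale_functions_def)
  have sf: "scale_function \<Phi> \<alpha>\<^sub>1 \<alpha>\<^sub>2"
    using assms(7) by unfold_locales (auto simp: scale_functions_def)
  have vs: "volume_space m R\<^sub>E d\<^sub>1 d\<^sub>2"
    using assms(1,2) by unfold_locales
  have "\<exists>R. Poly_tail \<nu> R \<beta>\<^sub>1 \<beta>\<^sub>2 \<and> hk_two_sided ?I D m \<Phi> \<Psi> h p 1 \<and>
      (\<not> bounded D \<and> R\<^sub>E = \<infinity> \<and> R = \<infinity> \<or>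
          bounded D \<and> 0 < diameter D \<and> (\<exists>C>0. \<exists>l>0. \<forall>t\<ge>2 * \<Phi> (diameter D). \<forall>x\<in>D. \<forall>y\<in>D.
            p t x y \<le> C * exp (- l * t) * h (\<Phi> (diameter D)) x y))"
  proof (cases "bounded D")
    case D: True
    have "dist x\<^sub>0 y\<^sub>0 \<le> diameter D" using diameter_bounded_bound[OF D xy(1,2)] .
    then have diam: "0 < diameter D" using xy(3) by (meson less_le_trans zero_less_dist_iff)
    interpret bounded_domain \<Phi> \<alpha>\<^sub>1 \<alpha>\<^sub>2 m R\<^sub>E d\<^sub>1 d\<^sub>2 D h \<Psi>
      using sf vs D diam \<Psi> assms(8) by (intro bounded_domain.intro bounded_domain_axioms.intro)
    from assms(9) show ?thesis
    proof
      assume B: "Poly_tail \<nu> R\<^sub>1 \<beta>\<^sub>1 \<beta>\<^sub>2 \<and> HK_B D m \<Phi> \<Psi> h p C\<^sub>0 \<and> scale_diam \<Phi> D < R\<^sub>1 / 8"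
      then have "HK_B D m \<Phi> \<Psi> h p 1" using assms(10) by simp
      from HK_B_imp[OF this] show ?thesis using B D diam by blast
    next
      assume U: "Poly_tail \<nu> \<infinity> \<beta>\<^sub>1 \<beta>\<^sub>2 \<and> HK_U R\<^sub>E D m \<Phi> \<Psi> h p C\<^sub>0"
      then have U': "HK_U R\<^sub>E D m \<Phi> \<Psi> h p 1" using assms(10) by simp
      then have "hk_two_sided ?I D m \<Phi> \<Psi> h p 1"
        unfolding HK_U_def by (blast intro: hk_two_sided_subset)
      then show ?thesis using U D diam HK_U_imp[OF U' assms(6,3)] by blast
    qed
  next
    case D: False
    then have U: "Poly_tail \<nu> \<infinity> \<beta>\<^sub>1 \<beta>\<^sub>2" "HK_U R\<^sub>E D m \<Phi> \<Psi> h p 1"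
      using assms(9,10) by (auto simp: HK_B_def)
    moreover have "?I = {0<..}" using D by (auto simp: scale_diam_def)
    ultimately show ?thesis using D by (intro exI[of _ \<infinity>]) (simp add: HK_U_def)
  qed
  then obtain R where R: "Poly_tail \<nu> R \<beta>\<^sub>1 \<beta>\<^sub>2" "hk_two_sided ?I D m \<Phi> \<Psi> h p 1"
      "\<not> bounded D \<and> R\<^sub>E = \<infinity> \<and> R = \<infinity> \<or>
          bounded D \<and> 0 < diameter D \<and> (\<exists>C>0. \<exists>l>0. \<forall>t\<ge>2 * \<Phi> (diameter D). \<forall>x\<in>D. \<forall>y\<in>D.
            p t x y \<le> C * exp (- l * t) * h (\<Phi> (diameter D)) x y)"
    by blast
  interpret s: green_setting \<Phi> \<alpha>\<^sub>1 \<alpha>\<^sub>2 m R\<^sub>E d\<^sub>1 d\<^sub>2 D P S \<nu> p h \<Psi> R \<beta>\<^sub>1 \<beta>\<^sub>2 \<gamma>\<^sub>s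
    using sf vs assms(3,4,8,11,12,13,14) sub levy \<Psi> R heat_kernel_measurable(1)[OF assms(6)]
    by (intro green_setting.intro green_setting_axioms.intro)
  obtain K \<gamma> \<gamma>' A\<^sub>f A\<^sub>v A\<^sub>h A\<^sub>s A\<^sub>s\<^sub>s A\<^sub>l A\<^sub>F a\<^sub>F where core:
    "green_core s.pairs s.times s.Uz s.f (exp 1) K (1 / 24) s.hz s.vz s.pz s.Tz s.\<tau>z s.Wz
      \<beta>\<^sub>1 (min \<beta>\<^sub>2 1) (d\<^sub>1 / \<alpha>\<^sub>2) (d\<^sub>2 / \<alpha>\<^sub>1) \<gamma> \<gamma>\<^sub>s \<gamma>' A\<^sub>f A\<^sub>v A\<^sub>h A\<^sub>s A\<^sub>s\<^sub>s A\<^sub>l A\<^sub>F a\<^sub>F"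
    by (rule s.core)
  interpret c: green_setting_core \<Phi> \<alpha>\<^sub>1 \<alpha>\<^sub>2 m R\<^sub>E d\<^sub>1 d\<^sub>2 D P S \<nu> p h \<Psi> R \<beta>\<^sub>1 \<beta>\<^sub>2 \<gamma>\<^sub>s
      K \<gamma> \<gamma>' A\<^sub>f A\<^sub>v A\<^sub>h A\<^sub>s A\<^sub>s\<^sub>s A\<^sub>l A\<^sub>F a\<^sub>F
    by (intro green_setting_core.intro green_setting_core_axioms.intro s.green_setting_axioms core)
  show ?thesis
    using c.green_estimate[OF assms(15)] unfolding s.pairs_def case_prod_unfold by blast
qed

end
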